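(* Let $g,n\ge0$ with $2g-2+n>0$. The categories $\mathcal X_{g,n}^{\mathrm{trop}}$ (the universal curve) and $\mathcal M_{g,n+1}^{\mathrm{trop}}$ (viewed over $\mathcal M_{g,n}^{\mathrm{trop}}$ via the forgetful morphism $\pi_{g,n+1}^{\mathrm{trop}}$) are isomorphic over $\mathcal M_{g,n}^{\mathrm{trop}}$; i.e. for any cone $\sigma$ and any stable tropical curve $\Gamma$ of genus $g$ with $n$ marked legs over $\sigma$, corresponding to a morphism $u_{[\Gamma]}:\sigma\to\mathcal M_{g,n}^{\mathrm{trop}}$, there is a $2$-cartesian diagram $$\begin{array}{ccc}\mathrm{Cone}(\Gamma)&\xrightarrow{\;U_{[\Gamma]}\;}&\mathcal M_{g,n+1}^{\mathrm{trop}}\\ {\scriptstyle c}\downarrow&&\downarrow{\scriptstyle\pi_{g,n+1}^{\mathrm{trop}}}\\ \sigma&\xrightarrow{\;u_{[\Gamma]}\;}&\mathcal M_{g,n}^{\mathrm{trop}}\end{array}$$ depending contravariantly on $\sigma$, and one has $H=h_{n+1}\circ U_{[\Gamma]}$.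
   Context: **Cones.** A (rational polyhedral) cone is a pair $(N,\sigma)$ of a finitely generated free abelian group $N$ and a strictly convex, full-dimensional rational polyhedral cone $\sigma\subseteq N_{\mathbb R}$; morphisms are homomorphisms $N\to N'$ carrying $\sigma$ into $\sigma'$; the category is $\mathbf{RPC}$. $S_\sigma=\sigma^\vee\cap\mathrm{Hom}(N,\mathbb Z)$ is a sharp toric monoid, and $f:\sigma\to\sigma'$ induces $f^*:S_{\sigma'}\to S_\sigma$. Elements of $S_\sigma$ are the same as morphisms $\sigma\to\mathbb R_{\ge0}$. A cone complex is a collection of cones with a collection of face morphisms, closed under composition and containing identities, such that every face of every cone is the image of exactly one of the face morphisms and there is at most one of them between two given cones; a morphism of cone complexes assigns to each cone of the source a morphism to a cone of the target not factoring through a proper face, compatibly with faces; it is strict if all these morphisms are isomorphisms. The face topology on cone complexes is generated by the families of all cones of a complex; stacks for it are the same as categories fibered in groupoids over $\mathbf{RPC}$. A cone space is a sheaf of sets for this topology with diagonal representable by cone complexes and with a strict cover by a cone complex. **Tropical curves.** A graph $G$ is a finite set $X(G)=V(G)\sqcup F(G)$ (vertices, flags) with an idempotent root map $r$ with image $V(G)$ and an involution $\iota$ fixing $V(G)$; two-element orbits of flags are edges, fixed flags are legs. Weights are $h:V(G)\to\mathbb Z_{\ge0}$, genus is $b_1(G)+\sum h(v)$, stability is $2h(v)-2+\mathrm{val}(v)>0$ for all $v$, and an $n$-marking is a bijection $i\mapsto l_i$ from $\{1,\dots,n\}$ to the set of legs. A morphism of weighted marked graphs is a composition of isomorphisms and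 weighted edge contractions (contracting a non-loop merges its ends and adds the weights; contracting a loop raises the weight of its vertex by $1$). A tropical curve over $\sigma$ of genus $g$ with $n$ marked legs is a connected weighted $n$-marked graph $\mathbb G(\Gamma)$ of genus $g$ with edge lengths $d(e)\in S_\sigma\setminus\{0\}$. $\mathcal M_{g,n}^{\mathrm{trop}}$ is the category, fibered in groupoids over $\mathbf{RPC}$, of pairs $(\sigma,\Gamma)$ with $\Gamma$ a stable such curve over $\sigma$; a morphism $(\sigma,\Gamma)\to(\sigma',\Gamma')$ is a morphism $f:\sigma\to\sigma'$ and a morphism of weighted marked graphs $\pi:\mathbb G(\Gamma')\to\mathbb G(\Gamma)$ contracting exactly the edges $e'$ with $f^*d'(e')=0$ and with $d(\pi(e'))=f^*d'(e')$ for the others. **Cone over a tropical curve.** For $\Gamma$ over $\sigma$ set $\mathrm{Cone}(v)=\sigma$ for each vertex, $\mathrm{Cone}(l)=\sigma\times\mathbb R_{\ge0}$ for each leg, and $\mathrm{Cone}(e)=\sigma\times_{\mathbb R_{\ge0}}\mathbb R_{\ge0}^2$ for each edge $e$, where $\mathbb R^2_{\ge0}\to\mathbb R_{\ge0}$ is $(a,b)\mapsto a+b$ and $\sigma\to\mathbb R_{\ge0}$ is given by $d(e)\in S_\sigma$. To each flag $f$ attach a face $\sigma(f)$, isomorphic to $\sigma$ by projection: $\sigma\times 0$ for a leg, and for the two flags of an edge the two faces $\sigma\times_{\mathbb R_{\ge0}}(\mathbb R_{\ge0}\times0)$ and $\sigma\times_{\mathbb R_{\ge0}}(0\times\mathbb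 R_{\ge0})$ (in a chosen order). $\mathrm{Cone}(\Gamma)$ is the cone space obtained by identifying $\sigma(f)$ with $\mathrm{Cone}(r(f))$ for every flag $f$; $q$ denotes the quotient map from the disjoint union of the pieces and $c:\mathrm{Cone}(\Gamma)\to\sigma$ the projection. **Universal curve.** $\mathcal X_{g,n}^{\mathrm{trop}}\to\mathcal M_{g,n}^{\mathrm{trop}}$ is the fibered category whose fiber over $u_{[\Gamma]}:\sigma\to\mathcal M_{g,n}^{\mathrm{trop}}$ is the set of sections of $c:\mathrm{Cone}(\Gamma)\to\sigma$. **Genus functions.** For a section $f$ of $\mathrm{Cone}(\Gamma)\to\sigma$, $H(f)=h(v)$ if there is a vertex $v$ with $f(\sigma)=q(\mathrm{Cone}(v))$, and $H(f)=0$ otherwise. For a tropical curve $\widetilde\Gamma$ in $\mathcal M_{g,n+1}^{\mathrm{trop}}(\sigma)$, $h_{n+1}(\widetilde\Gamma)=h(r(l_{n+1}))$ is the weight of the vertex carrying the $(n+1)$-st leg. The equality $H=h_{n+1}\circ U_{[\Gamma]}$ means $H(f)=h_{n+1}(U_{[\Gamma]}\circ f)$ for sections $f$. **Forgetful morphism.** For $\widetilde\Gamma\in\mathcal M_{g,n+1}^{\mathrm{trop}}(\sigma)$, let $\Gamma_*$ be obtained by deleting $l_{n+1}$, which was rooted at $v$. (a) If $\Gamma_*$ is stable, $\pi_{g,n+1}^{\mathrm{trop}}(\widetilde\Gamma)=\Gamma_*$. (b) If not, and $v$ (then of weight $0$) is connected to the rest by two distinct edges $e_1,e_2$, delete $v$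 and the two flags at it and join the remaining two flags into an edge of length $d(e_1)+d(e_2)$. (c) If not, and $v$ (of weight $0$) carries one edge $e$ and one leg $l_i$, delete $v$ and the two flags at it and make the remaining flag of $e$ the leg $l_i$. This defines a morphism $\pi^{\mathrm{trop}}_{g,n+1}:\mathcal M_{g,n+1}^{\mathrm{trop}}\to\mathcal M_{g,n}^{\mathrm{trop}}$. *)

theory Defs
  imports "HOL-Analysis.Analysis" "HOL-Library.Infinite_Typeclass"
begin

section \<open>Categories over a base\<close>

record ('o, 'a) cat =
  Obj :: "'o set"
  Arr :: "'a set"
  Dom :: "'a \<Rightarrow> 'o"
  Cod :: "'a \<Rightarrow> 'o"
  Ide :: "'o \<Rightarrow> 'a"
  Comp :: "'a \<Rightarrow> 'a \<Rightarrow> 'a"  \<comment> \<open>\<open>Comp C g f\<close> is \<open>g\<close> after \<open>f\<close>\<close>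

definition category :: "('o, 'a, 'z) cat_scheme \<Rightarrow> bool" where
  "category C \<longleftrightarrow>
     (\<forall>f\<in>Arr C. Dom C f \<in> Obj C \<and> Cod C f \<in> Obj C) \<and>
     (\<forall>x\<in>Obj C. Ide C x \<in> Arr C \<and> Dom C (Ide C x) = x \<and> Cod C (Ide C x) = x) \<and>
     (\<forall>f\<in>Arr C. \<forall>g\<in>Arr C. Cod C f = Dom C g \<longrightarrow>
        Comp C g f \<in> Arr C \<and> Dom C (Comp C g f) = Dom C f \<and> Cod C (Comp C g f) = Cod C g) \<and>
     (\<forall>f\<in>Arr C. Comp C f (Ide C (Dom C f)) = f \<and> Comp C (Ide C (Cod C f)) f = f) \<and>
     (\<forall>f\<in>Arr C. \<forall>g\<in>Arr C. \<forall>h\<in>Arr C. Cod C f = Dom C g \<and> Cod C g = Dom C h \<longrightarrow>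
        Comp C h (Comp C g f) = Comp C (Comp C h g) f)"

definition iso_arrow :: "('o, 'a, 'z) cat_scheme \<Rightarrow> 'a \<Rightarrow> bool" where
  "iso_arrow C f \<longleftrightarrow> f \<in> Arr C \<and>
     (\<exists>g\<in>Arr C. Dom C g = Cod C f \<and> Cod C g = Dom C f \<and>
        Comp C g f = Ide C (Dom C f) \<and> Comp C f g = Ide C (Cod C f))"

record ('o, 'a, 'p, 'b) ftor =
  FObj :: "'o \<Rightarrow> 'p"
  FArr :: "'a \<Rightarrow> 'b"

definition is_functor ::
  "('o, 'a, 'y) cat_scheme \<Rightarrow> ('p, 'b, 'z) cat_scheme \<Rightarrow> ('o, 'a, 'p, 'b) ftor \<Rightarrow> bool" where
  "is_functor C D F \<longleftrightarrow> category C \<and> category D \<and>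
     (\<forall>x\<in>Obj C. FObj F x \<in> Obj D \<and> FArr F (Ide C x) = Ide D (FObj F x)) \<and>
     (\<forall>f\<in>Arr C. FArr F f \<in> Arr D \<and>
        Dom D (FArr F f) = FObj F (Dom C f) \<and> Cod D (FArr F f) = FObj F (Cod C f)) \<and>
     (\<forall>f\<in>Arr C. \<forall>g\<in>Arr C. Cod C f = Dom C g \<longrightarrow>
        FArr F (Comp C g f) = Comp D (FArr F g) (FArr F f))"

definition id_ftor :: "('o, 'a, 'o, 'a) ftor" where
  "id_ftor = \<lparr>FObj = (\<lambda>x. x), FArr = (\<lambda>f. f)\<rparr>"

definition comp_ftor ::
  "('p, 'b, 'q, 'c) ftor \<Rightarrow> ('o, 'a, 'p, 'b) ftor \<Rightarrow> ('o, 'a, 'q, 'c) ftor" where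
  "comp_ftor G F = \<lparr>FObj = FObj G \<circ> FObj F, FArr = FArr G \<circ> FArr F\<rparr>"

text \<open>A category together with its projection to a base category (with objects \<open>'p\<close>, arrows \<open>'b\<close>).\<close>

record ('o, 'a, 'p, 'b) cat_over = "('o, 'a) cat" +
  Pr :: "('o, 'a, 'p, 'b) ftor"

definition functor_over ::
  "('p, 'b) cat \<Rightarrow> ('o1, 'a1, 'p, 'b) cat_over \<Rightarrow> ('o2, 'a2, 'p, 'b) cat_over
     \<Rightarrow> ('o1, 'a1, 'o2, 'a2) ftor \<Rightarrow> bool" where
  "functor_over B C D F \<longleftrightarrow>
     is_functor C B (Pr C) \<and> is_functor D B (Pr D) \<and> is_functor C D F \<and>
     (\<forall>x\<in>Obj C. FObj (Pr D) (FObj F x) = FObj (Pr C) x) \<and>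
     (\<forall>f\<in>Arr C. FArr (Pr D) (FArr F f) = FArr (Pr C) f)"

text \<open>2-isomorphisms of functors over \<open>B\<close>: natural isomorphisms with components over identities.\<close>

definition nat_iso_over ::
  "('p, 'b) cat \<Rightarrow> ('o1, 'a1, 'p, 'b) cat_over \<Rightarrow> ('o2, 'a2, 'p, 'b) cat_over
     \<Rightarrow> ('o1, 'a1, 'o2, 'a2) ftor \<Rightarrow> ('o1, 'a1, 'o2, 'a2) ftor \<Rightarrow> ('o1 \<Rightarrow> 'a2) \<Rightarrow> bool" where
  "nat_iso_over B C D F G t \<longleftrightarrow>
     functor_over B C D F \<and> functor_over B C D G \<and>
     (\<forall>x\<in>Obj C. iso_arrow D (t x) \<and> Dom D (t x) = FObj F x \<and> Cod D (t x) = FObj G x \<and>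
        FArr (Pr D) (t x) = Ide B (FObj (Pr C) x)) \<and>
     (\<forall>f\<in>Arr C. Comp D (FArr G f) (t (Dom C f)) = Comp D (t (Cod C f)) (FArr F f))"

definition equivalence_over ::
  "('p, 'b) cat \<Rightarrow> ('o1, 'a1, 'p, 'b) cat_over \<Rightarrow> ('o2, 'a2, 'p, 'b) cat_over
     \<Rightarrow> ('o1, 'a1, 'o2, 'a2) ftor \<Rightarrow> bool" where
  "equivalence_over B C D F \<longleftrightarrow> functor_over B C D F \<and>
     (\<exists>G. functor_over B D C G \<and>
        (\<exists>t. nat_iso_over B C C id_ftor (comp_ftor G F) t) \<and>
        (\<exists>t. nat_iso_over B D D (comp_ftor F G) id_ftor t))"

text \<open>
  An isomorphism between \<open>C\<close> and \<open>D\<close>, each viewed over \<open>S\<close> through \<open>P\<close> and \<open>Q\<close>, in the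
  2-category of categories over \<open>B\<close>: an equivalence whose triangle over \<open>S\<close> 2-commutes.
\<close>

definition isomorphism_over_object ::
  "('p, 'b) cat \<Rightarrow> ('o1, 'a1, 'p, 'b) cat_over \<Rightarrow> ('o2, 'a2, 'p, 'b) cat_over
     \<Rightarrow> ('o3, 'a3, 'p, 'b) cat_over \<Rightarrow> ('o1, 'a1, 'o3, 'a3) ftor \<Rightarrow> ('o2, 'a2, 'o3, 'a3) ftor
     \<Rightarrow> ('o1, 'a1, 'o2, 'a2) ftor \<Rightarrow> bool" where
  "isomorphism_over_object B C D S P Q F \<longleftrightarrow>
     equivalence_over B C D F \<and> functor_over B D S Q \<and>
     (\<exists>t. nat_iso_over B C S (comp_ftor Q F) P t)"

text \<open>
  The 2-fibre product of \<open>F : A \<rightarrow> S\<close> and \<open>G : D \<rightarrow> S\<close> over \<open>B\<close>.  Objects are triples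
  \<open>(a, d, s)\<close> with \<open>s : F a \<rightarrow> G d\<close> an isomorphism over an identity of \<open>B\<close>.
\<close>

type_synonym ('o1, 'a1, 'o2, 'a2, 'a3, 'p, 'b) fprod_cat =
  "('o1 \<times> 'o2 \<times> 'a3, ('o1 \<times> 'o2 \<times> 'a3) \<times> ('o1 \<times> 'o2 \<times> 'a3) \<times> ('a1 \<times> 'a2), 'p, 'b) cat_over"

definition fprod_obj ::
  "('p, 'b) cat \<Rightarrow> ('o1, 'a1, 'p, 'b) cat_over \<Rightarrow> ('o2, 'a2, 'p, 'b) cat_over
     \<Rightarrow> ('o3, 'a3, 'p, 'b) cat_over \<Rightarrow> ('o1, 'a1, 'o3, 'a3) ftor \<Rightarrow> ('o2, 'a2, 'o3, 'a3) ftor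
     \<Rightarrow> ('o1 \<times> 'o2 \<times> 'a3) set" where
  "fprod_obj B A D S F G =
     {(a, d, s). a \<in> Obj A \<and> d \<in> Obj D \<and> FObj (Pr A) a = FObj (Pr D) d \<and>
        iso_arrow S s \<and> Dom S s = FObj F a \<and> Cod S s = FObj G d \<and>
        FArr (Pr S) s = Ide B (FObj (Pr A) a)}"

definition fprod ::
  "('p, 'b) cat \<Rightarrow> ('o1, 'a1, 'p, 'b) cat_over \<Rightarrow> ('o2, 'a2, 'p, 'b) cat_over
     \<Rightarrow> ('o3, 'a3, 'p, 'b) cat_over \<Rightarrow> ('o1, 'a1, 'o3, 'a3) ftor \<Rightarrow> ('o2, 'a2, 'o3, 'a3) ftor
     \<Rightarrow> ('o1, 'a1, 'o2, 'a2, 'a3, 'p, 'b) fprod_cat" where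
  "fprod B A D S F G = \<lparr>
     Obj = fprod_obj B A D S F G,
     Arr = {((a, d, s), (a', d', s'), (k, l)).
        (a, d, s) \<in> fprod_obj B A D S F G \<and> (a', d', s') \<in> fprod_obj B A D S F G \<and>
        k \<in> Arr A \<and> Dom A k = a \<and> Cod A k = a' \<and>
        l \<in> Arr D \<and> Dom D l = d \<and> Cod D l = d' \<and>
        FArr (Pr A) k = FArr (Pr D) l \<and>
        Comp S s' (FArr F k) = Comp S (FArr G l) s},
     Dom = (\<lambda>(x, y, m). x),
     Cod = (\<lambda>(x, y, m). y),
     Ide = (\<lambda>(a, d, s). ((a, d, s), (a, d, s), (Ide A a, Ide D d))),
     Comp = (\<lambda>(y', z, (k', l')) (x, y, (k, l)). (x, z, (Comp A k' k, Comp D l' l))),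
     Pr = \<lparr>FObj = (\<lambda>(a, d, s). FObj (Pr A) a), FArr = (\<lambda>(x, y, (k, l)). FArr (Pr A) k)\<rparr>\<rparr>"

text \<open>
  The square with \<open>PA : P \<rightarrow> A\<close>, \<open>PD : P \<rightarrow> D\<close>, \<open>F : A \<rightarrow> S\<close>, \<open>G : D \<rightarrow> S\<close> and 2-isomorphism
  \<open>t : F PA \<Rightarrow> G PD\<close> is 2-cartesian if the induced functor to the 2-fibre product is an equivalence.
\<close>

definition two_cartesian ::
  "('p, 'b) cat \<Rightarrow> ('o0, 'a0, 'p, 'b) cat_over \<Rightarrow> ('o1, 'a1, 'p, 'b) cat_over
     \<Rightarrow> ('o2, 'a2, 'p, 'b) cat_over \<Rightarrow> ('o3, 'a3, 'p, 'b) cat_over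
     \<Rightarrow> ('o0, 'a0, 'o1, 'a1) ftor \<Rightarrow> ('o0, 'a0, 'o2, 'a2) ftor
     \<Rightarrow> ('o1, 'a1, 'o3, 'a3) ftor \<Rightarrow> ('o2, 'a2, 'o3, 'a3) ftor \<Rightarrow> ('o0 \<Rightarrow> 'a3) \<Rightarrow> bool" where
  "two_cartesian B P A D S PA PD F G t \<longleftrightarrow>
     functor_over B P A PA \<and> functor_over B P D PD \<and>
     functor_over B A S F \<and> functor_over B D S G \<and>
     nat_iso_over B P S (comp_ftor F PA) (comp_ftor G PD) t \<and>
     equivalence_over B P (fprod B A D S F G)
       \<lparr>FObj = (\<lambda>x. (FObj PA x, FObj PD x, t x)),
        FArr = (\<lambda>f. ((FObj PA (Dom P f), FObj PD (Dom P f), t (Dom P f)),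
                      (FObj PA (Cod P f), FObj PD (Cod P f), t (Cod P f)),
                      (FArr PA f, FArr PD f)))\<rparr>"


section \<open>Rational polyhedral cones\<close>

text \<open>
  A finitely generated free abelian group is given as the integral span \<open>Lat\<close> of a finite linearly
  independent subset of a real vector space, so that \<open>N\<^sub>\<real> = span Lat\<close>.  The ambient type has no
  other role.  If it has infinite dimension, every cone is isomorphic to one of this form.
\<close>

record 'v rpcone =
  Lat :: "'v set"
  Supp :: "'v set"

definition is_lattice :: "'v::real_vector set \<Rightarrow> bool" where
  "is_lattice N \<longleftrightarrow> (\<exists>B. finite B \<and> independent B \<and>
     N = {(\<Sum>b\<in>B. of_int (k b) *\<^sub>R b) | k :: 'v \<Rightarrow> int. True})"

definition is_rpcone :: "'v::real_vector rpcone \<Rightarrow> bool" where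
  "is_rpcone \<sigma> \<longleftrightarrow> is_lattice (Lat \<sigma>) \<and>
     (\<exists>A. finite A \<and> A \<subseteq> Lat \<sigma> \<and>
        Supp \<sigma> = {(\<Sum>a\<in>A. c a *\<^sub>R a) | c :: 'v \<Rightarrow> real. \<forall>a\<in>A. 0 \<le> c a}) \<and>
     (\<forall>x. x \<in> Supp \<sigma> \<and> - x \<in> Supp \<sigma> \<longrightarrow> x = 0) \<and>
     span (Supp \<sigma>) = span (Lat \<sigma>)"

text \<open>
  A homomorphism \<open>N \<rightarrow> N'\<close> is represented by its linear extension to \<open>N\<^sub>\<real>\<close>, continued by \<open>0\<close>
  outside \<open>N\<^sub>\<real>\<close>; with this normal form composition is plain composition of functions.
\<close>

definition rpc_hom ::
  "'v::real_vector rpcone \<Rightarrow> 'w::real_vector rpcone \<Rightarrow> ('v \<Rightarrow> 'w) set" where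
  "rpc_hom \<sigma> \<tau> = {f.
     (\<forall>x. x \<notin> span (Lat \<sigma>) \<longrightarrow> f x = 0) \<and>
     (\<forall>x\<in>span (Lat \<sigma>). \<forall>y\<in>span (Lat \<sigma>). f (x + y) = f x + f y) \<and>
     (\<forall>c. \<forall>x\<in>span (Lat \<sigma>). f (c *\<^sub>R x) = c *\<^sub>R f x) \<and>
     f ` Lat \<sigma> \<subseteq> Lat \<tau> \<and> f ` Supp \<sigma> \<subseteq> Supp \<tau>}"

definition rpc_id :: "'v::real_vector rpcone \<Rightarrow> 'v \<Rightarrow> 'v" where
  "rpc_id \<sigma> = (\<lambda>x. if x \<in> span (Lat \<sigma>) then x else 0)"

type_synonym 'v rpc_arr = "'v rpcone \<times> 'v rpcone \<times> ('v \<Rightarrow> 'v)"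

definition RPC :: "('v::real_vector rpcone, 'v rpc_arr) cat" where
  "RPC = \<lparr>
     Obj = {\<sigma>. is_rpcone \<sigma>},
     Arr = {(\<sigma>, \<tau>, f). is_rpcone \<sigma> \<and> is_rpcone \<tau> \<and> f \<in> rpc_hom \<sigma> \<tau>},
     Dom = (\<lambda>(\<sigma>, \<tau>, f). \<sigma>),
     Cod = (\<lambda>(\<sigma>, \<tau>, f). \<tau>),
     Ide = (\<lambda>\<sigma>. (\<sigma>, \<sigma>, rpc_id \<sigma>)),
     Comp = (\<lambda>(\<tau>', \<rho>, g) (\<sigma>, \<tau>, f). (\<sigma>, \<rho>, g \<circ> f))\<rparr>"

definition Rge0 :: "real rpcone" where
  "Rge0 = \<lparr>Lat = \<int>, Supp = {0..}\<rparr>"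

text \<open>\<open>S\<^sub>\<sigma> = \<sigma>\<^sup>\<or> \<inter> Hom(N, \<int>)\<close>; unfolding \<open>rpc_hom\<close> gives exactly this intersection.\<close>

definition dual_monoid :: "'v::real_vector rpcone \<Rightarrow> ('v \<Rightarrow> real) set" where
  "dual_monoid \<sigma> = rpc_hom \<sigma> Rge0"

definition prod_cone :: "'v::real_vector rpcone \<Rightarrow> 'w::real_vector rpcone \<Rightarrow> ('v \<times> 'w) rpcone" where
  "prod_cone \<sigma> \<tau> = \<lparr>Lat = Lat \<sigma> \<times> Lat \<tau>, Supp = Supp \<sigma> \<times> Supp \<tau>\<rparr>"

definition fibre_cone ::
  "'v::real_vector rpcone \<Rightarrow> ('v \<Rightarrow> 'u) \<Rightarrow> 'w::real_vector rpcone \<Rightarrow> ('w \<Rightarrow> 'u) \<Rightarrow> ('v \<times> 'w) rpcone" where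
  "fibre_cone \<sigma> p \<tau> q = \<lparr>
     Lat = {(x, y). x \<in> Lat \<sigma> \<and> y \<in> Lat \<tau> \<and> p x = q y},
     Supp = {(x, y). x \<in> Supp \<sigma> \<and> y \<in> Supp \<tau> \<and> p x = q y}\<rparr>"

text \<open>The representable category fibered over \<open>RPC\<close> attached to \<open>\<sigma>\<close>.\<close>

type_synonym 'v slice_obj = "'v rpcone \<times> ('v \<Rightarrow> 'v)"
type_synonym 'v slice_arr = "'v slice_obj \<times> 'v slice_obj \<times> ('v \<Rightarrow> 'v)"

definition slice ::
  "'v::real_vector rpcone \<Rightarrow> ('v slice_obj, 'v slice_arr, 'v rpcone, 'v rpc_arr) cat_over" where
  "slice \<sigma> = \<lparr>
     Obj = {(\<tau>, p). is_rpcone \<tau> \<and> p \<in> rpc_hom \<tau> \<sigma>},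
     Arr = {((\<tau>, p), (\<tau>', p'), g). is_rpcone \<tau> \<and> is_rpcone \<tau>' \<and>
        p \<in> rpc_hom \<tau> \<sigma> \<and> p' \<in> rpc_hom \<tau>' \<sigma> \<and> g \<in> rpc_hom \<tau> \<tau>' \<and> p' \<circ> g = p},
     Dom = (\<lambda>(x, y, g). x),
     Cod = (\<lambda>(x, y, g). y),
     Ide = (\<lambda>(\<tau>, p). ((\<tau>, p), (\<tau>, p), rpc_id \<tau>)),
     Comp = (\<lambda>(y', z, g') (x, y, g). (x, z, g' \<circ> g)),
     Pr = \<lparr>FObj = fst, FArr = (\<lambda>(x, y, g). (fst x, fst y, g))\<rparr>\<rparr>"

definition slice_id :: "'v::real_vector rpcone \<Rightarrow> 'v slice_obj" where
  "slice_id \<sigma> = (\<sigma>, rpc_id \<sigma>)"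


section \<open>Weighted marked graphs\<close>

text \<open>\<open>Cells\<close> is the set \<open>X(G)\<close>.  The values of the fields outside \<open>Cells\<close> are irrelevant.\<close>

record 'x wgraph =
  Cells :: "'x set"
  rt :: "'x \<Rightarrow> 'x"
  flip :: "'x \<Rightarrow> 'x"
  wt :: "'x \<Rightarrow> nat"
  mark :: "nat \<Rightarrow> 'x"

definition verts :: "('x, 'z) wgraph_scheme \<Rightarrow> 'x set" where
  "verts G = rt G ` Cells G"

definition flags :: "('x, 'z) wgraph_scheme \<Rightarrow> 'x set" where
  "flags G = Cells G - verts G"

definition legs :: "('x, 'z) wgraph_scheme \<Rightarrow> 'x set" where
  "legs G = {k \<in> flags G. flip G k = k}"

definition edges :: "('x, 'z) wgraph_scheme \<Rightarrow> 'x set set" where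
  "edges G = {{k, flip G k} | k. k \<in> flags G \<and> flip G k \<noteq> k}"

definition marked_graph :: "nat \<Rightarrow> ('x, 'z) wgraph_scheme \<Rightarrow> bool" where
  "marked_graph n G \<longleftrightarrow> finite (Cells G) \<and>
     (\<forall>x\<in>Cells G. rt G x \<in> Cells G \<and> rt G (rt G x) = rt G x) \<and>
     (\<forall>x\<in>Cells G. flip G x \<in> Cells G \<and> flip G (flip G x) = x) \<and>
     (\<forall>v\<in>verts G. flip G v = v) \<and>
     bij_betw (mark G) {1..n} (legs G)"

definition adjacent :: "('x, 'z) wgraph_scheme \<Rightarrow> ('x \<times> 'x) set" where
  "adjacent G = {(rt G k, rt G (flip G k)) | k. k \<in> flags G}"

definition components :: "('x, 'z) wgraph_scheme \<Rightarrow> 'x set set" where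
  "components G = verts G // ((adjacent G)\<^sup>* \<inter> verts G \<times> verts G)"

definition connected_graph :: "('x, 'z) wgraph_scheme \<Rightarrow> bool" where
  "connected_graph G \<longleftrightarrow> card (components G) = 1"

definition betti1 :: "('x, 'z) wgraph_scheme \<Rightarrow> int" where
  "betti1 G = int (card (edges G)) - int (card (verts G)) + int (card (components G))"

definition genus :: "('x, 'z) wgraph_scheme \<Rightarrow> int" where
  "genus G = betti1 G + int (\<Sum>v\<in>verts G. wt G v)"

definition valence :: "('x, 'z) wgraph_scheme \<Rightarrow> 'x \<Rightarrow> nat" where
  "valence G v = card {k \<in> flags G. rt G k = v}"

definition stable :: "('x, 'z) wgraph_scheme \<Rightarrow> bool" where
  "stable G \<longleftrightarrow> (\<forall>v\<in>verts G. 2 * int (wt G v) - 2 + int (valence G v) > 0)"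

text \<open>Maps \<open>X(G) \<rightarrow> X(H)\<close> are extensional functions, so that equality of maps is equality on \<open>X(G)\<close>.\<close>

definition cell_map :: "nat \<Rightarrow> 'x wgraph \<Rightarrow> 'x wgraph \<Rightarrow> ('x \<Rightarrow> 'x) \<Rightarrow> bool" where
  "cell_map n G H f \<longleftrightarrow> marked_graph n G \<and> marked_graph n H \<and>
     f \<in> extensional (Cells G) \<and> f ` Cells G \<subseteq> Cells H \<and>
     (\<forall>x\<in>Cells G. f (rt G x) = rt H (f x) \<and> f (flip G x) = flip H (f x)) \<and>
     (\<forall>i\<in>{1..n}. f (mark G i) = mark H i)"

definition wgraph_iso :: "nat \<Rightarrow> 'x wgraph \<Rightarrow> 'x wgraph \<Rightarrow> ('x \<Rightarrow> 'x) \<Rightarrow> bool" where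
  "wgraph_iso n G H f \<longleftrightarrow> cell_map n G H f \<and> bij_betw f (Cells G) (Cells H) \<and>
     (\<forall>v\<in>verts G. wt H (f v) = wt G v)"

text \<open>
  \<open>f\<close> presents \<open>H\<close> as the weighted contraction of the edge \<open>e\<close>: it is the quotient of \<open>X(G)\<close> in
  which the two flags of \<open>e\<close> and their roots become one point.  The edge is a loop iff \<open>rt G ` e\<close>
  is a singleton.
\<close>

definition edge_contraction ::
  "nat \<Rightarrow> 'x wgraph \<Rightarrow> 'x set \<Rightarrow> 'x wgraph \<Rightarrow> ('x \<Rightarrow> 'x) \<Rightarrow> bool" where
  "edge_contraction n G e H f \<longleftrightarrow> cell_map n G H f \<and> e \<in> edges G \<and> f ` Cells G = Cells H \<and>
     (\<forall>x\<in>Cells G. \<forall>y\<in>Cells G. f x = f y \<longleftrightarrow>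
        x = y \<or> (x \<in> e \<union> rt G ` e \<and> y \<in> e \<union> rt G ` e)) \<and>
     (\<forall>v \<in> verts G - rt G ` e. wt H (f v) = wt G v) \<and>
     (\<forall>v \<in> rt G ` e. wt H (f v) =
        (\<Sum>w\<in>rt G ` e. wt G w) + (if card (rt G ` e) = 1 then 1 else 0))"

inductive wgraph_mor :: "nat \<Rightarrow> 'x wgraph \<Rightarrow> 'x wgraph \<Rightarrow> ('x \<Rightarrow> 'x) \<Rightarrow> bool" for n where
  iso: "wgraph_iso n G H f \<Longrightarrow> wgraph_mor n G H f"
| contraction: "edge_contraction n G e H f \<Longrightarrow> wgraph_mor n G H f"
| comp: "wgraph_mor n G H f \<Longrightarrow> wgraph_mor n H K f' \<Longrightarrow> wgraph_mor n G K (compose (Cells G) f' f)"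


section \<open>Tropical curves and their moduli\<close>

record ('x, 'v) curve = "'x wgraph" +
  len :: "'x set \<Rightarrow> 'v \<Rightarrow> real"

abbreviation graph_of :: "('x, 'v) curve \<Rightarrow> 'x wgraph" where
  "graph_of \<Gamma> \<equiv> wgraph.truncate \<Gamma>"

definition tropical_curve ::
  "nat \<Rightarrow> nat \<Rightarrow> 'v::real_vector rpcone \<Rightarrow> ('x, 'v) curve \<Rightarrow> bool" where
  "tropical_curve g n \<sigma> \<Gamma> \<longleftrightarrow>
     marked_graph n \<Gamma> \<and> connected_graph \<Gamma> \<and> genus \<Gamma> = int g \<and>
     (\<forall>e\<in>edges \<Gamma>. len \<Gamma> e \<in> dual_monoid \<sigma> - {\<lambda>x. 0})"

type_synonym ('x, 'v) mtrop_obj = "'v rpcone \<times> ('x, 'v) curve"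
type_synonym ('x, 'v) mtrop_arr =
  "('x, 'v) mtrop_obj \<times> ('x, 'v) mtrop_obj \<times> (('v \<Rightarrow> 'v) \<times> ('x \<Rightarrow> 'x))"
type_synonym ('x, 'v) mtrop_cat =
  "(('x, 'v) mtrop_obj, ('x, 'v) mtrop_arr, 'v rpcone, 'v rpc_arr) cat_over"

definition mtrop_obj :: "nat \<Rightarrow> nat \<Rightarrow> ('x, 'v::real_vector) mtrop_obj set" where
  "mtrop_obj g n = {(\<sigma>, \<Gamma>). is_rpcone \<sigma> \<and> tropical_curve g n \<sigma> \<Gamma> \<and> stable \<Gamma>}"

text \<open>The graph component of an arrow \<open>(\<sigma>, \<Gamma>) \<rightarrow> (\<sigma>', \<Gamma>')\<close> goes from the graph of \<open>\<Gamma>'\<close> to that of \<open>\<Gamma>\<close>.\<close>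

definition mtrop_arr :: "nat \<Rightarrow> nat \<Rightarrow> ('x, 'v::real_vector) mtrop_arr set" where
  "mtrop_arr g n = {((\<sigma>, \<Gamma>), (\<sigma>', \<Gamma>'), (f, \<pi>)).
     (\<sigma>, \<Gamma>) \<in> mtrop_obj g n \<and> (\<sigma>', \<Gamma>') \<in> mtrop_obj g n \<and>
     f \<in> rpc_hom \<sigma> \<sigma>' \<and> wgraph_mor n (graph_of \<Gamma>') (graph_of \<Gamma>) \<pi> \<and>
     (\<forall>e'\<in>edges \<Gamma>'. \<pi> ` e' \<subseteq> verts \<Gamma> \<longleftrightarrow> len \<Gamma>' e' \<circ> f = (\<lambda>x. 0)) \<and>
     (\<forall>e'\<in>edges \<Gamma>'. len \<Gamma>' e' \<circ> f \<noteq> (\<lambda>x. 0) \<longrightarrow> len \<Gamma> (\<pi> ` e') = len \<Gamma>' e' \<circ> f)}"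

definition Mtrop :: "nat \<Rightarrow> nat \<Rightarrow> ('x, 'v::real_vector) mtrop_cat" where
  "Mtrop g n = \<lparr>
     Obj = mtrop_obj g n,
     Arr = mtrop_arr g n,
     Dom = (\<lambda>(x, y, m). x),
     Cod = (\<lambda>(x, y, m). y),
     Ide = (\<lambda>(\<sigma>, \<Gamma>). ((\<sigma>, \<Gamma>), (\<sigma>, \<Gamma>), (rpc_id \<sigma>, restrict (\<lambda>x. x) (Cells \<Gamma>)))),
     Comp = (\<lambda>(y', z, (f', \<pi>')) (x, y, (f, \<pi>)). (x, z, (f' \<circ> f, compose (Cells (snd z)) \<pi> \<pi>'))),
     Pr = \<lparr>FObj = fst, FArr = (\<lambda>(x, y, (f, \<pi>)). (fst x, fst y, f))\<rparr>\<rparr>"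

text \<open>The morphisms \<open>\<sigma> \<rightarrow> \<M>\<close> that correspond to the curve \<open>\<Gamma>\<close> over \<open>\<sigma>\<close> (2-Yoneda).\<close>

definition classifies ::
  "nat \<Rightarrow> nat \<Rightarrow> ('x, 'v::real_vector) mtrop_obj
     \<Rightarrow> ('v slice_obj, 'v slice_arr, ('x, 'v) mtrop_obj, ('x, 'v) mtrop_arr) ftor \<Rightarrow> bool" where
  "classifies g n X u \<longleftrightarrow>
     functor_over RPC (slice (fst X)) (Mtrop g n) u \<and> FObj u (slice_id (fst X)) = X"


section \<open>The cone over a tropical curve\<close>

text \<open>
  Sheaves for the face topology are presheaves on \<open>RPC\<close>, so \<open>Cone(\<Gamma>)\<close> is given by its sets of
  \<open>\<tau>\<close>-valued points: the quotient of the points of the disjoint union of the pieces by the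
  equivalence relation which the identifications of the faces generate.
\<close>

datatype ('x, 'v) cpoint =
    VPt 'x "'v \<Rightarrow> 'v"
  | LPt 'x "'v \<Rightarrow> 'v \<times> real"
  | EPt "'x set" "'v \<Rightarrow> 'v \<times> real \<times> real"

definition leg_cone :: "'v::real_vector rpcone \<Rightarrow> ('v \<times> real) rpcone" where
  "leg_cone \<sigma> = prod_cone \<sigma> Rge0"

definition edge_cone ::
  "('x, 'v::real_vector) curve \<Rightarrow> 'v rpcone \<Rightarrow> 'x set \<Rightarrow> ('v \<times> real \<times> real) rpcone" where
  "edge_cone \<Gamma> \<sigma> e = fibre_cone \<sigma> (len \<Gamma> e) (prod_cone Rge0 Rge0) (\<lambda>(a, b). a + b)"

definition pieces_pts ::
  "'v::real_vector rpcone \<Rightarrow> ('x, 'v) curve \<Rightarrow> 'v rpcone \<Rightarrow> ('x, 'v) cpoint set" where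
  "pieces_pts \<sigma> \<Gamma> \<tau> =
     {VPt v p | v p. v \<in> verts \<Gamma> \<and> p \<in> rpc_hom \<tau> \<sigma>} \<union>
     {LPt l p | l p. l \<in> legs \<Gamma> \<and> p \<in> rpc_hom \<tau> (leg_cone \<sigma>)} \<union>
     {EPt e p | e p. e \<in> edges \<Gamma> \<and> p \<in> rpc_hom \<tau> (edge_cone \<Gamma> \<sigma> e)}"

text \<open>The chosen order on the two flags of an edge.\<close>

definition first_flag :: "'x set \<Rightarrow> 'x" where
  "first_flag e = (SOME k. k \<in> e)"

definition leg_face :: "'v::real_vector rpcone \<Rightarrow> ('v \<times> real) set" where
  "leg_face \<sigma> = Supp \<sigma> \<times> {0}"

definition edge_face ::
  "('x, 'v::real_vector) curve \<Rightarrow> 'v rpcone \<Rightarrow> 'x set \<Rightarrow> 'x \<Rightarrow> ('v \<times> real \<times> real) set" where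
  "edge_face \<Gamma> \<sigma> e k = {(x, a, b) \<in> Supp (edge_cone \<Gamma> \<sigma> e).
     (if k = first_flag e then b = 0 else a = 0)}"

definition face_gluing ::
  "'v::real_vector rpcone \<Rightarrow> ('x, 'v) curve \<Rightarrow> 'v rpcone
     \<Rightarrow> (('x, 'v) cpoint \<times> ('x, 'v) cpoint) set" where
  "face_gluing \<sigma> \<Gamma> \<tau> =
     {(LPt k p, VPt (rt \<Gamma> k) (fst \<circ> p)) | k p.
        k \<in> legs \<Gamma> \<and> p \<in> rpc_hom \<tau> (leg_cone \<sigma>) \<and> p ` Supp \<tau> \<subseteq> leg_face \<sigma>} \<union>
     {(EPt e p, VPt (rt \<Gamma> k) (fst \<circ> p)) | e k p.
        e \<in> edges \<Gamma> \<and> k \<in> e \<and> p \<in> rpc_hom \<tau> (edge_cone \<Gamma> \<sigma> e) \<and> p ` Supp \<tau> \<subseteq> edge_face \<Gamma> \<sigma> e k}"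

definition glued ::
  "'v::real_vector rpcone \<Rightarrow> ('x, 'v) curve \<Rightarrow> 'v rpcone
     \<Rightarrow> (('x, 'v) cpoint \<times> ('x, 'v) cpoint) set" where
  "glued \<sigma> \<Gamma> \<tau> =
     (face_gluing \<sigma> \<Gamma> \<tau> \<union> (face_gluing \<sigma> \<Gamma> \<tau>)\<inverse>)\<^sup>* \<inter> pieces_pts \<sigma> \<Gamma> \<tau> \<times> pieces_pts \<sigma> \<Gamma> \<tau>"

definition cone_pts ::
  "'v::real_vector rpcone \<Rightarrow> ('x, 'v) curve \<Rightarrow> 'v rpcone \<Rightarrow> ('x, 'v) cpoint set set" where
  "cone_pts \<sigma> \<Gamma> \<tau> = pieces_pts \<sigma> \<Gamma> \<tau> // glued \<sigma> \<Gamma> \<tau>"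

fun pt_base :: "('x, 'v) cpoint \<Rightarrow> 'v \<Rightarrow> 'v" where
  "pt_base (VPt v p) = p"
| "pt_base (LPt l p) = fst \<circ> p"
| "pt_base (EPt e p) = fst \<circ> p"

fun pt_pull :: "('v \<Rightarrow> 'v) \<Rightarrow> ('x, 'v) cpoint \<Rightarrow> ('x, 'v) cpoint" where
  "pt_pull g (VPt v p) = VPt v (p \<circ> g)"
| "pt_pull g (LPt l p) = LPt l (p \<circ> g)"
| "pt_pull g (EPt e p) = EPt e (p \<circ> g)"

definition cone_base :: "('x, 'v) cpoint set \<Rightarrow> 'v \<Rightarrow> 'v" where
  "cone_base K = the_elem (pt_base ` K)"

text \<open>Restriction of a point along \<open>g\<close> whose source is \<open>\<tau>\<close>.\<close>

definition cone_pull ::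
  "'v::real_vector rpcone \<Rightarrow> ('x, 'v) curve \<Rightarrow> 'v rpcone \<Rightarrow> ('v \<Rightarrow> 'v)
     \<Rightarrow> ('x, 'v) cpoint set \<Rightarrow> ('x, 'v) cpoint set" where
  "cone_pull \<sigma> \<Gamma> \<tau> g K = glued \<sigma> \<Gamma> \<tau> `` (pt_pull g ` K)"

type_synonym ('x, 'v) cone_obj = "'v rpcone \<times> ('x, 'v) cpoint set"
type_synonym ('x, 'v) cone_arr = "('x, 'v) cone_obj \<times> ('x, 'v) cone_obj \<times> ('v \<Rightarrow> 'v)"

definition Cone ::
  "'v::real_vector rpcone \<Rightarrow> ('x, 'v) curve
     \<Rightarrow> (('x, 'v) cone_obj, ('x, 'v) cone_arr, 'v rpcone, 'v rpc_arr) cat_over" where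
  "Cone \<sigma> \<Gamma> = \<lparr>
     Obj = {(\<tau>, K). is_rpcone \<tau> \<and> K \<in> cone_pts \<sigma> \<Gamma> \<tau>},
     Arr = {((\<tau>, K), (\<tau>', K'), g). is_rpcone \<tau> \<and> is_rpcone \<tau>' \<and>
        K \<in> cone_pts \<sigma> \<Gamma> \<tau> \<and> K' \<in> cone_pts \<sigma> \<Gamma> \<tau>' \<and> g \<in> rpc_hom \<tau> \<tau>' \<and>
        cone_pull \<sigma> \<Gamma> \<tau> g K' = K},
     Dom = (\<lambda>(x, y, g). x),
     Cod = (\<lambda>(x, y, g). y),
     Ide = (\<lambda>(\<tau>, K). ((\<tau>, K), (\<tau>, K), rpc_id \<tau>)),
     Comp = (\<lambda>(y', z, g') (x, y, g). (x, z, g' \<circ> g)),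
     Pr = \<lparr>FObj = fst, FArr = (\<lambda>(x, y, g). (fst x, fst y, g))\<rparr>\<rparr>"

definition cone_proj ::
  "(('x, 'v) cone_obj, ('x, 'v) cone_arr, 'v slice_obj, 'v slice_arr) ftor" where
  "cone_proj = \<lparr>
     FObj = (\<lambda>(\<tau>, K). (\<tau>, cone_base K)),
     FArr = (\<lambda>((\<tau>, K), (\<tau>', K'), g). ((\<tau>, cone_base K), (\<tau>', cone_base K'), g))\<rparr>"

text \<open>
  The map \<open>Cone(\<Gamma>) \<rightarrow> Cone(\<Gamma>')\<close> induced by an arrow \<open>(f, \<pi>)\<close> from \<open>(\<sigma>, \<Gamma>)\<close> to \<open>(\<sigma>', \<Gamma>')\<close>.  A vertex
  \<open>v\<close> of \<open>\<Gamma>\<close> is sent to any vertex over \<open>v\<close>; all of these agree in \<open>Cone(\<Gamma>')\<close> because they are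
  joined by edges with length pulled back to \<open>0\<close>.  The coordinates on an edge are interchanged if
  \<open>\<pi>\<close> does not respect the chosen orders.
\<close>

definition pt_lift ::
  "('x, 'v) curve \<Rightarrow> ('x, 'v) curve \<Rightarrow> ('v \<Rightarrow> 'v) \<Rightarrow> ('x \<Rightarrow> 'x)
     \<Rightarrow> (('x, 'v) cpoint \<times> ('x, 'v) cpoint) set" where
  "pt_lift \<Gamma> \<Gamma>' f \<pi> =
     {(VPt (\<pi> v') p, VPt v' (f \<circ> p)) | v' p. v' \<in> verts \<Gamma>'} \<union>
     {(LPt (\<pi> l') p, LPt l' (map_prod f id \<circ> p)) | l' p. l' \<in> legs \<Gamma>'} \<union>
     {(EPt (\<pi> ` e') p,
       EPt e' (map_prod f (if \<pi> (first_flag e') = first_flag (\<pi> ` e') then id else prod.swap) \<circ> p))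
      | e' p. e' \<in> edges \<Gamma>' \<and> \<pi> ` e' \<in> edges \<Gamma>}"

definition cone_map ::
  "('x, 'v::real_vector) mtrop_arr \<Rightarrow> 'v rpcone \<Rightarrow> ('x, 'v) cpoint set \<Rightarrow> ('x, 'v) cpoint set" where
  "cone_map m \<tau> K = (case m of ((\<sigma>, \<Gamma>), (\<sigma>', \<Gamma>'), (f, \<pi>)) \<Rightarrow>
     glued \<sigma>' \<Gamma>' \<tau> `` (pt_lift \<Gamma> \<Gamma>' f \<pi> `` K))"

definition cone_map_ftor ::
  "('x, 'v::real_vector) mtrop_arr
     \<Rightarrow> (('x, 'v) cone_obj, ('x, 'v) cone_arr, ('x, 'v) cone_obj, ('x, 'v) cone_arr) ftor" where
  "cone_map_ftor m = \<lparr>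
     FObj = (\<lambda>(\<tau>, K). (\<tau>, cone_map m \<tau> K)),
     FArr = (\<lambda>((\<tau>, K), (\<tau>', K'), g). ((\<tau>, cone_map m \<tau> K), (\<tau>', cone_map m \<tau>' K'), g))\<rparr>"


section \<open>The universal curve\<close>

text \<open>By the Yoneda lemma a morphism \<open>\<sigma> \<rightarrow> Cone(\<Gamma>)\<close> is a \<open>\<sigma>\<close>-valued point.\<close>

definition cone_sections ::
  "'v::real_vector rpcone \<Rightarrow> ('x, 'v) curve \<Rightarrow> ('x, 'v) cpoint set set" where
  "cone_sections \<sigma> \<Gamma> = {s \<in> cone_pts \<sigma> \<Gamma> \<sigma>. cone_base s = rpc_id \<sigma>}"

type_synonym ('x, 'v) xtrop_obj = "'v rpcone \<times> ('x, 'v) curve \<times> ('x, 'v) cpoint set"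
type_synonym ('x, 'v) xtrop_arr =
  "('x, 'v) xtrop_obj \<times> ('x, 'v) xtrop_obj \<times> (('v \<Rightarrow> 'v) \<times> ('x \<Rightarrow> 'x))"
type_synonym ('x, 'v) xtrop_cat =
  "(('x, 'v) xtrop_obj, ('x, 'v) xtrop_arr, 'v rpcone, 'v rpc_arr) cat_over"

definition xtrop_obj :: "nat \<Rightarrow> nat \<Rightarrow> ('x, 'v::real_vector) xtrop_obj set" where
  "xtrop_obj g n = {(\<sigma>, \<Gamma>, s). (\<sigma>, \<Gamma>) \<in> mtrop_obj g n \<and> s \<in> cone_sections \<sigma> \<Gamma>}"

definition Xtrop :: "nat \<Rightarrow> nat \<Rightarrow> ('x, 'v::real_vector) xtrop_cat" where
  "Xtrop g n = \<lparr>
     Obj = xtrop_obj g n,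
     Arr = {((\<sigma>, \<Gamma>, s), (\<sigma>', \<Gamma>', s'), (f, \<pi>)).
        (\<sigma>, \<Gamma>, s) \<in> xtrop_obj g n \<and> (\<sigma>', \<Gamma>', s') \<in> xtrop_obj g n \<and>
        ((\<sigma>, \<Gamma>), (\<sigma>', \<Gamma>'), (f, \<pi>)) \<in> mtrop_arr g n \<and>
        cone_map ((\<sigma>, \<Gamma>), (\<sigma>', \<Gamma>'), (f, \<pi>)) \<sigma> s = cone_pull \<sigma>' \<Gamma>' \<sigma> f s'},
     Dom = (\<lambda>(x, y, m). x),
     Cod = (\<lambda>(x, y, m). y),
     Ide = (\<lambda>(\<sigma>, \<Gamma>, s). ((\<sigma>, \<Gamma>, s), (\<sigma>, \<Gamma>, s), (rpc_id \<sigma>, restrict (\<lambda>x. x) (Cells \<Gamma>)))),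
     Comp = (\<lambda>(y', z, (f', \<pi>')) (x, y, (f, \<pi>)).
        (x, z, (f' \<circ> f, compose (Cells (fst (snd z))) \<pi> \<pi>'))),
     Pr = \<lparr>FObj = fst, FArr = (\<lambda>(x, y, (f, \<pi>)). (fst x, fst y, f))\<rparr>\<rparr>"

definition xtrop_proj ::
  "(('x, 'v) xtrop_obj, ('x, 'v) xtrop_arr, ('x, 'v) mtrop_obj, ('x, 'v) mtrop_arr) ftor" where
  "xtrop_proj = \<lparr>
     FObj = (\<lambda>(\<sigma>, \<Gamma>, s). (\<sigma>, \<Gamma>)),
     FArr = (\<lambda>((\<sigma>, \<Gamma>, s), (\<sigma>', \<Gamma>', s'), m). ((\<sigma>, \<Gamma>), (\<sigma>', \<Gamma>'), m))\<rparr>"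


section \<open>The forgetful morphism\<close>

definition last_leg :: "nat \<Rightarrow> ('x, 'v) curve \<Rightarrow> 'x" where
  "last_leg n \<Gamma> = mark \<Gamma> (Suc n)"

definition last_vertex :: "nat \<Rightarrow> ('x, 'v) curve \<Rightarrow> 'x" where
  "last_vertex n \<Gamma> = rt \<Gamma> (last_leg n \<Gamma>)"

definition delete_last :: "nat \<Rightarrow> ('x, 'v) curve \<Rightarrow> ('x, 'v) curve" where
  "delete_last n \<Gamma> = \<Gamma>\<lparr>Cells := Cells \<Gamma> - {last_leg n \<Gamma>}\<rparr>"

definition other_flags :: "nat \<Rightarrow> ('x, 'v) curve \<Rightarrow> 'x set" where
  "other_flags n \<Gamma> = {k \<in> flags \<Gamma>. rt \<Gamma> k = last_vertex n \<Gamma> \<and> k \<noteq> last_leg n \<Gamma>}"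

definition joins_two_edges :: "nat \<Rightarrow> ('x, 'v) curve \<Rightarrow> bool" where
  "joins_two_edges n \<Gamma> \<longleftrightarrow> (\<exists>a b. other_flags n \<Gamma> = {a, b} \<and>
     flip \<Gamma> a \<noteq> a \<and> flip \<Gamma> b \<noteq> b \<and> {a, flip \<Gamma> a} \<noteq> {b, flip \<Gamma> b})"

text \<open>\<open>partner n \<Gamma> k\<close> is the other element of \<open>other_flags n \<Gamma>\<close> when there are exactly two.\<close>

definition partner :: "nat \<Rightarrow> ('x, 'v) curve \<Rightarrow> 'x \<Rightarrow> 'x" where
  "partner n \<Gamma> k = (THE k'. k' \<in> other_flags n \<Gamma> \<and> k' \<noteq> k)"

definition join_edges :: "nat \<Rightarrow> ('x, 'v) curve \<Rightarrow> ('x, 'v) curve" where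
  "join_edges n \<Gamma> = (let A = other_flags n \<Gamma> in
     \<Gamma>\<lparr>Cells := Cells \<Gamma> - ({last_leg n \<Gamma>, last_vertex n \<Gamma>} \<union> A),
       flip := (\<lambda>x. if flip \<Gamma> x \<in> A then flip \<Gamma> (partner n \<Gamma> (flip \<Gamma> x)) else flip \<Gamma> x),
       len := (\<lambda>e. if e = flip \<Gamma> ` A then (\<lambda>x. \<Sum>k\<in>A. len \<Gamma> {k, flip \<Gamma> k} x) else len \<Gamma> e)\<rparr>)"

definition edge_to_leg :: "nat \<Rightarrow> ('x, 'v) curve \<Rightarrow> ('x, 'v) curve" where
  "edge_to_leg n \<Gamma> = (let A = other_flags n \<Gamma>; k = (THE k. k \<in> A \<and> flip \<Gamma> k \<noteq> k) in
     \<Gamma>\<lparr>Cells := Cells \<Gamma> - ({last_leg n \<Gamma>, last_vertex n \<Gamma>} \<union> A),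
       flip := (\<lambda>x. if x = flip \<Gamma> k then x else flip \<Gamma> x),
       mark := (\<lambda>i. if mark \<Gamma> i = partner n \<Gamma> k then flip \<Gamma> k else mark \<Gamma> i)\<rparr>)"

definition forget_last :: "nat \<Rightarrow> ('x, 'v) curve \<Rightarrow> ('x, 'v) curve" where
  "forget_last n \<Gamma> =
     (if stable (delete_last n \<Gamma>) then delete_last n \<Gamma>
      else if joins_two_edges n \<Gamma> then join_edges n \<Gamma>
      else edge_to_leg n \<Gamma>)"

text \<open>
  The cells that remain keep their images, with one exception.  Suppose that the vertex of the last
  leg of \<open>\<Gamma>'\<close> is deleted, that \<open>x\<close> is the remaining flag of an edge \<open>{k, x}\<close> at it, and that \<open>\<pi>\<close>
  contracts this edge.  Then \<open>x\<close> takes over the image of the other flag deleted with \<open>k\<close>.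
\<close>

definition forget_map ::
  "nat \<Rightarrow> ('x, 'v) curve \<Rightarrow> ('x, 'v) curve \<Rightarrow> ('x \<Rightarrow> 'x) \<Rightarrow> 'x \<Rightarrow> 'x" where
  "forget_map n \<Gamma>' \<Gamma> \<pi> = restrict
     (\<lambda>x. if \<not> stable (delete_last n \<Gamma>') \<and> flip \<Gamma>' x \<in> other_flags n \<Gamma>' \<and> \<pi> x \<in> verts \<Gamma>
          then \<pi> (partner n \<Gamma>' (flip \<Gamma>' x)) else \<pi> x)
     (Cells (forget_last n \<Gamma>'))"

definition forget_ftor ::
  "nat \<Rightarrow> (('x, 'v) mtrop_obj, ('x, 'v) mtrop_arr, ('x, 'v) mtrop_obj, ('x, 'v) mtrop_arr) ftor" where
  "forget_ftor n = \<lparr>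
     FObj = (\<lambda>(\<sigma>, \<Gamma>). (\<sigma>, forget_last n \<Gamma>)),
     FArr = (\<lambda>((\<sigma>, \<Gamma>), (\<sigma>', \<Gamma>'), (f, \<pi>)).
        ((\<sigma>, forget_last n \<Gamma>), (\<sigma>', forget_last n \<Gamma>'), (f, forget_map n \<Gamma>' \<Gamma> \<pi>)))\<rparr>"


section \<open>Genus functions\<close>

text \<open>The equality of images \<open>s(\<sigma>) = q(Cone(v))\<close> in \<open>Cone(\<Gamma>)\<close>, tested on all \<open>\<tau>\<close>-valued points.\<close>

definition image_is_vertex ::
  "'v::real_vector rpcone \<Rightarrow> ('x, 'v) curve \<Rightarrow> ('x, 'v) cpoint set \<Rightarrow> 'x \<Rightarrow> bool" where
  "image_is_vertex \<sigma> \<Gamma> s v \<longleftrightarrow> (\<forall>\<tau>. is_rpcone \<tau> \<longrightarrow>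
     {cone_pull \<sigma> \<Gamma> \<tau> g s | g. g \<in> rpc_hom \<tau> \<sigma>} =
     {glued \<sigma> \<Gamma> \<tau> `` {VPt v p} | p. p \<in> rpc_hom \<tau> \<sigma>})"

definition section_genus ::
  "'v::real_vector rpcone \<Rightarrow> ('x, 'v) curve \<Rightarrow> ('x, 'v) cpoint set \<Rightarrow> nat" where
  "section_genus \<sigma> \<Gamma> s =
     (if \<exists>v\<in>verts \<Gamma>. image_is_vertex \<sigma> \<Gamma> s v
      then wt \<Gamma> (THE v. v \<in> verts \<Gamma> \<and> image_is_vertex \<sigma> \<Gamma> s v) else 0)"

definition last_leg_genus :: "nat \<Rightarrow> ('x, 'v) mtrop_obj \<Rightarrow> nat" where
  "last_leg_genus n X = wt (snd X) (last_vertex n (snd X))"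


section \<open>Contravariant dependence\<close>

text \<open>
  The squares of the curves \<open>X = (\<sigma>, \<Gamma>)\<close>, with 2-isomorphisms \<open>\<alpha> X : \<pi> U\<^sub>X \<Rightarrow> u\<^sub>X c\<close>, are compatible
  with base change along arrows \<open>m : X \<rightarrow> Y\<close>: there are isomorphisms \<open>\<theta> m : U\<^sub>X \<Rightarrow> U\<^sub>Y Cone(m)\<close>,
  functorial in \<open>m\<close> and compatible with the \<open>\<alpha> X\<close>.  In the last condition both sides are arrows
  \<open>\<pi> U\<^sub>X (\<tau>, K) \<rightarrow> Y\<close>; \<open>to_base X (\<tau>, K)\<close> is the arrow \<open>u\<^sub>X (\<tau>, p) \<rightarrow> X\<close> over \<open>p = c(\<tau>, K)\<close>.
\<close>

definition to_base ::
  "('v::real_vector slice_obj, 'v slice_arr, ('x, 'v) mtrop_obj, ('x, 'v) mtrop_arr) ftor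
     \<Rightarrow> ('x, 'v) mtrop_obj \<Rightarrow> ('x, 'v) cone_obj \<Rightarrow> ('x, 'v) mtrop_arr" where
  "to_base u X y =
     FArr u (FObj cone_proj y, slice_id (fst X), cone_base (snd y))"

definition contravariant_family ::
  "nat \<Rightarrow> nat
     \<Rightarrow> (('x, 'v::real_vector) mtrop_obj
          \<Rightarrow> ('v slice_obj, 'v slice_arr, ('x, 'v) mtrop_obj, ('x, 'v) mtrop_arr) ftor)
     \<Rightarrow> (('x, 'v) mtrop_obj
          \<Rightarrow> (('x, 'v) cone_obj, ('x, 'v) cone_arr, ('x, 'v) mtrop_obj, ('x, 'v) mtrop_arr) ftor)
     \<Rightarrow> (('x, 'v) mtrop_obj \<Rightarrow> ('x, 'v) cone_obj \<Rightarrow> ('x, 'v) mtrop_arr) \<Rightarrow> bool" where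
  "contravariant_family g n u U \<alpha> \<longleftrightarrow>
     (\<exists>\<theta> :: ('x, 'v) mtrop_arr \<Rightarrow> ('x, 'v) cone_obj \<Rightarrow> ('x, 'v) mtrop_arr.
       (let M = Mtrop g n; M' = Mtrop g (Suc n); C = (\<lambda>X. Cone (fst X) (snd X)) in
        (\<forall>m\<in>Arr M. nat_iso_over RPC (C (Dom M m)) M'
            (U (Dom M m)) (comp_ftor (U (Cod M m)) (cone_map_ftor m)) (\<theta> m)) \<and>
        (\<forall>X\<in>Obj M. \<forall>y\<in>Obj (C X). \<theta> (Ide M X) y = Ide M' (FObj (U X) y)) \<and>
        (\<forall>m\<in>Arr M. \<forall>m'\<in>Arr M. Cod M m = Dom M m' \<longrightarrow> (\<forall>y\<in>Obj (C (Dom M m)).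
            \<theta> (Comp M m' m) y = Comp M' (\<theta> m' (FObj (cone_map_ftor m) y)) (\<theta> m y))) \<and>
        (\<forall>m\<in>Arr M. \<forall>y\<in>Obj (C (Dom M m)).
            let X = Dom M m; Y = Cod M m; z = FObj (cone_map_ftor m) y in
            Comp M m (Comp M (to_base (u X) X y) (\<alpha> X y)) =
            Comp M (to_base (u Y) Y z) (Comp M (\<alpha> Y z) (FArr (forget_ftor n) (\<theta> m y))))))"

end

theory Submission
  imports Defs
begin

text \<open>
  Deleting the last leg sends a stable curve \<open>\<Gamma>'\<close> with \<open>n + 1\<close> legs to a stable curve \<open>\<Gamma>\<close> with a
  section of \<open>Cone(\<Gamma>)\<close>: the vertex of the last leg if it survives, and otherwise the point of the edge
  or leg of \<open>\<Gamma>\<close> that this vertex subdivides.  This functor from curves with \<open>n + 1\<close> legs to the universal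
  curve is fully faithful and essentially surjective, and \<open>\<Phi>\<close> is a quasi-inverse.  Arrows over a fixed
  morphism of cones are unique up to a unique vertical isomorphism, and a contraction of graphs
  induces bijections between the fibres of the cones of points with prescribed base; so fullness
  reduces to lifting isomorphisms.  The square of \<open>\<Gamma>\<close> is \<open>\<Phi>\<close> after the map \<open>Cone(\<Gamma>) \<rightarrow> \<X>\<close> that lifts a
  point to a section of the pulled back curve.
\<close>

text \<open>\<open>wgraph_mor\<close> is generated by isomorphisms and single contractions, which
  gives no hold on a composite, so the arguments use the direct description \<open>contr\<close>.
  There weights and valences occur only in \<open>echar\<close>, whose sum over a connected graph is
  \<open>2g - 2 + n\<close>. Additivity of \<open>echar\<close> over fibres carries genus and
  stability at once, and the value 1 at the vertex of the last leg of a stable curve is exactly the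
  failure of stability after deletion. The gluing of a cone is also a generated relation. Its closed
  form, beyond equality, is \<open>same_spot\<close>: equal base, and vertices joined by edges whose
  length vanishes over that base. The main obstacle is strictness. The functors \<open>u\<close> are
  arbitrary choices of pullbacks and \<open>\<Phi>\<close> is a chosen quasi-inverse, so neither can
  be computed. The lift of \<open>Cone(\<Gamma>)\<close> to sections does commute strictly with the
  projections, and a comparison between choices is characterised by its composite to a fixed target;
  naturality and functoriality then follow from uniqueness. Cells come from an infinite type so that
  new legs and vertices can be named in essential surjectivity.\<close>

abbreviation mobj :: "nat \<Rightarrow> nat \<Rightarrow> 'v::real_vector rpcone \<Rightarrow> ('x, 'v) curve \<Rightarrow> bool" where
  "mobj g n S G \<equiv> (S, G) \<in> mtrop_obj g n"

abbreviation marr :: "nat \<Rightarrow> nat \<Rightarrow> 'v::real_vector rpcone \<Rightarrow> ('x, 'v) curve \<Rightarrow> 'v rpcone \<Rightarrow> ('x, 'v) curve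
    \<Rightarrow> ('v \<Rightarrow> 'v) \<Rightarrow> ('x \<Rightarrow> 'x) \<Rightarrow> bool" where
  "marr g n S G S' G' f P \<equiv> ((S, G), (S', G'), (f, P)) \<in> mtrop_arr g n"

section \<open>Equivalences of categories over a base\<close>

lemma category_rules:
 assumes "category C"
 shows cat_Dom: "\<And>f. f \<in> Arr C ==> Dom C f \<in> Obj C"
  and cat_Cod: "\<And>f. f \<in> Arr C ==> Cod C f \<in> Obj C"
  and cat_Ide: "\<And>x. x \<in> Obj C ==> Ide C x \<in> Arr C"
  and cat_Dom_Ide: "\<And>x. x \<in> Obj C ==> Dom C (Ide C x) = x"
  and cat_Cod_Ide: "\<And>x. x \<in> Obj C ==> Cod C (Ide C x) = x"
  and cat_Comp: "\<And>f g. f \<in> Arr C ==> g \<in> Arr C ==> Cod C f = Dom C g ==> Comp C g f \<in> Arr C"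
  and cat_Dom_Comp: "\<And>f g. f \<in> Arr C ==> g \<in> Arr C ==> Cod C f = Dom C g ==> Dom C (Comp C g f) = Dom C f"
  and cat_Cod_Comp: "\<And>f g. f \<in> Arr C ==> g \<in> Arr C ==> Cod C f = Dom C g ==> Cod C (Comp C g f) = Cod C g"
  and cat_Comp_Ide: "\<And>f x. f \<in> Arr C ==> x = Dom C f ==> Comp C f (Ide C x) = f"
  and cat_Ide_Comp: "\<And>f x. f \<in> Arr C ==> x = Cod C f ==> Comp C (Ide C x) f = f"
  and cat_assoc: "\<And>f g h. f \<in> Arr C ==> g \<in> Arr C ==> h \<in> Arr C ==> Cod C f = Dom C g ==>
    Cod C g = Dom C h ==> Comp C h (Comp C g f) = Comp C (Comp C h g) f"
 using assms unfolding category_def by simp_all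

lemma functor_rules:
 assumes "is_functor C D F"
 shows ftor_dom: "category C" and ftor_cod: "category D"
  and ftor_Obj: "\<And>x. x \<in> Obj C ==> FObj F x \<in> Obj D"
  and ftor_Ide: "\<And>x. x \<in> Obj C ==> FArr F (Ide C x) = Ide D (FObj F x)"
  and ftor_Arr: "\<And>f. f \<in> Arr C ==> FArr F f \<in> Arr D"
  and ftor_Dom: "\<And>f. f \<in> Arr C ==> Dom D (FArr F f) = FObj F (Dom C f)"
  and ftor_Cod: "\<And>f. f \<in> Arr C ==> Cod D (FArr F f) = FObj F (Cod C f)"
  and ftor_Comp: "\<And>f g. f \<in> Arr C ==> g \<in> Arr C ==> Cod C f = Dom C g ==>
    FArr F (Comp C g f) = Comp D (FArr F g) (FArr F f)"
 using assms unfolding is_functor_def by auto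

lemma functor_over_rules:
 assumes "functor_over B C D F"
 shows fo_src: "is_functor C B (Pr C)" and fo_tgt: "is_functor D B (Pr D)"
  and fo_ftor: "is_functor C D F"
  and fo_Obj: "\<And>x. x \<in> Obj C ==> FObj (Pr D) (FObj F x) = FObj (Pr C) x"
  and fo_Arr: "\<And>f. f \<in> Arr C ==> FArr (Pr D) (FArr F f) = FArr (Pr C) f"
 using assms unfolding functor_over_def by auto

lemma comp_ftor_simps [simp]:
 "FObj (comp_ftor G F) x = FObj G (FObj F x)" "FArr (comp_ftor G F) f = FArr G (FArr F f)"
 "FObj id_ftor x = x" "FArr id_ftor f = f"
 by (simp_all add: comp_ftor_def id_ftor_def)

lemma is_functor_comp: "is_functor C D F ==> is_functor D E G ==> is_functor C E (comp_ftor G F)"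
 unfolding is_functor_def by simp

lemma functor_over_comp:
 "functor_over B C D F ==> functor_over B D E G ==> functor_over B C E (comp_ftor G F)"
 unfolding functor_over_def by (simp add: is_functor_comp) (simp add: is_functor_def)

lemma functor_over_id: "is_functor C B (Pr C) ==> functor_over B C C id_ftor"
 unfolding functor_over_def is_functor_def by simp

lemma iso_arrowI:
 assumes "f \<in> Arr C" "g \<in> Arr C" "Dom C g = Cod C f" "Cod C g = Dom C f"
  "Comp C g f = Ide C (Dom C f)" "Comp C f g = Ide C (Cod C f)"
 shows "iso_arrow C f"
 using assms unfolding iso_arrow_def by blast

lemma iso_arrow_functor:
 assumes F: "is_functor C D F" and f: "iso_arrow C f"
 shows "iso_arrow D (FArr F f)"
proof -
 obtain g where "f \<in> Arr C" "g \<in> Arr C" "Dom C g = Cod C f" "Cod C g = Dom C f"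
  "Comp C g f = Ide C (Dom C f)" "Comp C f g = Ide C (Cod C f)"
  using f unfolding iso_arrow_def by blast
 with functor_rules[OF F] cat_Dom[OF ftor_dom[OF F]] cat_Cod[OF ftor_dom[OF F]]
 show ?thesis by (intro iso_arrowI[of _ _ "FArr F g"]) (simp_all, metis+)
qed

section \<open>Inverses of isomorphisms and cancellation\<close>

definition inv_arr :: "('o, 'a, 'z) cat_scheme \<Rightarrow> 'a \<Rightarrow> 'a" where
 "inv_arr C f = (SOME g. g \<in> Arr C \<and> Dom C g = Cod C f \<and> Cod C g = Dom C f \<and>
    Comp C g f = Ide C (Dom C f) \<and> Comp C f g = Ide C (Cod C f))"

lemma inv_arr_rules:
 assumes "iso_arrow C f"
 shows inv_Arr: "inv_arr C f \<in> Arr C" and inv_Dom: "Dom C (inv_arr C f) = Cod C f"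
  and inv_Cod: "Cod C (inv_arr C f) = Dom C f"
  and inv_left: "Comp C (inv_arr C f) f = Ide C (Dom C f)"
  and inv_right: "Comp C f (inv_arr C f) = Ide C (Cod C f)"
  and inv_iso: "iso_arrow C (inv_arr C f)" and iso_Arr: "f \<in> Arr C"
proof -
 have ex: "\<exists>g. g \<in> Arr C \<and> Dom C g = Cod C f \<and> Cod C g = Dom C f \<and>
    Comp C g f = Ide C (Dom C f) \<and> Comp C f g = Ide C (Cod C f)" and f: "f \<in> Arr C"
  using assms unfolding iso_arrow_def by auto
 from ex have *: "inv_arr C f \<in> Arr C \<and> Dom C (inv_arr C f) = Cod C f \<and> Cod C (inv_arr C f) = Dom C f \<and>
    Comp C (inv_arr C f) f = Ide C (Dom C f) \<and> Comp C f (inv_arr C f) = Ide C (Cod C f)"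
  unfolding inv_arr_def by (rule someI_ex)
 thus "inv_arr C f \<in> Arr C" "Dom C (inv_arr C f) = Cod C f" "Cod C (inv_arr C f) = Dom C f"
  "Comp C (inv_arr C f) f = Ide C (Dom C f)" "Comp C f (inv_arr C f) = Ide C (Cod C f)"
  by auto
 show "iso_arrow C (inv_arr C f)" using * f by (intro iso_arrowI[of _ _ f]) auto
 show "f \<in> Arr C" by fact
qed

text \<open>Composing the projection of the inverse with the identity below \<open>f\<close> changes
  nothing, and by functoriality the composite is the projection of an identity.\<close>

lemma inv_arr_vertical:
 assumes P: "is_functor C B (Pr C)" and f: "iso_arrow C f"
  and v: "FArr (Pr C) f = Ide B b" and b: "FObj (Pr C) (Dom C f) = b"
 shows "FArr (Pr C) (inv_arr C f) = Ide B b"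
proof -
 note i = inv_arr_rules[OF f] and F = functor_rules[OF P]
 note c = category_rules[OF F(1)] and cB = category_rules[OF F(2)]
 have "FObj (Pr C) (Cod C f) = b"
  using F(7)[OF i(7)] v cB(5)[of b] F(3)[of "Dom C f"] c(1)[OF i(7)] b by auto
 hence "FArr (Pr C) (inv_arr C f) = Comp B (FArr (Pr C) (inv_arr C f)) (FArr (Pr C) f)"
  using cB(9)[of "FArr (Pr C) (inv_arr C f)"] v F i by simp
 also have "\<dots> = FArr (Pr C) (Comp C (inv_arr C f) f)" using F(8)[OF i(7,1)] i by simp
 finally show ?thesis using F(4)[of "Dom C f"] c(1)[OF i(7)] i(4) b by simp
qed

lemma comp_cancel:
 assumes C: "category C" and e: "iso_arrow C e" and f: "f \<in> Arr C" "Dom C f = Cod C e"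
 shows "Comp C (Comp C f e) (inv_arr C e) = f"
proof -
 note i = inv_arr_rules[OF e] and c = category_rules[OF C]
 have "Comp C (Comp C f e) (inv_arr C e) = Comp C f (Comp C e (inv_arr C e))"
  using c(11)[OF i(1) i(7) f(1)] i f by simp
 thus ?thesis using i(5) c(9)[OF f(1)] f by simp
qed

lemma comp_cancel_left:
 assumes C: "category C" and e: "iso_arrow C e" and f: "f \<in> Arr C" "Cod C f = Cod C e"
 shows "Comp C e (Comp C (inv_arr C e) f) = f"
proof -
 note i = inv_arr_rules[OF e] and c = category_rules[OF C]
 have "Comp C e (Comp C (inv_arr C e) f) = Comp C (Comp C e (inv_arr C e)) f"
  using c(11)[OF f(1) i(1) i(7)] i f by simp
 thus ?thesis using i(5) c(10)[OF f(1)] f by simp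
qed

lemma comp_cancel_left':
 assumes C: "category C" and e: "iso_arrow C e" and f: "f \<in> Arr C" "Cod C f = Dom C e"
 shows "Comp C (inv_arr C e) (Comp C e f) = f"
proof -
 note i = inv_arr_rules[OF e] and c = category_rules[OF C]
 have "Comp C (inv_arr C e) (Comp C e f) = Comp C (Comp C (inv_arr C e) e) f"
  using c(11)[OF f(1) i(7) i(1)] i f by simp
 thus ?thesis using i(4) c(10)[OF f(1)] f by simp
qed

lemma iso_left_cancel:
 assumes "category C" "iso_arrow C e" "f \<in> Arr C" "Cod C f = Dom C e"
  "f' \<in> Arr C" "Cod C f' = Dom C e" "Comp C e f = Comp C e f'"
 shows "f = f'"
proof -
 have "f = Comp C (inv_arr C e) (Comp C e f)" using comp_cancel_left'[OF assms(1-4)] by (rule sym)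
 also have "\<dots> = Comp C (inv_arr C e) (Comp C e f')" by (subst assms(7)) (rule refl)
 also have "\<dots> = f'" by (rule comp_cancel_left'[OF assms(1,2,5,6)])
 finally show ?thesis .
qed

lemma iso_comp:
 assumes C: "category C" and e: "iso_arrow C e" and f: "iso_arrow C f" and ef: "Cod C e = Dom C f"
 shows "iso_arrow C (Comp C f e)"
proof -
 note i = inv_arr_rules[OF e] and j = inv_arr_rules[OF f] and c = category_rules[OF C]
 let ?g = "Comp C (inv_arr C e) (inv_arr C f)" and ?h = "Comp C f e"
 have gh: "?g \<in> Arr C" "Dom C ?g = Cod C f" "Cod C ?g = Dom C e" "?h \<in> Arr C" "Dom C ?h = Dom C e" "Cod C ?h = Cod C f"
  using i j ef c(6,7,8) by simp_all
 show ?thesis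
 proof (rule iso_arrowI[of _ _ ?g])
  have "Comp C ?g ?h = Comp C (inv_arr C e) (Comp C (inv_arr C f) ?h)"
   using c(11)[of ?h "inv_arr C f" "inv_arr C e"] i j ef gh by simp
  also have "Comp C (inv_arr C f) ?h = e" using comp_cancel_left'[OF C f] i ef by simp
  finally show "Comp C ?g ?h = Ide C (Dom C ?h)" using i gh by simp
  have "Comp C ?h ?g = Comp C f (Comp C e ?g)"
   using c(11)[of ?g e f] i j ef gh by simp
  also have "Comp C e ?g = inv_arr C f" using comp_cancel_left[OF C e] j ef by simp
  finally show "Comp C ?h ?g = Ide C (Cod C ?h)" using j gh by simp
 qed (use gh in auto)
qed

section \<open>Natural isomorphisms over the base\<close>

lemma nat_iso_over_rules:
 assumes "nat_iso_over B C D F G t"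
 shows ni_src: "functor_over B C D F" and ni_tgt: "functor_over B C D G"
  and ni_iso: "\<And>x. x \<in> Obj C ==> iso_arrow D (t x)"
  and ni_Dom: "\<And>x. x \<in> Obj C ==> Dom D (t x) = FObj F x"
  and ni_Cod: "\<And>x. x \<in> Obj C ==> Cod D (t x) = FObj G x"
  and ni_Pr: "\<And>x. x \<in> Obj C ==> FArr (Pr D) (t x) = Ide B (FObj (Pr C) x)"
  and ni_nat: "\<And>f. f \<in> Arr C ==> Comp D (FArr G f) (t (Dom C f)) = Comp D (t (Cod C f)) (FArr F f)"
 using assms unfolding nat_iso_over_def by auto

lemma nat_iso_over_sym:
 assumes t: "nat_iso_over B C D F G t"
 shows "nat_iso_over B C D G F (\<lambda>x. inv_arr D (t x))"
proof -
 note n = nat_iso_over_rules[OF t]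
 note F = functor_over_rules[OF n(1)] and G = functor_over_rules[OF n(2)]
 note fF = functor_rules[OF F(3)] and fG = functor_rules[OF G(3)]
 note cC = category_rules[OF fF(1)] and cD = category_rules[OF fF(2)]
 have "Comp D (FArr F f) (inv_arr D (t (Dom C f))) = Comp D (inv_arr D (t (Cod C f))) (FArr G f)"
  if f: "f \<in> Arr C" for f
 proof -
  let ?a = "t (Dom C f)" and ?b = "t (Cod C f)"
  have x: "Dom C f \<in> Obj C" "Cod C f \<in> Obj C" using f cC by auto
  note ia = inv_arr_rules[OF n(3)[OF x(1)]] and ib = inv_arr_rules[OF n(3)[OF x(2)]]
  have "Comp D (inv_arr D ?b) (FArr G f)
    = Comp D (inv_arr D ?b) (Comp D (Comp D (FArr G f) ?a) (inv_arr D ?a))"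
   using comp_cancel[OF fF(2) n(3)[OF x(1)], of "FArr G f"] fG(5,6)[OF f] n(5)[OF x(1)] by simp
  also have "\<dots> = Comp D (inv_arr D ?b) (Comp D (Comp D ?b (FArr F f)) (inv_arr D ?a))"
   using n(7)[OF f] by simp
  also have "Comp D (Comp D ?b (FArr F f)) (inv_arr D ?a) = Comp D ?b (Comp D (FArr F f) (inv_arr D ?a))"
   using cD(11)[of "inv_arr D ?a" "FArr F f" ?b] ia ib fF(5,6,7)[OF f] n(4)[OF x(1)] n(4)[OF x(2)] by simp
  also have "Comp D (inv_arr D ?b) \<dots> = Comp D (FArr F f) (inv_arr D ?a)"
   using comp_cancel_left'[OF fF(2) n(3)[OF x(2)], of "Comp D (FArr F f) (inv_arr D ?a)"]
    ia fF(5,6,7)[OF f] n(4)[OF x(1)] n(4)[OF x(2)] cD by simp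
  finally show ?thesis by simp
 qed
 moreover have "FArr (Pr D) (inv_arr D (t x)) = Ide B (FObj (Pr C) x)" if "x \<in> Obj C" for x
  using inv_arr_vertical[OF F(2) n(3)[OF that] n(6)[OF that]] n(4)[OF that] F(4)[OF that] by simp
 ultimately show ?thesis unfolding nat_iso_over_def
  using n(1,2) inv_iso[OF n(3)] inv_Dom[OF n(3)] inv_Cod[OF n(3)] n(4,5) by simp
qed

lemma nat_iso_over_whisker:
 assumes t: "nat_iso_over B C D F G t" and H: "functor_over B D E H"
 shows "nat_iso_over B C E (comp_ftor H F) (comp_ftor H G) (\<lambda>x. FArr H (t x))"
proof -
 note n = nat_iso_over_rules[OF t]
 note fH = functor_rules[OF fo_ftor[OF H]]
 note fF = functor_rules[OF fo_ftor[OF n(1)]] and fG = functor_rules[OF fo_ftor[OF n(2)]]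
 note cC = category_rules[OF fF(1)]
 have "Comp E (FArr H (FArr G f)) (FArr H (t (Dom C f))) = Comp E (FArr H (t (Cod C f))) (FArr H (FArr F f))"
  if f: "f \<in> Arr C" for f
 proof -
  have x: "Dom C f \<in> Obj C" "Cod C f \<in> Obj C" using f cC by auto
  show ?thesis
   using fH(8)[of "t (Dom C f)" "FArr G f"] fH(8)[of "FArr F f" "t (Cod C f)"] n(7)[OF f]
    n(4)[OF x(2)] n(5)[OF x(1)] fF(5,7)[OF f] fG(5,6)[OF f] iso_Arr[OF n(3)[OF x(1)]] iso_Arr[OF n(3)[OF x(2)]] by simp
 qed
 moreover have "iso_arrow E (FArr H (t x))" "Dom E (FArr H (t x)) = FObj H (FObj F x)"
  "Cod E (FArr H (t x)) = FObj H (FObj G x)" "FArr (Pr E) (FArr H (t x)) = Ide B (FObj (Pr C) x)"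
  if x: "x \<in> Obj C" for x
  using iso_arrow_functor[OF fo_ftor[OF H] n(3)[OF x]] fH(6,7)[OF iso_Arr[OF n(3)[OF x]]] n(4,5,6)[OF x]
   fo_Arr[OF H iso_Arr[OF n(3)[OF x]]] by auto
 ultimately show ?thesis unfolding nat_iso_over_def
  using functor_over_comp[OF n(1) H] functor_over_comp[OF n(2) H] by simp
qed

lemma nat_iso_over_prewhisker:
 assumes t: "nat_iso_over B D E F G t" and H: "functor_over B C D H"
 shows "nat_iso_over B C E (comp_ftor F H) (comp_ftor G H) (\<lambda>x. t (FObj H x))"
proof -
 note n = nat_iso_over_rules[OF t] and fH = functor_rules[OF fo_ftor[OF H]]
 have "Comp E (FArr G (FArr H f)) (t (FObj H (Dom C f))) = Comp E (t (FObj H (Cod C f))) (FArr F (FArr H f))"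
  if f: "f \<in> Arr C" for f
  using n(7)[OF fH(5)[OF f]] fH(6,7)[OF f] by simp
 thus ?thesis unfolding nat_iso_over_def
  using functor_over_comp[OF H n(1)] functor_over_comp[OF H n(2)] n fH fo_Obj[OF H] by simp
qed

text \<open>The criterion "fully faithful and essentially surjective", with essential surjectivity
  up to isomorphisms over identities. This is what allows the quasi-inverse to commute strictly with
  the projections to \<open>B\<close>.\<close>

theorem quasi_inverse:
 assumes F: "functor_over B C D F"
  and ff: "\<And>x y h. x \<in> Obj C ==> y \<in> Obj C ==> h \<in> Arr D ==> Dom D h = FObj F x ==> Cod D h = FObj F y ==>
    \<exists>f. f \<in> Arr C \<and> Dom C f = x \<and> Cod C f = y \<and> FArr F f = h"
  and fa: "\<And>f f'. f \<in> Arr C ==> f' \<in> Arr C ==> Dom C f = Dom C f' ==> Cod C f = Cod C f' ==>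
    FArr F f = FArr F f' ==> f = f'"
  and es: "\<And>d. d \<in> Obj D ==> \<exists>c e. c \<in> Obj C \<and> iso_arrow D e \<and> Dom D e = FObj F c \<and> Cod D e = d \<and>
    FArr (Pr D) e = Ide B (FObj (Pr D) d)"
 shows "\<exists>G s t. functor_over B D C G \<and> nat_iso_over B C C id_ftor (comp_ftor G F) s \<and>
   nat_iso_over B D D (comp_ftor F G) id_ftor t"
proof -
 note FF = functor_over_rules[OF F]
 note f = functor_rules[OF FF(3)]
 note cC = category_rules[OF f(1)] and cD = category_rules[OF f(2)]
 note pC = functor_rules[OF FF(1)] and pD = functor_rules[OF FF(2)]
 note cB = category_rules[OF pC(2)]
 from es obtain G0 e where G0: "\<And>d. d \<in> Obj D ==> G0 d \<in> Obj C \<and> iso_arrow D (e d) \<and> Dom D (e d) = FObj F (G0 d) \<and>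
   Cod D (e d) = d \<and> FArr (Pr D) (e d) = Ide B (FObj (Pr D) d)" by metis
 \<comment> \<open>\<open>e d\<close> lies over an identity, so its source lies over the same object
   as \<open>d\<close>.\<close>
 have prG: "FObj (Pr C) (G0 d) = FObj (Pr D) d" if d: "d \<in> Obj D" for d
  using pD(6)[OF iso_Arr, of "e d"] G0[OF d] cB(4) pD(3)[OF d] FF(4) by simp
 \<comment> \<open>\<open>h\<close> conjugated by the chosen isomorphisms; the quasi-inverse sends
   \<open>h\<close> to the preimage of \<open>L h\<close> under \<open>F\<close>, and
   \<open>e\<close> becomes the counit.\<close>
 define L where "L h = Comp D (inv_arr D (e (Cod D h))) (Comp D h (e (Dom D h)))" for h
 have L: "L h \<in> Arr D" "Dom D (L h) = FObj F (G0 (Dom D h))" "Cod D (L h) = FObj F (G0 (Cod D h))"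
  "Comp D (e (Cod D h)) (L h) = Comp D h (e (Dom D h))" "FArr (Pr D) (L h) = FArr (Pr D) h"
  if h: "h \<in> Arr D" for h
 proof -
  have d: "Dom D h \<in> Obj D" "Cod D h \<in> Obj D" using cD h by auto
  note a = G0[OF d(1)] and b = G0[OF d(2)]
  note ia = inv_arr_rules[OF a[THEN conjunct2, THEN conjunct1]] and ib = inv_arr_rules[OF b[THEN conjunct2, THEN conjunct1]]
  have he: "Comp D h (e (Dom D h)) \<in> Arr D" "Dom D (Comp D h (e (Dom D h))) = FObj F (G0 (Dom D h))"
   "Cod D (Comp D h (e (Dom D h))) = Cod D h"
   using cD(6,7,8)[of "e (Dom D h)" h] h a ia by auto
  show "L h \<in> Arr D" "Dom D (L h) = FObj F (G0 (Dom D h))" "Cod D (L h) = FObj F (G0 (Cod D h))"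
   unfolding L_def using cD(6,7,8)[OF he(1) ib(1)] he(2,3) ib(2,3) b by auto
  show "Comp D (e (Cod D h)) (L h) = Comp D h (e (Dom D h))"
   unfolding L_def using comp_cancel_left[OF f(2) _ he(1), of "e (Cod D h)"] b he by simp
  have "FArr (Pr D) (inv_arr D (e (Cod D h))) = Ide B (FObj (Pr D) (Cod D h))"
   using inv_arr_vertical[OF FF(2), of "e (Cod D h)" "FObj (Pr D) (Cod D h)"] b FF(4) prG[OF d(2)] by simp
  thus "FArr (Pr D) (L h) = FArr (Pr D) h"
   unfolding L_def using pD(8)[OF he(1) ib(1)] pD(8)[OF ia(7) h] he ib(2) a b
    cB(9)[of "FArr (Pr D) h"] cB(10)[of "FArr (Pr D) h"] pD(5,6,7)[OF h] by simp
 qed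
 have "\<exists>k. k \<in> Arr C \<and> Dom C k = G0 (Dom D h) \<and> Cod C k = G0 (Cod D h) \<and> FArr F k = L h" if h: "h \<in> Arr D" for h
  using ff[OF _ _ L(1)[OF h] L(2)[OF h] L(3)[OF h]] G0 cD h by blast
 then obtain G1 where G1: "\<And>h. h \<in> Arr D ==> G1 h \<in> Arr C \<and> Dom C (G1 h) = G0 (Dom D h) \<and> Cod C (G1 h) = G0 (Cod D h) \<and>
   FArr F (G1 h) = L h" by metis
 define G where "G = \<lparr>FObj = G0, FArr = G1\<rparr>"
 have eArr: "e d \<in> Arr D" if "d \<in> Obj D" for d using G0[OF that] iso_Arr by auto
 have GI: "G1 (Ide D d) = Ide C (G0 d)" if d: "d \<in> Obj D" for d
 proof (rule fa)
  have "L (Ide D d) = Ide D (FObj F (G0 d))"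
   unfolding L_def using cD(4,5)[OF d] cD(10)[OF eArr[OF d]] inv_left[of D "e d"] G0[OF d] by simp
  thus "FArr F (G1 (Ide D d)) = FArr F (Ide C (G0 d))"
   using G1 cD(3)[OF d] f(4) G0[OF d] by simp
 qed (use G1[OF cD(3)[OF d]] cD(4,5)[OF d] cC(3,4,5) G0[OF d] in auto)
 have GC: "G1 (Comp D k h) = Comp C (G1 k) (G1 h)" if h: "h \<in> Arr D" and k: "k \<in> Arr D" and hk: "Cod D h = Dom D k" for h k
 proof -
  have kh: "Comp D k h \<in> Arr D" "Dom D (Comp D k h) = Dom D h" "Cod D (Comp D k h) = Cod D k"
   using cD(6,7,8)[OF h k hk] by auto
  have g: "Cod C (G1 h) = Dom C (G1 k)" using G1[OF h] G1[OF k] hk by simp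
  have ob: "Dom D h \<in> Obj D" "Cod D k \<in> Obj D" "Dom D k \<in> Obj D" using cD h k by auto
  show ?thesis
  proof (rule fa)
   \<comment> \<open>Functoriality is tested after composing with the isomorphism \<open>e\<close>,
     where the conjugations telescope.\<close>
   have "Comp D (e (Cod D k)) (L (Comp D k h)) = Comp D (Comp D k h) (e (Dom D h))" using L(4)[OF kh(1)] kh by simp
   also have "\<dots> = Comp D k (Comp D h (e (Dom D h)))" using cD(11)[OF eArr[OF ob(1)] h k] G0[OF ob(1)] hk by simp
   also have "\<dots> = Comp D k (Comp D (e (Cod D h)) (L h))" using L(4)[OF h] by simp
   also have "\<dots> = Comp D (Comp D k (e (Dom D k))) (L h)"
    using cD(11)[OF L(1)[OF h] eArr[OF ob(3)] k] L(3)[OF h] G0[OF ob(3)] hk by simp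
   also have "\<dots> = Comp D (Comp D (e (Cod D k)) (L k)) (L h)" using L(4)[OF k] by simp
   also have "\<dots> = Comp D (e (Cod D k)) (Comp D (L k) (L h))"
    using cD(11)[OF L(1)[OF h] L(1)[OF k] eArr[OF ob(2)]] L(2,3) h k hk G0[OF ob(2)] by simp
   finally have "L (Comp D k h) = Comp D (L k) (L h)"
    using iso_left_cancel[OF f(2), of "e (Cod D k)"] L kh h k hk G0[OF ob(2)] cD(6,7,8) by simp
   thus "FArr F (G1 (Comp D k h)) = FArr F (Comp C (G1 k) (G1 h))"
    using G1[OF kh(1)] G1[OF h] G1[OF k] f(8)[of "G1 h" "G1 k"] hk by simp
  qed (use G1[OF kh(1)] G1[OF h] G1[OF k] cC(6,7,8)[of "G1 h" "G1 k"] kh hk in auto)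
 qed
 have Gf: "functor_over B D C G"
  unfolding functor_over_def is_functor_def G_def
  using FF(1)[unfolded is_functor_def] FF(2)[unfolded is_functor_def] f(1,2) GI GC G1 G0 prG L(5) FF(5)
  by simp (metis (no_types))
 have 1: "nat_iso_over B D D (comp_ftor F G) id_ftor e"
  unfolding nat_iso_over_def using functor_over_comp[OF Gf F] functor_over_id[OF FF(2)] G0 L(4) G1
  by (simp add: G_def)
 \<comment> \<open>The unit at \<open>c\<close> is the preimage of the inverse of \<open>e\<close>.
   The preimage of \<open>e\<close> itself serves to show that this unit is invertible.\<close>
 have "\<exists>k. k \<in> Arr C \<and> Dom C k = c \<and> Cod C k = G0 (FObj F c) \<and> FArr F k = inv_arr D (e (FObj F c))"
  and "\<exists>k. k \<in> Arr C \<and> Dom C k = G0 (FObj F c) \<and> Cod C k = c \<and> FArr F k = e (FObj F c)" if c: "c \<in> Obj C" for c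
  using ff[of c "G0 (FObj F c)"] ff[of "G0 (FObj F c)" c] G0[OF f(3)[OF c]] inv_arr_rules[of D "e (FObj F c)"] c by auto
 then obtain s s' where s: "\<And>c. c \<in> Obj C ==> s c \<in> Arr C \<and> Dom C (s c) = c \<and> Cod C (s c) = G0 (FObj F c) \<and> FArr F (s c) = inv_arr D (e (FObj F c))"
  and s': "\<And>c. c \<in> Obj C ==> s' c \<in> Arr C \<and> Dom C (s' c) = G0 (FObj F c) \<and> Cod C (s' c) = c \<and> FArr F (s' c) = e (FObj F c)"
  by metis
 have 2: "nat_iso_over B C C id_ftor (comp_ftor G F) s"
 proof -
  have "iso_arrow C (s c) \<and> Dom C (s c) = c \<and> Cod C (s c) = G0 (FObj F c) \<and> FArr (Pr C) (s c) = Ide B (FObj (Pr C) c)"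
   if c: "c \<in> Obj C" for c
  proof -
   note i = inv_arr_rules[of D "e (FObj F c)"] and g = G0[OF f(3)[OF c]]
   have "iso_arrow C (s c)"
   proof (rule iso_arrowI[of _ _ "s' c"])
    show "Comp C (s' c) (s c) = Ide C (Dom C (s c))"
     by (rule fa) (use f(8)[of "s c" "s' c"] f(4)[OF c] s[OF c] s'[OF c] i g cC(3,4,5)[OF c] cC(6,7,8)[of "s c" "s' c"] in auto)
    have gc: "G0 (FObj F c) \<in> Obj C" using g by simp
    show "Comp C (s c) (s' c) = Ide C (Cod C (s c))"
     by (rule fa) (use f(8)[of "s' c" "s c"] f(4)[OF gc] s[OF c] s'[OF c] i g cC(3,4,5)[OF gc] cC(6,7,8)[of "s' c" "s c"] in auto)
   qed (use s[OF c] s'[OF c] in auto)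
   moreover have "FArr (Pr C) (s c) = Ide B (FObj (Pr C) c)"
    using FF(5)[of "s c"] s[OF c] g FF(4)[OF c] prG[OF f(3)[OF c]] FF(4)[of "G0 (FObj F c)"]
     inv_arr_vertical[OF FF(2), of "e (FObj F c)" "FObj (Pr C) c"] by simp
   ultimately show ?thesis using s[OF c] by simp
  qed
  moreover have "Comp C (G1 (FArr F k)) (s (Dom C k)) = Comp C (s (Cod C k)) k" if k: "k \<in> Arr C" for k
  proof -
   have x: "Dom C k \<in> Obj C" "Cod C k \<in> Obj C" using cC k by auto
   note sx = s[OF x(1)] and sy = s[OF x(2)] and g = G1[OF f(5)[OF k]] and ex = G0[OF f(3)[OF x(1)]] and ey = G0[OF f(3)[OF x(2)]]
   have 1: "Cod C (s (Dom C k)) = Dom C (G1 (FArr F k))" using sx g f(6)[OF k] by simp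
   have "FArr F (Comp C (G1 (FArr F k)) (s (Dom C k))) = Comp D (L (FArr F k)) (inv_arr D (e (FObj F (Dom C k))))"
    using f(8)[of "s (Dom C k)" "G1 (FArr F k)"] sx g 1 by simp
   also have "\<dots> = Comp D (inv_arr D (e (FObj F (Cod C k)))) (Comp D (Comp D (FArr F k) (e (FObj F (Dom C k)))) (inv_arr D (e (FObj F (Dom C k)))))"
    unfolding L_def using cD(11)[of "inv_arr D (e (FObj F (Dom C k)))" "Comp D (FArr F k) (e (FObj F (Dom C k)))" "inv_arr D (e (FObj F (Cod C k)))"]
     inv_arr_rules[of D "e (FObj F (Dom C k))"] inv_arr_rules[of D "e (FObj F (Cod C k))"] ex ey f(5,6,7)[OF k] cD(6,7,8)[of "e (FObj F (Dom C k))" "FArr F k"] by simp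
   also have "\<dots> = Comp D (inv_arr D (e (FObj F (Cod C k)))) (FArr F k)"
    using comp_cancel[OF f(2), of "e (FObj F (Dom C k))" "FArr F k"] ex f(5,6)[OF k] by simp
   also have "\<dots> = FArr F (Comp C (s (Cod C k)) k)" using f(8)[of k "s (Cod C k)"] k sy by simp
   finally have eq: "FArr F (Comp C (G1 (FArr F k)) (s (Dom C k))) = FArr F (Comp C (s (Cod C k)) k)" .
   show ?thesis
    by (rule fa[OF _ _ _ _ eq]) (use 1 sx sy g k f(6,7)[OF k] cC(6,7,8)[of "s (Dom C k)" "G1 (FArr F k)"] cC(6,7,8)[of k "s (Cod C k)"] in auto)
  qed
  ultimately show ?thesis unfolding nat_iso_over_def
   using functor_over_comp[OF F Gf] functor_over_id[OF FF(1)] by (simp add: G_def)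
 qed
 from Gf 1 2 show ?thesis by blast
qed

section \<open>Cones\<close>

lemma rpc_homD:
 assumes "f \<in> rpc_hom S T"
 shows rpc_hom_out: "\<And>x. x \<notin> span (Lat S) ==> f x = 0"
  and rpc_hom_add: "\<And>x y. x \<in> span (Lat S) ==> y \<in> span (Lat S) ==> f (x + y) = f x + f y"
  and rpc_hom_scale: "\<And>c x. x \<in> span (Lat S) ==> f (c *\<^sub>R x) = c *\<^sub>R f x"
  and rpc_hom_Lat: "\<And>x. x \<in> Lat S ==> f x \<in> Lat T"
  and rpc_hom_Supp: "\<And>x. x \<in> Supp S ==> f x \<in> Supp T"
 using assms unfolding rpc_hom_def by auto

lemma rpc_homI:
 assumes "\<And>x. x \<notin> span (Lat S) ==> f x = 0"
  and "\<And>x y. x \<in> span (Lat S) ==> y \<in> span (Lat S) ==> f (x + y) = f x + f y"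
  and "\<And>c x. x \<in> span (Lat S) ==> f (c *\<^sub>R x) = c *\<^sub>R f x"
  and "\<And>x. x \<in> Lat S ==> f x \<in> Lat T" and "\<And>x. x \<in> Supp S ==> f x \<in> Supp T"
 shows "f \<in> rpc_hom S T"
 using assms unfolding rpc_hom_def by auto

lemma rpc_hom_0:
 assumes "f \<in> rpc_hom S T" shows "f 0 = 0"
 using rpc_hom_scale[OF assms, of 0 0] span_zero[of "Lat S"] by simp

text \<open>Linearity carries lattice vectors to the span of the target lattice, and outside
  \<open>N\<^sub>\<real>\<close> the value is \<open>0\<close>. With this normal form a plain
  composite of functions is again a morphism and \<open>rpc_id\<close> is a unit.\<close>

lemma rpc_hom_span:
 assumes f: "f \<in> rpc_hom S T" shows "f x \<in> span (Lat T)"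
proof (cases "x \<in> span (Lat S)")
 case True
 hence "x \<in> span (Lat S) \<and> f x \<in> span (Lat T)"
 proof (induction rule: span_induct_alt)
  case base show ?case by (simp add: rpc_hom_0[OF f] span_zero)
 next
  case (step c x y)
  note x = span_base[OF step(1)] span_scale[OF span_base[OF step(1)], of c]
  from step have "f (c *\<^sub>R x + y) = c *\<^sub>R f x + f y"
   using rpc_hom_add[OF f, of "c *\<^sub>R x" y] rpc_hom_scale[OF f, of x c] x by simp
  thus ?case using step rpc_hom_Lat[OF f] x span_add span_scale span_base by metis
 qed
 thus ?thesis ..
qed (simp add: rpc_hom_out[OF f] span_zero)

lemma rpc_hom_comp:
 assumes f: "f \<in> rpc_hom S T" and g: "g \<in> rpc_hom T R"
 shows "g o f \<in> rpc_hom S R"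
 by (rule rpc_homI)
  (simp_all add: rpc_homD[OF f] rpc_homD[OF g] rpc_hom_0[OF g] rpc_hom_span[OF f])

lemma rpcone_span: "is_rpcone S ==> span (Supp S) = span (Lat S)"
 unfolding is_rpcone_def by simp

lemma rpc_id_in:
 assumes "is_rpcone S" shows "rpc_id S \<in> rpc_hom S S"
 using rpcone_span[OF assms] span_base[of _ "Supp S"] span_base[of _ "Lat S"]
 by (intro rpc_homI) (auto simp: rpc_id_def span_add span_scale)

lemma comp_rpc_id: "f \<in> rpc_hom S T ==> f o rpc_id S = f"
 using rpc_hom_0[of f S T] rpc_hom_out[of f S T] by (auto simp: rpc_id_def fun_eq_iff)

lemma rpc_id_comp: "f \<in> rpc_hom S T ==> rpc_id T o f = f"
 using rpc_hom_span[of f S T] by (auto simp: rpc_id_def fun_eq_iff)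

lemma RPC_simps [simp]:
 "Obj RPC = {S. is_rpcone S}"
 "Arr RPC = {(S, T, f). is_rpcone S \<and> is_rpcone T \<and> f \<in> rpc_hom S T}"
 "Dom RPC (S, T, f) = S" "Cod RPC (S, T, f) = T" "Ide RPC S = (S, S, rpc_id S)"
 "Comp RPC (T', R, g') (S, T, f) = (S, R, g' o f)"
 by (simp_all add: RPC_def)

lemma category_RPC: "category RPC"
 unfolding category_def
 by (auto simp: rpc_id_in rpc_hom_comp comp_rpc_id rpc_id_comp comp_assoc)

lemma slice_simps [simp]:
 "Obj (slice S) = {(T, p). is_rpcone T \<and> p \<in> rpc_hom T S}"
 "((T, p), (T', p'), g) \<in> Arr (slice S) \<longleftrightarrow> is_rpcone T \<and> is_rpcone T' \<and>
    p \<in> rpc_hom T S \<and> p' \<in> rpc_hom T' S \<and> g \<in> rpc_hom T T' \<and> p' o g = p"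
 "Dom (slice S) (x, y, g) = x" "Cod (slice S) (x, y, g) = y" "Ide (slice S) (T, p) = ((T, p), (T, p), rpc_id T)"
 "Comp (slice S) (y', z, g') (x, y, g) = (x, z, g' o g)"
 "FObj (Pr (slice S)) x = fst x" "FArr (Pr (slice S)) (x, y, g) = (fst x, fst y, g)"
 by (simp_all add: slice_def)

lemma category_slice: "category (slice S)"
 unfolding category_def
 by (auto simp: rpc_id_in rpc_hom_comp comp_rpc_id rpc_id_comp comp_assoc)

lemma is_functor_slice: "is_functor (slice S) RPC (Pr (slice S))"
 unfolding is_functor_def
 by (auto simp: category_RPC category_slice)

text \<open>Linear maps are compared on a spanning set. It is applied to the lattice and, because
  the cone is full-dimensional, also to the support.\<close>

lemma rpc_hom_eqI:
 assumes f: "f \<in> rpc_hom T R" and g: "g \<in> rpc_hom T R'"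
  and S: "span S = span (Lat T)" and eq: "\<And>x. x \<in> S ==> f x = g x"
 shows "f = g"
proof
 fix x show "f x = g x"
 proof (cases "x \<in> span (Lat T)")
  case True
  hence "x \<in> span S" using S by simp
  hence "x \<in> span S \<and> f x = g x"
  proof (induction rule: span_induct_alt)
   case base show ?case using rpc_hom_0[OF f] rpc_hom_0[OF g] span_zero by simp
  next
   case (step c x y)
   have "x \<in> span (Lat T)" "c *\<^sub>R x \<in> span (Lat T)" "y \<in> span (Lat T)"
    using step(2) span_base[OF step(1)] S span_scale by auto
   thus ?case
    using rpc_hom_add[OF f, of "c *\<^sub>R x" y] rpc_hom_scale[OF f, of x c]
     rpc_hom_add[OF g, of "c *\<^sub>R x" y] rpc_hom_scale[OF g, of x c] step eq[of x] S span_add by simp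
  qed
  thus ?thesis ..
 qed (simp add: rpc_hom_out[OF f] rpc_hom_out[OF g])
qed

section \<open>The dual monoid\<close>

lemma dualD:
 assumes "d \<in> dual_monoid T"
 shows dual_hom: "d \<in> rpc_hom T Rge0"
  and dual_nonneg: "\<And>x. x \<in> Supp T ==> 0 \<le> d x" and dual_Int: "\<And>x. x \<in> Lat T ==> d x \<in> \<int>"
  and dual_at_0: "d 0 = 0"
proof -
 show h: "d \<in> rpc_hom T Rge0" using assms by (simp add: dual_monoid_def)
 show "0 \<le> d x" if "x \<in> Supp T" for x using rpc_hom_Supp[OF h that] by (simp add: Rge0_def)
 show "d x \<in> \<int>" if "x \<in> Lat T" for x using rpc_hom_Lat[OF h that] by (simp add: Rge0_def)
 show "d 0 = 0" by (rule rpc_hom_0[OF h])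
qed

lemma dual_comp: "d \<in> dual_monoid T ==> f \<in> rpc_hom S T ==> d o f \<in> dual_monoid S"
 unfolding dual_monoid_def by (rule rpc_hom_comp)

lemma dual_zero: "(\<lambda>x. 0) \<in> dual_monoid T"
 unfolding dual_monoid_def by (rule rpc_homI) (auto simp: Rge0_def)

lemma dual_add: "d \<in> dual_monoid T ==> d' \<in> dual_monoid T ==> (\<lambda>x. d x + d' x) \<in> dual_monoid T"
 unfolding dual_monoid_def rpc_hom_def by (auto simp: Rge0_def image_subset_iff algebra_simps)

lemma dual_eq0_iff:
 assumes "is_rpcone T" "d \<in> dual_monoid T"
 shows "d = (\<lambda>x. 0) \<longleftrightarrow> (\<forall>x\<in>Supp T. d x = 0)"
 using rpc_hom_eqI[OF dual_hom[OF assms(2)] dual_hom[OF dual_zero] rpcone_span[OF assms(1)]] by auto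

text \<open>Sharpness of the dual monoid: two functions that are nonnegative on the support and have
  sum zero vanish there, and the support spans.\<close>

lemma dual_add_eq0:
 assumes "is_rpcone T" "d \<in> dual_monoid T" "d' \<in> dual_monoid T"
 shows "(\<lambda>x. d x + d' x) = (\<lambda>x. 0) \<longleftrightarrow> d = (\<lambda>x. 0) \<and> d' = (\<lambda>x. 0)"
proof -
 have "(\<forall>x\<in>Supp T. d x + d' x = 0) \<longleftrightarrow> (\<forall>x\<in>Supp T. d x = 0) \<and> (\<forall>x\<in>Supp T. d' x = 0)"
  using dual_nonneg[OF assms(2)] dual_nonneg[OF assms(3)] using add_nonneg_eq_0_iff by (smt (verit))
 thus ?thesis
  using dual_eq0_iff[OF assms(1) dual_add[OF assms(2,3)]] dual_eq0_iff[OF assms(1,2)] dual_eq0_iff[OF assms(1,3)] by simp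
qed

lemma leg_cone_hom:
 "p \<in> rpc_hom T (leg_cone S) \<longleftrightarrow> fst o p \<in> rpc_hom T S \<and> snd o p \<in> dual_monoid T"
 unfolding dual_monoid_def rpc_hom_def leg_cone_def prod_cone_def Rge0_def
 by (auto simp: image_subset_iff prod_eq_iff mem_Times_iff)

text \<open>The fibre product constrains only lattice and support vectors. By linearity the relation
  between length and coordinates holds on the whole span and, all maps being \<open>0\<close>
  outside, as an equation of functions.\<close>

lemma edge_cone_hom:
 assumes len: "len G e \<in> dual_monoid S"
 shows "p \<in> rpc_hom T (edge_cone G S e) \<longleftrightarrow> fst o p \<in> rpc_hom T S \<and>
   fst o snd o p \<in> dual_monoid T \<and> snd o snd o p \<in> dual_monoid T \<and>
   len G e o (fst o p) = (\<lambda>x. fst (snd (p x)) + snd (snd (p x)))"  (is "_ \<longleftrightarrow> ?R")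
proof
 assume p: "p \<in> rpc_hom T (edge_cone G S e)"
 have 1: "fst o p \<in> rpc_hom T S" "fst o snd o p \<in> dual_monoid T" "snd o snd o p \<in> dual_monoid T"
  using p unfolding dual_monoid_def rpc_hom_def edge_cone_def fibre_cone_def prod_cone_def Rge0_def
  by (auto simp: image_subset_iff prod_eq_iff mem_Times_iff case_prod_beta)
 have "len G e o (fst o p) = (\<lambda>x. (fst o snd o p) x + (snd o snd o p) x)"
 proof (rule rpc_hom_eqI[OF _ _ refl])
  show "len G e o (fst o p) \<in> rpc_hom T Rge0" using dual_hom[OF dual_comp[OF len 1(1)]] .
  show "(\<lambda>x. (fst o snd o p) x + (snd o snd o p) x) \<in> rpc_hom T Rge0"
   using dual_hom[OF dual_add[OF 1(2,3)]] .
  show "(len G e o (fst o p)) x = (fst o snd o p) x + (snd o snd o p) x" if "x \<in> Lat T" for x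
   using rpc_hom_Lat[OF p that] by (simp add: edge_cone_def fibre_cone_def case_prod_beta)
 qed
 with 1 show ?R by simp
next
 assume R: ?R
 hence "\<And>x. len G e (fst (p x)) = fst (snd (p x)) + snd (snd (p x))" by (simp add: fun_eq_iff)
 with R show "p \<in> rpc_hom T (edge_cone G S e)"
  unfolding dual_monoid_def rpc_hom_def edge_cone_def fibre_cone_def prod_cone_def Rge0_def
  by (auto simp: image_subset_iff prod_eq_iff mem_Times_iff case_prod_beta)
qed

section \<open>Weighted contractions\<close>

text \<open>Half-edges. Lengths and contractions are indexed by them instead of by two-element sets,
  so that an edge can be followed from either end.\<close>

definition hedges :: "('x, 'z) wgraph_scheme \<Rightarrow> 'x set" where
 "hedges G = {k \<in> flags G. flip G k ~= k}"

text \<open>The quantity in the stability condition. It is minus the Euler characteristic of a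
  surface whose genus is the weight and whose boundary circles are the flags, which explains its
  additivity under contraction.\<close>

definition echar :: "('x, 'z) wgraph_scheme \<Rightarrow> 'x \<Rightarrow> int" where
 "echar G v = 2 * int (wt G v) - 2 + int (valence G v)"

text \<open>Adjacency through prescribed flags. All flags give connectedness, the contracted flags
  give the fibres of a contraction, and the half-edges of vanishing length give the gluing of
  cones.\<close>

definition steps :: "('x, 'z) wgraph_scheme \<Rightarrow> 'x set \<Rightarrow> ('x \<times> 'x) set" where
 "steps G K = {(rt G k, rt G (flip G k)) | k. k \<in> K}"

lemma marked_graph_rules:
 assumes "marked_graph n G"
 shows mg_fin: "finite (Cells G)" and mg_rt: "\<And>x. x \<in> Cells G ==> rt G x \<in> Cells G"
  and mg_rt_rt: "\<And>x. x \<in> Cells G ==> rt G (rt G x) = rt G x"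
  and mg_flip: "\<And>x. x \<in> Cells G ==> flip G x \<in> Cells G"
  and mg_flip_flip: "\<And>x. x \<in> Cells G ==> flip G (flip G x) = x"
  and mg_flip_vert: "\<And>v. v \<in> verts G ==> flip G v = v"
  and mg_mark: "bij_betw (mark G) {1..n} (legs G)"
 using assms unfolding marked_graph_def by auto

lemma verts_iff: "marked_graph n G ==> v \<in> verts G \<longleftrightarrow> v \<in> Cells G \<and> rt G v = v"
 unfolding verts_def using marked_graph_rules[of n G] by (auto simp: image_iff) metis

lemma flags_iff: "marked_graph n G ==> k \<in> flags G \<longleftrightarrow> k \<in> Cells G \<and> rt G k ~= k"
 using verts_iff[of n G k] unfolding flags_def by auto

lemma flags_Cells: "k \<in> flags G ==> k \<in> Cells G"
 unfolding flags_def by auto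

lemma verts_Cells: "marked_graph n G ==> k \<in> verts G ==> k \<in> Cells G"
 by (simp add: verts_iff)

lemma rt_verts: "k \<in> Cells G ==> rt G k \<in> verts G"
 unfolding verts_def by auto

lemma rt_vert: "marked_graph n G ==> v \<in> verts G ==> rt G v = v"
 by (simp add: verts_iff)

lemma flip_flags: "marked_graph n G ==> k \<in> flags G ==> flip G k \<in> flags G"
 using marked_graph_rules[of n G] unfolding flags_def by (metis Diff_iff)

lemma flip_hedges: "marked_graph n G ==> k \<in> hedges G ==> flip G k \<in> hedges G"
 using flip_flags[of n G k] mg_flip_flip[of n G k] flags_Cells[of k G] unfolding hedges_def by auto

lemma finite_cells:
 assumes "marked_graph n G"
 shows "finite (verts G)" "finite (flags G)" "finite (hedges G)" "finite (edges G)"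
proof -
 show "finite (verts G)" "finite (flags G)" "finite (hedges G)"
  using mg_fin[OF assms] by (auto simp: verts_def flags_def hedges_def)
 moreover have "edges G = (\<lambda>k. {k, flip G k}) ` hedges G"
  by (auto simp: edges_def hedges_def)
 ultimately show "finite (edges G)" by simp
qed

lemma edges_hedges: "edges G = (\<lambda>k. {k, flip G k}) ` hedges G"
 by (auto simp: edges_def hedges_def)

lemma mark_legs: "marked_graph n G ==> i \<in> {1..n} ==> mark G i \<in> legs G"
 using bij_betw_apply[OF mg_mark] by blast

lemma mark_Cells: "marked_graph n G ==> i \<in> {1..n} ==> mark G i \<in> Cells G"
 using mark_legs[of n G i] by (simp add: legs_def flags_def)

lemma legs_mark: "marked_graph n G ==> l \<in> legs G ==> \<exists>i\<in>{1..n}. l = mark G i"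
 using mg_mark[of n G] unfolding bij_betw_def by blast

lemma stable_echar: "stable G \<longleftrightarrow> (\<forall>v\<in>verts G. echar G v > 0)"
 by (simp add: stable_def echar_def)

lemma adjacent_steps: "adjacent G = steps G (flags G)"
 by (simp add: adjacent_def steps_def)

lemma sym_steps:
 assumes "\<And>k. k \<in> K ==> flip G k \<in> K \<and> flip G (flip G k) = k"
 shows "sym ((steps G K)\<^sup>*)"
proof (rule sym_rtrancl, rule symI)
 fix a b assume "(a, b) \<in> steps G K"
 then obtain k where "k \<in> K" "a = rt G k" "b = rt G (flip G k)" unfolding steps_def by auto
 hence "(b, a) = (rt G (flip G k), rt G (flip G (flip G k)))" "flip G k \<in> K" using assms by auto
 thus "(b, a) \<in> steps G K" unfolding steps_def by blast
qed

lemma steps_mono: "K \<subseteq> K' ==> steps G K \<subseteq> steps G K'"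
 unfolding steps_def by auto

lemma connected_iff:
 assumes G: "marked_graph n G"
 shows "connected_graph G \<longleftrightarrow> verts G ~= {} \<and> (\<forall>v\<in>verts G. \<forall>w\<in>verts G. (v, w) \<in> (steps G (flags G))\<^sup>*)"
proof -
 define R where "R = (adjacent G)\<^sup>* \<inter> verts G \<times> verts G"
 have s: "sym ((steps G (flags G))\<^sup>*)"
  by (rule sym_steps) (use flip_flags[OF G] mg_flip_flip[OF G] flags_Cells[of _ G] in auto)
 have R: "equiv (verts G) R"
  unfolding R_def adjacent_steps
  by (rule equivI) (use s in \<open>auto simp: refl_on_def sym_def trans_def\<close>)
 show ?thesis
 proof
  assume "connected_graph G"
  then obtain X where X: "verts G // R = {X}"
   by (auto simp: connected_graph_def components_def R_def card_1_singleton_iff)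
  hence "\<And>v. v \<in> verts G ==> R `` {v} = X" using quotientI[of _ "verts G" R] by auto
  hence "(v, w) \<in> R" if "v \<in> verts G" "w \<in> verts G" for v w
   using eq_equiv_class_iff[OF R that] that by simp
  moreover have "verts G ~= {}" using X by auto
  ultimately show "verts G ~= {} \<and> (\<forall>v\<in>verts G. \<forall>w\<in>verts G. (v, w) \<in> (steps G (flags G))\<^sup>*)"
   unfolding R_def adjacent_steps by auto
 next
  assume *: "verts G ~= {} \<and> (\<forall>v\<in>verts G. \<forall>w\<in>verts G. (v, w) \<in> (steps G (flags G))\<^sup>*)"
  hence "R `` {v} = verts G" if "v \<in> verts G" for v
   using that unfolding R_def adjacent_steps by auto
  hence "verts G // R = {verts G}" using * unfolding quotient_def by auto
  thus "connected_graph G" by (simp add: connected_graph_def components_def R_def)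
 qed
qed

lemma card_hedges:
 assumes G: "marked_graph n G" shows "card (hedges G) = 2 * card (edges G)"
proof -
 have "card (hedges G) = (\<Sum>e\<in>edges G. \<Sum>k\<in>{k \<in> hedges G. {k, flip G k} = e}. 1)"
  using finite_cells[OF G] by (subst sum.group) (auto simp: edges_hedges)
 also have "\<dots> = (\<Sum>e\<in>edges G. 2)"
 proof (rule sum.cong[OF refl])
  fix e assume "e \<in> edges G"
  then obtain k where k: "k \<in> hedges G" "e = {k, flip G k}" by (auto simp: edges_hedges)
  hence "{k \<in> hedges G. {k, flip G k} = e} = {k, flip G k}"
   using flip_hedges[OF G] mg_flip_flip[OF G] flags_Cells[of k G] by (auto simp: hedges_def doubleton_eq_iff)
  thus "(\<Sum>k\<in>{k \<in> hedges G. {k, flip G k} = e}. 1) = (2::nat)" using k by (auto simp: hedges_def card_insert_if)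
 qed
 finally show ?thesis by simp
qed

text \<open>The valences add up to the number of flags, and the flags are \<open>n\<close> legs
  together with two half-edges for each edge.\<close>

lemma sum_echar:
 assumes G: "marked_graph n G"
 shows "(\<Sum>v\<in>verts G. echar G v) =
   2 * (int (card (edges G)) - int (card (verts G)) + int (\<Sum>v\<in>verts G. wt G v)) + int n"
proof -
 have "int (card (flags G)) = (\<Sum>v\<in>verts G. int (valence G v))"
 proof -
  have "card (flags G) = (\<Sum>v\<in>verts G. \<Sum>k\<in>{k \<in> flags G. rt G k = v}. 1)"
   using finite_cells[OF G] by (subst sum.group) (auto intro: rt_verts flags_Cells)
  thus ?thesis by (simp add: valence_def)
 qed
 moreover have "card (flags G) = card (legs G) + card (hedges G)"
  using finite_cells[OF G] by (subst card_Un_disjoint[symmetric])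
   (auto simp: legs_def hedges_def intro!: arg_cong[where f = card])
 moreover have "card (legs G) = n" using bij_betw_same_card[OF mg_mark[OF G]] by simp
 ultimately show ?thesis using card_hedges[OF G]
  by (simp add: echar_def sum.distrib sum_subtractf sum_distrib_left)
qed

text \<open>A connected graph contributes a single component to \<open>betti1\<close>, so half of
  \<open>sum_echar\<close> without the legs is the genus minus one.\<close>

lemma genus_iff:
 assumes G: "marked_graph n G" and c: "connected_graph G"
 shows "genus G = int g \<longleftrightarrow> (\<Sum>v\<in>verts G. echar G v) = 2 * int g - 2 + int n"
 using sum_echar[OF G] c by (auto simp: genus_def betti1_def connected_graph_def)

text \<open>
 The direct description of the maps generated by isomorphisms and weighted edge contractions.  The
 weights enter through additivity of \<open>2h(v) - 2 + val(v)\<close> over the fibres; unlike the genus of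
 a fibre this is visibly stable under composition.
\<close>

definition contr :: "nat \<Rightarrow> ('x, 'y) wgraph_scheme \<Rightarrow> ('x, 'z) wgraph_scheme \<Rightarrow> ('x \<Rightarrow> 'x) \<Rightarrow> bool" where
 "contr n G H f \<longleftrightarrow> marked_graph n G \<and> marked_graph n H \<and>
   f \<in> extensional (Cells G) \<and> f ` Cells G = Cells H \<and>
   (\<forall>x\<in>Cells G. f (rt G x) = rt H (f x) \<and> f (flip G x) = flip H (f x)) \<and>
   (\<forall>i\<in>{1..n}. f (mark G i) = mark H i) \<and>
   (\<forall>x\<in>Cells G. \<forall>y\<in>Cells G. f x = f y \<and> f x \<notin> verts H \<longrightarrow> x = y) \<and>
   (\<forall>v\<in>verts G. \<forall>w\<in>verts G. f v = f w \<longrightarrow> (v, w) \<in> (steps G {k \<in> flags G. f k \<in> verts H})\<^sup>*) \<and>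
   (\<forall>v\<in>verts H. echar H v = (\<Sum>w\<in>{w \<in> verts G. f w = v}. echar G w))"

lemma contr_rules:
 assumes "contr n G H f"
 shows contr_src: "marked_graph n G" and contr_tgt: "marked_graph n H"
  and contr_ext: "f \<in> extensional (Cells G)" and contr_img: "f ` Cells G = Cells H"
  and contr_Cells: "\<And>x. x \<in> Cells G ==> f x \<in> Cells H"
  and contr_rt: "\<And>x. x \<in> Cells G ==> f (rt G x) = rt H (f x)"
  and contr_flip: "\<And>x. x \<in> Cells G ==> f (flip G x) = flip H (f x)"
  and contr_mark: "\<And>i. i \<in> {1..n} ==> f (mark G i) = mark H i"
  and contr_inj: "\<And>x y. x \<in> Cells G ==> y \<in> Cells G ==> f x = f y ==> f x \<notin> verts H ==> x = y"
  and contr_conn: "\<And>v w. v \<in> verts G ==> w \<in> verts G ==> f v = f w ==>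
    (v, w) \<in> (steps G {k \<in> flags G. f k \<in> verts H})\<^sup>*"
  and contr_echar: "\<And>v. v \<in> verts H ==> echar H v = (\<Sum>w\<in>{w \<in> verts G. f w = v}. echar G w)"
 using assms unfolding contr_def by blast+

lemma contrI:
 assumes "marked_graph n G" "marked_graph n H" "f \<in> extensional (Cells G)" "f ` Cells G = Cells H"
  "\<And>x. x \<in> Cells G ==> f (rt G x) = rt H (f x)" "\<And>x. x \<in> Cells G ==> f (flip G x) = flip H (f x)"
  "\<And>i. i \<in> {1..n} ==> f (mark G i) = mark H i"
  "\<And>x y. x \<in> Cells G ==> y \<in> Cells G ==> f x = f y ==> f x \<notin> verts H ==> x = y"
  "\<And>v w. v \<in> verts G ==> w \<in> verts G ==> f v = f w ==> (v, w) \<in> (steps G {k \<in> flags G. f k \<in> verts H})\<^sup>*"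
  "\<And>v. v \<in> verts H ==> echar H v = (\<Sum>w\<in>{w \<in> verts G. f w = v}. echar G w)"
 shows "contr n G H f"
 unfolding contr_def by (intro conjI ballI impI; (rule assms(4) | blast intro: assms))

lemma contr_verts:
 assumes "contr n G H f" "v \<in> verts G" shows "f v \<in> verts H"
 using verts_iff[OF contr_src[OF assms(1)]] verts_iff[OF contr_tgt[OF assms(1)]]
  contr_rules[OF assms(1)] assms(2) by metis

lemma contr_vert_iff:
 assumes c: "contr n G H f" and x: "x \<in> Cells G"
 shows "f x \<in> verts H \<longleftrightarrow> f (rt G x) = f x"
 using verts_iff[OF contr_tgt[OF c]] contr_rt[OF c x] contr_Cells[OF c x] by auto

lemma contr_surj_verts:
 assumes c: "contr n G H f" and v: "v \<in> verts H" shows "\<exists>w\<in>verts G. f w = v"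
proof -
 obtain x where x: "x \<in> Cells G" "v = f x"
  using v verts_Cells[OF contr_tgt[OF c]] contr_img[OF c] by auto
 hence "f (rt G x) = v" using contr_vert_iff[OF c x(1)] v by simp
 thus ?thesis using rt_verts[OF x(1)] by blast
qed

lemma contr_surj_flags:
 assumes c: "contr n G H f" and k: "k \<in> flags H" shows "\<exists>x\<in>flags G. f x = k"
proof -
 obtain x where x: "x \<in> Cells G" "k = f x"
  using flags_Cells[OF k] contr_img[OF c] by blast
 hence "x \<in> flags G" using k contr_verts[OF c] unfolding flags_def by auto
 thus ?thesis using x by blast
qed

text \<open>Every leg carries a marking and markings are preserved, so no leg is contracted to a
  vertex.\<close>

lemma contr_legs:
 assumes c: "contr n G H f" and k: "k \<in> legs G" shows "f k \<in> legs H"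
proof -
 obtain i where "i \<in> {1..n}" "k = mark G i" using k mg_mark[OF contr_src[OF c]] unfolding bij_betw_def by blast
 thus ?thesis using contr_mark[OF c] mg_mark[OF contr_tgt[OF c]] by (auto simp: bij_betw_def)
qed

lemma contr_contracted:
 assumes c: "contr n G H f"
 shows "{k \<in> flags G. f k \<in> verts H} = {k \<in> hedges G. f k \<in> verts H}"
 using contr_legs[OF c] unfolding hedges_def legs_def flags_def by auto

lemma contr_flip_vert:
 assumes c: "contr n G H f" and k: "k \<in> Cells G"
 shows "f (flip G k) \<in> verts H \<longleftrightarrow> f k \<in> verts H"
proof -
 have "f (flip G k) \<in> verts H" if "f k \<in> verts H" "k \<in> Cells G" for k
  using contr_flip[OF c that(2)] mg_flip_vert[OF contr_tgt[OF c]] that by simp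
 thus ?thesis using k mg_flip[OF contr_src[OF c]] mg_flip_flip[OF contr_src[OF c]] by metis
qed

lemma contr_steps_eq:
 assumes c: "contr n G H f" and vw: "(v, w) \<in> (steps G {k \<in> flags G. f k \<in> verts H})\<^sup>*"
 shows "f v = f w"
 using vw
proof (induction rule: rtrancl_induct)
 case (step y z)
 then obtain k where k: "k \<in> flags G" "f k \<in> verts H" "y = rt G k" "z = rt G (flip G k)"
  unfolding steps_def by auto
 have "f (flip G k) \<in> verts H" using contr_flip_vert[OF c] k flags_Cells[of k G] by auto
 hence "f y = f z"
  using contr_vert_iff[OF c] k mg_flip[OF contr_src[OF c]] flags_Cells[of k G]
   contr_flip[OF c] mg_flip_vert[OF contr_tgt[OF c] k(2)] by metis
 with step show ?case by simp
qed simp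

text \<open>Two cells over the same vertex have roots in the same connected fibre; away from
  vertices \<open>f\<close> is injective. Hence the kernel of \<open>f\<close> depends only on the
  set of contracted flags, which is what makes contractions comparable.\<close>

lemma contr_kernel:
 assumes c: "contr n G H f" and x: "x \<in> Cells G" and y: "y \<in> Cells G"
 shows "f x = f y \<longleftrightarrow> x = y \<or> (f x \<in> verts H \<and> f y \<in> verts H \<and>
   (rt G x, rt G y) \<in> (steps G {k \<in> flags G. f k \<in> verts H})\<^sup>*)"
proof
 assume e: "f x = f y"
 show "x = y \<or> (f x \<in> verts H \<and> f y \<in> verts H \<and>
   (rt G x, rt G y) \<in> (steps G {k \<in> flags G. f k \<in> verts H})\<^sup>*)"
 proof (cases "f x \<in> verts H")
  case True
  hence "f (rt G x) = f (rt G y)" using e contr_vert_iff[OF c x] contr_vert_iff[OF c y] by simp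
  thus ?thesis using True e contr_conn[OF c rt_verts[OF x] rt_verts[OF y]] by simp
 qed (use contr_inj[OF c x y e] in simp)
next
 assume "x = y \<or> (f x \<in> verts H \<and> f y \<in> verts H \<and>
   (rt G x, rt G y) \<in> (steps G {k \<in> flags G. f k \<in> verts H})\<^sup>*)"
 thus "f x = f y"
  using contr_steps_eq[OF c] contr_vert_iff[OF c x] contr_vert_iff[OF c y] by metis
qed

text \<open>A path in \<open>H\<close> lifts because each of its flags lifts and the gaps are filled
  inside connected fibres; a path in \<open>G\<close> descends because contracted steps become
  constant. It is used for composing contractions and for edges of length zero.\<close>

lemma contr_path:
 assumes c: "contr n G H f" and K: "K \<subseteq> flags H" and v: "v \<in> verts G" and w: "w \<in> verts G"
 shows "(f v, f w) \<in> (steps H K)\<^sup>* \<longleftrightarrow> (v, w) \<in> (steps G {k \<in> flags G. f k \<in> verts H \<or> f k \<in> K})\<^sup>*"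
proof
 note C = contr_rules[OF c]
 let ?S = "steps G {k \<in> flags G. f k \<in> verts H \<or> f k \<in> K}"
 have sub: "(v, w) \<in> ?S\<^sup>*" if "(v, w) \<in> (steps G {k \<in> flags G. f k \<in> verts H})\<^sup>*" for v w
  using that rtrancl_mono[OF steps_mono[of "{k \<in> flags G. f k \<in> verts H}" "{k \<in> flags G. f k \<in> verts H \<or> f k \<in> K}" G]]
  by auto
 have path: "\<forall>w\<in>verts G. f w = u \<longrightarrow> (v, w) \<in> ?S\<^sup>*" if "(f v, u) \<in> (steps H K)\<^sup>*" for u
  using that
 proof (induction rule: rtrancl_induct)
  case base
  show ?case by (intro ballI impI sub C(10)[OF v]) simp_all
 next
  case (step u u')
  show ?case
  proof (intro ballI impI)
   fix w assume w: "w \<in> verts G" "f w = u'"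
   obtain k where k: "k \<in> K" "u = rt H k" "u' = rt H (flip H k)"
    using step(2) unfolding steps_def by auto
   \<comment> \<open>One lifted flag \<open>x\<close> performs the step; before and after it the
     path moves within the fibres of its two ends.\<close>
   obtain x where x: "x \<in> flags G" "f x = k" using contr_surj_flags[OF c] K k(1) by blast
   have xc: "x \<in> Cells G" "flip G x \<in> Cells G" using flags_Cells[OF x(1)] mg_flip[OF C(1)] by auto
   have "(v, rt G x) \<in> ?S\<^sup>*" using step(3) C(6)[OF xc(1)] k x rt_verts[OF xc(1)] by auto
   moreover have "(rt G x, rt G (flip G x)) \<in> ?S" using x k xc unfolding steps_def by (intro CollectI exI[of _ x]) auto
   moreover have "(rt G (flip G x), w) \<in> ?S\<^sup>*"
    using C(10)[OF rt_verts[OF xc(2)] w(1)] C(6)[OF xc(2)] C(7)[OF xc(1)] k x w(2) sub by auto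
   ultimately show "(v, w) \<in> ?S\<^sup>*" by auto
  qed
 qed
 thus "(f v, f w) \<in> (steps H K)\<^sup>* ==> (v, w) \<in> ?S\<^sup>*" using w by blast
 show "(v, w) \<in> ?S\<^sup>* ==> (f v, f w) \<in> (steps H K)\<^sup>*"
 proof (induction rule: rtrancl_induct)
  case (step y z)
  then obtain k where k: "k \<in> flags G" "f k \<in> verts H \<or> f k \<in> K" "y = rt G k" "z = rt G (flip G k)"
   unfolding steps_def by auto
  have kc: "k \<in> Cells G" "flip G k \<in> Cells G" using flags_Cells[OF k(1)] mg_flip[OF C(1)] by auto
  have "f y = f z \<or> (f y, f z) \<in> steps H K"
  proof (cases "f k \<in> verts H")
   case True
   hence "(y, z) \<in> (steps G {k \<in> flags G. f k \<in> verts H})\<^sup>*" using k unfolding steps_def by blast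
   thus ?thesis using contr_steps_eq[OF c] by blast
  next
   case False
   thus ?thesis using k C(6)[OF kc(1)] C(6)[OF kc(2)] C(7)[OF kc(1)] unfolding steps_def by auto
  qed
  with step show ?case by auto
 qed simp
qed

text \<open>Additivity of \<open>echar\<close> composes by grouping the fibre of the composite over
  the middle graph. Connected fibres compose by \<open>contr_path\<close>, taken with the flags that
  \<open>f'\<close> contracts.\<close>

lemma contr_comp:
 assumes c: "contr n G H f" and d: "contr n H K f'"
 shows "contr n G K (compose (Cells G) f' f)"
proof -
 note C = contr_rules[OF c] and D = contr_rules[OF d]
 let ?h = "compose (Cells G) f' f"
 have h: "?h x = f' (f x)" if "x \<in> Cells G" for x using that by (simp add: compose_def)
 have img: "?h ` Cells G = Cells K"
  using h C(4) D(4) by (metis (no_types, lifting) image_comp image_cong o_apply)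
 have inj: "x = y" if "x \<in> Cells G" "y \<in> Cells G" "?h x = ?h y" "?h x \<notin> verts K" for x y
 proof -
  have "f x = f y" using D(9)[of "f x" "f y"] that h C(5) by simp
  moreover have "f x \<notin> verts H" using contr_verts[OF d] that h by metis
  ultimately show ?thesis using C(9) that by blast
 qed
 let ?S = "steps G {k \<in> flags G. ?h k \<in> verts K}"
 have "{k \<in> flags G. ?h k \<in> verts K} = {k \<in> flags G. f k \<in> verts H \<or> f k \<in> {k \<in> flags H. f' k \<in> verts K}}"
  using h C(5) contr_verts[OF d] by (auto simp: flags_def)
 hence conn: "(v, w) \<in> ?S\<^sup>*" if v: "v \<in> verts G" and w: "w \<in> verts G" and e: "?h v = ?h w" for v w
  using contr_path[OF c, of "{k \<in> flags H. f' k \<in> verts K}" v w] D(10)[of "f v" "f w"]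
   contr_verts[OF c] v w e h verts_Cells[OF C(1)] by auto
 have ech: "echar K u = (\<Sum>w\<in>{w \<in> verts G. ?h w = u}. echar G w)" if u: "u \<in> verts K" for u
 proof -
  have "(\<Sum>w\<in>{w \<in> verts G. ?h w = u}. echar G w)
    = (\<Sum>v\<in>{v \<in> verts H. f' v = u}. \<Sum>w\<in>{w \<in> {w \<in> verts G. ?h w = u}. f w = v}. echar G w)"
   by (rule sum.group[symmetric])
    (use finite_cells[OF C(1)] finite_cells[OF C(2)] contr_verts[OF c] h verts_Cells[OF C(1)] in auto)
  also have "\<dots> = (\<Sum>v\<in>{v \<in> verts H. f' v = u}. echar H v)"
  proof (rule sum.cong[OF refl])
   fix v assume v: "v \<in> {v \<in> verts H. f' v = u}"
   hence "{w \<in> {w \<in> verts G. ?h w = u}. f w = v} = {w \<in> verts G. f w = v}"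
    using h verts_Cells[OF C(1)] by auto
   thus "(\<Sum>w\<in>{w \<in> {w \<in> verts G. ?h w = u}. f w = v}. echar G w) = echar H v"
    using C(11) v by simp
  qed
  finally show ?thesis using D(11)[OF u] by simp
 qed
 have "?h (mark G i) = mark K i" if "i \<in> {1..n}" for i
  using h[OF mark_Cells[OF C(1) that]] C(8) D(8) that by simp
 moreover have "?h (rt G x) = rt K (?h x) \<and> ?h (flip G x) = flip K (?h x)" if "x \<in> Cells G" for x
  using h that C(5-7) D(6,7) mg_rt[OF C(1)] mg_flip[OF C(1)] by simp
 moreover have "?h \<in> extensional (Cells G)" by (simp add: compose_def)
 ultimately show ?thesis unfolding contr_def using C(1) D(2) img inj conn ech by blast
qed

lemma truncate_simps [simp]:
 "Cells (wgraph.truncate G) = Cells G" "rt (wgraph.truncate G) = rt G"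
 "flip (wgraph.truncate G) = flip G" "wt (wgraph.truncate G) = wt G" "mark (wgraph.truncate G) = mark G"
 by (simp_all add: wgraph.truncate_def)

lemma truncate_simps2 [simp]:
 "verts (wgraph.truncate G) = verts G" "flags (wgraph.truncate G) = flags G"
 "legs (wgraph.truncate G) = legs G" "edges (wgraph.truncate G) = edges G"
 "valence (wgraph.truncate G) = valence G" "echar (wgraph.truncate G) = echar G"
 "steps (wgraph.truncate G) = steps G" "marked_graph n (wgraph.truncate G) = marked_graph n G"
 "hedges (wgraph.truncate G) = hedges G"
 by (auto simp: verts_def flags_def legs_def edges_def valence_def echar_def steps_def marked_graph_def hedges_def fun_eq_iff)

lemma contr_truncate [simp]:
 "contr n (wgraph.truncate G) (wgraph.truncate H) f = contr n G H f"
 "contr n (wgraph.truncate G) H' f = contr n G H' f"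
 "contr n G' (wgraph.truncate H) f = contr n G' H f"
 by (simp_all add: contr_def)

section \<open>Isomorphisms and edge contractions as instances of \<open>contr\<close>\<close>

lemma iso_cells:
 assumes G: "marked_graph n G" and H: "marked_graph n H" and b: "bij_betw f (Cells G) (Cells H)"
  and r': "\<forall>x\<in>Cells G. f (rt G x) = rt H (f x)"
 shows "\<And>x. x \<in> Cells G ==> f x \<in> verts H \<longleftrightarrow> x \<in> verts G"
  and "\<And>v. v \<in> verts G ==> valence H (f v) = valence G v"
proof -
 have r: "f (rt G x) = rt H (f x)" if "x \<in> Cells G" for x using r' that by blast
 show 1: "f x \<in> verts H \<longleftrightarrow> x \<in> verts G" if "x \<in> Cells G" for x
  using verts_iff[OF G] verts_iff[OF H] r[OF that] that bij_betwE[OF b] mg_rt[OF G that] bij_betw_imp_inj_on[OF b]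
  by (metis inj_onD)
 show "valence H (f v) = valence G v" if v: "v \<in> verts G" for v
 proof -
  have "bij_betw f {k \<in> flags G. rt G k = v} {k \<in> flags H. rt H k = f v}"
  proof (rule bij_betw_imageI)
   show "inj_on f {k \<in> flags G. rt G k = v}"
    using bij_betw_imp_inj_on[OF b] by (rule inj_on_subset) (auto simp: flags_def)
   show "f ` {k \<in> flags G. rt G k = v} = {k \<in> flags H. rt H k = f v}"
   proof (intro subset_antisym subsetI)
    fix y assume "y \<in> f ` {k \<in> flags G. rt G k = v}"
    then obtain k where k: "k \<in> flags G" "rt G k = v" "y = f k" by blast
    thus "y \<in> {k \<in> flags H. rt H k = f v}"
     unfolding k(3) flags_def
     using 1[OF flags_Cells[OF k(1)]] r[OF flags_Cells[OF k(1)]] bij_betw_apply[OF b flags_Cells[OF k(1)]]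
     by (simp add: flags_def)
   next
    fix y assume y: "y \<in> {k \<in> flags H. rt H k = f v}"
    hence "y \<in> f ` Cells G" using bij_betw_imp_surj_on[OF b] by (simp add: flags_def)
    then obtain x where x: "x \<in> Cells G" "y = f x" by blast
    hence "f (rt G x) = f v" using y r by simp
    hence "rt G x = v"
     using inj_onD[OF bij_betw_imp_inj_on[OF b]] mg_rt[OF G x(1)] verts_Cells[OF G v] by blast
    thus "y \<in> f ` {k \<in> flags G. rt G k = v}" using x y 1 by (auto simp: flags_def)
   qed
  qed
  thus ?thesis unfolding valence_def by (simp add: bij_betw_same_card)
 qed
qed

lemma iso_imp_contr:
 assumes i: "wgraph_iso n G H f" shows "contr n G H f"
proof -
 have G: "marked_graph n G" and H: "marked_graph n H" and b: "bij_betw f (Cells G) (Cells H)"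
  and c: "cell_map n G H f" and w: "\<And>v. v \<in> verts G ==> wt H (f v) = wt G v"
  using i unfolding wgraph_iso_def cell_map_def by auto
 have r: "\<forall>x\<in>Cells G. f (rt G x) = rt H (f x)" using c unfolding cell_map_def by auto
 note I = iso_cells[OF G H b r]
 have fib: "{w \<in> verts G. f w = f v} = {v}" if "v \<in> verts G" for v
  using that bij_betw_imp_inj_on[OF b] verts_Cells[OF G] by (auto dest: inj_onD)
 have "echar H v = (\<Sum>w\<in>{w \<in> verts G. f w = v}. echar G w)" if v: "v \<in> verts H" for v
 proof -
  obtain x where x: "x \<in> Cells G" "v = f x" using v verts_Cells[OF H] bij_betw_imp_surj_on[OF b] by blast
  hence "x \<in> verts G" using v I(1) by simp
  thus ?thesis using x fib I(2) w by (simp add: echar_def)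
 qed
 moreover have "(v, w) \<in> (steps G K)\<^sup>*" if "v \<in> verts G" "w \<in> verts G" "f v = f w" for v w K
  using fib[OF that(1)] that by auto
 ultimately show ?thesis
  using c b inj_onD[OF bij_betw_imp_inj_on[OF b]] bij_betw_imp_surj_on[OF b]
  unfolding contr_def cell_map_def by auto
qed

text \<open>All fibres over vertices are singletons, so \<open>echar\<close> agrees vertex by
  vertex; since the valences agree as well, so do the weights.\<close>

lemma contr_inj_iso:
 assumes c: "contr n G H f" and i: "inj_on f (Cells G)"
 shows "wgraph_iso n (wgraph.truncate G) (wgraph.truncate H) f"
proof -
 note C = contr_rules[OF c]
 have b: "bij_betw f (Cells G) (Cells H)" using i C(4) by (simp add: bij_betw_def)
 have r: "\<forall>x\<in>Cells G. f (rt G x) = rt H (f x)" using C(6) by blast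
 note I = iso_cells[OF C(1,2) b r]
 have "wt H (f v) = wt G v" if v: "v \<in> verts G" for v
 proof -
  have "{w \<in> verts G. f w = f v} = {v}" using v by (auto simp: inj_on_eq_iff[OF i] verts_Cells[OF C(1)])
  hence "echar H (f v) = echar G v" using C(11)[OF contr_verts[OF c v]] by simp
  thus ?thesis using I(2)[OF v] by (simp add: echar_def)
 qed
 moreover have "cell_map n (wgraph.truncate G) (wgraph.truncate H) f"
  unfolding cell_map_def by (simp add: C(1-3,6-8) image_subset_iff C(5))
 ultimately show ?thesis unfolding wgraph_iso_def using b by simp
qed

text \<open>Contracting an edge loses two flags. For a non-loop the two vertices contribute
  \<open>- 4\<close> to the sum of \<open>echar\<close> but the merged vertex only
  \<open>- 2\<close>, and for a loop the weight grows by 1; either way \<open>echar\<close> is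
  additive.\<close>

lemma edge_contraction_imp_contr:
 assumes ec: "edge_contraction n G e H f" shows "contr n G H f"
  and "{k \<in> flags G. f k \<in> verts H} = e"
proof -
 have cm: "cell_map n G H f" and e: "e \<in> edges G" and img: "f ` Cells G = Cells H"
  and ker: "\<And>x y. x \<in> Cells G ==> y \<in> Cells G ==> f x = f y \<longleftrightarrow>
    x = y \<or> (x \<in> e \<union> rt G ` e \<and> y \<in> e \<union> rt G ` e)"
  and w1: "\<And>v. v \<in> verts G ==> v \<notin> rt G ` e ==> wt H (f v) = wt G v"
  and w2: "\<And>v. v \<in> rt G ` e ==> wt H (f v) =
    (\<Sum>w\<in>rt G ` e. wt G w) + (if card (rt G ` e) = 1 then 1 else 0)"
  using ec unfolding edge_contraction_def by simp_all auto
 have G: "marked_graph n G" and H: "marked_graph n H" and ext: "f \<in> extensional (Cells G)"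
  and r: "\<And>x. x \<in> Cells G ==> f (rt G x) = rt H (f x)"
  and fl: "\<And>x. x \<in> Cells G ==> f (flip G x) = flip H (f x)"
  and mk: "\<And>i. i \<in> {1..n} ==> f (mark G i) = mark H i"
  using cm unfolding cell_map_def by auto
 obtain k where k: "k \<in> hedges G" "e = {k, flip G k}" using e by (auto simp: edges_hedges)
 have kf: "k \<in> flags G" "flip G k \<in> flags G" "flip G k ~= k"
  using k flip_hedges[OF G k(1)] by (auto simp: hedges_def)
 have kc: "k \<in> Cells G" "flip G k \<in> Cells G" using kf by (auto simp: flags_def)
 have ef: "e \<subseteq> flags G" "rt G ` e \<subseteq> verts G" using k kf rt_verts[OF kc(1)] rt_verts[OF kc(2)] by auto
 have vf: "f x \<in> verts H \<longleftrightarrow> x \<in> verts G \<or> x \<in> e" if x: "x \<in> Cells G" for x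
 proof -
  have "f x \<in> verts H \<longleftrightarrow> f (rt G x) = f x" using verts_iff[OF H] r[OF x] x img by auto
  also have "\<dots> \<longleftrightarrow> x \<in> verts G \<or> x \<in> e"
   using ker[OF mg_rt[OF G x] x] verts_iff[OF G, of x] ef x by auto
  finally show ?thesis .
 qed
 show ct: "{k \<in> flags G. f k \<in> verts H} = e"
  using vf ef flags_Cells by (auto simp: flags_def)
 have fin: "finite e" "card e = 2" using k kf by auto
 have fibre: "{w \<in> verts G. f w = f v} = (if v \<in> rt G ` e then rt G ` e else {v})" if v: "v \<in> verts G" for v
  using ker[OF verts_Cells[OF G] verts_Cells[OF G v]] v ef by (auto simp: flags_def)
 have val: "valence H (f v) = card {k \<in> flags G - e. f (rt G k) = f v}" if v: "v \<in> verts G" for v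
 proof -
  have "f ` {k \<in> flags G - e. f (rt G k) = f v} = {h \<in> flags H. rt H h = f v}"
  proof (intro subset_antisym subsetI)
   fix y assume "y \<in> f ` {k \<in> flags G - e. f (rt G k) = f v}"
   then obtain x where x: "x \<in> flags G - e" "f (rt G x) = f v" "y = f x" by auto
   moreover have "x \<in> Cells G" using x by (auto simp: flags_def)
   ultimately show "y \<in> {h \<in> flags H. rt H h = f v}" using vf r img by (auto simp: flags_def)
  next
   fix y assume y: "y \<in> {h \<in> flags H. rt H h = f v}"
   then obtain x where x: "x \<in> Cells G" "y = f x" using img by (auto simp: flags_def)
   thus "y \<in> f ` {k \<in> flags G - e. f (rt G k) = f v}" using y vf r by (auto simp: flags_def)
  qed
  moreover have "inj_on f {k \<in> flags G - e. f (rt G k) = f v}"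
   using ker ef by (intro inj_onI) (auto simp: flags_def)
  hence "card (f ` {k \<in> flags G - e. f (rt G k) = f v}) = card {k \<in> flags G - e. f (rt G k) = f v}"
   by (rule card_image)
  ultimately show ?thesis unfolding valence_def by simp
 qed
 have ech: "echar H u = (\<Sum>w\<in>{w \<in> verts G. f w = u}. echar G w)" if u: "u \<in> verts H" for u
 proof -
  obtain x where x: "x \<in> Cells G" "u = f x" using u verts_Cells[OF H] img by blast
  define v where "v = rt G x"
  have v: "v \<in> verts G" "u = f v" using x u r verts_iff[OF H] rt_verts unfolding v_def by auto
  show ?thesis
  proof (cases "v \<in> rt G ` e")
   case False
   have "v \<notin> e" using ef v(1) by (auto simp: flags_def)
   have "{k \<in> flags G - e. f (rt G k) = f v} = {k \<in> flags G. rt G k = v}"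
    using False \<open>v \<notin> e\<close> ker[OF mg_rt[OF G] verts_Cells[OF G v(1)]] by (auto simp: flags_def)
   hence "valence H u = valence G v" using val[OF v(1)] v(2) by (simp add: valence_def)
   thus ?thesis using fibre[OF v(1)] False v w1[OF v(1) False] by (simp add: echar_def)
  next
   case True
   have fv: "f w = f v \<longleftrightarrow> w \<in> rt G ` e" if "w \<in> verts G" for w
    using fibre[OF v(1)] True that by auto
   have "{k \<in> flags G - e. f (rt G k) = f v} = {k \<in> flags G. rt G k \<in> rt G ` e} - e"
    using fv rt_verts[of _ G] by (auto simp: flags_def)
   moreover have "e \<subseteq> {k \<in> flags G. rt G k \<in> rt G ` e}" using ef by auto
   ultimately have "valence H u = card {k \<in> flags G. rt G k \<in> rt G ` e} - 2"
    "card {k \<in> flags G. rt G k \<in> rt G ` e} \<ge> 2"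
    using val[OF v(1)] v(2) fin card_Diff_subset[of e] card_mono[of _ e] finite_cells[OF G] by auto
   moreover have "card {k \<in> flags G. rt G k \<in> rt G ` e} = (\<Sum>w\<in>rt G ` e. valence G w)"
   proof -
    have "card {k \<in> flags G. rt G k \<in> rt G ` e}
      = (\<Sum>w\<in>rt G ` e. \<Sum>h\<in>{h \<in> {k \<in> flags G. rt G k \<in> rt G ` e}. rt G h = w}. 1)"
     using finite_cells[OF G] fin by (subst sum.group) auto
    also have "\<dots> = (\<Sum>w\<in>rt G ` e. valence G w)"
     by (rule sum.cong) (auto simp: valence_def intro!: arg_cong[where f = card])
    finally show ?thesis .
   qed
   ultimately have vv: "int (valence H u) = (\<Sum>w\<in>rt G ` e. int (valence G w)) - 2" by (simp add: of_nat_diff)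
   have "card (rt G ` e) = 1 \<or> card (rt G ` e) = 2" using k by (auto simp: card_insert_if)
   thus ?thesis using vv w2[OF True] fibre[OF v(1)] True v(2)
    by (auto simp: echar_def sum.distrib sum_subtractf sum_distrib_left)
  qed
 qed
 have conn: "(v, w) \<in> (steps G e)\<^sup>*" if v: "v \<in> verts G" "w \<in> verts G" "f v = f w" for v w
 proof (cases "v = w")
  case False
  hence "v \<in> rt G ` e" "w \<in> rt G ` e" using ker[OF verts_Cells[OF G v(1)] verts_Cells[OF G v(2)]] v ef by (auto simp: flags_def)
  hence "(v, w) = (rt G k, rt G (flip G k)) \<or> (v, w) = (rt G (flip G k), rt G (flip G (flip G k)))"
   using k False mg_flip_flip[OF G kc(1)] by auto
  hence "(v, w) \<in> steps G e" using k unfolding steps_def by auto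
  thus ?thesis by auto
 qed simp
 have inj: "x = y" if "x \<in> Cells G" "y \<in> Cells G" "f x = f y" "f x \<notin> verts H" for x y
  using ker[OF that(1,2)] that vf ef by auto
 show "contr n G H f"
 proof (rule contrI[OF G H ext img r fl mk])
  show "x = y" if "x \<in> Cells G" "y \<in> Cells G" "f x = f y" "f x \<notin> verts H" for x y using that by (rule inj)
  show "(v, w) \<in> (steps G {k \<in> flags G. f k \<in> verts H})\<^sup>*" if "v \<in> verts G" "w \<in> verts G" "f v = f w" for v w
   unfolding ct using that by (rule conn)
  show "echar H u = (\<Sum>w\<in>{w \<in> verts G. f w = u}. echar G w)" if "u \<in> verts H" for u using that by (rule ech)
 qed
qed

lemma wgraph_mor_imp_contr: "wgraph_mor n G H f ==> contr n G H f"
proof (induction rule: wgraph_mor.induct)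
 case (comp G H f K f')
 thus ?case using contr_comp by blast
qed (auto intro: iso_imp_contr edge_contraction_imp_contr)

text \<open>The edge and its ends are collapsed onto one of its roots \<open>r\<close> and all other
  cells keep their names. So \<open>Cells H\<close> is a subset of \<open>Cells G\<close> and no new
  cells are required.\<close>

lemma ex_edge_contraction:
 fixes G :: "'x wgraph"
 assumes G: "marked_graph n G" and e: "e \<in> edges G"
 shows "\<exists>H f. edge_contraction n G e H f"
proof -
 obtain k where k: "k \<in> hedges G" "e = {k, flip G k}" using e by (auto simp: edges_hedges)
 have kf: "k \<in> flags G" "flip G k \<in> flags G" "flip G k ~= k" "flip G (flip G k) = k"
  using k flip_hedges[OF G k(1)] mg_flip_flip[OF G, of k] by (auto simp: hedges_def flags_def)
 have kc: "k \<in> Cells G" "flip G k \<in> Cells G" using kf by (auto simp: flags_def)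
 define r where "r = rt G k"
 define U where "U = e \<union> rt G ` e"
 define f where "f = restrict (\<lambda>x. if x \<in> U then r else x) (Cells G)"
 define H where "H = \<lparr>Cells = (Cells G - U) \<union> {r}, rt = (\<lambda>x. f (rt G x)), flip = (\<lambda>x. f (flip G x)),
  wt = (\<lambda>v. if v = r then (\<Sum>w\<in>rt G ` e. wt G w) + (if card (rt G ` e) = 1 then 1 else 0) else wt G v),
  mark = mark G\<rparr>"
 have rU: "r \<in> U" "r \<in> verts G" "r \<in> Cells G" using k kc rt_verts mg_rt[OF G] unfolding r_def U_def by auto
 have rr: "rt G r = r" "flip G r = r" using rU rt_vert[OF G] mg_flip_vert[OF G] by auto
 have UC: "U \<subseteq> Cells G" using k kc mg_rt[OF G] unfolding U_def by auto
 have Ue: "x \<in> e \<or> x \<in> verts G" if "x \<in> U" for x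
  using that k rt_verts[OF kc(1)] rt_verts[OF kc(2)] unfolding U_def by auto
 have frt: "f (rt G x) = rt H (f x)" if x: "x \<in> Cells G" for x
 proof (cases "x \<in> U")
  case True
  hence "rt G x \<in> U" using Ue[OF True] rt_vert[OF G, of x] unfolding U_def by auto
  thus ?thesis using x True mg_rt[OF G x] rU rr by (simp add: f_def H_def)
 qed (simp add: f_def H_def x mg_rt[OF G])
 have ffl: "f (flip G x) = flip H (f x)" if x: "x \<in> Cells G" for x
 proof (cases "x \<in> U")
  case True
  hence "flip G x \<in> U" using Ue[OF True] mg_flip_vert[OF G, of x] k kf unfolding U_def by auto
  thus ?thesis using x True mg_flip[OF G x] rU rr by (simp add: f_def H_def)
 qed (simp add: f_def H_def x mg_flip[OF G])
 have fC: "f ` Cells G = Cells H" using rU by (auto simp: f_def H_def)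
 have fH: "f x = x" if "x \<in> Cells H" for x using that rU by (auto simp: f_def H_def)
 have HC: "Cells H \<subseteq> Cells G" using rU by (auto simp: H_def)
 have idem: "rt H (rt H x) = rt H x" "flip H (flip H x) = x" "rt H x \<in> Cells H" "flip H x \<in> Cells H"
  if x: "x \<in> Cells H" for x
 proof -
  have xG: "x \<in> Cells G" "rt H x = f (rt G x)" "flip H x = f (flip G x)" using x HC by (auto simp: H_def)
  show "rt H (rt H x) = rt H x" using frt[OF mg_rt[OF G xG(1)]] xG mg_rt_rt[OF G xG(1)] by simp
  show "flip H (flip H x) = x" using ffl[OF mg_flip[OF G xG(1)]] xG mg_flip_flip[OF G xG(1)] fH[OF x] by simp
  show "rt H x \<in> Cells H" "flip H x \<in> Cells H"
   using xG fC mg_rt[OF G xG(1)] mg_flip[OF G xG(1)] by blast+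
 qed
 have vH: "verts H = f ` verts G"
 proof -
  have "verts H = rt H ` f ` Cells G" unfolding verts_def[of H] fC ..
  also have "\<dots> = f ` verts G" using frt by (force simp: verts_def)
  finally show ?thesis .
 qed
 have lf: "l \<notin> U" if "l \<in> legs G" for l
  using that k kf unfolding U_def by (auto simp: legs_def flags_def rt_verts[OF kc(1)] rt_verts[OF kc(2)])
 have inj: "x = y" if "x \<in> Cells G" "y \<in> Cells G" "f x = f y" "x \<notin> U" for x y
  using that rU by (auto simp: f_def split: if_splits)
 have "legs H = legs G"
 proof (intro subset_antisym subsetI)
  fix l assume l: "l \<in> legs G"
  hence lc: "l \<in> Cells G" "flip G l = l" "l \<notin> U" "l \<notin> verts G" using lf by (auto simp: legs_def flags_def)
  hence "f l = l" by (simp add: f_def)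
  moreover have "l ~= f v" if "v \<in> verts G" for v
   using that lc verts_Cells[OF G that] rU by (auto simp: f_def)
  ultimately show "l \<in> legs H"
   using lc vH by (auto simp: legs_def flags_def H_def)
 next
  fix l assume l: "l \<in> legs H"
  hence lc: "l \<in> Cells H" "f (flip G l) = l" "l \<notin> f ` verts G" using vH by (auto simp: legs_def flags_def H_def)
  have lG: "l \<in> Cells G" "f l = l" using lc fH HC by auto
  have lU: "l \<notin> U"
  proof
   assume "l \<in> U"
   hence "l = f r" using lG rU by (simp add: f_def)
   thus False using lc rU by blast
  qed
  have "l = flip G l" using inj[OF lG(1) mg_flip[OF G lG(1)] _ lU] lG lc by simp
  moreover have "l \<notin> verts G" using lc lG by force
  ultimately show "l \<in> legs G" using lG by (simp add: legs_def flags_def)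
 qed
 hence "marked_graph n H"
 proof -
  have "\<forall>v\<in>verts H. flip H v = v" using ffl mg_flip_vert[OF G] verts_Cells[OF G] vH by force
  moreover have "mark H = mark G" by (simp add: H_def)
  moreover have "finite (Cells H)" using HC mg_fin[OF G] finite_subset by blast
  ultimately show ?thesis using \<open>legs H = legs G\<close> mg_mark[OF G] idem
   unfolding marked_graph_def by metis
 qed
 moreover have "f (mark G i) = mark H i" if "i \<in> {1..n}" for i
  using lf[OF mark_legs[OF G that]] mark_Cells[OF G that] by (simp add: f_def H_def)
 ultimately have cm: "cell_map n G H f"
  unfolding cell_map_def using G fC frt ffl by (simp add: f_def)
 have ker: "f x = f y \<longleftrightarrow> x = y \<or> (x \<in> U \<and> y \<in> U)" if "x \<in> Cells G" "y \<in> Cells G" for x y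
  using inj[OF that] inj[OF that(2,1)] that by (auto simp: f_def)
 have "edge_contraction n G e H f"
  unfolding edge_contraction_def U_def[symmetric]
 proof (intro conjI ballI)
  fix v assume v: "v \<in> verts G - rt G ` e"
  hence "v \<notin> U" using kf k unfolding U_def by (auto simp: flags_def)
  thus "wt H (f v) = wt G v" using v verts_Cells[OF G] rU by (auto simp: f_def H_def)
 next
  fix v assume v: "v \<in> rt G ` e"
  hence "v \<in> U" unfolding U_def by blast
  hence "f v = r" using UC by (auto simp: f_def)
  thus "wt H (f v) = (\<Sum>w\<in>rt G ` e. wt G w) + (if card (rt G ` e) = 1 then 1 else 0)"
   by (simp add: H_def)
 qed (use cm e fC ker in blast)+
 thus ?thesis by blast
qed

lemma wgraph_mor_id:
 assumes G: "marked_graph n (G :: 'x wgraph)" shows "wgraph_mor n G G (restrict (\<lambda>x. x) (Cells G))"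
proof (rule wgraph_mor.iso)
 show "wgraph_iso n G G (restrict (\<lambda>x. x) (Cells G))"
  unfolding wgraph_iso_def cell_map_def
  using G verts_Cells[OF G] mark_Cells[OF G] mg_rt[OF G] mg_flip[OF G] by (auto simp: bij_betw_def inj_on_def)
qed

text \<open>The edges are contracted one at a time; an edge outside those already contracted
  survives as an edge of the intermediate graph.\<close>

lemma ex_contraction:
 fixes G :: "'x wgraph"
 assumes G: "marked_graph n G" and Z: "Z \<subseteq> edges G"
 shows "\<exists>H f. wgraph_mor n G H f \<and> {k \<in> flags G. f k \<in> verts H} = \<Union>Z"
proof -
 have "finite Z" using Z finite_cells(4)[OF G] finite_subset by blast
 thus ?thesis using Z
 proof (induction Z rule: finite_induct)
  case empty
  have "{k \<in> flags G. restrict (\<lambda>x. x) (Cells G) k \<in> verts G} = {}"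
   by (auto simp: flags_def)
  thus ?case using wgraph_mor_id[OF G] by blast
 next
  case (insert e Z)
  then obtain H f where f: "wgraph_mor n G H f" "{k \<in> flags G. f k \<in> verts H} = \<Union>Z" by auto
  have c: "contr n G H f" by (rule wgraph_mor_imp_contr[OF f(1)])
  note C = contr_rules[OF c]
  obtain k where k: "k \<in> hedges G" "e = {k, flip G k}" using insert by (auto simp: edges_hedges)
  have kc: "k \<in> flags G" "k \<in> Cells G" "flip G k \<in> Cells G" "flip G k ~= k"
   using k flip_hedges[OF G k(1)] by (auto simp: hedges_def flags_def)
  \<comment> \<open>Distinct edges are disjoint, being orbits of the involution.\<close>
  have "k \<notin> \<Union>Z"
  proof
   assume "k \<in> \<Union>Z"
   then obtain k' where "k' \<in> hedges G" "{k', flip G k'} \<in> Z" "k \<in> {k', flip G k'}"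
    using insert by (auto simp: edges_hedges)
   hence "e \<in> Z" using k mg_flip_flip[OF G, of k'] by (auto simp: hedges_def flags_def insert_commute)
   with insert show False by simp
  qed
  hence kn: "f k \<notin> verts H" using f(2) kc by auto
  hence "f k \<in> flags H" using C(5) kc by (simp add: flags_def)
  moreover have "flip H (f k) ~= f k" using C(7,9) kc kn by metis
  ultimately have "f ` e \<in> edges H" using k C(7) kc by (auto simp: edges_hedges hedges_def)
  then obtain K f' where ec: "edge_contraction n H (f ` e) K f'" using ex_edge_contraction[OF C(2)] by blast
  have "wgraph_mor n G K (compose (Cells G) f' f)"
   by (rule wgraph_mor.comp[OF f(1) wgraph_mor.contraction[OF ec]])
  moreover have "{x \<in> flags G. compose (Cells G) f' f x \<in> verts K} = \<Union>(insert e Z)"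
  proof -
   note d = edge_contraction_imp_contr[OF ec]
   have "f' (f x) \<in> verts K \<longleftrightarrow> x \<in> e \<or> x \<in> \<Union>Z" if x: "x \<in> flags G" for x
   proof -
    have xc: "x \<in> Cells G" using x by (simp add: flags_def)
    have "f' (f x) \<in> verts K \<longleftrightarrow> f x \<in> verts H \<or> f x \<in> f ` e"
     using d(2) contr_verts[OF d(1)] C(5)[OF xc] by (auto simp: flags_def)
    moreover have "f x \<in> f ` e \<longrightarrow> x \<in> e \<or> f x \<in> verts H"
     using C(9)[OF xc] k kc by auto
    ultimately show ?thesis using f(2) x by auto
   qed
   moreover have "e \<subseteq> flags G" using k flip_hedges[OF G k(1)] by (auto simp: hedges_def)
   moreover have "\<Union>Z \<subseteq> flags G" using f(2) by auto
   ultimately show ?thesis by (auto simp: compose_def flags_def)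
  qed
  ultimately show ?case by blast
 qed
qed

text \<open>By \<open>contr_kernel\<close> the two maps have the same kernel, so they differ by a
  bijection of the quotients. It respects weights because \<open>echar\<close> is computed from the
  same fibres and valences are preserved.\<close>

lemma contr_factor:
 assumes c: "contr n G H1 f" and d: "contr n G H2 h"
  and eq: "\<And>k. k \<in> flags G ==> f k \<in> verts H1 \<longleftrightarrow> h k \<in> verts H2"
 shows "\<exists>j. wgraph_iso n (wgraph.truncate H1) (wgraph.truncate H2) j \<and> contr n H1 H2 j \<and> compose (Cells G) j f = h"
proof -
 note C = contr_rules[OF c] and D = contr_rules[OF d]
 have ct: "{k \<in> flags G. f k \<in> verts H1} = {k \<in> flags G. h k \<in> verts H2}" using eq by auto
 have vv: "f x \<in> verts H1 \<longleftrightarrow> h x \<in> verts H2" if "x \<in> Cells G" for x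
  using eq[of x] contr_verts[OF c, of x] contr_verts[OF d, of x] that by (auto simp: flags_def)
 have ker: "f x = f y \<longleftrightarrow> h x = h y" if "x \<in> Cells G" "y \<in> Cells G" for x y
  unfolding contr_kernel[OF c that] contr_kernel[OF d that] ct using vv that by simp
 define j where "j = restrict (\<lambda>y. h (inv_into (Cells G) f y)) (Cells H1)"
 have j: "j (f x) = h x" if x: "x \<in> Cells G" for x
 proof -
  have "inv_into (Cells G) f (f x) \<in> Cells G" "f (inv_into (Cells G) f (f x)) = f x"
   using x by (auto intro: inv_into_into f_inv_into_f)
  thus ?thesis using ker x C(5) by (simp add: j_def)
 qed
 have H1: "\<exists>x\<in>Cells G. y = f x" if "y \<in> Cells H1" for y using that C(4) by blast
 have inj: "inj_on j (Cells H1)"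
  by (rule inj_onI) (use H1 j ker in metis)
 have img: "j ` Cells H1 = Cells H2"
  unfolding C(4)[symmetric] D(4)[symmetric] image_image using j by (intro image_cong) auto
 have jr: "j (rt H1 y) = rt H2 (j y)" "j (flip H1 y) = flip H2 (j y)" if "y \<in> Cells H1" for y
  using H1[OF that] j C(6,7) D(6,7) mg_rt[OF C(1)] mg_flip[OF C(1)] by (metis (no_types, lifting))+
 have jm: "j (mark H1 i) = mark H2 i" if "i \<in> {1..n}" for i
  using j[OF mark_Cells[OF C(1) that]] C(8) D(8) that by simp
 have b: "bij_betw j (Cells H1) (Cells H2)" using inj img by (simp add: bij_betw_def)
 have "\<forall>y\<in>Cells H1. j (rt H1 y) = rt H2 (j y)" using jr by blast
 note I = iso_cells[OF C(2) D(2) b this]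
 have "wt H2 (j v) = wt H1 v" if v: "v \<in> verts H1" for v
 proof -
  obtain w where w: "w \<in> verts G" "v = f w" using contr_surj_verts[OF c v] by blast
  have "j v \<in> verts H2" using I(1) v verts_Cells[OF C(2)] by blast
  moreover have "{u \<in> verts G. h u = j v} = {u \<in> verts G. f u = v}"
   using w j ker verts_Cells[OF C(1)] by auto
  ultimately have "echar H2 (j v) = echar H1 v" using C(11)[OF v] D(11) by simp
  thus ?thesis using I(2)[OF v] by (simp add: echar_def)
 qed
 hence iso: "wgraph_iso n (wgraph.truncate H1) (wgraph.truncate H2) j"
  unfolding wgraph_iso_def cell_map_def using C(2) D(2) img jr jm b by (simp add: j_def)
 moreover have "contr n H1 H2 j" using iso_imp_contr[OF iso] by simp
 moreover have "compose (Cells G) j f = h"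
  using j D(3) by (intro extensionalityI[of _ "Cells G"]) (auto simp: compose_def)
 ultimately show ?thesis by blast
qed

text \<open>For the converse, contract one by one the edges that \<open>f\<close> contracts. The
  result has the same contracted flags as \<open>f\<close>, so by \<open>contr_factor\<close> it
  differs from \<open>f\<close> by an isomorphism.\<close>

theorem contr_iff_wgraph_mor: "wgraph_mor n (wgraph.truncate G) (wgraph.truncate H) f \<longleftrightarrow> contr n G H f"
proof
 assume c: "contr n G H f"
 note C = contr_rules[OF c]
 let ?Z = "{e \<in> edges G. f ` e \<subseteq> verts H}"
 have Z: "\<Union>?Z = {k \<in> flags G. f k \<in> verts H}"
  unfolding contr_contracted[OF c]
  using contr_flip_vert[OF c] flip_hedges[OF C(1)] by (auto simp: edges_hedges hedges_def flags_def)
 obtain H' f' where f': "wgraph_mor n (wgraph.truncate G) H' f'"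
  "{k \<in> flags (wgraph.truncate G). f' k \<in> verts H'} = \<Union>?Z"
  using ex_contraction[of n "wgraph.truncate G" ?Z] C(1) by auto
 have c': "contr n G H' f'" using wgraph_mor_imp_contr[OF f'(1)] by simp
 obtain j where j: "wgraph_iso n (wgraph.truncate H') (wgraph.truncate H) j" "compose (Cells G) j f' = f"
  using contr_factor[OF c' c] f'(2) Z by auto
 have "wgraph.truncate H' = H'" by (simp add: wgraph.truncate_def)
 thus "wgraph_mor n (wgraph.truncate G) (wgraph.truncate H) f"
  using wgraph_mor.comp[OF f'(1) wgraph_mor.iso[of n H' "wgraph.truncate H" j]] j
  by (metis truncate_simps(1))
qed (use wgraph_mor_imp_contr in force)

text \<open>The vertices of \<open>G\<close> are partitioned by the fibres. Together with
  \<open>genus_iff\<close> this is the invariance of the genus under contraction.\<close>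

lemma contr_echar_sum:
 assumes c: "contr n G H f"
 shows "(\<Sum>v\<in>verts H. echar H v) = (\<Sum>v\<in>verts G. echar G v)"
proof -
 have "(\<Sum>v\<in>verts H. echar H v) = (\<Sum>v\<in>verts H. \<Sum>w\<in>{w \<in> verts G. f w = v}. echar G w)"
  using contr_echar[OF c] by simp
 also have "\<dots> = (\<Sum>v\<in>verts G. echar G v)"
  using contr_verts[OF c] finite_cells[OF contr_src[OF c]] finite_cells[OF contr_tgt[OF c]] by (intro sum.group) auto
 finally show ?thesis .
qed

text \<open>The value of \<open>echar\<close> at a vertex is a sum of positive terms over a nonempty
  fibre.\<close>

lemma contr_stable:
 assumes c: "contr n G H f" and s: "stable G" shows "stable H"
 unfolding stable_echar
proof
 fix v assume v: "v \<in> verts H"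
 obtain w where "w \<in> verts G" "f w = v" using contr_surj_verts[OF c v] by blast
 thus "0 < echar H v"
  unfolding contr_echar[OF c v] using s finite_cells[OF contr_src[OF c]]
  by (intro sum_pos) (auto simp: stable_echar)
qed

lemma contr_connected:
 assumes c: "contr n G H f" and s: "connected_graph G" shows "connected_graph H"
proof -
 note C = contr_rules[OF c]
 have st: "(f v, f w) \<in> (steps H (flags H))\<^sup>*" if "(v, w) \<in> (steps G (flags G))\<^sup>*" for v w
  using that
 proof (induction rule: rtrancl_induct)
  case (step y z)
  then obtain k where k: "k \<in> flags G" "y = rt G k" "z = rt G (flip G k)" unfolding steps_def by auto
  hence kc: "k \<in> Cells G" "flip G k \<in> Cells G" using mg_flip[OF C(1)] by (auto simp: flags_def)
  have "(f y, f z) \<in> (steps H (flags H))\<^sup>*"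
  proof (cases "f k \<in> verts H")
   case True
   hence "f y = f z"
    using k kc C(7) contr_flip_vert[OF c kc(1)] contr_vert_iff[OF c] mg_flip_vert[OF C(2) True] by metis
   thus ?thesis by simp
  next
   case False
   hence "f k \<in> flags H" using C(5) kc by (simp add: flags_def)
   moreover have "f y = rt H (f k)" "f z = rt H (flip H (f k))" using k kc C(6,7) by auto
   ultimately show ?thesis unfolding steps_def by blast
  qed
  with step show ?case by auto
 qed simp
 show ?thesis
  using s st contr_surj_verts[OF c] contr_verts[OF c] unfolding connected_iff[OF C(1)] connected_iff[OF C(2)]
  by (metis all_not_in_conv)
qed

section \<open>The moduli category\<close>

text \<open>The edge length as a function of a half-edge; it agrees on the two halves by
  \<open>fl_flip\<close>.\<close>

definition fl :: "('x, 'v) curve \<Rightarrow> 'x \<Rightarrow> 'v \<Rightarrow> real" where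
 "fl G k = len G {k, flip G k}"

lemma fl_flip:
 assumes "marked_graph n G" "k \<in> Cells G" shows "fl G (flip G k) = fl G k"
 using mg_flip_flip[OF assms] by (simp add: fl_def insert_commute)

lemma mtrop_obj_iff:
 "mobj g n S G \<longleftrightarrow> is_rpcone S \<and> marked_graph n G \<and> connected_graph G \<and>
   (\<Sum>v\<in>verts G. echar G v) = 2 * int g - 2 + int n \<and> stable G \<and>
   (\<forall>k\<in>hedges G. fl G k \<in> dual_monoid S \<and> fl G k ~= (\<lambda>x. 0))"
proof -
 have "(\<forall>e\<in>edges G. len G e \<in> dual_monoid S - {\<lambda>x. 0}) \<longleftrightarrow>
   (\<forall>k\<in>hedges G. fl G k \<in> dual_monoid S \<and> fl G k ~= (\<lambda>x. 0))"
  by (simp add: edges_hedges fl_def)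
 thus ?thesis
  unfolding mtrop_obj_def tropical_curve_def using genus_iff[of n G g] by auto
qed

lemma mtrop_objD:
 assumes "mobj g n S G"
 shows obj_cone: "is_rpcone S" and obj_graph: "marked_graph n G" and obj_connected: "connected_graph G"
  and obj_echar: "(\<Sum>v\<in>verts G. echar G v) = 2 * int g - 2 + int n" and obj_stable: "stable G"
  and obj_dual: "\<And>k. k \<in> hedges G ==> fl G k \<in> dual_monoid S"
  and obj_nz: "\<And>k. k \<in> hedges G ==> fl G k ~= (\<lambda>x. 0)"
 using assms unfolding mtrop_obj_iff by auto

lemma contr_hedges:
 assumes c: "contr n G H f" and k: "k \<in> hedges G" and f: "f k \<notin> verts H"
 shows "f k \<in> hedges H"
proof -
 have kc: "k \<in> Cells G" "flip G k \<in> Cells G" "flip G k ~= k"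
  using k mg_flip[OF contr_src[OF c]] by (auto simp: hedges_def flags_def)
 have "flip H (f k) ~= f k" using contr_inj[OF c kc(1,2)] contr_flip[OF c kc(1)] kc(3) f by metis
 thus ?thesis using contr_Cells[OF c kc(1)] f by (simp add: hedges_def flags_def)
qed

lemma contr_surj_hedges:
 assumes c: "contr n G H f" and k: "k \<in> hedges H" shows "\<exists>x\<in>hedges G. f x = k"
proof -
 obtain x where x: "x \<in> flags G" "f x = k" using contr_surj_flags[OF c] k by (auto simp: hedges_def)
 hence "x \<notin> legs G" using contr_legs[OF c, of x] k by (auto simp: hedges_def legs_def)
 thus ?thesis using x by (auto simp: hedges_def legs_def)
qed

text \<open>Lengths on \<open>G\<close> are nonzero, so the single equation on pulled back lengths
  already decides which half-edges are contracted. The two conditions on edges in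
  \<open>mtrop_arr\<close> are thereby merged.\<close>

lemma mtrop_arr_iff:
 "marr g n S G S' G' f P \<longleftrightarrow>
   mobj g n S G \<and> mobj g n S' G' \<and> f \<in> rpc_hom S S' \<and> contr n G' G P \<and>
   (\<forall>k\<in>hedges G'. fl G' k o f = (if P k \<in> verts G then (\<lambda>x. 0) else fl G (P k)))"
proof (cases "mobj g n S G \<and> mobj g n S' G' \<and> f \<in> rpc_hom S S' \<and> contr n G' G P")
 case True
 hence X: "mobj g n S G" and c: "contr n G' G P" by auto
 note C = contr_rules[OF c]
 have kc: "k \<in> Cells G'" "flip G' k \<in> Cells G'" if "k \<in> hedges G'" for k
  using that mg_flip[OF C(1)] by (auto simp: hedges_def flags_def)
 have im: "P ` {k, flip G' k} = {P k, flip G (P k)}" if "k \<in> hedges G'" for k using C(7)[OF kc(1)[OF that]] by simp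
 have vv: "P ` {k, flip G' k} \<subseteq> verts G \<longleftrightarrow> P k \<in> verts G" if "k \<in> hedges G'" for k
  using contr_flip_vert[OF c kc(1)[OF that]] by auto
 have nz: "(\<lambda>x. 0) ~= fl G (P k)" if "k \<in> hedges G'" "P k \<notin> verts G" for k
  using obj_nz[OF X contr_hedges[OF c that]] by auto
 have "(\<forall>e'\<in>edges G'. P ` e' \<subseteq> verts G \<longleftrightarrow> len G' e' o f = (\<lambda>x. 0)) \<and>
   (\<forall>e'\<in>edges G'. len G' e' o f ~= (\<lambda>x. 0) \<longrightarrow> len G (P ` e') = len G' e' o f) \<longleftrightarrow>
   (\<forall>k\<in>hedges G'. (P k \<in> verts G \<longleftrightarrow> fl G' k o f = (\<lambda>x. 0)) \<and>
    (fl G' k o f ~= (\<lambda>x. 0) \<longrightarrow> fl G (P k) = fl G' k o f))"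
  using vv im by (simp add: edges_hedges fl_def ball_conj_distrib del: image_insert insert_subset cong: ball_cong)
 also have "\<dots> \<longleftrightarrow> (\<forall>k\<in>hedges G'. fl G' k o f = (if P k \<in> verts G then (\<lambda>x. 0) else fl G (P k)))"
  using nz by (intro ball_cong[OF refl]) auto
 finally show ?thesis using True by (simp add: mtrop_arr_def contr_iff_wgraph_mor)
qed (auto simp: mtrop_arr_def contr_iff_wgraph_mor)

lemma mtrop_arrD:
 assumes "marr g n S G S' G' f P"
 shows arr_dom: "mobj g n S G" and arr_cod: "mobj g n S' G'"
  and arr_hom: "f \<in> rpc_hom S S'" and arr_contr: "contr n G' G P"
  and arr_len: "\<And>k. k \<in> hedges G' ==> fl G' k o f = (if P k \<in> verts G then (\<lambda>x. 0) else fl G (P k))"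
  and arr_zero: "\<And>k. k \<in> hedges G' ==> P k \<in> verts G \<longleftrightarrow> fl G' k o f = (\<lambda>x. 0)"
proof -
 show 1: "mobj g n S G" "mobj g n S' G'" "f \<in> rpc_hom S S'" "contr n G' G P"
  and 2: "\<And>k. k \<in> hedges G' ==> fl G' k o f = (if P k \<in> verts G then (\<lambda>x. 0) else fl G (P k))"
  using assms unfolding mtrop_arr_iff by auto
 show "P k \<in> verts G \<longleftrightarrow> fl G' k o f = (\<lambda>x. 0)" if "k \<in> hedges G'" for k
  using 2[OF that] contr_hedges[OF 1(4) that] obj_nz[OF 1(1), of "P k"] by auto
qed

text \<open>The right-hand side mentions only \<open>G'\<close> and \<open>f\<close>: an arrow has
  no freedom in what it contracts.\<close>

lemma mtrop_arr_contracted: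
 assumes a: "marr g n S G S' G' f P" and k: "k \<in> flags G'"
 shows "P k \<in> verts G \<longleftrightarrow> k \<in> hedges G' \<and> fl G' k o f = (\<lambda>x. 0)"
 using contr_contracted[OF arr_contr[OF a]] arr_zero[OF a] k by auto

lemma mtrop_arr_cases:
 assumes "m \<in> mtrop_arr g n"
 obtains S G S' G' f P where "m = ((S, G), (S', G'), (f, P))"
  "marr g n S G S' G' f P"
 using assms by (metis surj_pair)

lemma Mtrop_simps [simp]:
 "Obj (Mtrop g n) = mtrop_obj g n" "Arr (Mtrop g n) = mtrop_arr g n"
 "Dom (Mtrop g n) (x, y, m) = x" "Cod (Mtrop g n) (x, y, m) = y"
 "Ide (Mtrop g n) (S, G) = ((S, G), (S, G), (rpc_id S, restrict (\<lambda>x. x) (Cells G)))"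
 "Comp (Mtrop g n) (y', z, (f', P')) (x, y, (f, P)) = (x, z, (f' o f, compose (Cells (snd z)) P P'))"
 "FObj (Pr (Mtrop g n)) x = fst x" "FArr (Pr (Mtrop g n)) (x, y, (f, P)) = (fst x, fst y, f)"
 by (simp_all add: Mtrop_def)

text \<open>Records that describe the same graph may differ in their values outside
  \<open>Cells\<close>. They are then not equal, but the identity on cells is an isomorphism between
  them.\<close>

lemma contr_agree:
 assumes G: "marked_graph n G" and C: "Cells H = Cells G"
  and r: "\<And>x. x \<in> Cells G ==> rt H x = rt G x" and f: "\<And>x. x \<in> Cells G ==> flip H x = flip G x"
  and w: "\<And>v. v \<in> verts G ==> wt H v = wt G v" and m: "\<And>i. i \<in> {1..n} ==> mark H i = mark G i"
 shows "contr n G H (restrict (\<lambda>x. x) (Cells G))"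
proof -
 have V: "verts H = verts G" unfolding verts_def C using r by auto
 have L: "legs H = legs G" unfolding legs_def flags_def V C using f by auto
 have H: "marked_graph n H"
  unfolding marked_graph_def V L C using marked_graph_rules[OF G] r f verts_Cells[OF G]
   bij_betw_cong[of "{1..n}" "mark H" "mark G" "legs G"] m by simp
 have "wgraph_iso n (wgraph.truncate G) (wgraph.truncate H) (restrict (\<lambda>x. x) (Cells G))"
  unfolding wgraph_iso_def cell_map_def
  using G H C r f w m verts_Cells[OF G] mark_Cells[OF G] mg_rt[OF G] mg_flip[OF G]
  by (auto simp: bij_betw_def inj_on_def)
 from iso_imp_contr[OF this] show ?thesis by simp
qed

lemma mtrop_ide:
 assumes X: "mobj g n S G"
 shows "((S, G), (S, G), (rpc_id S, restrict (\<lambda>x. x) (Cells G))) \<in> mtrop_arr g n"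
 unfolding mtrop_arr_iff
 using X rpc_id_in[OF obj_cone[OF X]] contr_agree[OF obj_graph[OF X], of G]
  comp_rpc_id[OF dual_hom[OF obj_dual[OF X]]]
 by (auto simp: hedges_def flags_def)

lemma mtrop_comp:
 assumes a: "marr g n S G S' G' f P"
  and b: "marr g n S' G' S'' G'' f' P'"
 shows "((S, G), (S'', G''), (f' o f, compose (Cells G'') P P')) \<in> mtrop_arr g n"
 unfolding mtrop_arr_iff
proof (intro conjI ballI)
 show "mobj g n S G" "mobj g n S'' G''" "f' o f \<in> rpc_hom S S''"
  "contr n G'' G (compose (Cells G'') P P')"
  using mtrop_arrD[OF a] mtrop_arrD[OF b] rpc_hom_comp contr_comp by blast+
 fix k assume k: "k \<in> hedges G''"
 hence kc: "k \<in> Cells G''" by (simp add: hedges_def flags_def)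
 have "fl G'' k o (f' o f) = (if P' k \<in> verts G' then (\<lambda>x. 0) else fl G' (P' k)) o f"
  unfolding arr_len[OF b k, symmetric] by (simp add: comp_assoc)
 also have "\<dots> = (if P (P' k) \<in> verts G then (\<lambda>x. 0) else fl G (P (P' k)))"
  using arr_len[OF a] contr_hedges[OF arr_contr[OF b] k] contr_verts[OF arr_contr[OF a], of "P' k"] by auto
 finally show "fl G'' k o (f' o f) = (if compose (Cells G'') P P' k \<in> verts G then (\<lambda>x. 0)
   else fl G (compose (Cells G'') P P' k))"
  using kc by (simp add: compose_def)
qed

lemma compose_restrict_id:
 assumes "f \<in> extensional A" "f ` A \<subseteq> B"
 shows "compose A (restrict (\<lambda>x. x) B) f = f" "compose A f (restrict (\<lambda>x. x) A) = f"
 using assms by (auto simp: compose_def fun_eq_iff extensional_def)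

lemma compose_assoc':
 "f ` A \<subseteq> B ==> compose A (compose B h g) f = compose A h (compose A g f)"
 by (auto simp: compose_def fun_eq_iff)

lemma category_Mtrop: "category (Mtrop g n :: ('x, 'v::real_vector) mtrop_cat)" (is "category ?M")
 unfolding category_def
proof (intro conjI ballI impI)
 fix m :: "('x, 'v) mtrop_arr" assume "m \<in> Arr ?M"
 hence "m \<in> mtrop_arr g n" by simp
 then obtain S G S' G' f P where m: "m = ((S, G), (S', G'), (f, P))"
  "marr g n S G S' G' f P" by (rule mtrop_arr_cases)
 note A = mtrop_arrD[OF m(2)]
 have "P ` Cells G' \<subseteq> Cells G" using contr_img[OF A(4)] by simp
 note e = compose_restrict_id[OF contr_ext[OF A(4)] this]
 show "Dom ?M m \<in> Obj ?M" "Cod ?M m \<in> Obj ?M"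
  "Comp ?M m (Ide ?M (Dom ?M m)) = m"
  "Comp ?M (Ide ?M (Cod ?M m)) m = m"
  unfolding m(1) by (simp_all add: A(1,2) e comp_rpc_id[OF A(3)] rpc_id_comp[OF A(3)])
next
 fix x :: "('x, 'v) mtrop_obj" assume "x \<in> Obj ?M"
 then obtain S G where x: "x = (S, G)" "mobj g n S G" by (cases x) simp
 show "Ide ?M x \<in> Arr ?M" "Dom ?M (Ide ?M x) = x"
  "Cod ?M (Ide ?M x) = x"
  unfolding x(1) using mtrop_ide[OF x(2)] by simp_all
next
 fix a b :: "('x, 'v) mtrop_arr" assume a: "a \<in> Arr ?M" and b: "b \<in> Arr ?M"
  and ab: "Cod ?M a = Dom ?M b"
 from a have "a \<in> mtrop_arr g n" by simp
 then obtain S G S' G' f P where a': "a = ((S, G), (S', G'), (f, P))" by (rule mtrop_arr_cases)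
 from b have "b \<in> mtrop_arr g n" by simp
 then obtain S1 G1 S'' G'' f' P' where b': "b = ((S1, G1), (S'', G''), (f', P'))" by (rule mtrop_arr_cases)
 show "Comp ?M b a \<in> Arr ?M" "Dom ?M (Comp ?M b a) = Dom ?M a"
  "Cod ?M (Comp ?M b a) = Cod ?M b"
  using a b ab mtrop_comp[of S G S' G' f P] unfolding a' b' by simp_all
next
 fix a b c :: "('x, 'v) mtrop_arr"
 assume a: "a \<in> Arr ?M" and b: "b \<in> Arr ?M" and c: "c \<in> Arr ?M"
  and bc: "Cod ?M a = Dom ?M b \<and> Cod ?M b = Dom ?M c"
 from a have "a \<in> mtrop_arr g n" by simp
 then obtain S G S' G' f P where a': "a = ((S, G), (S', G'), (f, P))" by (rule mtrop_arr_cases)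
 from b have "b \<in> mtrop_arr g n" by simp
 then obtain S1 G1 S'' G'' f' P' where b': "b = ((S1, G1), (S'', G''), (f', P'))" by (rule mtrop_arr_cases)
 from c have "c \<in> mtrop_arr g n" by simp
 then obtain S2 G2 S3 G3 f'' P'' where c': "c = ((S2, G2), (S3, G3), (f'', P''))" by (rule mtrop_arr_cases)
 have "P'' ` Cells G3 = Cells G''" using contr_img[OF arr_contr, of S2 G2 S3 G3 f'' P''] c bc unfolding c' b' by simp
 thus "Comp ?M c (Comp ?M b a) = Comp ?M (Comp ?M c b) a"
  unfolding a' b' c' by (simp add: compose_assoc' comp_assoc)
qed

lemma is_functor_Mtrop: "is_functor (Mtrop g n) RPC (Pr (Mtrop g n))"
 unfolding is_functor_def
proof (intro conjI ballI impI category_Mtrop category_RPC)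
 fix m :: "('x, 'v::real_vector) mtrop_arr" assume "m \<in> Arr (Mtrop g n)"
 hence "m \<in> mtrop_arr g n" by simp
 then obtain S G S' G' f P where m: "m = ((S, G), (S', G'), (f, P))"
  "marr g n S G S' G' f P" by (rule mtrop_arr_cases)
 note A = mtrop_arrD[OF m(2)]
 show "FArr (Pr (Mtrop g n)) m \<in> Arr RPC" "Dom RPC (FArr (Pr (Mtrop g n)) m) = FObj (Pr (Mtrop g n)) (Dom (Mtrop g n) m)"
  "Cod RPC (FArr (Pr (Mtrop g n)) m) = FObj (Pr (Mtrop g n)) (Cod (Mtrop g n) m)"
  unfolding m(1) using obj_cone[OF A(1)] obj_cone[OF A(2)] A(3) by simp_all
next
 fix x :: "('x, 'v::real_vector) mtrop_obj" assume "x \<in> Obj (Mtrop g n)"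
 thus "FObj (Pr (Mtrop g n)) x \<in> Obj RPC" "FArr (Pr (Mtrop g n)) (Ide (Mtrop g n) x) = Ide RPC (FObj (Pr (Mtrop g n)) x)"
  using obj_cone by (cases x; auto)+
next
 fix a b :: "('x, 'v::real_vector) mtrop_arr"
 show "FArr (Pr (Mtrop g n)) (Comp (Mtrop g n) b a) = Comp RPC (FArr (Pr (Mtrop g n)) b) (FArr (Pr (Mtrop g n)) a)"
  by (cases a; cases b) auto
qed

text \<open>Contract the edges whose length becomes zero along \<open>f\<close> and give the
  surviving edges the pulled back lengths. Connectedness, stability and genus are inherited through
  \<open>contr\<close>.\<close>

lemma mtrop_pullback:
 assumes X': "mobj g n S' G'" and S: "is_rpcone S" and f: "f \<in> rpc_hom S S'"
 shows "\<exists>G P. marr g n S G S' G' f P"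
proof -
 note X = mtrop_objD[OF X']
 let ?Z = "{e \<in> edges G'. len G' e o f = (\<lambda>x. 0)}"
 obtain H P where "wgraph_mor n (wgraph.truncate G') H P"
  and ct: "{k \<in> flags (wgraph.truncate G'). P k \<in> verts H} = \<Union>?Z"
  using ex_contraction[of n "wgraph.truncate G'" ?Z] X(2) by auto
 hence c: "contr n G' H P" using wgraph_mor_imp_contr by fastforce
 note C = contr_rules[OF c]
 \<comment> \<open>The set in \<open>len\<close> is the preimage of \<open>e\<close>. For an edge
   \<open>e\<close> it is the unique edge above it, since \<open>P\<close> is injective over cells
   that are not vertices.\<close>
 define G where "G = \<lparr>Cells = Cells H, rt = rt H, flip = flip H, wt = wt H, mark = mark H,
   len = (\<lambda>e. len G' {k \<in> Cells G'. P k \<in> e} o f)\<rparr>"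
 have tr: "wgraph.truncate G = H" by (simp add: wgraph.truncate_def G_def)
 hence c': "contr n G' G P" using c contr_truncate(3)[of n G' G P] by simp
 have VH: "verts G = verts H" using tr truncate_simps2(1)[of G] by simp
 have z: "P k \<in> verts G \<longleftrightarrow> fl G' k o f = (\<lambda>x. 0)" if k: "k \<in> hedges G'" for k
 proof -
  have kf: "k \<in> flags G'" "{k, flip G' k} \<in> edges G'" using k by (auto simp: hedges_def edges_hedges)
  have "P k \<in> verts G \<longleftrightarrow> k \<in> \<Union>?Z" unfolding VH ct[symmetric] using kf by simp
  also have "\<dots> \<longleftrightarrow> fl G' k o f = (\<lambda>x. 0)"
  proof
   assume "k \<in> \<Union>?Z"
   then obtain k' where k': "k' \<in> hedges G'" "fl G' k' o f = (\<lambda>x. 0)" "k = k' \<or> k = flip G' k'"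
    by (auto simp: edges_hedges fl_def)
   thus "fl G' k o f = (\<lambda>x. 0)" using fl_flip[OF X(2), of k'] by (auto simp: hedges_def flags_def)
  qed (use kf in \<open>auto simp: fl_def\<close>)
  finally show ?thesis .
 qed
 have len: "fl G (P k) = fl G' k o f" if k: "k \<in> hedges G'" "P k \<notin> verts G" for k
 proof -
  have kc: "k \<in> Cells G'" "flip G' k \<in> Cells G'" using k mg_flip[OF X(2)] by (auto simp: hedges_def flags_def)
  have "P (flip G' k) \<notin> verts G" using contr_flip_vert[OF c' kc(1)] k(2) by simp
  hence "{x \<in> Cells G'. P x \<in> {P k, flip G (P k)}} = {k, flip G' k}"
   using contr_inj[OF c'] contr_flip[OF c' kc(1)] k kc by auto
  thus ?thesis by (simp add: fl_def G_def)
 qed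
 have "mobj g n S G"
  unfolding mtrop_obj_iff
 proof (intro conjI ballI)
  show "is_rpcone S" by fact
  show "marked_graph n G" using contr_tgt[OF c'] .
  show "connected_graph G" using contr_connected[OF c' X(3)] .
  show "(\<Sum>v\<in>verts G. echar G v) = 2 * int g - 2 + int n" using contr_echar_sum[OF c'] X(4) by simp
  show "stable G" using contr_stable[OF c' X(5)] .
  fix k assume k: "k \<in> hedges G"
  then obtain x where x: "x \<in> hedges G'" "P x = k" using contr_surj_hedges[OF c'] by blast
  moreover have "k \<notin> verts G" using k by (auto simp: hedges_def flags_def)
  ultimately show "fl G k \<in> dual_monoid S" "fl G k ~= (\<lambda>x. 0)"
   using len[OF x(1)] z[OF x(1)] dual_comp[OF X(6)[OF x(1)] f] by auto
 qed
 hence "marr g n S G S' G' f P"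
  unfolding mtrop_arr_iff using X' f c' z len by auto
 thus ?thesis by blast
qed

text \<open>Both graph maps contract exactly the half-edges whose length vanishes along
  \<open>f\<close>, so \<open>contr_factor\<close> compares them. This is the cartesian property of
  arrows of the moduli category.\<close>

lemma mtrop_cartesian:
 assumes a: "marr g n T G1 S G f P1"
  and b: "marr g n T G2 S G f P2"
 shows "\<exists>j. marr g n T G1 T G2 (rpc_id T) j \<and> compose (Cells G) j P2 = P1"
proof -
 note A = mtrop_arrD[OF a] and B = mtrop_arrD[OF b]
 have "P2 k \<in> verts G2 \<longleftrightarrow> P1 k \<in> verts G1" if "k \<in> flags G" for k
  using mtrop_arr_contracted[OF a that] mtrop_arr_contracted[OF b that] by simp
 from contr_factor[OF B(4) A(4) this] obtain j where
  j: "contr n G2 G1 j" "compose (Cells G) j P2 = P1" by blast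
 have "fl G2 k o rpc_id T = (if j k \<in> verts G1 then (\<lambda>x. 0) else fl G1 (j k))" if k: "k \<in> hedges G2" for k
 proof -
  obtain x where x: "x \<in> hedges G" "P2 x = k" using contr_surj_hedges[OF B(4) k] by blast
  have "j k = P1 x" using compose_eq[of x "Cells G" j P2] j(2) x by (simp add: hedges_def flags_def)
  moreover have "k \<notin> verts G2" using k by (auto simp: hedges_def flags_def)
  ultimately show ?thesis
   using A(5)[OF x(1)] B(5)[OF x(1)] A(6)[OF x(1)] B(6)[OF x(1)] x(2) comp_rpc_id[OF dual_hom[OF obj_dual[OF B(1) k]]] by auto
 qed
 thus ?thesis unfolding mtrop_arr_iff[of T G1] using A(1) B(1) j rpc_id_in[OF obj_cone[OF A(1)]] by blast
qed

text \<open>Graph maps run against the arrows and are surjective, so precomposition with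
  \<open>P\<close> can be cancelled.\<close>

lemma mtrop_faithful:
 assumes a: "marr g n T G1 S G f P"
  and j: "j \<in> extensional (Cells G1)" and j': "j' \<in> extensional (Cells G1)"
  and eq: "compose (Cells G) j P = compose (Cells G) j' P"
 shows "j = j'"
proof (rule extensionalityI[OF j j'])
 fix x assume "x \<in> Cells G1"
 then obtain y where "y \<in> Cells G" "x = P y" using contr_img[OF arr_contr[OF a]] by auto
 thus "j x = j' x" using eq by (metis compose_eq)
qed

text \<open>The identity factors through the given arrow by \<open>mtrop_cartesian\<close>, which
  yields a one-sided inverse; surjectivity of \<open>P\<close> makes it two-sided.\<close>

lemma mtrop_vertical_inverse:
 assumes a: "marr g n S G S G' (rpc_id S) P"
 shows "\<exists>P'. marr g n S G' S G (rpc_id S) P' \<and>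
   compose (Cells G') P' P = restrict (\<lambda>x. x) (Cells G') \<and> compose (Cells G) P P' = restrict (\<lambda>x. x) (Cells G)"
proof -
 note A = mtrop_arrD[OF a]
 obtain j where j: "marr g n S G' S G (rpc_id S) j"
  "compose (Cells G') j P = restrict (\<lambda>x. x) (Cells G')"
  using mtrop_cartesian[OF mtrop_ide[OF A(2)] a] by blast
 have "compose (Cells G) P j = restrict (\<lambda>x. x) (Cells G)"
 proof (rule mtrop_faithful[OF a])
  have "compose (Cells G') (compose (Cells G) P j) P = compose (Cells G') P (compose (Cells G') j P)"
   using contr_img[OF A(4)] by (intro compose_assoc') simp
  also have "\<dots> = P" unfolding j(2) using compose_restrict_id(2)[OF contr_ext[OF A(4)]] contr_img[OF A(4)] by blast
  also have "\<dots> = compose (Cells G') (restrict (\<lambda>x. x) (Cells G)) P"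
   using compose_restrict_id(1)[OF contr_ext[OF A(4)]] contr_img[OF A(4)] by simp
  finally show "compose (Cells G') (compose (Cells G) P j) P = compose (Cells G') (restrict (\<lambda>x. x) (Cells G)) P" .
 qed (simp_all add: compose_def)
 with j show ?thesis by blast
qed

lemma rpc_id_idem: "rpc_id S o rpc_id S = rpc_id S"
 by (auto simp: rpc_id_def fun_eq_iff)

lemma mtrop_agree:
 assumes X: "mobj g n S G" and C: "Cells G' = Cells G"
  and r: "\<And>x. x \<in> Cells G ==> rt G' x = rt G x" and f: "\<And>x. x \<in> Cells G ==> flip G' x = flip G x"
  and w: "\<And>v. v \<in> verts G ==> wt G' v = wt G v" and m: "\<And>i. i \<in> {1..n} ==> mark G' i = mark G i"
  and l: "\<And>k. k \<in> hedges G ==> fl G' k = fl G k"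
 shows "((S, G'), (S, G), (rpc_id S, restrict (\<lambda>x. x) (Cells G))) \<in> mtrop_arr g n"
proof -
 note X' = mtrop_objD[OF X]
 have c: "contr n G G' (restrict (\<lambda>x. x) (Cells G))" by (rule contr_agree[OF X'(2) C r f w m])
 have V: "verts G' = verts G" unfolding verts_def C using r by auto
 have H: "hedges G' = hedges G" unfolding hedges_def flags_def C V using f by auto
 have "mobj g n S G'"
  unfolding mtrop_obj_iff H
  using X' contr_tgt[OF c] contr_connected[OF c] contr_echar_sum[OF c] contr_stable[OF c] l by auto
 thus ?thesis
  unfolding mtrop_arr_iff using X c rpc_id_in[OF X'(1)] comp_rpc_id[OF dual_hom[OF X'(6)]] l V
  by (auto simp: hedges_def flags_def)
qed

section \<open>Points of the cone over a tropical curve\<close>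

text \<open>The distance of a point of the edge \<open>e\<close> from the root of \<open>k\<close>.
  It vanishes exactly on the face attached to \<open>k\<close>, and \<open>edge_face\<close> puts
  the second coordinate equal to \<open>0\<close> for the first flag.\<close>

definition dst :: "'x set \<Rightarrow> 'x \<Rightarrow> ('v \<Rightarrow> 'v \<times> real \<times> real) \<Rightarrow> 'v \<Rightarrow> real" where
 "dst e k p = (if k = first_flag e then snd o snd o p else fst o snd o p)"

text \<open>The vertices to whose cones the point is glued directly. It is empty for a point that
  meets no face, and both roots occur for a point of an edge whose length vanishes over the
  base.\<close>

fun at_v :: "('x, 'v::real_vector) curve \<Rightarrow> ('x, 'v) cpoint \<Rightarrow> 'x set" where
 "at_v G (VPt v p) = {v}"
| "at_v G (LPt l p) = (if snd o p = (\<lambda>x. 0) then {rt G l} else {})"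
| "at_v G (EPt e p) = {rt G k | k. k \<in> e \<and> dst e k p = (\<lambda>x. 0)}"

text \<open>Over the base \<open>p\<close> an edge of length zero has coinciding faces, so the cones
  of its two ends are identified there.\<close>

definition zadj :: "('x, 'v::real_vector) curve \<Rightarrow> ('v \<Rightarrow> 'v) \<Rightarrow> ('x \<times> 'x) set" where
 "zadj G p = steps G {k \<in> hedges G. fl G k o p = (\<lambda>x. 0)}"

lemma zadj_sym:
 assumes G: "marked_graph n G" and p: "(v, w) \<in> (zadj G p)\<^sup>*" shows "(w, v) \<in> (zadj G p)\<^sup>*"
proof -
 have "sym ((zadj G p)\<^sup>*)"
  unfolding zadj_def
  using flip_hedges[OF G] fl_flip[OF G] mg_flip_flip[OF G]
  by (intro sym_steps) (auto simp: hedges_def flags_def)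
 thus ?thesis using p by (rule symD)
qed

lemma pieces_V: "VPt v p \<in> pieces_pts S G T \<longleftrightarrow> v \<in> verts G \<and> p \<in> rpc_hom T S"
 by (auto simp: pieces_pts_def)

lemma pieces_L: "LPt l p \<in> pieces_pts S G T \<longleftrightarrow> l \<in> legs G \<and> fst o p \<in> rpc_hom T S \<and> snd o p \<in> dual_monoid T"
 by (auto simp: pieces_pts_def leg_cone_hom)

lemma pieces_E:
 assumes X: "mobj g n S G"
 shows "EPt e p \<in> pieces_pts S G T \<longleftrightarrow> e \<in> edges G \<and> fst o p \<in> rpc_hom T S \<and>
   fst o snd o p \<in> dual_monoid T \<and> snd o snd o p \<in> dual_monoid T \<and>
   len G e o (fst o p) = (\<lambda>x. fst (snd (p x)) + snd (snd (p x)))"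
proof -
 have "EPt e p \<in> pieces_pts S G T \<longleftrightarrow> e \<in> edges G \<and> p \<in> rpc_hom T (edge_cone G S e)"
  by (auto simp: pieces_pts_def)
 moreover have "len G e \<in> dual_monoid S" if "e \<in> edges G"
  using obj_dual[OF X] that by (auto simp: edges_hedges fl_def)
 ultimately show ?thesis by (cases "e \<in> edges G") (simp_all add: edge_cone_hom)
qed

lemma base_hom: "x \<in> pieces_pts S G T ==> mobj g n S G ==> pt_base x \<in> rpc_hom T S"
 by (cases x) (auto simp: pieces_V pieces_L pieces_E)

lemma first_flag_in: "e ~= {} ==> first_flag e \<in> e"
 unfolding first_flag_def by (rule someI_ex) auto

lemma edge_ex:
 assumes X: "mobj g n S G" and e: "e \<in> edges G"
 shows "\<exists>k. k \<in> hedges G \<and> e = {k, flip G k} \<and> first_flag e = k \<and> flip G k \<in> hedges G \<and> k ~= flip G k \<and>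
  flip G (flip G k) = k \<and> len G e = fl G k"
proof -
 note G = obj_graph[OF X]
 obtain h where h: "h \<in> hedges G" "e = {h, flip G h}" using e by (auto simp: edges_hedges)
 have h': "flip G h \<in> hedges G" by (rule flip_hedges[OF G h(1)])
 have hc: "h \<in> Cells G" "flip G h ~= h" using h(1) by (simp_all add: hedges_def flags_def)
 have ff: "flip G (flip G h) = h" by (rule mg_flip_flip[OF G hc(1)])
 have "first_flag e = h \<or> first_flag e = flip G h" using first_flag_in[of e] h(2) by auto
 thus ?thesis
 proof
  assume "first_flag e = h" thus ?thesis using h h' hc ff by (intro exI[of _ h]) (simp add: fl_def)
 next
  assume "first_flag e = flip G h"
  thus ?thesis using h h' hc ff by (intro exI[of _ "flip G h"]) (simp add: fl_def insert_commute)
 qed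
qed

lemma dst_comp: "dst e k (p o h) = dst e k p o h"
 by (simp add: dst_def comp_assoc)

lemma dst_pieces:
 assumes X: "mobj g n S G" and p: "EPt e p \<in> pieces_pts S G T" and k: "k \<in> e"
 shows "dst e k p \<in> dual_monoid T"
  and "(\<lambda>x. dst e k p x + dst e (flip G k) p x) = fl G k o (fst o p)"
  and "k \<in> hedges G" and "e = {k, flip G k}" and "flip G k ~= k"
proof -
 obtain h where h: "h \<in> hedges G" "e = {h, flip G h}" "first_flag e = h" "flip G h \<in> hedges G" "h ~= flip G h"
  "flip G (flip G h) = h" "len G e = fl G h"
  using edge_ex[OF X, of e] p[unfolded pieces_E[OF X]] by blast
 note P = p[unfolded pieces_E[OF X]]
 show "dst e k p \<in> dual_monoid T" using P by (simp add: dst_def)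
 have "fl G k = fl G h" using k h by (auto simp: fl_def insert_commute)
 thus "(\<lambda>x. dst e k p x + dst e (flip G k) p x) = fl G k o (fst o p)"
  using P h k by (auto simp: dst_def fun_eq_iff)
 show "k \<in> hedges G" "e = {k, flip G k}" "flip G k ~= k" using k h by auto
qed

lemma at_v_verts:
 assumes X: "mobj g n S G" and x: "x \<in> pieces_pts S G T" and w: "w \<in> at_v G x"
 shows "w \<in> verts G"
proof (cases x)
 case (EPt e p)
 then obtain k where "k \<in> e" "w = rt G k" using w by auto
 thus ?thesis using dst_pieces(3)[OF X, of e p T k] x EPt rt_verts[of k G] by (auto simp: hedges_def flags_def)
qed (use x w rt_verts[of _ G] in \<open>auto simp: pieces_V pieces_L legs_def flags_def split: if_splits\<close>)

text \<open>Two different vertices occur only for an edge point at distance zero from both ends. The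
  distances add up to the edge length, which therefore vanishes over the base.\<close>

lemma at_v_connected:
 assumes X: "mobj g n S G" and x: "x \<in> pieces_pts S G T"
  and v: "v \<in> at_v G x" and w: "w \<in> at_v G x"
 shows "(v, w) \<in> (zadj G (pt_base x))\<^sup>*"
proof (cases "v = w")
 case False
 then obtain e p where ep: "x = EPt e p" using v w by (cases x) (auto split: if_splits)
 obtain k h where k: "k \<in> e" "v = rt G k" "dst e k p = (\<lambda>x. 0)" and h: "h \<in> e" "w = rt G h" "dst e h p = (\<lambda>x. 0)"
  using v w ep by auto
 note d = dst_pieces[OF X x[unfolded ep] k(1)]
 have "h = flip G k" using h(1) d(4) k h False by auto
 hence "fl G k o pt_base x = (\<lambda>x. 0)" using d(2) k h ep by auto
 hence "(v, w) \<in> zadj G (pt_base x)" using k h d(3) \<open>h = flip G k\<close> unfolding zadj_def steps_def by auto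
 thus ?thesis by auto
qed simp

text \<open>The closed form of the generated gluing for points that touch a vertex. It is not
  reflexive: a point that meets no vertex is glued only to itself.\<close>

definition same_spot :: "('x, 'v::real_vector) curve \<Rightarrow> ('x, 'v) cpoint \<Rightarrow> ('x, 'v) cpoint \<Rightarrow> bool" where
 "same_spot G x y \<longleftrightarrow> pt_base x = pt_base y \<and>
   (\<exists>v\<in>at_v G x. \<exists>w\<in>at_v G y. (v, w) \<in> (zadj G (pt_base x))\<^sup>*)"

lemma same_spot_sym: "mobj g n S G ==> same_spot G x y ==> same_spot G y x"
 unfolding same_spot_def using zadj_sym[OF obj_graph] by metis

text \<open>The vertex at which \<open>y\<close> is reached may differ from the one at which it is
  left, but by \<open>at_v_connected\<close> the two are joined over the base.\<close>

lemma same_spot_trans: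
 assumes X: "mobj g n S G" and y: "y \<in> pieces_pts S G T"
  and xy: "same_spot G x y" and yz: "same_spot G y z"
 shows "same_spot G x z"
proof -
 from xy obtain v w where a: "pt_base x = pt_base y" "v \<in> at_v G x" "w \<in> at_v G y" "(v, w) \<in> (zadj G (pt_base y))\<^sup>*"
  unfolding same_spot_def by auto
 from yz obtain v' w' where b: "pt_base y = pt_base z" "v' \<in> at_v G y" "w' \<in> at_v G z" "(v', w') \<in> (zadj G (pt_base y))\<^sup>*"
  unfolding same_spot_def by auto
 have "(v, w') \<in> (zadj G (pt_base y))\<^sup>*" using a(4) b(4) at_v_connected[OF X y a(3) b(2)] by auto
 with a b show ?thesis unfolding same_spot_def by auto
qed

text \<open>Lying in a face means that one function of the dual monoid vanishes on the support,
  hence everywhere.\<close>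

lemma face_gluing_iff:
 assumes X: "mobj g n S G" and T: "is_rpcone T"
 shows "(x, y) \<in> face_gluing S G T \<longleftrightarrow> x \<in> pieces_pts S G T \<and> (\<forall>v p. x ~= VPt v p) \<and>
   (\<exists>w\<in>at_v G x. y = VPt w (pt_base x))"
proof (cases x)
 case (VPt v p)
 thus ?thesis by (auto simp: face_gluing_def)
next
 case (LPt l p)
 have "p ` Supp T \<subseteq> leg_face S \<longleftrightarrow> snd o p = (\<lambda>x. 0)" if p: "p \<in> rpc_hom T (leg_cone S)"
  using dual_eq0_iff[OF T, of "snd o p"] p[unfolded leg_cone_hom] rpc_hom_Supp[of "fst o p" T S]
  by (auto simp: leg_face_def image_subset_iff mem_Times_iff)
 thus ?thesis using LPt by (auto simp: face_gluing_def pieces_pts_def)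
next
 case (EPt e p)
 have "p ` Supp T \<subseteq> edge_face G S e k \<longleftrightarrow> dst e k p = (\<lambda>x. 0)"
  if p: "p \<in> rpc_hom T (edge_cone G S e)" and e: "e \<in> edges G" and k: "k \<in> e" for k
 proof -
  have "EPt e p \<in> pieces_pts S G T" using p e by (auto simp: pieces_pts_def)
  hence "dst e k p = (\<lambda>x. 0) \<longleftrightarrow> (\<forall>x\<in>Supp T. dst e k p x = 0)"
   using dual_eq0_iff[OF T] dst_pieces(1)[OF X _ k] by blast
  thus ?thesis using rpc_hom_Supp[OF p]
   by (auto simp: edge_face_def dst_def image_subset_iff case_prod_beta)
 qed
 thus ?thesis using EPt by (auto simp: face_gluing_def pieces_pts_def)
qed

text \<open>Each generating identification is an instance of \<open>same_spot\<close>, which is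
  symmetric and transitive. Conversely a chain of edges of length zero is realised by points of
  those edges that lie on both faces.\<close>

lemma glued_iff:
 assumes X: "mobj g n S G" and T: "is_rpcone T"
 shows "(x, y) \<in> glued S G T \<longleftrightarrow> x \<in> pieces_pts S G T \<and> y \<in> pieces_pts S G T \<and> (x = y \<or> same_spot G x y)"
proof -
 let ?P = "pieces_pts S G T" and ?E = "face_gluing S G T \<union> (face_gluing S G T)\<inverse>"
 note fg = face_gluing_iff[OF X T]
 have vp: "VPt w (pt_base x) \<in> ?P" if "x \<in> ?P" "w \<in> at_v G x" for x w
  using that base_hom[OF _ X] at_v_verts[OF X] by (simp add: pieces_V)
 have ss: "same_spot G x (VPt w (pt_base x))" if "w \<in> at_v G x" for x w
  using that unfolding same_spot_def by auto
 have 1: "y \<in> ?P \<and> (x = y \<or> same_spot G x y)" if "(x, y) \<in> ?E\<^sup>*" "x \<in> ?P" for x y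
  using that
 proof (induction rule: rtrancl_induct)
  case (step y z)
  have "z \<in> ?P \<and> same_spot G y z"
   using step(2) fg vp ss same_spot_sym[OF X] by auto
  with step show ?case using same_spot_trans[OF X] by metis
 qed simp
 have 2: "(x, VPt w (pt_base x)) \<in> ?E\<^sup>*" if "x \<in> ?P" "w \<in> at_v G x" for x w
  using that fg[of x "VPt w (pt_base x)"] by (cases x) auto
 have t2: "(VPt w (pt_base x), x) \<in> ?E\<^sup>*" if "x \<in> ?P" "w \<in> at_v G x" for x w
  using that fg[of x "VPt w (pt_base x)"] by (cases x) auto
 have 3: "(VPt v p, VPt w p) \<in> ?E\<^sup>*" if "(v, w) \<in> (zadj G p)\<^sup>*" "p \<in> rpc_hom T S" for v w p
  using that
 proof (induction rule: rtrancl_induct)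
  case (step y z)
  then obtain k where k: "k \<in> hedges G" "fl G k o p = (\<lambda>x. 0)" "y = rt G k" "z = rt G (flip G k)"
   unfolding zadj_def steps_def by auto
  \<comment> \<open>Both coordinates can be \<open>0\<close> because the edge has length zero over
    \<open>p\<close>. This point lies on both faces and so links the points of the two
    vertices.\<close>
  let ?x = "EPt {k, flip G k} (\<lambda>x. (p x, 0, 0))"
  have "?x \<in> ?P" unfolding pieces_E[OF X] using k step.prems
   by (auto simp: edges_hedges comp_def dual_zero fl_def)
  moreover have "dst {k, flip G k} k (\<lambda>x. (p x, 0, 0)) = (\<lambda>x. 0)"
   "dst {k, flip G k} (flip G k) (\<lambda>x. (p x, 0, 0)) = (\<lambda>x. 0)" by (auto simp: dst_def)
  hence "y \<in> at_v G ?x" "z \<in> at_v G ?x" using k by auto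
  ultimately have "(VPt y p, VPt z p) \<in> ?E\<^sup>*" using 2[of ?x z] t2[of ?x y] by (auto simp: comp_def)
  with step show ?case by auto
 qed simp
 have "(x, y) \<in> ?E\<^sup>*" if xy: "x \<in> ?P" "y \<in> ?P" "same_spot G x y"
 proof -
  from xy(3) obtain v w where a: "pt_base x = pt_base y" "v \<in> at_v G x" "w \<in> at_v G y" "(v, w) \<in> (zadj G (pt_base x))\<^sup>*"
   unfolding same_spot_def by auto
  show ?thesis
   using 2[OF xy(1) a(2)] 3[OF a(4) base_hom[OF xy(1) X]] t2[OF xy(2) a(3)] a(1) by auto
 qed
 with 1 show ?thesis unfolding glued_def by auto
qed

section \<open>Classes of points and their restriction\<close>

definition cls :: "'v::real_vector rpcone \<Rightarrow> ('x, 'v) curve \<Rightarrow> 'v rpcone \<Rightarrow> ('x, 'v) cpoint \<Rightarrow> ('x, 'v) cpoint set" where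
 "cls S G T x = glued S G T `` {x}"

lemma equiv_glued:
 assumes X: "mobj g n S G" and T: "is_rpcone T"
 shows "equiv (pieces_pts S G T) (glued S G T)"
proof (rule equivI)
 show "glued S G T \<subseteq> pieces_pts S G T \<times> pieces_pts S G T" by (auto simp: glued_def)
 show "refl_on (pieces_pts S G T) (glued S G T)" by (rule refl_onI) (auto simp: glued_iff[OF X T])
 show "sym (glued S G T)" by (rule symI) (auto simp: glued_iff[OF X T] intro: same_spot_sym[OF X])
 show "trans (glued S G T)" by (rule transI) (auto simp: glued_iff[OF X T] intro: same_spot_trans[OF X])
qed

lemma cone_pts_cls: "cone_pts S G T = cls S G T ` pieces_pts S G T"
 by (auto simp: cone_pts_def cls_def quotient_def)

lemma cls_eq_iff:
 assumes X: "mobj g n S G" and T: "is_rpcone T" and "x \<in> pieces_pts S G T" "y \<in> pieces_pts S G T"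
 shows "cls S G T x = cls S G T y \<longleftrightarrow> x = y \<or> same_spot G x y"
 unfolding cls_def eq_equiv_class_iff[OF equiv_glued[OF X T] assms(3,4)] using assms by (simp add: glued_iff)

lemma cone_base_cls:
 assumes X: "mobj g n S G" and T: "is_rpcone T" and x: "x \<in> pieces_pts S G T"
 shows "cone_base (cls S G T x) = pt_base x"
proof -
 have "pt_base ` cls S G T x = {pt_base x}"
  using x by (auto simp: cls_def glued_iff[OF X T] same_spot_def image_iff)
 thus ?thesis by (simp add: cone_base_def)
qed

text \<open>\<open>cone_pull\<close> and \<open>cone_map\<close> are defined by saturating the image
  of a class. Once this image lies in one class, the saturation is that class and can be computed
  from a single representative.\<close>

lemma Image_cls:
 assumes X: "mobj g n S G" and T: "is_rpcone T"
  and ne: "y \<in> A" and A: "\<And>z. z \<in> A ==> (y, z) \<in> glued S G T"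
 shows "glued S G T `` A = cls S G T y"
proof -
 have "(\<Union>z\<in>A. glued S G T `` {z}) = (\<Union>z\<in>A. glued S G T `` {y})"
  using equiv_class_eq[OF equiv_glued[OF X T] A] by (intro SUP_cong refl) blast
 moreover have "glued S G T `` A = (\<Union>z\<in>A. glued S G T `` {z})" by auto
 moreover have "(\<Union>z\<in>A. glued S G T `` {y}) = glued S G T `` {y}" using ne by blast
 ultimately show ?thesis unfolding cls_def by (simp only:)
qed

lemma pt_base_pull [simp]: "pt_base (pt_pull g x) = pt_base x o g"
 by (cases x) (auto simp: comp_assoc)

lemma pull_pieces:
 assumes X: "mobj g n S G" and x: "x \<in> pieces_pts S G T'" and h: "h \<in> rpc_hom T T'"
 shows "pt_pull h x \<in> pieces_pts S G T"
proof (cases x)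
 case (EPt e p)
 hence "len G e o (fst o p) = (\<lambda>x. fst (snd (p x)) + snd (snd (p x)))" using x pieces_E[OF X] by auto
 hence "len G e o (fst o (p o h)) = (\<lambda>x. fst (snd ((p o h) x)) + snd (snd ((p o h) x)))"
  by (auto simp: fun_eq_iff)
 thus ?thesis using x EPt rpc_hom_comp[OF h, of "fst o p" S] dual_comp[OF _ h, of "fst o snd o p"]
   dual_comp[OF _ h, of "snd o snd o p"]
  by (simp add: pieces_E[OF X] comp_assoc)
next
 case (LPt l p)
 thus ?thesis using x rpc_hom_comp[OF h, of "fst o p" S] dual_comp[OF _ h, of "snd o p"]
  by (simp add: pieces_L comp_assoc)
qed (use x rpc_hom_comp[OF h, of _ S] in \<open>simp add: pieces_V\<close>)

text \<open>A function that vanishes still vanishes after composition with \<open>h\<close>, so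
  restriction can only add vertices.\<close>

lemma at_v_pull: "at_v G x \<subseteq> at_v G (pt_pull h x)"
 by (cases x) (auto simp: dst_comp fun_eq_iff split: if_splits)

lemma zadj_comp: "(zadj G p)\<^sup>* \<subseteq> (zadj G (p o h))\<^sup>*"
 unfolding zadj_def by (intro rtrancl_mono steps_mono) (auto simp: fun_eq_iff)

lemma same_spot_pull: "same_spot G x y ==> same_spot G (pt_pull h x) (pt_pull h y)"
 unfolding same_spot_def using at_v_pull[of G x h] at_v_pull[of G y h] zadj_comp[of G "pt_base x" h]
 by (auto, blast)

lemma cone_pull_cls:
 assumes X: "mobj g n S G" and T: "is_rpcone T" "is_rpcone T'"
  and x: "x \<in> pieces_pts S G T'" and h: "h \<in> rpc_hom T T'"
 shows "cone_pull S G T h (cls S G T' x) = cls S G T (pt_pull h x)"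
 unfolding cone_pull_def
proof (rule Image_cls[OF X T(1)])
 show "pt_pull h x \<in> pt_pull h ` cls S G T' x" using x by (auto simp: cls_def glued_iff[OF X T(2)])
 show "(pt_pull h x, z) \<in> glued S G T" if "z \<in> pt_pull h ` cls S G T' x" for z
  using that pull_pieces[OF X _ h] same_spot_pull[of G x _ h]
  by (auto simp: cls_def glued_iff[OF X T(2)] glued_iff[OF X T(1)])
qed

lemma pt_pull_comp: "pt_pull g (pt_pull h x) = pt_pull (h o g) x"
 by (cases x) (auto simp: comp_assoc)

lemma pt_pull_id:
 assumes X: "mobj g n S G" and x: "x \<in> pieces_pts S G T"
 shows "pt_pull (rpc_id T) x = x"
 using x by (cases x) (auto simp: pieces_pts_def intro: comp_rpc_id)

lemma cone_pullD:
 assumes X: "mobj g n S G" and T: "is_rpcone T" "is_rpcone T'" and K: "K \<in> cone_pts S G T'"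
  and h: "h \<in> rpc_hom T T'"
 shows cone_pull_pts: "cone_pull S G T h K \<in> cone_pts S G T"
  and cone_pull_base: "cone_base (cone_pull S G T h K) = cone_base K o h"
  and cone_base_hom: "cone_base K \<in> rpc_hom T' S"
proof -
 obtain x where x: "x \<in> pieces_pts S G T'" "K = cls S G T' x" using K by (auto simp: cone_pts_cls)
 show "cone_pull S G T h K \<in> cone_pts S G T"  "cone_base (cone_pull S G T h K) = cone_base K o h"
  "cone_base K \<in> rpc_hom T' S"
  using x pull_pieces[OF X x(1) h] base_hom[OF x(1) X]
  by (auto simp: cone_pull_cls[OF X T x(1) h] cone_pts_cls cone_base_cls[OF X T(1)] cone_base_cls[OF X T(2) x(1)])
qed

lemma cone_pull_id:
 assumes X: "mobj g n S G" and T: "is_rpcone T" and K: "K \<in> cone_pts S G T"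
 shows "cone_pull S G T (rpc_id T) K = K"
 using K by (auto simp: cone_pts_cls cone_pull_cls[OF X T T _ rpc_id_in[OF T]] pt_pull_id[OF X])

lemma cone_pull_comp:
 assumes X: "mobj g n S G" and T: "is_rpcone T" "is_rpcone T'" "is_rpcone T''" and K: "K \<in> cone_pts S G T''"
  and h: "h \<in> rpc_hom T T'" and h': "h' \<in> rpc_hom T' T''"
 shows "cone_pull S G T h (cone_pull S G T' h' K) = cone_pull S G T (h' o h) K"
proof -
 obtain x where x: "x \<in> pieces_pts S G T''" "K = cls S G T'' x" using K by (auto simp: cone_pts_cls)
 show ?thesis using x pull_pieces[OF X x(1) h']
  by (simp add: cone_pull_cls[OF X T(2,3) _ h'] cone_pull_cls[OF X T(1,2) _ h]
    cone_pull_cls[OF X T(1,3) _ rpc_hom_comp[OF h h']] pt_pull_comp)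
qed

subsection \<open>Functoriality in the curve\<close>

text \<open>A half-edge of \<open>G'\<close> has length zero over \<open>f o p\<close> if and only
  if it is contracted or its image has length zero over \<open>p\<close>; \<open>contr_path\<close>
  applies to exactly these half-edges.\<close>

lemma zadj_arr:
 assumes a: "marr g n S G S' G' f P" and v: "v \<in> verts G'" "w \<in> verts G'"
 shows "(P v, P w) \<in> (zadj G p)\<^sup>* \<longleftrightarrow> (v, w) \<in> (zadj G' (f o p))\<^sup>*"
proof -
 note A = mtrop_arrD[OF a]
 let ?K = "{k \<in> hedges G. fl G k o p = (\<lambda>x. 0)}"
 have "{k \<in> flags G'. P k \<in> verts G \<or> P k \<in> ?K} = {k \<in> hedges G'. fl G' k o (f o p) = (\<lambda>x. 0)}"
 proof (intro set_eqI)
  fix k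
  show "k \<in> {k \<in> flags G'. P k \<in> verts G \<or> P k \<in> ?K} \<longleftrightarrow>
   k \<in> {k \<in> hedges G'. fl G' k o (f o p) = (\<lambda>x. 0)}"
  proof (cases "k \<in> hedges G'")
   case True
   hence kf: "k \<in> flags G'" by (simp add: hedges_def)
   have e: "fl G' k o (f o p) = (if P k \<in> verts G then (\<lambda>x. 0) else fl G (P k)) o p"
    unfolding A(5)[OF True, symmetric] by (simp add: comp_assoc)
   show ?thesis
   proof (cases "P k \<in> verts G")
    case v: True
    thus ?thesis using True kf e by (simp add: comp_def)
   next
    case v: False
    thus ?thesis using True kf e contr_hedges[OF A(4) True v] by simp
   qed
  next
   case False
   thus ?thesis
    using contr_legs[OF A(4), of k] mtrop_arr_contracted[OF a, of k] by (auto simp: hedges_def legs_def)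
  qed
 qed
 moreover have K: "?K \<subseteq> flags G" by (auto simp: hedges_def)
 ultimately show ?thesis unfolding zadj_def contr_path[OF A(4) K v] by (simp only:)
qed

text \<open>The chosen orders of the flags of \<open>e\<close> and of its image are unrelated. The
  interchange of coordinates in \<open>pt_lift\<close> compensates for this, so that distances
  depend only on flags.\<close>

lemma lift_dst:
 assumes a: "marr g n S G S' G' f P" and e: "e \<in> edges G'" "P ` e \<in> edges G" and k: "k \<in> e"
 shows "dst e k (map_prod f (if P (first_flag e) = first_flag (P ` e) then id else prod.swap) o p)
   = dst (P ` e) (P k) p"
proof -
 note A = mtrop_arrD[OF a]
 obtain h where h: "h \<in> hedges G'" "e = {h, flip G' h}" "first_flag e = h" "h ~= flip G' h" using edge_ex[OF A(2) e(1)] by blast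
 obtain h' where h': "h' \<in> hedges G" "P ` e = {h', flip G h'}" "first_flag (P ` e) = h'" "h' ~= flip G h'" using edge_ex[OF A(1) e(2)] by blast
 have "P h ~= P (flip G' h)" using h h' by auto
 moreover have "h' = P h \<or> h' = P (flip G' h)" using h h' by auto
 ultimately show ?thesis using h h' k by (auto simp: dst_def fun_eq_iff)
qed

lemma lift_props:
 assumes a: "marr g n S G S' G' f P"
  and l: "(x, x') \<in> pt_lift G G' f P" and x: "x \<in> pieces_pts S G T"
 shows lift_pieces: "x' \<in> pieces_pts S' G' T" and lift_base: "pt_base x' = f o pt_base x"
  and lift_at: "at_v G x = P ` at_v G' x'"
proof -
 note A = mtrop_arrD[OF a]
 consider (V) v p where "x = VPt (P v) p" "x' = VPt v (f o p)" "v \<in> verts G'"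
  | (L) l p where "x = LPt (P l) p" "x' = LPt l (map_prod f id o p)" "l \<in> legs G'"
  | (E) e p where "x = EPt (P ` e) p" "x' = EPt e (map_prod f (if P (first_flag e) = first_flag (P ` e) then id else prod.swap) o p)"
    "e \<in> edges G'" "P ` e \<in> edges G"
  using l unfolding pt_lift_def by blast
 hence "x' \<in> pieces_pts S' G' T \<and> pt_base x' = f o pt_base x \<and> at_v G x = P ` at_v G' x'"
 proof cases
  case V
  thus ?thesis using x rpc_hom_comp[OF _ A(3)] by (auto simp: pieces_V)
 next
  case L
  have "fst o (map_prod f id o p) = f o (fst o p)" "snd o (map_prod f id o p) = snd o p" by (auto simp: fun_eq_iff)
  moreover have "P (rt G' l) = rt G (P l)" using contr_rt[OF A(4)] L(3) by (auto simp: legs_def flags_def)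
  ultimately show ?thesis using L x rpc_hom_comp[OF _ A(3)] by (auto simp: pieces_L)
 next
  case E
  let ?p = "map_prod f (if P (first_flag e) = first_flag (P ` e) then id else prod.swap) o p"
  obtain k where k: "k \<in> hedges G'" "e = {k, flip G' k}" "len G' e = fl G' k" using edge_ex[OF A(2) E(3)] by blast
  have kc: "k \<in> Cells G'" using k by (simp add: hedges_def flags_def)
  have "P k \<notin> verts G"
  proof -
   obtain h' where "h' \<in> hedges G" "P ` e = {h', flip G h'}" "flip G h' \<in> hedges G" using edge_ex[OF A(1) E(4)] by blast
   thus ?thesis using k by (auto simp: hedges_def flags_def)
  qed
  hence len: "len G' e o f = len G (P ` e)"
   using A(5)[OF k(1)] k contr_flip[OF A(4) kc] by (simp add: fl_def)
  have b: "fst o ?p = f o (fst o p)" by (auto simp: fun_eq_iff)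
  have P: "fst o p \<in> rpc_hom T S" "fst o snd o p \<in> dual_monoid T" "snd o snd o p \<in> dual_monoid T"
   "len G (P ` e) o (fst o p) = (\<lambda>x. fst (snd (p x)) + snd (snd (p x)))" using x E pieces_E[OF A(1)] by auto
  have "len G' e o (fst o ?p) = len G (P ` e) o (fst o p)" unfolding b len[symmetric] by (simp add: comp_assoc)
  also have "\<dots> = (\<lambda>x. fst (snd (?p x)) + snd (snd (?p x)))" unfolding P(4) by (auto simp: fun_eq_iff)
  finally have "len G' e o (fst o ?p) = (\<lambda>x. fst (snd (?p x)) + snd (snd (?p x)))" .
  moreover have "fst o snd o ?p \<in> dual_monoid T" "snd o snd o ?p \<in> dual_monoid T"
  proof -
   have "fst o snd o ?p \<in> {fst o snd o p, snd o snd o p}" "snd o snd o ?p \<in> {fst o snd o p, snd o snd o p}"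
    by (auto simp: fun_eq_iff)
   thus "fst o snd o ?p \<in> dual_monoid T" "snd o snd o ?p \<in> dual_monoid T" using P by auto
  qed
  ultimately have "x' \<in> pieces_pts S' G' T"
   unfolding E(2) pieces_E[OF A(2)] using E(3) rpc_hom_comp[OF P(1) A(3)] b by metis
  moreover have "at_v G x = P ` at_v G' x'"
  proof -
   have rt: "P (rt G' h) = rt G (P h)" if "h \<in> e" for h
    using that k contr_rt[OF A(4), of h] mg_flip[OF contr_src[OF A(4)] kc] kc by auto
   have "at_v G x = {rt G (P h) | h. h \<in> e \<and> dst (P ` e) (P h) p = (\<lambda>x. 0)}" unfolding E(1) by auto
   also have "\<dots> = {P (rt G' h) | h. h \<in> e \<and> dst e h ?p = (\<lambda>x. 0)}"
    using rt lift_dst[OF a E(3,4), of _ p] by (intro Collect_cong ex_cong1) auto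
   also have "\<dots> = P ` at_v G' x'" unfolding E(2) at_v.simps by blast
   finally show ?thesis .
  qed
  ultimately show ?thesis using b E by simp
 qed
 thus "x' \<in> pieces_pts S' G' T" "pt_base x' = f o pt_base x" "at_v G x = P ` at_v G' x'" by auto
qed

lemma lift_V: "(x, VPt v q) \<in> pt_lift G G' f P \<longleftrightarrow> v \<in> verts G' \<and> (\<exists>p. x = VPt (P v) p \<and> q = f o p)"
 unfolding pt_lift_def by blast

lemma lift_L: "(x, LPt l q) \<in> pt_lift G G' f P \<longleftrightarrow> l \<in> legs G' \<and> (\<exists>p. x = LPt (P l) p \<and> q = map_prod f id o p)"
 unfolding pt_lift_def by blast

lemma lift_E: "(x, EPt e q) \<in> pt_lift G G' f P \<longleftrightarrow> e \<in> edges G' \<and> P ` e \<in> edges G \<and> (\<exists>p. x = EPt (P ` e) p \<and>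
  q = map_prod f (if P (first_flag e) = first_flag (P ` e) then id else prod.swap) o p)"
 unfolding pt_lift_def by blast

lemma edge_Cells:
 assumes "mobj g n S G" "e \<in> edges G" shows "e \<subseteq> Cells G"
proof -
 obtain k where "k \<in> hedges G" "e = {k, flip G k}" "flip G k \<in> hedges G" using edge_ex[OF assms] by blast
 thus ?thesis by (auto simp: hedges_def flags_def)
qed

lemma arr_vert:
 assumes "marr g n S G S' G' f P" "e \<in> edges G'" "k \<in> e"
 shows "P ` e \<in> edges G \<longleftrightarrow> P k \<notin> verts G"
proof -
 note A = mtrop_arrD[OF assms(1)]
 obtain h where h: "h \<in> hedges G'" "e = {h, flip G' h}" using edge_ex[OF A(2) assms(2)] by blast
 have hc: "h \<in> Cells G'" using h by (simp add: hedges_def flags_def)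
 have im: "P ` e = {P h, flip G (P h)}" using h contr_flip[OF A(4) hc] by simp
 have "P k \<in> verts G \<longleftrightarrow> P h \<in> verts G" using assms(3) h contr_flip_vert[OF A(4) hc] by auto
 moreover have "P ` e \<in> edges G" if "P h \<notin> verts G"
  unfolding im edges_hedges using contr_hedges[OF A(4) h(1) that] by blast
 moreover have "P h \<notin> verts G" if pe: "P ` e \<in> edges G"
 proof -
  obtain h' where "h' \<in> hedges G" "P ` e = {h', flip G h'}" "flip G h' \<in> hedges G" using edge_ex[OF A(1) pe] by blast
  moreover have "P h \<in> P ` e" using h by simp
  ultimately show ?thesis by (auto simp: hedges_def flags_def)
 qed
 ultimately show ?thesis by blast
qed

lemma map_prod_swap_eq:
 assumes "map_prod f s o p = map_prod f s o q" "fst o p = fst o q" "inj s"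
 shows "p = q"
proof
 fix z
 have "s (snd (p z)) = s (snd (q z))" "fst (p z) = fst (q z)"
  using fun_cong[OF assms(1), of z] fun_cong[OF assms(2), of z] by (simp_all add: map_prod_def split_beta)
 thus "p z = q z" using assms(3) by (simp add: prod_eq_iff inj_def)
qed

text \<open>Since \<open>f\<close> need not be injective, the first coordinate of \<open>x\<close>
  is not determined by \<open>x'\<close>; it is supplied by the common base, and the remaining
  coordinates are read off from \<open>x'\<close>.\<close>

lemma lift_unique:
 assumes a: "marr g n S G S' G' f P"
  and l: "(x, x') \<in> pt_lift G G' f P" and l': "(y, x') \<in> pt_lift G G' f P" and b: "pt_base x = pt_base y"
 shows "x = y"
proof (cases x')
 case (VPt v p)
 obtain q q' where "x = VPt (P v) q" "y = VPt (P v) q'" using l l' unfolding VPt lift_V by blast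
 thus ?thesis using b by simp
next
 case (LPt k p)
 obtain q where q1: "x = LPt (P k) q" "p = map_prod f id o q"
  using l unfolding LPt lift_L by (elim conjE exE) (rule that)
 obtain q' where q2: "y = LPt (P k) q'" "p = map_prod f id o q'"
  using l' unfolding LPt lift_L by (elim conjE exE) (rule that)
 note q = q1(1) q2(1) q1(2)[symmetric] q2(2)[symmetric]
 have "q = q'" by (rule map_prod_swap_eq[of f id]) (use q b in auto)
 thus ?thesis using q by simp
next
 case (EPt e p)
 let ?s = "if P (first_flag e) = first_flag (P ` e) then id else prod.swap"
 obtain q where q1: "x = EPt (P ` e) q" "p = map_prod f ?s o q"
  using l unfolding EPt lift_E by (elim conjE exE) (rule that)
 obtain q' where q2: "y = EPt (P ` e) q'" "p = map_prod f ?s o q'"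
  using l' unfolding EPt lift_E by (elim conjE exE) (rule that)
 note q = q1(1) q2(1) q1(2)[symmetric] q2(2)[symmetric]
 have "q = q'" by (rule map_prod_swap_eq[of f ?s]) (use q b in \<open>auto simp: inj_def\<close>)
 thus ?thesis using q by simp
qed

text \<open>A point that meets no vertex lies on a leg or an edge, and the graph map is injective
  there. At a vertex the lift depends on the choice of a vertex in the fibre, so uniqueness holds
  only up to gluing.\<close>

lemma lift_same_pt:
 assumes a: "marr g n S G S' G' f P"
  and l: "(x, x') \<in> pt_lift G G' f P" and l': "(x, y') \<in> pt_lift G G' f P" and em: "at_v G x = {}"
 shows "x' = y'"
proof (cases x)
 case (VPt v p)
 thus ?thesis using em by simp
next
 case (LPt k p)
 then obtain h h' where h: "k = P h" "h \<in> legs G'" "x' = LPt h (map_prod f id o p)" "k = P h'" "h' \<in> legs G'" "y' = LPt h' (map_prod f id o p)"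
  using l l' unfolding pt_lift_def by blast
 note A = arr_contr[OF a]
 have "P h \<notin> verts G" using contr_legs[OF A h(2)] by (simp add: legs_def flags_def)
 hence "h = h'" using contr_inj[OF A, of h h'] h by (simp add: legs_def flags_def)
 thus ?thesis using h by simp
next
 case (EPt e p)
 let ?s = "\<lambda>e. if P (first_flag e) = first_flag (P ` e) then id else prod.swap"
 from EPt obtain h h' where h: "e = P ` h" "h \<in> edges G'" "x' = EPt h (map_prod f (?s h) o p)"
  "e = P ` h'" "h' \<in> edges G'" "y' = EPt h' (map_prod f (?s h') o p)" "P ` h \<in> edges G"
  using l l' unfolding pt_lift_def by blast
 note A = arr_contr[OF a]
 have "h \<subseteq> Cells G'" "h' \<subseteq> Cells G'"
  using edge_Cells[OF arr_cod[OF a]] h(2,5) by blast+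
 moreover have "k \<in> h'" if "k \<in> h" for k
 proof -
  have "P k \<notin> verts G" using arr_vert[OF a h(2) that] h(7) by simp
  moreover have "P k \<in> P ` h'" unfolding h(4)[symmetric] h(1) using that by blast
  then obtain k' where "k' \<in> h'" "P k = P k'" by blast
  ultimately show ?thesis using contr_inj[OF A, of k k'] that \<open>h \<subseteq> Cells G'\<close> \<open>h' \<subseteq> Cells G'\<close> by blast
 qed
 moreover have "k \<in> h" if "k \<in> h'" for k
 proof -
  have "P k \<notin> verts G" using arr_vert[OF a h(5) that] h(1,4,7) by simp
  moreover have "P k \<in> P ` h" unfolding h(1)[symmetric] h(4) using that by blast
  then obtain k' where "k' \<in> h" "P k = P k'" by blast
  ultimately show ?thesis using contr_inj[OF A, of k k'] that \<open>h \<subseteq> Cells G'\<close> \<open>h' \<subseteq> Cells G'\<close> by blast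
 qed
 ultimately have "h = h'" by blast
 thus ?thesis using h by simp
qed

text \<open>\<open>zadj_arr\<close> is an equivalence, so gluing is preserved and reflected. One
  direction makes \<open>cone_map\<close> well defined, the other makes it injective on points with
  the same base.\<close>

lemma lift_glued:
 assumes a: "marr g n S G S' G' f P"
  and l: "(x, x') \<in> pt_lift G G' f P" and l': "(y, y') \<in> pt_lift G G' f P"
  and x: "x \<in> pieces_pts S G T" and y: "y \<in> pieces_pts S G T" and b: "pt_base x = pt_base y"
 shows "x' = y' \<or> same_spot G' x' y' \<longleftrightarrow> x = y \<or> same_spot G x y"
proof -
 note A = mtrop_arrD[OF a] and L = lift_props[OF a l x] and L' = lift_props[OF a l' y]
 have ss: "same_spot G' x' y' \<longleftrightarrow> same_spot G x y"
 proof -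
  have "(\<exists>v\<in>at_v G x. \<exists>w\<in>at_v G y. (v, w) \<in> (zadj G (pt_base x))\<^sup>*) \<longleftrightarrow>
    (\<exists>v\<in>at_v G' x'. \<exists>w\<in>at_v G' y'. (P v, P w) \<in> (zadj G (pt_base x))\<^sup>*)" unfolding L(3) L'(3) by blast
  also have "\<dots> \<longleftrightarrow> (\<exists>v\<in>at_v G' x'. \<exists>w\<in>at_v G' y'. (v, w) \<in> (zadj G' (pt_base x'))\<^sup>*)"
   unfolding L(2) using zadj_arr[OF a] at_v_verts[OF A(2) L(1)] at_v_verts[OF A(2) L'(1)] by (intro bex_cong refl) blast
  finally show ?thesis unfolding same_spot_def using b L(2) L'(2) by simp
 qed
 moreover have "x' = y' \<or> same_spot G x y" if "x = y"
 proof (cases "at_v G x = {}")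
  case True
  thus ?thesis using lift_same_pt[OF a l] l' that by blast
 next
  case False
  thus ?thesis using that unfolding same_spot_def by auto
 qed
 ultimately show ?thesis using lift_unique[OF a l] l' b by blast
qed

lemma lift_ex:
 assumes a: "marr g n S G S' G' f P" and x: "x \<in> pieces_pts S G T"
 shows "\<exists>x'. (x, x') \<in> pt_lift G G' f P"
proof (cases x)
 case (VPt v p)
 then obtain v' where "v' \<in> verts G'" "P v' = v" using x contr_surj_verts[OF arr_contr[OF a]] by (auto simp: pieces_V)
 thus ?thesis using VPt unfolding pt_lift_def by blast
next
 case (LPt l p)
 hence l: "l \<in> legs G" using x by (simp add: pieces_L)
 then obtain l' where l': "l' \<in> flags G'" "P l' = l" using contr_surj_flags[OF arr_contr[OF a], of l] by (auto simp: legs_def)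
 have "l \<notin> verts G" "l \<notin> hedges G" using l by (auto simp: legs_def flags_def hedges_def)
 hence "l' \<in> legs G'" using contr_hedges[OF arr_contr[OF a], of l'] l' by (auto simp: hedges_def legs_def)
 thus ?thesis using LPt l' unfolding pt_lift_def by blast
next
 case (EPt e p)
 hence e: "e \<in> edges G" using x pieces_E[OF arr_dom[OF a]] by blast
 then obtain k where k: "k \<in> hedges G" "e = {k, flip G k}" using edge_ex[OF arr_dom[OF a]] by blast
 then obtain k' where k': "k' \<in> hedges G'" "P k' = k" using contr_surj_hedges[OF arr_contr[OF a]] by blast
 hence "P ` {k', flip G' k'} = e" using k contr_flip[OF arr_contr[OF a], of k'] by (simp add: hedges_def flags_def)
 moreover have "{k', flip G' k'} \<in> edges G'" using k' by (auto simp: edges_hedges)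
 ultimately show ?thesis using EPt e unfolding pt_lift_def by blast
qed

text \<open>A point of a leg or of a surviving edge has its coordinates carried back with
  \<open>p\<close> in place of \<open>f o p\<close>. On a contracted edge both coordinates vanish,
  so the point is glued to a vertex point, and those come from \<open>G\<close>.\<close>

lemma lift_surj:
 assumes a: "marr g n S G S' G' f P" and x': "x' \<in> pieces_pts S' G' T"
  and p: "p \<in> rpc_hom T S" and b: "pt_base x' = f o p" and T: "is_rpcone T"
 shows "\<exists>x x''. x \<in> pieces_pts S G T \<and> pt_base x = p \<and> (x, x'') \<in> pt_lift G G' f P \<and> (x'' = x' \<or> same_spot G' x'' x')"
proof -
 note A = mtrop_arrD[OF a]
 have V: "VPt (P v) p \<in> pieces_pts S G T \<and> (VPt (P v) p, VPt v (f o p)) \<in> pt_lift G G' f P" if "v \<in> verts G'" for v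
  using that p contr_verts[OF A(4)] unfolding pt_lift_def by (auto simp: pieces_V)
 have atv: ?thesis if v: "v \<in> at_v G' x'" for v
 proof -
  have "same_spot G' (VPt v (f o p)) x'" unfolding same_spot_def using b v by auto
  thus ?thesis using V[OF at_v_verts[OF A(2) x' v]] by (intro exI[of _ "VPt (P v) p"] exI[of _ "VPt v (f o p)"]) simp
 qed
 show ?thesis
 proof (cases x')
  case (VPt v q)
  thus ?thesis using atv by simp
 next
  case (LPt l q)
  let ?x = "LPt (P l) (\<lambda>z. (p z, snd (q z)))"
  have l: "l \<in> legs G'" "snd o q \<in> dual_monoid T" "fst o q = f o p" using x' LPt b by (auto simp: pieces_L)
  have "map_prod f id o (\<lambda>z. (p z, snd (q z))) = q" using l(3) by (auto simp: fun_eq_iff prod_eq_iff)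
  hence "(?x, x') \<in> pt_lift G G' f P" using l(1) unfolding LPt lift_L by metis
  moreover have "?x \<in> pieces_pts S G T" using contr_legs[OF A(4) l(1)] l p by (simp add: pieces_L comp_def)
  ultimately show ?thesis by (intro exI[of _ ?x] exI[of _ x']) (simp add: comp_def)
 next
  case (EPt e q)
  have q: "e \<in> edges G'" "fst o q = f o p" "fst o snd o q \<in> dual_monoid T" "snd o snd o q \<in> dual_monoid T"
   "len G' e o (fst o q) = (\<lambda>x. fst (snd (q x)) + snd (snd (q x)))" using x' b pieces_E[OF A(2)] unfolding EPt by auto
  obtain k where k: "k \<in> hedges G'" "e = {k, flip G' k}" "first_flag e = k" "len G' e = fl G' k" using edge_ex[OF A(2) q(1)] by blast
  have kc: "k \<in> Cells G'" using k by (simp add: hedges_def flags_def)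
  show ?thesis
  proof (cases "P k \<in> verts G")
   case True
   hence "len G' e o (f o p) = (\<lambda>x. 0)" using A(5)[OF k(1)] k(4) by (simp add: fun_eq_iff)
   hence "(\<lambda>x. (fst o snd o q) x + (snd o snd o q) x) = (\<lambda>x. 0)" using q(2,5) by simp
   hence "dst e k q = (\<lambda>x. 0)" using dual_add_eq0[OF T q(3,4)] by (simp add: dst_def)
   hence "rt G' k \<in> at_v G' x'" using k(2) EPt by auto
   thus ?thesis by (rule atv)
  next
   case False
   hence e: "P ` e \<in> edges G" using arr_vert[OF a q(1), of k] k(2) by simp
   let ?s = "if P (first_flag e) = first_flag (P ` e) then id else prod.swap"
   let ?q = "\<lambda>z. (p z, ?s (snd (q z)))"
   let ?x = "EPt (P ` e) ?q"
   have "map_prod f ?s o ?q = q" using q(2) by (auto simp: fun_eq_iff prod_eq_iff)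
   hence lf: "(?x, x') \<in> pt_lift G G' f P" using e q(1) unfolding EPt lift_E by metis
   have "len G (P ` e) = len G' e o f"
    using A(5)[OF k(1)] k(2,4) False contr_flip[OF A(4) kc] by (simp add: fl_def)
   hence "len G (P ` e) o (fst o ?q) = (\<lambda>x. fst (snd (q x)) + snd (snd (q x)))"
    using q(2,5) by (simp add: comp_assoc) (simp add: comp_def)
   also have "\<dots> = (\<lambda>x. fst (snd (?q x)) + snd (snd (?q x)))" by (auto simp: fun_eq_iff)
   finally have "len G (P ` e) o (fst o ?q) = (\<lambda>x. fst (snd (?q x)) + snd (snd (?q x)))" .
   moreover have "fst o snd o ?q \<in> {fst o snd o q, snd o snd o q}" "snd o snd o ?q \<in> {fst o snd o q, snd o snd o q}"
    by (auto simp: fun_eq_iff)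
   hence "fst o snd o ?q \<in> dual_monoid T" "snd o snd o ?q \<in> dual_monoid T" using q(3,4) by auto
   moreover have "fst o ?q = p" by (auto simp: fun_eq_iff)
   ultimately have "?x \<in> pieces_pts S G T" unfolding pieces_E[OF A(1)] using e p by simp
   thus ?thesis using lf by (intro exI[of _ ?x] exI[of _ x']) (simp add: comp_def)
  qed
 qed
qed

lemma cone_map_cls:
 assumes a: "marr g n S G S' G' f P" and T: "is_rpcone T"
  and l: "(x, x') \<in> pt_lift G G' f P" and x: "x \<in> pieces_pts S G T"
 shows "cone_map ((S, G), (S', G'), (f, P)) T (cls S G T x) = cls S' G' T x'"
proof -
 note A = mtrop_arrD[OF a]
 have xx: "x \<in> cls S G T x" using x by (simp add: cls_def glued_iff[OF A(1) T])
 show ?thesis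
  unfolding cone_map_def prod.case
 proof (rule Image_cls[OF A(2) T])
  show "x' \<in> pt_lift G G' f P `` cls S G T x" using l xx by blast
  fix z assume "z \<in> pt_lift G G' f P `` cls S G T x"
  then obtain y where y: "(x, y) \<in> glued S G T" "(y, z) \<in> pt_lift G G' f P" by (auto simp: cls_def)
  hence y': "y \<in> pieces_pts S G T" "x = y \<or> same_spot G x y" by (auto simp: glued_iff[OF A(1) T])
  hence "pt_base x = pt_base y" by (auto simp: same_spot_def)
  thus "(x', z) \<in> glued S' G' T"
   using lift_glued[OF a l y(2) x y'(1)] y'(2) lift_pieces[OF a l x] lift_pieces[OF a y(2) y'(1)]
   by (simp add: glued_iff[OF A(2) T])
 qed
qed

text \<open>\<open>cone_map_inj\<close> and \<open>cone_map_surj\<close> say that points over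
  \<open>p\<close> correspond bijectively to points over \<open>f o p\<close>: the cone of the
  pulled back curve is the pullback of the cone.\<close>

lemma cone_map_rules:
 assumes a: "marr g n S G S' G' f P" and T: "is_rpcone T"
 defines "m \<equiv> ((S, G), (S', G'), (f, P))"
 shows cone_map_pts: "\<And>K. K \<in> cone_pts S G T ==> cone_map m T K \<in> cone_pts S' G' T"
  and cone_map_base: "\<And>K. K \<in> cone_pts S G T ==> cone_base (cone_map m T K) = f o cone_base K"
  and cone_map_inj: "\<And>K L. K \<in> cone_pts S G T ==> L \<in> cone_pts S G T ==> cone_base K = cone_base L ==>
   cone_map m T K = cone_map m T L ==> K = L"
  and cone_map_surj: "\<And>K' p. K' \<in> cone_pts S' G' T ==> p \<in> rpc_hom T S ==> cone_base K' = f o p ==>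
   \<exists>K\<in>cone_pts S G T. cone_base K = p \<and> cone_map m T K = K'"
  and cone_map_pull: "\<And>K T0 h. K \<in> cone_pts S G T ==> is_rpcone T0 ==> h \<in> rpc_hom T0 T ==>
   cone_map m T0 (cone_pull S G T0 h K) = cone_pull S' G' T0 h (cone_map m T K)"
proof -
 note A = mtrop_arrD[OF a] and cm = cone_map_cls[OF a T, folded m_def]
 have rep: "\<exists>x x'. x \<in> pieces_pts S G T \<and> K = cls S G T x \<and> (x, x') \<in> pt_lift G G' f P" if "K \<in> cone_pts S G T" for K
  using that lift_ex[OF a, of _ T] by (auto simp: cone_pts_cls)
 show "cone_map m T K \<in> cone_pts S' G' T" "cone_base (cone_map m T K) = f o cone_base K"
  if K: "K \<in> cone_pts S G T" for K
 proof -
  obtain x x' where x: "x \<in> pieces_pts S G T" "K = cls S G T x" "(x, x') \<in> pt_lift G G' f P" using rep[OF K] by blast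
  note L = lift_props[OF a x(3,1)]
  show "cone_map m T K \<in> cone_pts S' G' T" "cone_base (cone_map m T K) = f o cone_base K"
   unfolding x(2) cm[OF x(3,1)] cone_base_cls[OF A(1) T x(1)] cone_base_cls[OF A(2) T L(1)]
   using L by (auto simp: cone_pts_cls)
 qed
 show "K = L" if K: "K \<in> cone_pts S G T" "L \<in> cone_pts S G T" "cone_base K = cone_base L"
  and eq: "cone_map m T K = cone_map m T L" for K L
 proof -
  obtain x x' where x: "x \<in> pieces_pts S G T" "K = cls S G T x" "(x, x') \<in> pt_lift G G' f P" using rep[OF K(1)] by blast
  obtain y y' where y: "y \<in> pieces_pts S G T" "L = cls S G T y" "(y, y') \<in> pt_lift G G' f P" using rep[OF K(2)] by blast
  have b: "pt_base x = pt_base y" using K(3) x y cone_base_cls[OF A(1) T] by simp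
  have "x' = y' \<or> same_spot G' x' y'"
   using eq cls_eq_iff[OF A(2) T lift_pieces[OF a x(3,1)] lift_pieces[OF a y(3,1)]] cm[OF x(3,1)] cm[OF y(3,1)] x y by simp
  thus ?thesis using lift_glued[OF a x(3) y(3) x(1) y(1) b] cls_eq_iff[OF A(1) T x(1) y(1)] x y by simp
 qed
 show "\<exists>K\<in>cone_pts S G T. cone_base K = p \<and> cone_map m T K = K'"
  if K: "K' \<in> cone_pts S' G' T" and p: "p \<in> rpc_hom T S" and b: "cone_base K' = f o p" for K' p
 proof -
  obtain x' where x': "x' \<in> pieces_pts S' G' T" "K' = cls S' G' T x'" using K by (auto simp: cone_pts_cls)
  hence "pt_base x' = f o p" using b cone_base_cls[OF A(2) T] by simp
  from lift_surj[OF a x'(1) p this T] obtain x x'' where x: "x \<in> pieces_pts S G T" "pt_base x = p"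
   "(x, x'') \<in> pt_lift G G' f P" "x'' = x' \<or> same_spot G' x'' x'" by blast
  have "cls S' G' T x'' = K'" using cls_eq_iff[OF A(2) T lift_pieces[OF a x(3,1)] x'(1)] x(4) x'(2) by simp
  thus ?thesis using x cm[OF x(3,1)] cone_base_cls[OF A(1) T x(1)] by (auto simp: cone_pts_cls)
 qed
 show "cone_map m T0 (cone_pull S G T0 h K) = cone_pull S' G' T0 h (cone_map m T K)"
  if K: "K \<in> cone_pts S G T" and T0: "is_rpcone T0" and h: "h \<in> rpc_hom T0 T" for K T0 h
 proof -
  obtain x x' where x: "x \<in> pieces_pts S G T" "K = cls S G T x" "(x, x') \<in> pt_lift G G' f P" using rep[OF K] by blast
  have "(pt_pull h x, pt_pull h x') \<in> pt_lift G G' f P"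
  proof -
   consider (V) v p where "x = VPt (P v) p" "x' = VPt v (f o p)" "v \<in> verts G'"
    | (L) l p where "x = LPt (P l) p" "x' = LPt l (map_prod f id o p)" "l \<in> legs G'"
    | (E) e p where "x = EPt (P ` e) p" "x' = EPt e (map_prod f (if P (first_flag e) = first_flag (P ` e) then id else prod.swap) o p)"
      "e \<in> edges G'" "P ` e \<in> edges G"
    using x(3) unfolding pt_lift_def by blast
   thus ?thesis
   proof cases
    case V thus ?thesis by (simp add: comp_assoc lift_V)
   next
    case L thus ?thesis by (auto simp: comp_assoc lift_L)
   next
    case E
    show ?thesis unfolding E(1,2) pt_pull.simps comp_assoc lift_E using E(3,4) by blast
   qed
  qed
  thus ?thesis
   using x cm[OF x(3,1)] cone_pull_cls[OF A(1) T0 T x(1) h] cone_pull_cls[OF A(2) T0 T lift_pieces[OF a x(3,1)] h]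
    cone_map_cls[OF a T0 _ pull_pieces[OF A(1) x(1) h]] by (simp add: m_def)
 qed
qed

lemma cone_map_id:
 assumes X: "mobj g n S G" and T: "is_rpcone T" and K: "K \<in> cone_pts S G T"
 shows "cone_map ((S, G), (S, G), (rpc_id S, restrict (\<lambda>x. x) (Cells G))) T K = K"
proof -
 obtain x where x: "x \<in> pieces_pts S G T" "K = cls S G T x" using K by (auto simp: cone_pts_cls)
 let ?i = "restrict (\<lambda>x. x) (Cells G)"
 have "(x, x) \<in> pt_lift G G (rpc_id S) ?i"
 proof (cases x)
  case (VPt v p)
  have v: "v \<in> verts G" "p \<in> rpc_hom T S" using x VPt by (auto simp: pieces_V)
  have "?i v = v" "rpc_id S o p = p" using rpc_id_comp[OF v(2)] verts_Cells[OF obj_graph[OF X] v(1)] by auto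
  thus ?thesis using v unfolding VPt lift_V by metis
 next
  case (LPt l p)
  have l: "l \<in> legs G" "fst o p \<in> rpc_hom T S" using x LPt by (auto simp: pieces_L)
  have "map_prod (rpc_id S) id o p = p" using fun_cong[OF rpc_id_comp[OF l(2)]] by (auto simp: fun_eq_iff prod_eq_iff)
  moreover have "?i l = l" using l by (simp add: legs_def flags_def)
  ultimately show ?thesis using l unfolding LPt lift_L by metis
 next
  case (EPt e p)
  have e: "e \<in> edges G" "fst o p \<in> rpc_hom T S" using x pieces_E[OF X] unfolding EPt by auto
  have "map_prod (rpc_id S) id o p = p" using fun_cong[OF rpc_id_comp[OF e(2)]] by (auto simp: fun_eq_iff prod_eq_iff)
  moreover obtain k where k: "k \<in> hedges G" "e = {k, flip G k}" "flip G k \<in> hedges G" "first_flag e = k" using edge_ex[OF X e(1)] by blast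
  hence i: "?i ` e = e" "?i (first_flag e) = first_flag e" by (auto simp: hedges_def flags_def)
  ultimately have "x = EPt (?i ` e) p" "x = EPt e (map_prod (rpc_id S) (if ?i (first_flag e) = first_flag (?i ` e) then id else prod.swap) o p)"
   using EPt by simp_all
  moreover have "?i ` e \<in> edges G" using e i by simp
  ultimately show ?thesis using e unfolding pt_lift_def by blast
 qed
 thus ?thesis using cone_map_cls[OF mtrop_ide[OF X] T _ x(1)] x(2) by blast
qed

text \<open>Lifts of representatives are composed. Only edges need care, since the two interchanges
  of coordinates must combine to the one prescribed for the composite.\<close>

lemma cone_map_comp:
 assumes a: "marr g n S G S' G' f P"
  and b: "marr g n S' G' S'' G'' f' P'"
  and T: "is_rpcone T" and K: "K \<in> cone_pts S G T"
 shows "cone_map ((S, G), (S'', G''), (f' o f, compose (Cells G'') P P')) T K =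
  cone_map ((S', G'), (S'', G''), (f', P')) T (cone_map ((S, G), (S', G'), (f, P)) T K)"
proof -
 note A = mtrop_arrD[OF a] and B = mtrop_arrD[OF b]
 obtain x where x: "x \<in> pieces_pts S G T" "K = cls S G T x" using K by (auto simp: cone_pts_cls)
 obtain x' where x': "(x, x') \<in> pt_lift G G' f P" using lift_ex[OF a x(1)] by blast
 note xp = lift_pieces[OF a x' x(1)]
 obtain x'' where x'': "(x', x'') \<in> pt_lift G' G'' f' P'" using lift_ex[OF b xp] by blast
 let ?p = "compose (Cells G'') P P'"
 have "(x, x'') \<in> pt_lift G G'' (f' o f) ?p"
 proof (cases x'')
  case (VPt v q)
  hence v: "v \<in> verts G''" using x'' by (auto simp: pt_lift_def)
  hence "?p v = P (P' v)" using verts_Cells[OF obj_graph[OF B(2)]] by (simp add: compose_def)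
  thus ?thesis using v x' x'' unfolding VPt lift_V by (auto simp: lift_V comp_assoc)
 next
  case (LPt l q)
  hence v: "l \<in> legs G''" using x'' by (auto simp: pt_lift_def)
  hence "?p l = P (P' l)" by (simp add: compose_def legs_def flags_def)
  moreover have "map_prod f' id o (map_prod f id o p) = map_prod (f' o f) id o p" for p :: "'a \<Rightarrow> 'a \<times> real"
   by (simp only: comp_assoc[symmetric] map_prod.comp id_comp)
  ultimately show ?thesis using v x' x'' unfolding LPt lift_L by (auto simp: lift_L)
 next
  case (EPt e q)
  let ?s' = "if P' (first_flag e) = first_flag (P' ` e) then id else prod.swap"
  let ?s = "if P (first_flag (P' ` e)) = first_flag (P ` P' ` e) then id else prod.swap"
  from EPt x'' obtain q' where q': "e \<in> edges G''" "P' ` e \<in> edges G'" "x' = EPt (P' ` e) q'" "q = map_prod f' ?s' o q'"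
   unfolding pt_lift_def by blast
  from x' q'(3) obtain q0 where q0: "P ` P' ` e \<in> edges G" "x = EPt (P ` P' ` e) q0" "q' = map_prod f ?s o q0"
   unfolding pt_lift_def by blast
  obtain k where k: "k \<in> hedges G''" "e = {k, flip G'' k}" "flip G'' k \<in> hedges G''" "first_flag e = k" using edge_ex[OF B(2) q'(1)] by blast
  have kc: "k \<in> Cells G''" "flip G'' k \<in> Cells G''" using k by (auto simp: hedges_def flags_def)
  have pe: "?p ` e = P ` P' ` e" "?p (first_flag e) = P (P' (first_flag e))" using k kc by (auto simp: compose_def)
  obtain h where h: "P' ` e = {h, flip G' h}" "first_flag (P' ` e) = h" "h ~= flip G' h" using edge_ex[OF A(2) q'(2)] by blast
  obtain j where j: "P ` P' ` e = {j, flip G j}" "first_flag (P ` P' ` e) = j" "j ~= flip G j" using edge_ex[OF A(1) q0(1)] by blast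
  have pk: "P' k = h \<or> P' k = flip G' h" "P h ~= P (flip G' h)" "P h = j \<or> P (flip G' h) = j"
  proof -
   have "P' k \<in> {h, flip G' h}" using h(1) k(2) by blast
   thus "P' k = h \<or> P' k = flip G' h" by simp
   have "{P h, P (flip G' h)} = {j, flip G j}" using j(1) unfolding h(1) by simp
   thus "P h ~= P (flip G' h)" "P h = j \<or> P (flip G' h) = j"
    unfolding doubleton_eq_iff using j(3) by metis+
  qed
  \<comment> \<open>The composite keeps the order of the flags exactly if both maps keep it or both
    reverse it.\<close>
  have "?s' o ?s = ((if ?p (first_flag e) = first_flag (?p ` e) then id else prod.swap) :: real \<times> real \<Rightarrow> real \<times> real)"
   unfolding pe h(2) j(2) k(4) using pk h(3) pe(2)[unfolded k(4)] by (auto simp: fun_eq_iff)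
  hence "q = map_prod (f' o f) (if ?p (first_flag e) = first_flag (?p ` e) then id else prod.swap) o q0"
   unfolding q'(4) q0(3) by (simp only: comp_assoc[symmetric] map_prod.comp)
  hence "x'' = EPt e (map_prod (f' o f) (if ?p (first_flag e) = first_flag (?p ` e) then id else prod.swap) o q0)"
   "x = EPt (?p ` e) q0" "?p ` e \<in> edges G" using EPt q0 pe by simp_all
  thus ?thesis using q'(1) unfolding pt_lift_def by blast
 qed
 thus ?thesis
  using cone_map_cls[OF mtrop_comp[OF a b] T _ x(1)] cone_map_cls[OF a T x' x(1)] cone_map_cls[OF b T x'' xp] x(2) by simp
qed

section \<open>The categories of points and of sections\<close>

lemma Cone_simps [simp]:
 "Obj (Cone S G) = {(T, K). is_rpcone T \<and> K \<in> cone_pts S G T}"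
 "((T, K), (T', K'), h) \<in> Arr (Cone S G) \<longleftrightarrow> is_rpcone T \<and> is_rpcone T' \<and>
    K \<in> cone_pts S G T \<and> K' \<in> cone_pts S G T' \<and> h \<in> rpc_hom T T' \<and> cone_pull S G T h K' = K"
 "Dom (Cone S G) (x, y, h) = x" "Cod (Cone S G) (x, y, h) = y"
 "Ide (Cone S G) (T, K) = ((T, K), (T, K), rpc_id T)"
 "Comp (Cone S G) (y', z, h') (x, y, h) = (x, z, h' o h)"
 "FObj (Pr (Cone S G)) x = fst x" "FArr (Pr (Cone S G)) (x, y, h) = (fst x, fst y, h)"
 by (simp_all add: Cone_def)

lemma category_Cone:
 assumes X: "mobj g n S G" shows "category (Cone S G)"
 unfolding category_def
proof (intro conjI ballI impI)
 fix a b assume "a \<in> Arr (Cone S G)" "b \<in> Arr (Cone S G)" "Cod (Cone S G) a = Dom (Cone S G) b"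
 moreover obtain T K T' K' h where "a = ((T, K), (T', K'), h)" by (metis surj_pair)
 moreover obtain T1 K1 T'' K'' h' where "b = ((T1, K1), (T'', K''), h')" by (metis surj_pair)
 ultimately show "Comp (Cone S G) b a \<in> Arr (Cone S G)" "Dom (Cone S G) (Comp (Cone S G) b a) = Dom (Cone S G) a"
  "Cod (Cone S G) (Comp (Cone S G) b a) = Cod (Cone S G) b"
  using rpc_hom_comp[of h T T' h' T''] cone_pull_comp[OF X, of T T' T'' K'' h h'] by auto
qed (auto simp: rpc_id_in cone_pull_id[OF X] comp_rpc_id rpc_id_comp comp_assoc)

lemma is_functor_Cone:
 assumes X: "mobj g n S G" shows "is_functor (Cone S G) RPC (Pr (Cone S G))"
 unfolding is_functor_def using category_Cone[OF X] category_RPC by auto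

lemma cone_proj_simps [simp]:
 "FObj cone_proj (T, K) = (T, cone_base K)"
 "FArr cone_proj ((T, K), (T', K'), h) = ((T, cone_base K), (T', cone_base K'), h)"
 by (simp_all add: cone_proj_def)

lemma cone_map_ftor_simps [simp]:
 "FObj (cone_map_ftor m) (T, K) = (T, cone_map m T K)"
 "FArr (cone_map_ftor m) ((T, K), (T', K'), h) = ((T, cone_map m T K), (T', cone_map m T' K'), h)"
 by (simp_all add: cone_map_ftor_def)

lemma functor_cone_proj:
 assumes X: "mobj g n S G" shows "functor_over RPC (Cone S G) (slice S) cone_proj"
 unfolding functor_over_def is_functor_def[of "Cone S G" "slice S"]
 using category_Cone[OF X] category_slice is_functor_Cone[OF X] is_functor_slice
  cone_base_hom[OF X _ _ _ rpc_id_in] cone_pull_base[OF X]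
 by auto

lemma functor_cone_map:
 assumes a: "marr g n S G S' G' f P"
 shows "functor_over RPC (Cone S G) (Cone S' G') (cone_map_ftor ((S, G), (S', G'), (f, P)))"
 unfolding functor_over_def is_functor_def[of "Cone S G" "Cone S' G'"]
 using category_Cone[OF arr_dom[OF a]] category_Cone[OF arr_cod[OF a]]
  is_functor_Cone[OF arr_dom[OF a]] is_functor_Cone[OF arr_cod[OF a]]
  cone_map_pts[OF a] cone_map_pull[OF a]
 by auto

lemma sections_iff: "s \<in> cone_sections S G \<longleftrightarrow> s \<in> cone_pts S G S \<and> cone_base s = rpc_id S"
 by (simp add: cone_sections_def)

section \<open>The category of curves with a section\<close>

lemma Xtrop_simps [simp]:
 "(S, G, s) \<in> Obj (Xtrop g n) \<longleftrightarrow> mobj g n S G \<and> s \<in> cone_sections S G"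
 "((S, G, s), (S', G', s'), (f, P)) \<in> Arr (Xtrop g n) \<longleftrightarrow>
   s \<in> cone_sections S G \<and> s' \<in> cone_sections S' G' \<and> marr g n S G S' G' f P \<and>
   cone_map ((S, G), (S', G'), (f, P)) S s = cone_pull S' G' S f s'"
 "Dom (Xtrop g n) (x, y, m) = x" "Cod (Xtrop g n) (x, y, m) = y"
 "Ide (Xtrop g n) (S, G, s) = ((S, G, s), (S, G, s), (rpc_id S, restrict (\<lambda>x. x) (Cells G)))"
 "Comp (Xtrop g n) (y', z, (f', P')) (x, y, (f, P)) = (x, z, (f' o f, compose (Cells (fst (snd z))) P P'))"
 "FObj (Pr (Xtrop g n)) x = fst x" "FArr (Pr (Xtrop g n)) (x, y, (f, P)) = (fst x, fst y, f)"
 using arr_dom arr_cod by (auto simp: Xtrop_def xtrop_obj_def mtrop_arr_def)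

lemma xtrop_proj_simps [simp]:
 "FObj xtrop_proj (S, G, s) = (S, G)"
 "FArr xtrop_proj ((S, G, s), (S', G', s'), m) = ((S, G), (S', G'), m)"
 by (simp_all add: xtrop_proj_def)

lemma section_comp:
 assumes a: "marr g n S G S' G' f P"
  and b: "marr g n S' G' S'' G'' f' P'"
  and s: "s \<in> cone_sections S G" and s': "s' \<in> cone_sections S' G'" and s'': "s'' \<in> cone_sections S'' G''"
  and eq: "cone_map ((S, G), (S', G'), (f, P)) S s = cone_pull S' G' S f s'"
  and eq': "cone_map ((S', G'), (S'', G''), (f', P')) S' s' = cone_pull S'' G'' S' f' s''"
 shows "cone_map ((S, G), (S'', G''), (f' o f, compose (Cells G'') P P')) S s = cone_pull S'' G'' S (f' o f) s''"
proof -
 note A = mtrop_arrD[OF a] and B = mtrop_arrD[OF b]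
 have r: "is_rpcone S" "is_rpcone S'" "is_rpcone S''" using obj_cone A(1,2) B(2) by auto
 show ?thesis
  using cone_map_comp[OF a b r(1), of s] s s' s'' eq eq' cone_map_pull[OF b r(2), of s' S f] r A(3) B(3)
   cone_pull_comp[OF B(2) r, of s'' f f'] by (simp add: sections_iff)
qed

lemma Xtrop_arr_cases:
 assumes "a \<in> Arr (Xtrop g n)"
 obtains S G s S' G' s' f P where "a = ((S, G, s), (S', G', s'), (f, P))"
 using assms by (metis surj_pair)

lemma category_Xtrop: "category (Xtrop g n :: ('x, 'v::real_vector) xtrop_cat)" (is "category ?X")
 unfolding category_def
proof (intro conjI ballI impI)
 fix a :: "('x, 'v) xtrop_arr" assume a: "a \<in> Arr ?X"
 then obtain S G s S' G' s' f P where a': "a = ((S, G, s), (S', G', s'), (f, P))" by (rule Xtrop_arr_cases)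
 hence m: "marr g n S G S' G' f P" using a by simp
 note A = mtrop_arrD[OF m]
 have "P ` Cells G' \<subseteq> Cells G" using contr_img[OF A(4)] by simp
 note e = compose_restrict_id[OF contr_ext[OF A(4)] this]
 show "Dom ?X a \<in> Obj ?X" "Cod ?X a \<in> Obj ?X"
  "Comp ?X a (Ide ?X (Dom ?X a)) = a"
  "Comp ?X (Ide ?X (Cod ?X a)) a = a"
  using a A(1,2) unfolding a' by (simp_all add: e comp_rpc_id[OF A(3)] rpc_id_comp[OF A(3)])
next
 fix x :: "('x, 'v) xtrop_obj" assume x: "x \<in> Obj ?X"
 obtain S G s where x': "x = (S, G, s)" by (metis surj_pair)
 have X: "mobj g n S G" "s \<in> cone_sections S G" using x x' by auto
 show "Ide ?X x \<in> Arr ?X" "Dom ?X (Ide ?X x) = x"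
  "Cod ?X (Ide ?X x) = x"
  using X mtrop_ide[OF X(1)] cone_map_id[OF X(1) obj_cone[OF X(1)], of s] cone_pull_id[OF X(1) obj_cone[OF X(1)], of s]
  unfolding x' by (simp_all add: sections_iff)
next
 fix a b :: "('x, 'v) xtrop_arr" assume ab: "a \<in> Arr ?X" "b \<in> Arr ?X" "Cod ?X a = Dom ?X b"
 from ab(1) obtain S G s S' G' s' f P where a': "a = ((S, G, s), (S', G', s'), (f, P))" by (rule Xtrop_arr_cases)
 from ab(2) obtain S1 G1 s1 S'' G'' s'' f' P' where b': "b = ((S1, G1, s1), (S'', G'', s''), (f', P'))" by (rule Xtrop_arr_cases)
 show "Comp ?X b a \<in> Arr ?X" "Dom ?X (Comp ?X b a) = Dom ?X a"
  "Cod ?X (Comp ?X b a) = Cod ?X b"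
  using ab mtrop_comp[of S G S' G' f P] section_comp[of S G S' G' f P g n S'' G'' f' P' s s' s''] unfolding a' b' by simp_all
next
 fix a b c :: "('x, 'v) xtrop_arr" assume abc: "a \<in> Arr ?X" "b \<in> Arr ?X" "c \<in> Arr ?X"
  "Cod ?X a = Dom ?X b \<and> Cod ?X b = Dom ?X c"
 from abc(1) obtain S G s S' G' s' f P where a': "a = ((S, G, s), (S', G', s'), (f, P))" by (rule Xtrop_arr_cases)
 from abc(2) obtain S1 G1 s1 S'' G'' s'' f' P' where b': "b = ((S1, G1, s1), (S'', G'', s''), (f', P'))" by (rule Xtrop_arr_cases)
 from abc(3) obtain S2 G2 s2 S3 G3 s3 f'' P'' where c': "c = ((S2, G2, s2), (S3, G3, s3), (f'', P''))" by (rule Xtrop_arr_cases)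
 have "P'' ` Cells G3 = Cells G''" using contr_img[OF arr_contr[of S2 G2 S3 G3 f'' P'' g n]] abc unfolding c' b' by simp
 thus "Comp ?X c (Comp ?X b a) = Comp ?X (Comp ?X c b) a"
  unfolding a' b' c' by (simp add: compose_assoc' comp_assoc)
qed

lemma functor_xtrop_proj:
 "functor_over RPC (Xtrop g n :: ('x, 'v::real_vector) xtrop_cat) (Mtrop g n) xtrop_proj" (is "functor_over _ ?X ?M _")
proof -
 have ob: "FObj xtrop_proj x \<in> Obj ?M" "FArr xtrop_proj (Ide ?X x) = Ide ?M (FObj xtrop_proj x)"
   "FObj (Pr ?M) (FObj xtrop_proj x) = FObj (Pr ?X) x"
  if x: "x \<in> Obj ?X" for x :: "('x, 'v::real_vector) xtrop_obj"
 proof -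
  obtain S G s where "x = (S, G, s)" by (metis surj_pair)
  thus "FObj xtrop_proj x \<in> Obj ?M" "FArr xtrop_proj (Ide ?X x) = Ide ?M (FObj xtrop_proj x)"
   "FObj (Pr ?M) (FObj xtrop_proj x) = FObj (Pr ?X) x" using x by simp_all
 qed
 have ar: "FArr xtrop_proj a \<in> Arr ?M" "Dom ?M (FArr xtrop_proj a) = FObj xtrop_proj (Dom ?X a)"
   "Cod ?M (FArr xtrop_proj a) = FObj xtrop_proj (Cod ?X a)"
   "FArr (Pr ?M) (FArr xtrop_proj a) = FArr (Pr ?X) a"
  if a: "a \<in> Arr ?X" for a :: "('x, 'v::real_vector) xtrop_arr"
 proof -
  obtain S G s S' G' s' f P where "a = ((S, G, s), (S', G', s'), (f, P))" using a by (rule Xtrop_arr_cases)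
  thus "FArr xtrop_proj a \<in> Arr ?M" "Dom ?M (FArr xtrop_proj a) = FObj xtrop_proj (Dom ?X a)"
   "Cod ?M (FArr xtrop_proj a) = FObj xtrop_proj (Cod ?X a)"
   "FArr (Pr ?M) (FArr xtrop_proj a) = FArr (Pr ?X) a" using a by simp_all
 qed
 have cm: "FArr xtrop_proj (Comp ?X b a) = Comp ?M (FArr xtrop_proj b) (FArr xtrop_proj a)"
  if ab: "a \<in> Arr ?X" "b \<in> Arr ?X" for a b :: "('x, 'v::real_vector) xtrop_arr"
 proof -
  obtain S G s S' G' s' f P where a': "a = ((S, G, s), (S', G', s'), (f, P))" using ab(1) by (rule Xtrop_arr_cases)
  obtain S1 G1 s1 S'' G'' s'' f' P' where b': "b = ((S1, G1, s1), (S'', G'', s''), (f', P'))" using ab(2) by (rule Xtrop_arr_cases)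
  show ?thesis unfolding a' b' by simp
 qed
 have F: "is_functor (Xtrop g n :: ('x, 'v::real_vector) xtrop_cat) ?M xtrop_proj"
  unfolding is_functor_def using category_Xtrop category_Mtrop ob(1,2) ar(1-3) cm by blast
 have "is_functor (Xtrop g n :: ('x, 'v::real_vector) xtrop_cat) RPC (Pr ?X)"
  unfolding is_functor_def
 proof (intro conjI ballI impI category_Xtrop category_RPC)
  fix a :: "('x, 'v) xtrop_arr" assume a: "a \<in> Arr ?X"
  then obtain S G s S' G' s' f P where a': "a = ((S, G, s), (S', G', s'), (f, P))" by (rule Xtrop_arr_cases)
  hence m: "marr g n S G S' G' f P" using a by simp
  show "FArr (Pr ?X) a \<in> Arr RPC" "Dom RPC (FArr (Pr ?X) a) = FObj (Pr ?X) (Dom ?X a)"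
   "Cod RPC (FArr (Pr ?X) a) = FObj (Pr ?X) (Cod ?X a)"
   unfolding a' using obj_cone[OF arr_dom[OF m]] obj_cone[OF arr_cod[OF m]] arr_hom[OF m] by simp_all
 next
  fix x :: "('x, 'v) xtrop_obj" assume x: "x \<in> Obj ?X"
  obtain S G s where x': "x = (S, G, s)" by (metis surj_pair)
  show "FObj (Pr ?X) x \<in> Obj RPC" "FArr (Pr ?X) (Ide ?X x) = Ide RPC (FObj (Pr ?X) x)"
   using x obj_cone[of S G g n] unfolding x' by simp_all
 next
  fix a b :: "('x, 'v) xtrop_arr"
  obtain x y f P where a': "a = (x, y, (f, P))" by (metis surj_pair)
  obtain x1 y1 f1 P1 where b': "b = (x1, y1, (f1, P1))" by (metis surj_pair)
  show "FArr (Pr ?X) (Comp ?X b a) = Comp RPC (FArr (Pr ?X) b) (FArr (Pr ?X) a)"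
   unfolding a' b' by simp
 qed
 thus ?thesis unfolding functor_over_def using F is_functor_Mtrop ob(3) ar(4) by blast
qed

text \<open>The vertical arrow of curves has an inverse by \<open>mtrop_vertical_inverse\<close>,
  and functoriality of \<open>cone_map\<close> shows that this inverse carries \<open>s'\<close>
  back to \<open>s\<close>.\<close>

lemma iso_arrow_Xtrop:
 assumes "((S, G, s), (S, G', s'), (rpc_id S, P)) \<in> Arr (Xtrop g n)"
 shows "iso_arrow (Xtrop g n) ((S, G, s), (S, G', s'), (rpc_id S, P))"
proof -
 have a: "marr g n S G S G' (rpc_id S) P" and s: "s \<in> cone_sections S G" "s' \<in> cone_sections S G'"
  and eq: "cone_map ((S, G), (S, G'), (rpc_id S, P)) S s = cone_pull S G' S (rpc_id S) s'" using assms by auto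
 note A = mtrop_arrD[OF a]
 from mtrop_vertical_inverse[OF a] obtain j where j: "marr g n S G' S G (rpc_id S) j"
   "compose (Cells G') j P = restrict (\<lambda>x. x) (Cells G')" "compose (Cells G) P j = restrict (\<lambda>x. x) (Cells G)" by blast
 have r: "is_rpcone S" using obj_cone A(1) by blast
 have K: "s \<in> cone_pts S G S" "s' \<in> cone_pts S G' S" using s by (auto simp: sections_iff)
 have "cone_map ((S, G'), (S, G), (rpc_id S, j)) S s' = s"
  using cone_map_comp[OF a j(1) r K(1)] cone_map_id[OF A(1) r K(1)] eq cone_pull_id[OF A(2) r K(2)] j(3)
  by (simp add: rpc_id_idem)
 hence "((S, G', s'), (S, G, s), (rpc_id S, j)) \<in> Arr (Xtrop g n)"
  using j s cone_pull_id[OF A(1) r K(1)] by simp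
 thus ?thesis using assms j(2,3)
  by (intro iso_arrowI[of _ _ "((S, G', s'), (S, G, s), (rpc_id S, j))"]) (simp_all add: rpc_id_idem)
qed

section \<open>Inserting the last leg\<close>

text \<open>A relation rather than an operation, so that it describes a deleted leg as well as an
  inserted one and ignores values outside \<open>Cells\<close>. It includes just enough closure of
  \<open>G\<close> to transfer validity of the graph in both directions.\<close>

definition leg_added :: "nat \<Rightarrow> ('x, 'v) curve \<Rightarrow> ('x, 'v) curve \<Rightarrow> bool" where
 "leg_added n G G' \<longleftrightarrow> last_leg n G' \<notin> Cells G \<and> Cells G' = insert (last_leg n G') (Cells G) \<and>
   last_vertex n G' \<in> verts G \<and> flip G' (last_leg n G') = last_leg n G' \<and>
   (\<forall>z\<in>Cells G. rt G z \<in> Cells G \<and> flip G z \<in> Cells G \<and> rt G' z = rt G z \<and> flip G' z = flip G z) \<and>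
   (\<forall>w\<in>verts G. wt G' w = wt G w) \<and> (\<forall>i\<in>{1..n}. mark G' i = mark G i \<and> mark G i \<in> Cells G) \<and>
   (\<forall>k\<in>hedges G. fl G' k = fl G k)"

text \<open>
 A new vertex with flags \<open>a\<close>, \<open>b\<close> and the last leg is inserted next to the flag \<open>x\<close>, where \<open>a\<close>
 becomes the other half of \<open>x\<close>.  If \<open>x\<close> is a leg, its marking moves to \<open>b\<close>, and otherwise \<open>b\<close>
 becomes the other half of \<open>flip G x\<close>; this treats legs and edges uniformly.
\<close>

definition vertex_added :: "nat \<Rightarrow> ('x, 'v) curve \<Rightarrow> ('x, 'v) curve \<Rightarrow> 'x \<Rightarrow> 'x \<Rightarrow> 'x \<Rightarrow> bool" where
 "vertex_added n G G' x a b \<longleftrightarrow> (let l = last_leg n G'; v = last_vertex n G'; y = flip G x in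
   x \<in> flags G \<and> y \<in> flags G \<and> flip G y = x \<and> distinct [l, v, a, b] \<and> {l, v, a, b} \<inter> Cells G = {} \<and>
   Cells G' = {l, v, a, b} \<union> Cells G \<and> (\<forall>z\<in>{l, v, a, b}. rt G' z = v) \<and>
   flip G' l = l \<and> flip G' v = v \<and> flip G' a = x \<and> flip G' x = a \<and>
   flip G' b = (if y = x then b else y) \<and> (y ~= x \<longrightarrow> flip G' y = b) \<and>
   (\<forall>z\<in>Cells G. rt G z \<in> Cells G \<and> flip G z \<in> Cells G \<and> rt G' z = rt G z) \<and>
   (\<forall>z\<in>Cells G - {x, y}. flip G' z = flip G z) \<and>
   wt G' v = 0 \<and> (\<forall>w\<in>verts G. wt G' w = wt G w) \<and>
   (\<forall>i\<in>{1..n}. mark G' i = (if mark G i = x then b else mark G i) \<and> mark G i \<in> Cells G) \<and>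
   (\<forall>k\<in>hedges G - {x, y}. fl G' k = fl G k) \<and>
   (y ~= x \<longrightarrow> fl G x = (\<lambda>z. fl G' x z + fl G' y z)))"

lemma leg_addedD:
 assumes "leg_added n G G'"
 shows la_new: "last_leg n G' \<notin> Cells G" and la_Cells: "Cells G' = insert (last_leg n G') (Cells G)"
  and la_vert: "last_vertex n G' \<in> verts G" and la_flip_last: "flip G' (last_leg n G') = last_leg n G'"
  and la_rt_in: "\<And>z. z \<in> Cells G ==> rt G z \<in> Cells G" and la_flip_in: "\<And>z. z \<in> Cells G ==> flip G z \<in> Cells G"
  and la_rt: "\<And>z. z \<in> Cells G ==> rt G' z = rt G z" and la_flip: "\<And>z. z \<in> Cells G ==> flip G' z = flip G z"
  and la_wt: "\<And>w. w \<in> verts G ==> wt G' w = wt G w"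
  and la_mark: "\<And>i. i \<in> {1..n} ==> mark G' i = mark G i" and la_mark_in: "\<And>i. i \<in> {1..n} ==> mark G i \<in> Cells G"
  and la_fl: "\<And>k. k \<in> hedges G ==> fl G' k = fl G k"
 using assms unfolding leg_added_def by blast+

lemma leg_added_sets:
 assumes s: "leg_added n G G'"
 shows la_verts: "verts G' = verts G" and la_flags: "flags G' = insert (last_leg n G') (flags G)"
  and la_legs: "legs G' = insert (last_leg n G') (legs G)" and la_hedges: "hedges G' = hedges G"
  and la_verts_sub: "verts G \<subseteq> Cells G"
proof -
 note S = leg_addedD[OF s]
 have "rt G' ` Cells G = rt G ` Cells G" using S(7) by (rule image_cong[OF refl])
 thus V: "verts G' = verts G" using S(3) unfolding verts_def S(2) last_vertex_def by auto
 show VC: "verts G \<subseteq> Cells G" using S(5) by (auto simp: verts_def)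
 show F: "flags G' = insert (last_leg n G') (flags G)" unfolding flags_def V S(2) using VC S(1) by auto
 show "legs G' = insert (last_leg n G') (legs G)" "hedges G' = hedges G"
  unfolding legs_def hedges_def F using S(4,8) by (auto simp: flags_def)
qed

lemma leg_added_graph:
 assumes s: "leg_added n G G'"
 shows "marked_graph (Suc n) G' \<longleftrightarrow> marked_graph n G"
proof -
 note S = leg_addedD[OF s] and T = leg_added_sets[OF s]
 have last: "mark G' (Suc n) = last_leg n G'" by (simp add: last_leg_def)
 have ll: "last_leg n G' \<notin> legs G" using S(1) by (simp add: legs_def flags_def)
 have "bij_betw (mark G') {1..Suc n} (legs G') \<longleftrightarrow> bij_betw (mark G) {1..n} (legs G)"
 proof -
  have e: "{1..Suc n} = {1..n} \<union> {Suc n}" by auto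
  have "bij_betw (mark G') {1..n} (legs G) \<longleftrightarrow> bij_betw (mark G') {1..Suc n} (legs G')"
   unfolding e T(3) using notIn_Un_bij_betw3[of "Suc n" "{1..n}" "mark G'" "legs G"] last ll by simp
  moreover have "bij_betw (mark G') {1..n} (legs G) \<longleftrightarrow> bij_betw (mark G) {1..n} (legs G)"
   using S(10) by (intro bij_betw_cong) simp
  ultimately show ?thesis by simp
 qed
 moreover have "finite (Cells G') \<longleftrightarrow> finite (Cells G)" using S(2) by simp
 moreover have "(\<forall>x\<in>Cells G'. rt G' x \<in> Cells G' \<and> rt G' (rt G' x) = rt G' x) \<longleftrightarrow>
   (\<forall>x\<in>Cells G. rt G x \<in> Cells G \<and> rt G (rt G x) = rt G x)"
 proof -
  have "rt G' (rt G' (last_leg n G')) = rt G' (last_leg n G')" if "\<forall>x\<in>Cells G. rt G (rt G x) = rt G x"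
  proof -
   obtain z where "z \<in> Cells G" "last_vertex n G' = rt G z" using S(3) by (auto simp: verts_def)
   thus ?thesis using that S(5,7) by (simp add: last_vertex_def)
  qed
  moreover have "rt G' (last_leg n G') \<in> Cells G" using S(3) T(5) by (auto simp: last_vertex_def)
  ultimately show ?thesis using S(2,5,7) by auto
 qed
 moreover have "(\<forall>x\<in>Cells G'. flip G' x \<in> Cells G' \<and> flip G' (flip G' x) = x) \<longleftrightarrow>
   (\<forall>x\<in>Cells G. flip G x \<in> Cells G \<and> flip G (flip G x) = x)"
  using S(2,4,6,8) by auto
 moreover have "(\<forall>v\<in>verts G'. flip G' v = v) \<longleftrightarrow> (\<forall>v\<in>verts G. flip G v = v)"
  unfolding T(1) using S(8) subsetD[OF T(5)] by (intro ball_cong) auto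
 ultimately show ?thesis unfolding marked_graph_def by simp
qed

lemma leg_added_echar:
 assumes s: "leg_added n G G'" and G: "marked_graph n G" and w: "w \<in> verts G"
 shows "echar G' w = echar G w + (if w = last_vertex n G' then 1 else 0)"
proof -
 note S = leg_addedD[OF s] and T = leg_added_sets[OF s]
 have "{k \<in> flags G'. rt G' k = w} = (if w = last_vertex n G' then {last_leg n G'} else {}) \<union> {k \<in> flags G. rt G k = w}"
  unfolding T(2) using S(7) by (auto simp: last_vertex_def flags_def)
 moreover have "last_leg n G' \<notin> flags G" using S(1) by (simp add: flags_def)
 ultimately show ?thesis using S(9)[OF w] finite_cells(2)[OF G] by (simp add: echar_def valence_def card_insert_if)
qed

text \<open>The last leg is fixed by the involution, so its step stays at one vertex and is absorbed
  by the reflexive closure.\<close>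

lemma leg_added_steps:
 assumes s: "leg_added n G G'" and K: "K - {last_leg n G'} \<subseteq> flags G"
 shows "(steps G' K)\<^sup>* = (steps G (K - {last_leg n G'}))\<^sup>*"
proof -
 note S = leg_addedD[OF s]
 have "steps G' K \<subseteq> (steps G (K - {last_leg n G'}))\<^sup>="
 proof
  fix p assume "p \<in> steps G' K"
  then obtain k where k: "k \<in> K" "p = (rt G' k, rt G' (flip G' k))" unfolding steps_def by auto
  show "p \<in> (steps G (K - {last_leg n G'}))\<^sup>="
  proof (cases "k = last_leg n G'")
   case False
   hence kc: "k \<in> Cells G" using K k by (auto simp: flags_def)
   hence "p = (rt G k, rt G (flip G k))" using S(6,7,8) k by simp
   thus ?thesis using k False unfolding steps_def by blast
  qed (use k S(4) in simp)
 qed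
 moreover have "steps G (K - {last_leg n G'}) \<subseteq> steps G' K"
 proof
  fix p assume "p \<in> steps G (K - {last_leg n G'})"
  then obtain k where k: "k \<in> K - {last_leg n G'}" "p = (rt G k, rt G (flip G k))" unfolding steps_def by auto
  hence kc: "k \<in> Cells G" using K by (auto simp: flags_def)
  hence "p = (rt G' k, rt G' (flip G' k))" using S(6,7,8) k by simp
  thus "p \<in> steps G' K" using k unfolding steps_def by blast
 qed
 ultimately show ?thesis by (metis rtrancl_mono rtrancl_reflcl subset_antisym)
qed

text \<open>\<open>echar\<close> rises by 1 at one vertex, which matches the passage from
  \<open>n\<close> to \<open>n + 1\<close> in \<open>2g - 2 + n\<close>. Stability of
  \<open>G\<close> is assumed because the new leg may be the very reason why its vertex is stable in
  \<open>G'\<close>.\<close>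

lemma leg_added_obj:
 assumes s: "leg_added n G G'" and st: "stable G"
 shows "mobj g (Suc n) S G' \<longleftrightarrow> mobj g n S G"
proof (cases "marked_graph n G")
 case G: True
 hence G': "marked_graph (Suc n) G'" using leg_added_graph[OF s] by simp
 note S = leg_addedD[OF s] and T = leg_added_sets[OF s] and E = leg_added_echar[OF s G]
 have fin: "finite (verts G)" using finite_cells[OF G] by simp
 have "(\<Sum>v\<in>verts G'. echar G' v) = (\<Sum>v\<in>verts G. echar G v + (if v = last_vertex n G' then 1 else 0))"
  unfolding T(1) using E by (intro sum.cong) auto
 also have "\<dots> = (\<Sum>v\<in>verts G. echar G v) + 1" using S(3) fin by (simp add: sum.distrib)
 finally have sum: "(\<Sum>v\<in>verts G'. echar G' v) = (\<Sum>v\<in>verts G. echar G v) + 1" .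
 have "stable G'" using st unfolding stable_echar T(1) using E by force
 moreover have "connected_graph G' \<longleftrightarrow> connected_graph G"
 proof -
  have "flags G' - {last_leg n G'} = flags G" using T(2) S(1) by (auto simp: flags_def)
  hence "(steps G' (flags G'))\<^sup>* = (steps G (flags G))\<^sup>*" using leg_added_steps[OF s, of "flags G'"] by simp
  thus ?thesis unfolding connected_iff[OF G] connected_iff[OF G'] T(1) by simp
 qed
 ultimately show ?thesis unfolding mtrop_obj_iff T(4) using G G' st sum S(12) by auto
next
 case False
 thus ?thesis using leg_added_graph[OF s] by (auto simp: mtrop_obj_iff)
qed

section \<open>Inserting a vertex on an edge or on a leg\<close>

lemma vertex_addedD:
 assumes "vertex_added n G G' x a b"
 defines "l \<equiv> last_leg n G'" and "v \<equiv> last_vertex n G'" and "y \<equiv> flip G x"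
 shows va_x: "x \<in> flags G" and va_y: "y \<in> flags G" and va_yx: "flip G y = x"
  and va_distinct: "distinct [l, v, a, b]" and va_new: "l \<notin> Cells G" "v \<notin> Cells G" "a \<notin> Cells G" "b \<notin> Cells G"
  and va_Cells: "Cells G' = {l, v, a, b} \<union> Cells G"
  and va_rt_new: "rt G' l = v" "rt G' v = v" "rt G' a = v" "rt G' b = v"
  and va_flip_new: "flip G' l = l" "flip G' v = v" "flip G' a = x" "flip G' x = a" "flip G' b = (if y = x then b else y)"
   "y ~= x ==> flip G' y = b"
  and va_rt_in: "\<And>z. z \<in> Cells G ==> rt G z \<in> Cells G" and va_flip_in: "\<And>z. z \<in> Cells G ==> flip G z \<in> Cells G"
  and va_rt: "\<And>z. z \<in> Cells G ==> rt G' z = rt G z"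
  and va_flip: "\<And>z. z \<in> Cells G ==> z ~= x ==> z ~= y ==> flip G' z = flip G z"
  and va_wt_new: "wt G' v = 0" and va_wt: "\<And>w. w \<in> verts G ==> wt G' w = wt G w"
  and va_mark: "\<And>i. i \<in> {1..n} ==> mark G' i = (if mark G i = x then b else mark G i)"
  and va_mark_in: "\<And>i. i \<in> {1..n} ==> mark G i \<in> Cells G"
  and va_fl: "\<And>k. k \<in> hedges G ==> k ~= x ==> k ~= y ==> fl G' k = fl G k"
  and va_fl_x: "y ~= x ==> fl G x = (\<lambda>z. fl G' x z + fl G' y z)"
 using assms(1) unfolding vertex_added_def Let_def l_def[symmetric] v_def[symmetric] y_def[symmetric]
 by auto

lemma vertex_added_sets:
 assumes s: "vertex_added n G G' x a b"
 defines "l \<equiv> last_leg n G'" and "v \<equiv> last_vertex n G'" and "y \<equiv> flip G x"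
 shows va_verts: "verts G' = insert v (verts G)" and va_flags: "flags G' = {l, a, b} \<union> flags G"
  and va_legs: "legs G' = insert l ((\<lambda>z. if z = x then b else z) ` legs G)"
  and va_hedges: "hedges G' = {x, a} \<union> (if y = x then {} else {b}) \<union> hedges G"
  and va_verts_sub: "verts G \<subseteq> Cells G" and va_xy: "x \<in> Cells G" "y \<in> Cells G"
  and va_xl: "x \<in> legs G \<longleftrightarrow> y = x" and va_xh: "x \<in> hedges G \<longleftrightarrow> y ~= x" "y \<in> hedges G \<longleftrightarrow> y ~= x"
proof -
 note S = vertex_addedD[OF s, folded l_def v_def y_def]
 show xy: "x \<in> Cells G" "y \<in> Cells G" using S(1,2) by (auto simp: flags_def)
 have "rt G' ` Cells G = rt G ` Cells G" using va_rt[OF s] by (rule image_cong[OF refl])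
 thus V: "verts G' = insert v (verts G)" unfolding verts_def va_Cells[OF s] using va_rt_new[OF s] unfolding v_def by auto
 show VC: "verts G \<subseteq> Cells G" using va_rt_in[OF s] by (auto simp: verts_def)
 show F: "flags G' = {l, a, b} \<union> flags G"
  unfolding flags_def V va_Cells[OF s, folded l_def v_def] using VC S(4-8) by auto
 show "x \<in> legs G \<longleftrightarrow> y = x" "x \<in> hedges G \<longleftrightarrow> y ~= x" "y \<in> hedges G \<longleftrightarrow> y ~= x"
  using S(1-3) unfolding y_def by (auto simp: legs_def hedges_def)
 have f: "flip G' k = flip G k" if "k \<in> flags G" "k ~= x" "k ~= y" for k
  using va_flip[OF s, of k] that by (simp add: flags_def y_def)
 have xa: "a ~= x" "b ~= x" "b ~= y" "a ~= y" "l ~= x" "l ~= y" using S(5-8) xy by auto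
 note fn = va_flip_new[OF s, folded l_def v_def y_def]
 have fx: "flip G x = y" "flip G y = x" using S(3) by (auto simp: y_def)
 have Lk: "k \<in> legs G' \<longleftrightarrow> k \<in> insert l ((\<lambda>z. if z = x then b else z) ` legs G)"
  and Hk: "k \<in> hedges G' \<longleftrightarrow> k \<in> {x, a} \<union> (if y = x then {} else {b}) \<union> hedges G" for k
 proof -
  consider "k = l" | "k = a" | "k = b" | "k = x" | "k = y" "y ~= x" | "k \<in> flags G" "k ~= x" "k ~= y" | "k \<notin> flags G'" "k \<notin> flags G"
   unfolding F by blast
  note cs = this
  have im: "k \<in> (\<lambda>z. if z = x then b else z) ` legs G \<longleftrightarrow> (k \<in> legs G \<and> k ~= x) \<or> (k = b \<and> x \<in> legs G)"
   by (auto simp: image_iff)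
  have nl: "l \<notin> flags G" "a \<notin> flags G" "b \<notin> flags G" using S(5-8) by (auto simp: flags_def)
  show "k \<in> legs G' \<longleftrightarrow> k \<in> insert l ((\<lambda>z. if z = x then b else z) ` legs G)"
   unfolding insert_iff im legs_def mem_Collect_eq using S(1,2,4) F nl fn fx xa
   by (cases rule: cs) (auto simp: f)
  show "k \<in> hedges G' \<longleftrightarrow> k \<in> {x, a} \<union> (if y = x then {} else {b}) \<union> hedges G"
   unfolding hedges_def using S(1,2,4) F nl fn fx xa
   by (cases rule: cs) (auto simp: f)
 qed
 show "legs G' = insert l ((\<lambda>z. if z = x then b else z) ` legs G)"
  "hedges G' = {x, a} \<union> (if y = x then {} else {b}) \<union> hedges G" using Lk Hk by blast+
qed

text \<open>On an edge the new vertex can be described from either half. This permits choosing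
  \<open>x\<close> as the half that is contracted, or the half from which a distance is
  measured.\<close>

lemma vertex_added_swap:
 assumes s: "vertex_added n G G' x a b" and xy: "flip G x ~= x" and G: "marked_graph n G"
 shows "vertex_added n G G' (flip G x) b a"
proof -
 note S = vertex_addedD[OF s] and T = vertex_added_sets[OF s]
 have "mark G i ~= x \<and> mark G i ~= flip G x" if "i \<in> {1..n}" for i
  using mark_legs[OF G that] T(8) xy S(3) by (auto simp: legs_def)
 hence mk: "mark G' i = (if mark G i = flip G x then a else mark G i)" if "i \<in> {1..n}" for i
  using va_mark[OF s that] that by simp
 have fy: "fl G (flip G x) = (\<lambda>z. fl G' (flip G x) z + fl G' x z)"
  using va_fl_x[OF s xy] S(3) by (simp add: fl_def insert_commute add.commute)
 have d: "distinct [last_leg n G', last_vertex n G', b, a]" using S(4) by auto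
 show ?thesis
  unfolding vertex_added_def Let_def
  by (intro conjI ballI impI; (rule d)?; insert xy;
   auto simp: S(1-3) va_new[OF s] va_Cells[OF s] va_rt_new[OF s] va_flip_new[OF s] va_rt_in[OF s] va_flip_in[OF s]
    va_rt[OF s] va_flip[OF s] va_wt_new[OF s] va_wt[OF s] mk va_mark_in[OF s] va_fl[OF s] fy)
qed

lemma vertex_added_graph:
 assumes s: "vertex_added n G G' x a b"
 shows "marked_graph (Suc n) G' \<longleftrightarrow> marked_graph n G"
proof -
 define l v y where "l = last_leg n G'" and "v = last_vertex n G'" and "y = flip G x"
 note S = vertex_addedD[OF s, folded l_def v_def y_def] and T = vertex_added_sets[OF s, folded l_def v_def y_def]
 note C = va_Cells[OF s, folded l_def v_def] and R = va_rt_new[OF s, folded l_def v_def]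
  and Fn = va_flip_new[OF s, folded l_def v_def y_def] and rt = va_rt[OF s] and flip = va_flip[OF s, folded y_def]
  and rin = va_rt_in[OF s] and fin = va_flip_in[OF s]
 have last: "mark G' (Suc n) = l" by (simp add: last_leg_def l_def)
 \<comment> \<open>When \<open>x\<close> is a leg its marking passes to \<open>b\<close>; the
   relabelling is injective because \<open>b\<close> is new.\<close>
 let ?\<phi> = "\<lambda>z. if z = x then b else z"
 have b1: "bij_betw (mark G') {1..Suc n} (legs G') \<longleftrightarrow> bij_betw (mark G) {1..n} (legs G)"
 proof -
  have e: "{1..Suc n} = {1..n} \<union> {Suc n}" by auto
  have ll: "l \<notin> ?\<phi> ` legs G" using S(4,5) by (auto simp: legs_def flags_def)
  have inj: "inj_on ?\<phi> (Cells G)" using S(8) by (auto simp: inj_on_def)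
  have LC: "legs G \<subseteq> Cells G" by (auto simp: legs_def flags_def)
  have mC: "mark G ` {1..n} \<subseteq> Cells G" using va_mark_in[OF s] by auto
  have "bij_betw (mark G') {1..Suc n} (legs G') \<longleftrightarrow> bij_betw (mark G') {1..n} (?\<phi> ` legs G)"
   unfolding e T(3) using notIn_Un_bij_betw3[of "Suc n" "{1..n}" "mark G'" "?\<phi> ` legs G"] last ll by simp
  also have "\<dots> \<longleftrightarrow> bij_betw (?\<phi> o mark G) {1..n} (?\<phi> ` legs G)"
   using va_mark[OF s] by (intro bij_betw_cong) simp
  also have "\<dots> \<longleftrightarrow> bij_betw (mark G) {1..n} (legs G)"
  proof
   assume "bij_betw (?\<phi> o mark G) {1..n} (?\<phi> ` legs G)"
   hence "inj_on (?\<phi> o mark G) {1..n}" "?\<phi> ` mark G ` {1..n} = ?\<phi> ` legs G" unfolding bij_betw_def image_comp by blast+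
   thus "bij_betw (mark G) {1..n} (legs G)"
    unfolding bij_betw_def using inj_on_imageI2[of ?\<phi> "mark G" "{1..n}"] inj_on_image_eq_iff[OF inj mC LC] by simp
  next
   assume m: "bij_betw (mark G) {1..n} (legs G)"
   show "bij_betw (?\<phi> o mark G) {1..n} (?\<phi> ` legs G)"
    by (rule bij_betw_trans[OF m]) (use inj_on_subset[OF inj LC] in \<open>simp add: bij_betw_def\<close>)
  qed
  finally show ?thesis .
 qed
 have b2: "finite (Cells G') \<longleftrightarrow> finite (Cells G)" using C by simp
 have b3: "(\<forall>x\<in>Cells G'. rt G' x \<in> Cells G' \<and> rt G' (rt G' x) = rt G' x) \<longleftrightarrow>
   (\<forall>x\<in>Cells G. rt G x \<in> Cells G \<and> rt G (rt G x) = rt G x)"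
  unfolding C using R rt rin by auto
 have b4: "(\<forall>x\<in>Cells G'. flip G' x \<in> Cells G' \<and> flip G' (flip G' x) = x) \<longleftrightarrow>
   (\<forall>x\<in>Cells G. flip G x \<in> Cells G \<and> flip G (flip G x) = x)" (is "?L \<longleftrightarrow> ?R")
 proof
  assume L: ?L
  have "flip G (flip G z) = z" if z: "z \<in> Cells G" for z
  proof (cases "z = x \<or> z = y")
   case True thus ?thesis using S(3) by (auto simp: y_def)
  next
   case False
   hence fz: "flip G' z = flip G z" using flip z by simp
   have ff: "flip G' (flip G' z) = z" using L z C by auto
   have "flip G z ~= x" using ff fz Fn(4) z S(7) by auto
   moreover have "flip G z ~= y" using ff fz Fn(4,6) z S(7,8) by metis
   ultimately show ?thesis using flip[OF fin[OF z]] ff fz by simp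
  qed
  thus ?R using fin by blast
 next
  assume R: ?R
  have "flip G' z \<in> Cells G' \<and> flip G' (flip G' z) = z" if z: "z \<in> Cells G'" for z
  proof -
   consider "z \<in> {l, v, a, b}" | "z = x" | "z = y" "y ~= x" | "z \<in> Cells G" "z ~= x" "z ~= y" using z C by blast
   thus ?thesis
   proof cases
    case 4
    hence "flip G z ~= x" "flip G z ~= y" using R S(3) unfolding y_def by metis+
    thus ?thesis using 4 flip fin R C by simp
   next
    case 1
    thus ?thesis using Fn(1-3,5) Fn(4,6) T(6,7) unfolding C by (elim insertE emptyE) (simp_all split: if_splits)
   next
    case 2
    thus ?thesis using Fn(3,4) unfolding C by simp
   next
    case 3
    thus ?thesis using Fn(5,6) unfolding C by simp
   qed
  qed
  thus ?L by blast
 qed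
 have b5: "(\<forall>v\<in>verts G'. flip G' v = v) \<longleftrightarrow> (\<forall>v\<in>verts G. flip G v = v)"
 proof -
  have "flip G' w = flip G w" if "w \<in> verts G" for w
   using that S(1,2) T(5) by (intro flip) (auto simp: flags_def)
  thus ?thesis unfolding T(1) using Fn(2) by auto
 qed
 show ?thesis unfolding marked_graph_def using b1 b2 b3 b4 b5 by simp
qed

text \<open>The new vertex has weight \<open>0\<close> and three flags, and
  \<open>0 - 2 + 3 = 1\<close>. The old vertices keep their flags, since \<open>x\<close> and its
  partner stay where they were.\<close>

lemma vertex_added_echar:
 assumes s: "vertex_added n G G' x a b"
 shows "w \<in> verts G ==> echar G' w = echar G w" and "echar G' (last_vertex n G') = 1"
proof -
 define l v y where "l = last_leg n G'" and "v = last_vertex n G'" and "y = flip G x"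
 note S = vertex_addedD[OF s, folded l_def v_def y_def] and T = vertex_added_sets[OF s, folded l_def v_def y_def]
 note R = va_rt_new[OF s, folded l_def v_def] and rt = va_rt[OF s] and rin = va_rt_in[OF s]
 have "{k \<in> flags G'. rt G' k = w} = {k \<in> flags G. rt G k = w}" if "w \<in> verts G"
  unfolding T(2) using that R rt T(5) S(6) by (auto simp: flags_def)
 thus "w \<in> verts G ==> echar G' w = echar G w"
  using va_wt[OF s] by (simp add: echar_def valence_def)
 have "rt G' k ~= v" if "k \<in> flags G" for k
  using that rt[of k] rin[of k] S(6) by (auto simp: flags_def)
 hence "{k \<in> flags G'. rt G' k = v} = {l, a, b}"
  unfolding T(2) using R by auto
 thus "echar G' (last_vertex n G') = 1"
  using va_wt_new[OF s] S(4) by (simp add: echar_def valence_def v_def[symmetric])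
qed

text \<open>The graph \<open>G'\<close> is retracted onto the old vertices by moving the new vertex
  to an end of the subdivided edge. A step of \<open>G'\<close> then becomes a path of
  \<open>G\<close>.\<close>

lemma vertex_added_path:
 assumes s: "vertex_added n G G' x a b"
  and K: "K' \<subseteq> flags G'" "\<And>k. k \<in> K' ==> flip G' k \<in> K'"
  and sub: "\<And>z. z \<in> K' ==> z \<in> flags G ==> z ~= x ==> z ~= flip G x ==> z \<in> K"
  and xy: "x \<in> K' ==> flip G x \<in> K' ==> flip G x ~= x ==> x \<in> K \<and> flip G x \<in> K"
  and w: "w1 \<in> verts G" "w2 \<in> verts G" and p: "(w1, w2) \<in> (steps G' K')\<^sup>*"
 shows "(w1, w2) \<in> (steps G K)\<^sup>*"
proof -
 define l v y where "l = last_leg n G'" and "v = last_vertex n G'" and "y = flip G x"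
 note S = vertex_addedD[OF s, folded l_def v_def y_def] and T = vertex_added_sets[OF s, folded l_def v_def y_def]
 note R = va_rt_new[OF s, folded l_def v_def] and rt = va_rt[OF s] and rin = va_rt_in[OF s] and fin = va_flip_in[OF s]
  and Fn = va_flip_new[OF s, folded l_def v_def y_def] and flip = va_flip[OF s, folded y_def]
 \<comment> \<open>The new vertex goes to the root of \<open>x\<close> if \<open>x\<close> may be
   traversed, otherwise to the root of \<open>y\<close>. If both halves may be traversed,
   \<open>stepx\<close> accounts for the step along the whole edge.\<close>
 define R where "R w = (if w = v then (if x \<in> K' then rt G x else rt G y) else w)" for w
 have vr: "rt G z ~= v" if "z \<in> Cells G" for z using rin[OF that] S(6) by auto
 have stepx: "(rt G x, rt G y) \<in> (steps G K)\<^sup>*" "(rt G y, rt G x) \<in> (steps G K)\<^sup>*" if "x \<in> K'" "y \<in> K'" "y ~= x"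
 proof -
  have "x \<in> K" "y \<in> K" "flip G x = y" "flip G y = x" using xy that S(3) by (auto simp: y_def)
  hence "(rt G x, rt G y) \<in> steps G K" "(rt G y, rt G x) \<in> steps G K" unfolding steps_def by force+
  thus "(rt G x, rt G y) \<in> (steps G K)\<^sup>*" "(rt G y, rt G x) \<in> (steps G K)\<^sup>*" by auto
 qed
 have one: "(R (rt G' k), R (rt G' (flip G' k))) \<in> (steps G K)\<^sup>*" if k: "k \<in> K'" for k
 proof -
  consider "k = l" | "k = a" | "k = b" "y = x" | "k = b" "y ~= x" | "k = x" | "k = y" "y ~= x" | "k \<in> flags G" "k ~= x" "k ~= y"
   using K(1) k unfolding T(2) by blast
  thus ?thesis
  proof cases
   case 1 thus ?thesis using R Fn by simp
  next
   case 2
   hence "x \<in> K'" using K(2)[OF k] Fn by simp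
   thus ?thesis using 2 R Fn rt[OF T(6)] vr[OF T(6)] by (simp add: R_def)
  next
   case 3 thus ?thesis using R Fn by simp
  next
   case 4
   hence "y \<in> K'" using K(2)[OF k] Fn by simp
   thus ?thesis using 4 R Fn rt[OF T(7)] vr[OF T(7)] stepx by (simp add: R_def)
  next
   case 5
   thus ?thesis using k R Fn rt[OF T(6)] vr[OF T(6)] by (simp add: R_def)
  next
   case 6
   thus ?thesis using k R Fn rt[OF T(7)] vr[OF T(7)] stepx by (simp add: R_def)
  next
   case 7
   hence kc: "k \<in> Cells G" by (simp add: flags_def)
   have "k \<in> K" using sub[OF k] 7 by (simp add: y_def)
   hence "(rt G k, rt G (flip G k)) \<in> steps G K" unfolding steps_def by blast
   thus ?thesis using 7 rt[OF kc] flip[OF kc] rt[OF fin[OF kc]] vr[OF kc] vr[OF fin[OF kc]] by (simp add: R_def)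
  qed
 qed
 have "(R w1, R w2) \<in> (steps G K)\<^sup>*" using p
 proof (induction rule: rtrancl_induct)
  case (step u u')
  thus ?case using one unfolding steps_def by (auto intro: rtrancl_trans)
 qed simp
 moreover have "w1 ~= v" "w2 ~= v" using w T(5) S(6) by auto
 ultimately show ?thesis by (simp add: R_def)
qed

lemma vertex_added_connected:
 assumes s: "vertex_added n G G' x a b" and G: "marked_graph n G"
 shows "connected_graph G' \<longleftrightarrow> connected_graph G"
proof -
 define l v y where "l = last_leg n G'" and "v = last_vertex n G'" and "y = flip G x"
 note S = vertex_addedD[OF s, folded l_def v_def y_def] and T = vertex_added_sets[OF s, folded l_def v_def y_def]
 note R = va_rt_new[OF s, folded l_def v_def] and rt = va_rt[OF s] and rin = va_rt_in[OF s] and fin = va_flip_in[OF s]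
  and Fn = va_flip_new[OF s, folded l_def v_def y_def] and flip = va_flip[OF s, folded y_def]
 have G': "marked_graph (Suc n) G'" using vertex_added_graph[OF s] G by simp
 let ?P = "(steps G' (flags G'))\<^sup>*"
 have st: "(rt G' k, rt G' (flip G' k)) \<in> ?P" if "k \<in> flags G'" for k using that unfolding steps_def by blast
 have sym: "(p, q) \<in> ?P ==> (q, p) \<in> ?P" for p q
  using symD[OF sym_steps[of "flags G'" G']] flip_flags[OF G'] mg_flip_flip[OF G'] by (auto simp: flags_def)
 have vx: "(v, rt G x) \<in> ?P" using st[of a] T(2) R Fn rt[OF T(6)] by simp
 have vy: "(v, rt G y) \<in> ?P" using st[of b] vx T(2) R Fn rt[OF T(7)] by (cases "y = x") auto
 have 1: "(p, q) \<in> ?P" if "(p, q) \<in> (steps G (flags G))\<^sup>*" for p q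
  using that
 proof (induction rule: rtrancl_induct)
  case (step u u')
  then obtain k where k: "k \<in> flags G" "u = rt G k" "u' = rt G (flip G k)" unfolding steps_def by auto
  hence kc: "k \<in> Cells G" by (simp add: flags_def)
  have "(u, u') \<in> ?P"
  proof (cases "k = x \<or> k = y")
   case True
   thus ?thesis using k vx vy sym[OF vx] sym[OF vy] S(3) by (auto simp: y_def intro: rtrancl_trans)
  next
   case False
   thus ?thesis using st[of k] T(2) k rt[OF kc] rt[OF fin[OF kc]] flip[OF kc] by simp
  qed
  with step show ?case by auto
 qed simp
 have "verts G ~= {}" using rt_verts[OF T(6)] by auto
 moreover have "(p, q) \<in> ?P" if "\<forall>p\<in>verts G. \<forall>q\<in>verts G. (p, q) \<in> (steps G (flags G))\<^sup>*" "p \<in> verts G'" "q \<in> verts G'" for p q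
 proof -
  have "(rt G x, p) \<in> ?P" if "p \<in> verts G'" for p
   using that \<open>\<forall>p\<in>verts G. \<forall>q\<in>verts G. _\<close> 1 rt_verts[OF T(6)] sym[OF vx] unfolding T(1) by auto
  thus ?thesis using that sym by (meson rtrancl_trans)
 qed
 moreover have "(p, q) \<in> (steps G (flags G))\<^sup>*" if "(p, q) \<in> ?P" "p \<in> verts G" "q \<in> verts G" for p q
  by (rule vertex_added_path[OF s _ _ _ _ that(2,3,1)]) (use flip_flags[OF G'] S(1,2) in \<open>auto simp: y_def\<close>)
 ultimately show ?thesis unfolding connected_iff[OF G] connected_iff[OF G'] T(1) by blast
qed

text \<open>The length of a subdivided edge is the sum of the two parts and is nonzero once they
  are, but the parts are not determined by it; hence the extra condition. For a leg the only new
  length is the one at \<open>x\<close>.\<close>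

lemma vertex_added_obj:
 assumes s: "vertex_added n G G' x a b"
 shows "mobj g (Suc n) S G' \<longleftrightarrow> mobj g n S G \<and>
   (\<forall>z\<in>{x, flip G x}. z \<in> hedges G' \<longrightarrow> fl G' z \<in> dual_monoid S \<and> fl G' z ~= (\<lambda>x. 0))"
proof (cases "is_rpcone S \<and> marked_graph n G")
 case True
 hence G: "marked_graph n G" and rc: "is_rpcone S" and G': "marked_graph (Suc n) G'" using vertex_added_graph[OF s] by auto
 define l v y where "l = last_leg n G'" and "v = last_vertex n G'" and "y = flip G x"
 note S = vertex_addedD[OF s, folded l_def v_def y_def] and T = vertex_added_sets[OF s, folded l_def v_def y_def]
 note Fn = va_flip_new[OF s, folded l_def v_def y_def] and E = vertex_added_echar[OF s, folded v_def]
 have "v \<notin> verts G" using T(5) S(6) by auto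
 hence sum: "(\<Sum>v\<in>verts G'. echar G' v) = (\<Sum>v\<in>verts G. echar G v) + 1"
  unfolding T(1) using finite_cells(1)[OF G] E by simp
 have st: "stable G' \<longleftrightarrow> stable G" unfolding stable_echar T(1) using E by auto
 define P where "P d \<longleftrightarrow> d \<in> dual_monoid S \<and> d ~= (\<lambda>x. 0)" for d
 have fa: "fl G' a = fl G' x" using Fn by (simp add: fl_def insert_commute)
 have fb: "fl G' b = fl G' y" if "y ~= x" using Fn that by (simp add: fl_def insert_commute)
 have fy: "fl G y = fl G x" using S(3) by (simp add: fl_def y_def insert_commute)
 have Px: "P (fl G x)" if "P (fl G' x)" "P (fl G' y)" "y ~= x"
  unfolding va_fl_x[OF s, folded y_def, OF that(3)] P_def
  using that(1,2) dual_add dual_add_eq0[OF rc] by (auto simp: P_def)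
 have "(\<forall>k\<in>hedges G'. P (fl G' k)) \<longleftrightarrow> (\<forall>k\<in>hedges G. P (fl G k)) \<and> (\<forall>z\<in>{x, y}. z \<in> hedges G' \<longrightarrow> P (fl G' z))"
 proof (cases "y = x")
  case True
  hence "fl G' k = fl G k" if "k \<in> hedges G" for k using va_fl[OF s that, folded y_def] T(9) that by auto
  thus ?thesis unfolding T(4) using fa True by auto
 next
  case False
  have "(\<forall>k\<in>hedges G'. P (fl G' k)) \<longleftrightarrow> (\<forall>k\<in>hedges G - {x, y}. P (fl G k)) \<and> P (fl G' x) \<and> P (fl G' y)"
  proof -
   have "hedges G' = {x, y, a, b} \<union> (hedges G - {x, y})" unfolding T(4) using T(9,10) False by auto
   moreover have "(\<forall>k\<in>hedges G - {x, y}. P (fl G' k)) \<longleftrightarrow> (\<forall>k\<in>hedges G - {x, y}. P (fl G k))"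
    using va_fl[OF s, folded y_def] by (intro ball_cong) auto
   ultimately show ?thesis using fa fb[OF False] by (simp add: ball_Un) blast
  qed
  moreover have "(\<forall>k\<in>hedges G. P (fl G k)) \<longleftrightarrow> (\<forall>k\<in>hedges G - {x, y}. P (fl G k)) \<and> P (fl G x)"
   using fy T(9,10) False by auto
  moreover have "x \<in> hedges G'" "y \<in> hedges G'" unfolding T(4) using T(10) False by auto
  ultimately show ?thesis using Px False by auto
 qed
 thus ?thesis unfolding mtrop_obj_iff P_def y_def
  using S G G' st sum vertex_added_connected[OF s G] by auto
next
 case False
 thus ?thesis using vertex_added_graph[OF s] by (auto simp: mtrop_obj_iff)
qed

section \<open>Forgetting the last leg\<close>

lemma delete_last_simps [simp]:
 "Cells (delete_last n G) = Cells G - {last_leg n G}" "rt (delete_last n G) = rt G"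
 "flip (delete_last n G) = flip G" "wt (delete_last n G) = wt G" "mark (delete_last n G) = mark G"
 "fl (delete_last n G) = fl G"
 by (simp_all add: delete_last_def fl_def fun_eq_iff)

lemma last_leg_rules:
 assumes G: "marked_graph (Suc n) G"
 shows "last_leg n G \<in> legs G" "last_leg n G \<in> Cells G" "flip G (last_leg n G) = last_leg n G"
  "last_leg n G \<notin> verts G" "last_vertex n G \<in> verts G" "last_leg n G \<in> flags G"
proof -
 show l: "last_leg n G \<in> legs G" unfolding last_leg_def by (rule mark_legs[OF G]) simp
 thus c: "last_leg n G \<in> Cells G" "flip G (last_leg n G) = last_leg n G" "last_leg n G \<notin> verts G" "last_leg n G \<in> flags G"
  by (auto simp: legs_def flags_def)
 show "last_vertex n G \<in> verts G" unfolding last_vertex_def by (rule rt_verts[OF c(1)])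
qed

lemma leg_added_delete:
 assumes G: "marked_graph (Suc n) G"
 shows "leg_added n (delete_last n G) G"
proof -
 note L = last_leg_rules[OF G]
 have r: "rt G z ~= last_leg n G" if "z \<in> Cells G" for z using rt_verts[OF that] L(4) by auto
 have f: "flip G z ~= last_leg n G" if "z \<in> Cells G" "z ~= last_leg n G" for z
  using mg_flip_flip[OF G that(1)] L(3) that(2) by metis
 have m: "mark G i ~= last_leg n G" if "i \<in> {1..n}" for i
  using bij_betw_imp_inj_on[OF mg_mark[OF G]] that unfolding last_leg_def by (auto dest: inj_onD)
 have "last_vertex n G \<in> verts (delete_last n G)"
 proof -
  have "last_vertex n G = rt G (last_vertex n G)" using rt_vert[OF G L(5)] by simp
  moreover have "last_vertex n G \<in> Cells (delete_last n G)" using verts_Cells[OF G L(5)] L(4,5) by auto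
  ultimately show ?thesis using rt_verts[of "last_vertex n G" "delete_last n G"] by simp
 qed
 moreover have "mark G i \<in> Cells G" if "i \<in> {1..n}" for i using mark_Cells[OF G, of i] that by simp
 ultimately show ?thesis unfolding leg_added_def
  using L(2,3) r f m mg_rt[OF G] mg_flip[OF G] by auto
qed

lemma delete_echar:
 assumes G: "marked_graph (Suc n) G"
 shows "verts (delete_last n G) = verts G"
  and "w \<in> verts G ==> echar G w = echar (delete_last n G) w + (if w = last_vertex n G then 1 else 0)"
proof -
 note d = leg_added_delete[OF G]
 show V: "verts (delete_last n G) = verts G" using la_verts[OF d] by simp
 show "w \<in> verts G ==> echar G w = echar (delete_last n G) w + (if w = last_vertex n G then 1 else 0)"
  using leg_added_echar[OF d] leg_added_graph[OF d] G V by simp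
qed

text \<open>Deletion lowers \<open>echar\<close> by 1 at the vertex of the last leg and nowhere
  else; the values are positive integers, so only the value 1 is harmful.\<close>

lemma delete_stable_iff:
 assumes G: "marked_graph (Suc n) G" and s: "stable G"
 shows "stable (delete_last n G) \<longleftrightarrow> echar G (last_vertex n G) ~= 1"
 unfolding stable_echar delete_echar(1)[OF G]
 using delete_echar(2)[OF G] s last_leg_rules(5)[OF G] unfolding stable_echar by (smt (verit))

lemma forget_leg_added:
 assumes G: "marked_graph (Suc n) G" and s: "stable (delete_last n G)"
 shows "leg_added n (forget_last n G) G"
 using leg_added_delete[OF G] s by (simp add: forget_last_def)

lemma leg_added_stable:
 assumes s: "leg_added n G G'" and X: "mobj g n S G"
 shows "stable (delete_last n G')"
proof -
 note G = obj_graph[OF X]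
 have G': "marked_graph (Suc n) G'" using leg_added_graph[OF s] G by simp
 have X': "mobj g (Suc n) S G'" using leg_added_obj[OF s obj_stable[OF X]] X by simp
 have "echar G' (last_vertex n G') = echar G (last_vertex n G') + 1" "echar G (last_vertex n G') > 0"
  using leg_added_echar[OF s G la_vert[OF s]] la_vert[OF s] obj_stable[OF X] by (auto simp: stable_echar)
 thus ?thesis using delete_stable_iff[OF G' obj_stable[OF X']] by simp
qed

lemma vertex_added_unstable:
 assumes s: "vertex_added n G G' x a b" and X: "mobj g (Suc n) S G'"
 shows "\<not> stable (delete_last n G')"
 using delete_stable_iff[OF obj_graph[OF X] obj_stable[OF X]] vertex_added_echar(2)[OF s] by simp

lemma vertex_added_other_flags:
 assumes s: "vertex_added n G G' x a b" shows "other_flags n G' = {a, b}"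
proof -
 have "rt G' k ~= last_vertex n G'" if "k \<in> flags G" for k
  using that va_rt[OF s, of k] va_rt_in[OF s, of k] va_new(2)[OF s] by (auto simp: flags_def)
 thus ?thesis
  using va_rt_new[OF s] va_distinct[OF s] unfolding other_flags_def va_flags[OF s] by auto
qed

lemma partner_eq: "other_flags n G = {a, b} ==> a ~= b ==> partner n G a = b \<and> partner n G b = a"
 unfolding partner_def by (auto intro!: the_equality)

text \<open>The value 1 of \<open>echar\<close> means that twice the weight plus the number of other
  flags is 2. If no flag led away, connectedness would leave a single vertex, which
  \<open>2g - 2 + n > 0\<close> excludes; so there are other flags, hence exactly two, and the
  weight is \<open>0\<close>.\<close>

lemma unstable_other_flags:
 assumes X: "mobj g (Suc n) S G" and gn: "2 * int g - 2 + int n > 0"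
  and u: "\<not> stable (delete_last n G)"
 shows "card (other_flags n G) = 2" and "wt G (last_vertex n G) = 0"
  and "\<exists>k\<in>other_flags n G. rt G (flip G k) ~= last_vertex n G"
proof -
 note G = obj_graph[OF X] and L = last_leg_rules[OF obj_graph[OF X]]
 let ?v = "last_vertex n G" and ?l = "last_leg n G"
 have e1: "echar G ?v = 1" using delete_stable_iff[OF G obj_stable[OF X]] u by simp
 show ex: "\<exists>k\<in>other_flags n G. rt G (flip G k) ~= ?v"
 proof (rule ccontr)
  assume "\<not> ?thesis"
  hence o: "rt G (flip G k) = ?v" if "k \<in> flags G" "rt G k = ?v" for k
   using that L(3) by (cases "k = ?l") (auto simp: other_flags_def last_vertex_def)
  have "w = ?v" if w: "w \<in> verts G" for w
  proof -
   have "(?v, w) \<in> (steps G (flags G))\<^sup>*" using obj_connected[OF X] w L(5) unfolding connected_iff[OF G] by blast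
   thus ?thesis
   proof (induction rule: rtrancl_induct)
    case (step p q)
    then obtain k where "k \<in> flags G" "p = rt G k" "q = rt G (flip G k)" unfolding steps_def by blast
    thus ?case using step.IH o by simp
   qed simp
  qed
  hence "verts G = {?v}" using L(5) by blast
  \<comment> \<open>With only one vertex the sum of \<open>echar\<close> is its value 1; removing
    the contribution of the last leg leaves \<open>2g - 2 + n = 0\<close>.\<close>
  hence "2 * int g - 2 + int (Suc n) = 1" using obj_echar[OF X] e1 by simp
  thus False using gn by simp
 qed
 have "{k \<in> flags G. rt G k = ?v} = insert ?l (other_flags n G)" "?l \<notin> other_flags n G"
  using L(6) by (auto simp: other_flags_def last_vertex_def)
 moreover have fin: "finite (other_flags n G)" using finite_cells(2)[OF G] by (simp add: other_flags_def)
 ultimately have "2 * wt G ?v + card (other_flags n G) = 2" using e1 by (simp add: echar_def valence_def)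
 moreover have "card (other_flags n G) ~= 0" using ex fin by auto
 ultimately show "card (other_flags n G) = 2" "wt G ?v = 0" by arith+
qed

text \<open>Both unstable operations are recognised as the inverse of one insertion:
  \<open>a\<close> is any flag of an edge at the deleted vertex, its other half is \<open>x\<close>,
  and the second flag \<open>b\<close> may be a leg or lie on an edge.\<close>

lemma forget_vertex_added:
 assumes X: "mobj g (Suc n) S G'" and gn: "2 * int g - 2 + int n > 0"
  and u: "\<not> stable (delete_last n G')" and a: "a \<in> other_flags n G'" "flip G' a ~= a"
 shows "\<exists>b. vertex_added n (forget_last n G') G' (flip G' a) a b"
proof -
 note G = obj_graph[OF X] and L = last_leg_rules[OF obj_graph[OF X]] and U = unstable_other_flags[OF X gn u]
 define l v x G where "l = last_leg n G'" and "v = last_vertex n G'" and "x = flip G' a" and "G = forget_last n G'"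
 note L = L[folded l_def v_def] and U = U[folded v_def]
 obtain p q where pq: "other_flags n G' = {p, q}" "p ~= q" using U(1) unfolding card_2_iff by blast
 define b where "b = (if a = p then q else p)"
 have ab: "other_flags n G' = {a, b}" "a ~= b" using pq a(1) by (auto simp: b_def)
 have A: "k \<in> {a, b} \<longleftrightarrow> k \<in> flags G' \<and> rt G' k = v \<and> k ~= l" for k
  unfolding ab(1)[symmetric] by (auto simp: other_flags_def l_def v_def)
 have af: "a \<in> flags G'" "b \<in> flags G'" "rt G' a = v" "rt G' b = v" "a ~= l" "b ~= l" using A by blast+
 have ac: "a \<in> Cells G'" "b \<in> Cells G'" "v \<in> Cells G'" "l \<in> Cells G'"
  using af verts_Cells[OF G L(5)] L(2) by (auto simp: flags_def)
 have vr: "rt G' v = v" "flip G' v = v" "v \<notin> flags G'" using rt_vert[OF G L(5)] mg_flip_vert[OF G L(5)] L(5) by (auto simp: flags_def)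
 have lr: "rt G' l = v" by (simp add: l_def v_def last_vertex_def)
 have xf: "x \<in> flags G'" "flip G' x = a" "x ~= a" using flip_flags[OF G af(1)] mg_flip_flip[OF G ac(1)] a(2) by (simp_all add: x_def)
 have xl: "x ~= l" using xf(2) L(3) af(5) by auto
 \<comment> \<open>Otherwise \<open>a\<close> and \<open>b\<close> would be the two halves of a loop
   and no flag at \<open>v\<close> would lead to another vertex.\<close>
 have rx: "rt G' x ~= v"
 proof
  assume "rt G' x = v"
  hence "x = b" using A[of x] xf xl by simp
  hence "flip G' b = a" using xf by simp
  thus False using U(3) ab(1) af \<open>rt G' x = v\<close> by (auto simp: x_def)
 qed
 \<comment> \<open>The partner of \<open>x\<close> after forgetting: \<open>x\<close> itself if
   \<open>b\<close> is a leg, since \<open>x\<close> then becomes a leg, and otherwise the other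
   half of \<open>b\<close>.\<close>
 define y where "y = (if flip G' b = b then x else flip G' b)"
 have yb: "y = flip G' b" "flip G' y = b" "y ~= a" "y ~= b" "y ~= x" "rt G' y ~= v" "y \<in> flags G'" "y ~= l" if nb: "flip G' b ~= b"
 proof -
  show y: "y = flip G' b" using nb by (simp add: y_def)
  show fy: "flip G' y = b" using y mg_flip_flip[OF G ac(2)] by simp
  show "y \<in> flags G'" using y flip_flags[OF G af(2)] by simp
  show "y ~= l" using fy L(3) af(6) by auto
  show "y ~= b" using y nb by simp
  show "y ~= x" using fy xf(2) ab(2) by auto
  show "y ~= a"
  proof
   assume "y = a"
   hence "b = x" using fy by (simp add: x_def)
   thus False using rx af(4) by simp
  qed
  thus "rt G' y ~= v" using A[of y] \<open>y \<in> flags G'\<close> \<open>y ~= l\<close> \<open>y ~= b\<close> by auto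
 qed
 have yx: "y = x \<longleftrightarrow> flip G' b = b" using yb(5) by (auto simp: y_def)
 have ry: "rt G' y ~= v" "y \<in> flags G'" "y ~= l" "y ~= a" "y ~= b"
  using yb xf rx xl yx af(4) by (cases "flip G' b = b"; auto)+
 have xb: "x ~= b" using rx af(4) by auto
 note P = partner_eq[OF ab]
 have jt: "joins_two_edges n G' \<longleftrightarrow> flip G' b ~= b"
 proof
  assume "joins_two_edges n G'"
  thus "flip G' b ~= b" unfolding joins_two_edges_def ab(1) by (auto simp: doubleton_eq_iff)
 next
  assume nb: "flip G' b ~= b"
  have "{a, flip G' a} ~= {b, flip G' b}" using yb(1,5)[OF nb] ab(2) xb by (auto simp: doubleton_eq_iff x_def)
  thus "joins_two_edges n G'" unfolding joins_two_edges_def using ab a(2) nb by blast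
 qed
 have mb: "mark G' i \<in> Cells G' \<and> mark G' i ~= l \<and> mark G' i ~= v \<and> mark G' i ~= a \<and> mark G' i ~= x \<and> (flip G' b ~= b \<longrightarrow> mark G' i ~= b)"
  if i: "i \<in> {1..n}" for i
 proof -
  have "i \<in> {1..Suc n}" using i by simp
  note m = mark_legs[OF G this]
  have "mark G' i ~= l" unfolding l_def using la_mark_in[OF leg_added_delete[OF G] i] by simp
  thus ?thesis using m xf a(2) vr by (auto simp: legs_def flags_def)
 qed
 \<comment> \<open>These equations are all that is used of \<open>join_edges\<close> and
   \<open>edge_to_leg\<close>; from here on the two cases are treated together.\<close>
 have Gam: "Cells G = Cells G' - {l, v, a, b} \<and> rt G = rt G' \<and> wt G = wt G' \<and> flip G x = y \<and> flip G y = x \<and>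
   (\<forall>z\<in>Cells G'. z \<notin> {a, b, x, y} \<longrightarrow> flip G z = flip G' z \<and> fl G z = fl G' z) \<and>
   (\<forall>i\<in>{1..n}. mark G i = (if mark G' i = b then x else mark G' i)) \<and>
   (y ~= x \<longrightarrow> fl G x = (\<lambda>z. fl G' x z + fl G' y z))"
 proof (cases "flip G' b = b")
  case False
  have F: "G = join_edges n G'" using u jt False by (simp add: G_def forget_last_def)
  note y = yb[OF False]
  have fz: "flip G' z \<notin> {a, b}" if "z \<in> Cells G'" "z \<notin> {a, b, x, y}" for z
   using mg_flip_flip[OF G that(1)] that(2) y(1) by (auto simp: x_def)
  have im: "flip G' ` {a, b} = {x, y}" using y(1) by (simp add: x_def)
  have sum: "(\<lambda>z. \<Sum>k\<in>{a, b}. len G' {k, flip G' k} z) = (\<lambda>z. fl G' x z + fl G' y z)"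
   using ab(2) xf(2) y(1,2) by (simp add: fl_def x_def insert_commute)
  show ?thesis
   unfolding F join_edges_def Let_def ab(1) im sum
   using fz xf(2) y P mb False by (auto simp: l_def v_def fl_def x_def[symmetric] doubleton_eq_iff)
 next
  case True
  have F: "G = edge_to_leg n G'" using u jt True by (simp add: G_def forget_last_def)
  have "(THE k. k \<in> {a, b} \<and> flip G' k ~= k) = a" using True a(2) by (intro the_equality) auto
  thus ?thesis
   unfolding F edge_to_leg_def Let_def ab(1)
   using True yx P by (auto simp: l_def v_def fl_def x_def[symmetric])
 qed
 have C: "Cells G = Cells G' - {l, v, a, b}" and rtG: "rt G = rt G'" "wt G = wt G'" and fxy: "flip G x = y" "flip G y = x"
  and fz: "\<And>z. z \<in> Cells G' ==> z \<notin> {a, b, x, y} ==> flip G z = flip G' z \<and> fl G z = fl G' z"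
  and mk: "\<And>i. i \<in> {1..n} ==> mark G i = (if mark G' i = b then x else mark G' i)"
  and flx: "y ~= x ==> fl G x = (\<lambda>z. fl G' x z + fl G' y z)"
  using Gam by blast+
 have xc: "x \<in> Cells G" "y \<in> Cells G" unfolding C using xf xl xb ry vr(3) by (auto simp: flags_def)
 have rin: "rt G' z \<in> Cells G" if z: "z \<in> Cells G" for z
 proof -
  have zc: "z \<in> Cells G'" "z \<notin> {l, v, a, b}" using z C by auto
  have "rt G' z ~= v"
  proof
   assume "rt G' z = v"
   hence "z \<in> flags G'" using zc flags_iff[OF G, of z] by auto
   thus False using A[of z] zc \<open>rt G' z = v\<close> by auto
  qed
  moreover have "rt G' z \<in> verts G'" using rt_verts[OF zc(1)] .
  ultimately show ?thesis unfolding C using mg_rt[OF G zc(1)] L(4) af by (auto simp: flags_def)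
 qed
 have fin: "flip G z \<in> Cells G" if z: "z \<in> Cells G" for z
 proof (cases "z = x \<or> z = y")
  case False
  have zc: "z \<in> Cells G'" "z \<notin> {l, v, a, b}" using z C by auto
  have "flip G' (flip G' z) = z" using mg_flip_flip[OF G zc(1)] .
  hence "flip G' z \<notin> {l, v, a, b}" using zc(2) False L(3) vr(2) by (auto simp: x_def y_def split: if_splits)
  thus ?thesis using fz[OF zc(1)] zc False mg_flip[OF G zc(1)] C by auto
 qed (use xc fxy in auto)
 have vC: "verts G \<subseteq> verts G'" using C rtG by (auto simp: verts_def)
 have xfl: "x \<in> flags G" "y \<in> flags G" using xc vC xf(1) ry(2) by (auto simp: flags_def)
 have mC: "mark G i \<in> Cells G" "mark G' i = (if mark G i = x then b else mark G i)" if i: "i \<in> {1..n}" for i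
  using mb[OF i] mk[OF i] xc C by (auto split: if_splits)
 have fb: "flip G' b = (if y = x then b else y)" "y ~= x ==> flip G' y = b" using yx yb by auto
 have d: "distinct [l, v, a, b]" using af ab(2) L(4,5) by (auto simp: flags_def)
 have hz: "fl G' k = fl G k" if "k \<in> hedges G" "k ~= x" "k ~= y" for k
  using fz[of k] that C by (auto simp: hedges_def flags_def)
 have fz': "flip G' z = flip G z" if "z \<in> Cells G" "z ~= x" "z ~= y" for z using fz[of z] that C by auto
 have Cu: "Cells G' = {l, v, a, b} \<union> Cells G" using C ac by auto
 have nw: "l \<notin> Cells G" "v \<notin> Cells G" "a \<notin> Cells G" "b \<notin> Cells G" using C by auto
 have "vertex_added n G G' x a b"
  unfolding vertex_added_def Let_def l_def[symmetric] v_def[symmetric] fxy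
  by (intro conjI ballI impI; (rule d Cu)?;
   auto simp: xfl nw lr vr af L(3) x_def[symmetric] xf fb rin fin rtG U(2) mC fz' hz flx)
 thus ?thesis unfolding G_def x_def by blast
qed

lemma forget_cases:
 assumes X: "mobj g (Suc n) S G'" and gn: "2 * int g - 2 + int n > 0"
 obtains (stable) "stable (delete_last n G')" "leg_added n (forget_last n G') G'"
 | (unstable) x a b where "\<not> stable (delete_last n G')" "vertex_added n (forget_last n G') G' x a b"
proof (cases "stable (delete_last n G')")
 case True
 thus ?thesis using stable forget_leg_added[OF obj_graph[OF X]] by blast
next
 case False
 then obtain k where k: "k \<in> other_flags n G'" "rt G' (flip G' k) ~= last_vertex n G'"
  using unstable_other_flags(3)[OF X gn] by blast
 hence "flip G' k ~= k" by (auto simp: other_flags_def)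
 thus ?thesis using unstable[OF False] forget_vertex_added[OF X gn False k(1)] by blast
qed

lemma forget_obj:
 assumes X: "mobj g (Suc n) S G'" and gn: "2 * int g - 2 + int n > 0"
 shows "(S, forget_last n G') \<in> mtrop_obj g n"
 using X gn
proof (cases rule: forget_cases)
 case stable
 thus ?thesis using leg_added_obj X by (metis forget_last_def)
next
 case (unstable x a b)
 thus ?thesis using vertex_added_obj[OF unstable(2)] X by blast
qed

text \<open>The larger graph with the flags \<open>x\<close>, \<open>a\<close>, \<open>b\<close>
  determines every relevant value of the smaller one. Inserting and then forgetting therefore
  returns the curve up to the identity on cells, though not up to equality of records.\<close>

lemma vertex_added_agree:
 assumes s: "vertex_added n G1 G' x a b" and s2: "vertex_added n G2 G' x a b" and X: "mobj g n S G1"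
 shows "((S, G2), (S, G1), (rpc_id S, restrict (\<lambda>x. x) (Cells G1))) \<in> mtrop_arr g n"
proof (rule mtrop_agree[OF X])
 show C: "Cells G2 = Cells G1"
 proof -
  have "Cells G1 = Cells G' - {last_leg n G', last_vertex n G', a, b}" using va_Cells[OF s] va_new[OF s] by auto
  moreover have "Cells G2 = Cells G' - {last_leg n G', last_vertex n G', a, b}" using va_Cells[OF s2] va_new[OF s2] by auto
  ultimately show ?thesis by simp
 qed
 \<comment> \<open>Whether \<open>x\<close> is a leg, and what its partner is, can be read off from
   \<open>flip G' b\<close>.\<close>
 have y: "flip G2 x = flip G1 x" using va_flip_new(5)[OF s] va_flip_new(5)[OF s2] va_new(4)[OF s] va_new(4)[OF s2]
   va_xy[OF s] va_xy[OF s2] by (metis (full_types))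
 show "rt G2 z = rt G1 z" if "z \<in> Cells G1" for z using va_rt[OF s that] va_rt[OF s2, of z] that C by simp
 show f: "flip G2 z = flip G1 z" if "z \<in> Cells G1" for z
  using va_flip[OF s that] va_flip[OF s2, of z] that C y va_yx[OF s] va_yx[OF s2] by (cases "z = x \<or> z = flip G1 x") auto
 show "wt G2 w = wt G1 w" if "w \<in> verts G1" for w
 proof -
  have "verts G2 = verts G1" using C va_rt[OF s] va_rt[OF s2] unfolding verts_def by (intro image_cong) auto
  thus ?thesis using va_wt[OF s that] va_wt[OF s2, of w] that by simp
 qed
 show "mark G2 i = mark G1 i" if "i \<in> {1..n}" for i
  using va_mark[OF s that] va_mark[OF s2 that] va_mark_in[OF s that] va_mark_in[OF s2 that] va_new(4)[OF s] va_new(4)[OF s2]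
  by (auto split: if_splits)
 show "fl G2 k = fl G1 k" if k: "k \<in> hedges G1" for k
 proof -
  have VC: "verts G2 = verts G1" using C va_rt[OF s] va_rt[OF s2] unfolding verts_def by (intro image_cong) auto
  have k2: "k \<in> hedges G2" using k f C VC by (auto simp: hedges_def flags_def)
  show ?thesis
  proof (cases "k = x \<or> k = flip G1 x")
   case True
   hence "flip G1 x ~= x" using k va_xh[OF s] by auto
   hence "fl G2 x = fl G1 x" using va_fl_x[OF s] va_fl_x[OF s2] y by simp
   moreover have "fl G1 (flip G1 x) = fl G1 x" "fl G2 (flip G2 x) = fl G2 x"
    using va_yx[OF s] va_yx[OF s2] by (simp_all add: fl_def insert_commute)
   ultimately show ?thesis using True y by auto
  qed (use va_fl[OF s k] va_fl[OF s2 k2] y in auto)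
 qed
qed

lemma leg_added_agree:
 assumes s: "leg_added n G1 G'" and s2: "leg_added n G2 G'" and X: "mobj g n S G1"
 shows "((S, G2), (S, G1), (rpc_id S, restrict (\<lambda>x. x) (Cells G1))) \<in> mtrop_arr g n"
proof (rule mtrop_agree[OF X])
 show C: "Cells G2 = Cells G1"
 proof -
  have "Cells G1 = Cells G' - {last_leg n G'}" using la_Cells[OF s] la_new[OF s] by auto
  moreover have "Cells G2 = Cells G' - {last_leg n G'}" using la_Cells[OF s2] la_new[OF s2] by auto
  ultimately show ?thesis by simp
 qed
 show "rt G2 z = rt G1 z" "flip G2 z = flip G1 z" if "z \<in> Cells G1" for z
  using la_rt[OF s that] la_rt[OF s2, of z] la_flip[OF s that] la_flip[OF s2, of z] that C by simp_all
 show "wt G2 w = wt G1 w" if "w \<in> verts G1" for w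
  using la_wt[OF s that] la_wt[OF s2, of w] that la_verts[OF s] la_verts[OF s2] by simp
 show "mark G2 i = mark G1 i" if "i \<in> {1..n}" for i using la_mark[OF s that] la_mark[OF s2 that] by simp
 show "fl G2 k = fl G1 k" if "k \<in> hedges G1" for k
  using la_fl[OF s that] la_fl[OF s2, of k] that la_hedges[OF s] la_hedges[OF s2] by simp
qed

text \<open>The graph is finite and the type of cells infinite, so a fresh cell for the leg
  exists.\<close>

lemma leg_added_ex:
 fixes G :: "('x::infinite, 'v::real_vector) curve"
 assumes X: "mobj g n S G" and v: "v \<in> verts G"
 shows "\<exists>G'. leg_added n G G' \<and> last_vertex n G' = v \<and> mobj g (Suc n) S G'"
proof -
 note G = obj_graph[OF X]
 obtain l where l: "l \<notin> Cells G" using ex_new_if_finite[OF infinite_UNIV mg_fin[OF G]] by blast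
 define G' where "G' = G\<lparr>Cells := insert l (Cells G), rt := (rt G)(l := v), flip := (flip G)(l := l),
   mark := (mark G)(Suc n := l)\<rparr>"
 have L: "last_leg n G' = l" "last_vertex n G' = v" by (simp_all add: last_leg_def last_vertex_def G'_def)
 have "leg_added n G G'"
  unfolding leg_added_def L using l v mg_rt[OF G] mg_flip[OF G] mark_Cells[OF G]
  by (auto simp: G'_def fl_def hedges_def flags_def)
 thus ?thesis using L leg_added_obj[OF _ obj_stable[OF X]] X by blast
qed

text \<open>The part at \<open>x\<close> receives the length \<open>t\<close>; on an edge the other
  part receives the rest, which must be an admissible length too. On a leg any nonzero
  \<open>t\<close> is possible.\<close>

lemma vertex_added_ex:
 fixes G :: "('x::infinite, 'v::real_vector) curve"
 assumes X: "mobj g n S G" and x: "x \<in> flags G" and t: "t \<in> dual_monoid S" "t ~= (\<lambda>x. 0)"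
  and u: "flip G x ~= x ==> (\<lambda>z. fl G x z - t z) \<in> dual_monoid S \<and> (\<lambda>z. fl G x z - t z) ~= (\<lambda>x. 0)"
 shows "\<exists>G' a b. vertex_added n G G' x a b \<and> fl G' x = t \<and> mobj g (Suc n) S G'"
proof -
 note G = obj_graph[OF X]
 have new: "\<exists>l. l \<notin> S" if "finite S" for S :: "'x set" using ex_new_if_finite[OF infinite_UNIV that] by blast
 obtain l where l: "l \<notin> Cells G" using new[OF mg_fin[OF G]] by blast
 obtain v where v: "v \<notin> insert l (Cells G)" using new mg_fin[OF G] by blast
 obtain a where a: "a \<notin> {l, v} \<union> Cells G" using new[of "{l, v} \<union> Cells G"] mg_fin[OF G] by auto
 obtain b where b: "b \<notin> {l, v, a} \<union> Cells G" using new[of "{l, v, a} \<union> Cells G"] mg_fin[OF G] by auto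
 define y where "y = flip G x"
 have xc: "x \<in> Cells G" using x by (simp add: flags_def)
 have yf: "y \<in> flags G" "y \<in> Cells G" "flip G y = x" using flip_flags[OF G x] mg_flip_flip[OF G xc] by (auto simp: y_def flags_def)
 have d: "distinct [l, v, a, b]" using v a b by auto
 have nw: "l \<notin> Cells G" "v \<notin> Cells G" "a \<notin> Cells G" "b \<notin> Cells G" using l v a b by auto
 have ne: "x ~= l" "x ~= v" "x ~= a" "x ~= b" "y ~= l" "y ~= v" "y ~= a" "y ~= b" using nw xc yf by auto
 \<comment> \<open>In \<open>len\<close> the test for \<open>x\<close> comes first, so on a leg,
   where \<open>y = x\<close>, the remainder is never assigned.\<close>
 define G' where "G' = G\<lparr>Cells := {l, v, a, b} \<union> Cells G, rt := (\<lambda>z. if z \<in> {l, v, a, b} then v else rt G z),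
   flip := (\<lambda>z. if z = a then x else if z = x then a else if z \<in> {l, v} then z else
    if z = b then (if y = x then b else y) else if z = y then b else flip G z),
   wt := (wt G)(v := 0), mark := (\<lambda>i. if i = Suc n then l else if mark G i = x then b else mark G i),
   len := (\<lambda>e. if x \<in> e then t else if y \<in> e then (\<lambda>z. fl G x z - t z) else len G e)\<rparr>"
 have s [simp]: "Cells G' = {l, v, a, b} \<union> Cells G" "rt G' = (\<lambda>z. if z \<in> {l, v, a, b} then v else rt G z)"
  "wt G' = (wt G)(v := 0)"
  "mark G' = (\<lambda>i. if i = Suc n then l else if mark G i = x then b else mark G i)" by (simp_all add: G'_def)
 have L: "last_leg n G' = l" "last_vertex n G' = v" by (simp_all add: last_leg_def last_vertex_def)
 have F: "flip G' l = l" "flip G' v = v" "flip G' a = x" "flip G' x = a" "flip G' b = (if y = x then b else y)"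
  "y ~= x ==> flip G' y = b" "\<And>z. z \<in> Cells G ==> z ~= x ==> z ~= y ==> flip G' z = flip G z"
  using d nw ne by (auto simp: G'_def)
 have lx: "fl G' x = t" by (simp add: fl_def F(4)) (simp add: G'_def)
 have ly: "fl G' y = (\<lambda>z. fl G x z - t z)" if "y ~= x" using F(6)[OF that] that ne by (simp add: fl_def) (simp add: G'_def fl_def)
 have lk: "fl G' k = fl G k" if "k \<in> hedges G" "k ~= x" "k ~= y" for k
 proof -
  have kc: "k \<in> Cells G" using that by (simp add: hedges_def flags_def)
  have "flip G k ~= x" "flip G k ~= y" using mg_flip_flip[OF G kc] that(2,3) yf(3) by (auto simp: y_def)
  thus ?thesis using F(7)[OF kc that(2,3)] that by (simp add: fl_def) (simp add: G'_def)
 qed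
 have wv: "w ~= v" if "w \<in> verts G" for w using that verts_Cells[OF G that] nw by auto
 have rn: "rt G' z = rt G z" if "z \<in> Cells G" for z using that nw by auto
 have rw: "rt G' l = v" "rt G' v = v" "rt G' a = v" "rt G' b = v" by auto
 have va: "vertex_added n G G' x a b"
  unfolding vertex_added_def Let_def L y_def[symmetric]
  by (intro conjI ballI impI; (rule d s(1))?;
   auto simp: x yf nw F lx ly lk wv rn rw mg_rt[OF G] mg_flip[OF G] mark_Cells[OF G] simp del: s(2))
 moreover have "mobj g (Suc n) S G'"
  unfolding vertex_added_obj[OF va] using X t u lx ly unfolding y_def by (cases "flip G x = x") simp_all
 ultimately show ?thesis using lx by blast
qed

section \<open>The point of the last leg\<close>

text \<open>The point at distance \<open>t\<close> from the root of the flag \<open>x\<close>, over the base point \<open>p\<close>.\<close>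

definition pt_at :: "('x, 'v) curve \<Rightarrow> 'x \<Rightarrow> ('v \<Rightarrow> real) \<Rightarrow> ('v \<Rightarrow> 'v) \<Rightarrow> ('x, 'v) cpoint" where
 "pt_at G x t p = (if flip G x = x then LPt x (\<lambda>z. (p z, t z))
   else EPt {x, flip G x} (\<lambda>z. (p z, if x = first_flag {x, flip G x} then (fl G x (p z) - t z, t z)
    else (t z, fl G x (p z) - t z))))"

lemma pt_at_base: "pt_base (pt_at G x t p) = p"
 by (simp add: pt_at_def comp_def)

lemma pt_at_pull: "pt_pull h (pt_at G x t p) = pt_at G x (t o h) (p o h)"
 by (auto simp: pt_at_def)

lemma pt_at_pieces:
 assumes X: "mobj g n S G" and x: "x \<in> flags G" and p: "p \<in> rpc_hom T S" and t: "t \<in> dual_monoid T"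
  and u: "flip G x ~= x ==> (\<lambda>z. fl G x (p z) - t z) \<in> dual_monoid T"
 shows "pt_at G x t p \<in> pieces_pts S G T"
proof (cases "flip G x = x")
 case True
 thus ?thesis using x p t by (simp add: pt_at_def pieces_L legs_def comp_def)
next
 case False
 hence e: "{x, flip G x} \<in> edges G" using x by (auto simp: edges_def)
 show ?thesis
  using False e p t u[OF False] fl_def[of G x]
  by (cases "x = first_flag {x, flip G x}") (simp_all add: pt_at_def pieces_E[OF X] comp_def)
qed

lemma pt_at_at_v:
 assumes G: "marked_graph n G" and x: "x \<in> flags G"
 shows "at_v G (pt_at G x t p) = (if t = (\<lambda>z. 0) then {rt G x} else {}) \<union>
   (if flip G x ~= x \<and> (\<lambda>z. fl G x (p z) - t z) = (\<lambda>z. 0) then {rt G (flip G x)} else {})"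
proof (cases "flip G x = x")
 case True
 thus ?thesis by (simp add: pt_at_def comp_def)
next
 case False
 define y where "y = flip G x"
 have "first_flag {x, y} = x \<or> first_flag {x, y} = y" using first_flag_in[of "{x, y}"] by auto
 hence "dst {x, y} x (\<lambda>z. (p z, if x = first_flag {x, y} then (fl G x (p z) - t z, t z) else (t z, fl G x (p z) - t z))) = t"
  "dst {x, y} y (\<lambda>z. (p z, if x = first_flag {x, y} then (fl G x (p z) - t z, t z) else (t z, fl G x (p z) - t z))) = (\<lambda>z. fl G x (p z) - t z)"
  using False by (auto simp: dst_def fun_eq_iff y_def)
 thus ?thesis using False unfolding pt_at_def y_def[symmetric] by auto
qed

lemma pt_at_flip:
 assumes G: "marked_graph n G" and x: "x \<in> flags G" and xy: "flip G x ~= x"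
 shows "pt_at G (flip G x) (\<lambda>z. fl G x (p z) - t z) p = pt_at G x t p"
proof -
 define y where "y = flip G x"
 have y: "flip G y = x" "fl G y = fl G x" using mg_flip_flip[OF G, of x] fl_flip[OF G, of x] x by (auto simp: y_def flags_def)
 have s: "{y, x} = {x, y}" by auto
 have "first_flag {x, y} = x \<or> first_flag {x, y} = y" using first_flag_in[of "{x, y}"] by auto
 thus ?thesis using xy unfolding pt_at_def y_def[symmetric] y s by (auto simp: fun_eq_iff)
qed

text \<open>The surviving half-edge keeps its length along \<open>f\<close>, so the complementary
  coordinate agrees as well, and the interchange in \<open>pt_lift\<close> absorbs the chosen
  orders.\<close>

lemma pt_at_lift:
 assumes a: "marr g n S G S' G' f P" and x: "x \<in> flags G'" and v: "P x \<notin> verts G"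
 shows "(pt_at G (P x) t p, pt_at G' x t (f o p)) \<in> pt_lift G G' f P"
proof -
 note A = mtrop_arrD[OF a] and C = contr_rules[OF arr_contr[OF a]]
 have xc: "x \<in> Cells G'" "flip G' x \<in> Cells G'" using x mg_flip[OF C(1)] by (auto simp: flags_def)
 have fx: "flip G (P x) = P (flip G' x)" using C(7)[OF xc(1)] by simp
 show ?thesis
 proof (cases "flip G' x = x")
  case True
  hence "x \<in> legs G'" using x by (simp add: legs_def)
  moreover have "map_prod f id o (\<lambda>z. (p z, t z)) = (\<lambda>z. ((f o p) z, t z))" by auto
  ultimately show ?thesis using True fx unfolding pt_at_def by (auto simp: lift_L)
 next
  case False
  define y where "y = flip G' x"
  have xh: "x \<in> hedges G'" using x False by (simp add: hedges_def)
  have len: "fl G' x (f w) = fl G (P x) w" for w using fun_cong[OF A(5)[OF xh], of w] v by simp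
  have ph: "P x ~= P y" using C(9)[OF xc] v False unfolding y_def by metis
  have e: "{x, y} \<in> edges G'" using xh by (auto simp: edges_hedges y_def)
  have im: "P ` {x, y} = {P x, P y}" by simp
  have e': "P ` {x, y} \<in> edges G" using arr_vert[OF a e, of x] v by simp
  have ff: "first_flag {x, y} = x \<or> first_flag {x, y} = y" using first_flag_in[of "{x, y}"] by auto
  have ff': "first_flag {P x, P y} = P x \<or> first_flag {P x, P y} = P y" using first_flag_in[of "{P x, P y}"] by auto
  have "(\<lambda>z. ((f o p) z, if x = first_flag {x, y} then (fl G' x ((f o p) z) - t z, t z) else (t z, fl G' x ((f o p) z) - t z)))
   = map_prod f (if P (first_flag {x, y}) = first_flag (P ` {x, y}) then id else prod.swap) o
    (\<lambda>z. (p z, if P x = first_flag {P x, P y} then (fl G (P x) (p z) - t z, t z) else (t z, fl G (P x) (p z) - t z)))"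
   unfolding im using ff ff' ph False[folded y_def] len by (auto simp: fun_eq_iff)
  thus ?thesis using False ph e e' fx unfolding pt_at_def y_def[symmetric] by (simp add: lift_E) 
 qed
qed

text \<open>The cell of the point leaves only the two halves of one edge as starting flags, and each
  of them fixes its distance.\<close>

lemma pt_at_eq:
 assumes G: "marked_graph n G" and x: "x \<in> flags G" and eq: "pt_at G x t p = pt_at G x0 t0 p"
 shows "(x0 = x \<and> t0 = t) \<or> (flip G x ~= x \<and> x0 = flip G x \<and> t0 = (\<lambda>z. fl G x (p z) - t z))"
proof (cases "flip G x = x")
 case True
 thus ?thesis using eq by (auto simp: pt_at_def fun_eq_iff split: if_splits)
next
 case False
 define y where "y = flip G x"
 have y: "flip G y = x" "fl G y = fl G x" using mg_flip_flip[OF G, of x] fl_flip[OF G, of x] x by (auto simp: y_def flags_def)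
 have "{x, flip G x} = {x0, flip G x0}" using eq False by (auto simp: pt_at_def split: if_splits)
 hence "x0 = x \<or> x0 = y" unfolding y_def by auto
 thus ?thesis
 proof
  assume "x0 = x"
  thus ?thesis using eq False
   by (cases "x = first_flag {x, flip G x}") (auto simp: pt_at_def fun_eq_iff split: if_splits)
 next
  assume x0: "x0 = y"
  hence "pt_at G y (\<lambda>z. fl G x (p z) - t z) p = pt_at G y t0 p" using eq pt_at_flip[OF G x False, of p t] by (simp add: y_def)
  hence "t0 = (\<lambda>z. fl G x (p z) - t z)" using y False
   by (cases "y = first_flag {y, x}") (auto simp: pt_at_def fun_eq_iff y_def split: if_splits)
  thus ?thesis using x0 False by (simp add: y_def)
 qed
qed

lemma pt_at_ex:
 assumes X: "mobj g n S G" and y: "y \<in> pieces_pts S G T" and nv: "at_v G y = {}"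
 shows "\<exists>x t. x \<in> flags G \<and> t \<in> dual_monoid T \<and> (flip G x ~= x \<longrightarrow> (\<lambda>z. fl G x (pt_base y z) - t z) \<in> dual_monoid T) \<and>
  y = pt_at G x t (pt_base y)"
proof (cases y)
 case (VPt v p) thus ?thesis using nv by simp
next
 case (LPt l p)
 hence "l \<in> legs G" "snd o p \<in> dual_monoid T" using y by (auto simp: pieces_L)
 thus ?thesis using LPt by (intro exI[of _ l] exI[of _ "snd o p"]) (auto simp: pt_at_def legs_def)
next
 case (EPt e p)
 have P: "e \<in> edges G" "fst o snd o p \<in> dual_monoid T" "snd o snd o p \<in> dual_monoid T"
   "len G e o (fst o p) = (\<lambda>x. fst (snd (p x)) + snd (snd (p x)))" using y pieces_E[OF X] unfolding EPt by auto
 obtain k where k: "k \<in> hedges G" "e = {k, flip G k}" "first_flag e = k" "k ~= flip G k" "len G e = fl G k" using edge_ex[OF X P(1)] by blast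
 have l: "fl G k (fst (p z)) - snd (snd (p z)) = fst (snd (p z))" for z using fun_cong[OF P(4), of z] k(5) by simp
 have "y = pt_at G k (snd o snd o p) (pt_base y)"
  unfolding EPt pt_at_def using k l by (auto simp: fun_eq_iff)
 moreover have "(\<lambda>z. fl G k (pt_base y z) - (snd o snd o p) z) = fst o snd o p" using l EPt by (auto simp: fun_eq_iff)
 ultimately show ?thesis using k(1) P by (intro exI[of _ k] exI[of _ "snd o snd o p"]) (simp add: hedges_def)
qed

text \<open>If the vertex of the last leg disappears, it subdivides an edge or a leg of the
  forgotten curve. For an edge flag \<open>a\<close> at it, \<open>flip G a\<close> survives and the
  vertex lies at distance \<open>fl G a\<close> from the root of that flag. There may be two such
  flags to choose from.\<close>

definition last_pt :: "nat \<Rightarrow> 'v::real_vector rpcone \<Rightarrow> ('x, 'v) curve \<Rightarrow> ('x, 'v) cpoint" where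
 "last_pt n S G = (if stable (delete_last n G) then VPt (last_vertex n G) (rpc_id S)
   else let a = SOME a. a \<in> other_flags n G \<and> flip G a ~= a
    in pt_at (forget_last n G) (flip G a) (fl G a) (rpc_id S))"

definition last_section :: "nat \<Rightarrow> 'v::real_vector rpcone \<Rightarrow> ('x, 'v) curve \<Rightarrow> ('x, 'v) cpoint set" where
 "last_section n S G = cls S (forget_last n G) S (last_pt n S G)"

lemma vertex_added_lengths:
 assumes s: "vertex_added n G G' x a b" and X: "mobj g (Suc n) S G'"
 shows "fl G' x \<in> dual_monoid S" "fl G' x ~= (\<lambda>z. 0)" "x \<in> hedges G'" "a \<in> hedges G'" "fl G' a = fl G' x"
  and "flip G x ~= x ==> fl G' (flip G x) \<in> dual_monoid S \<and> fl G' (flip G x) ~= (\<lambda>z. 0) \<and> flip G x \<in> hedges G' \<and>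
   b \<in> hedges G' \<and> fl G' b = fl G' (flip G x) \<and>
   (\<lambda>z. fl G x (rpc_id S z) - fl G' x z) = fl G' (flip G x)"
proof -
 show xh: "x \<in> hedges G'" "a \<in> hedges G'" using va_hedges[OF s] by auto
 show "fl G' x \<in> dual_monoid S" "fl G' x ~= (\<lambda>z. 0)" using obj_dual[OF X xh(1)] obj_nz[OF X xh(1)] by auto
 show "fl G' a = fl G' x" using va_flip_new(3,4)[OF s] by (simp add: fl_def insert_commute)
 assume xy: "flip G x ~= x"
 have yh: "flip G x \<in> hedges G'" "b \<in> hedges G'" using va_hedges[OF s] va_xh(2)[OF s] xy by auto
 have fb: "fl G' b = fl G' (flip G x)" using va_flip_new(5,6)[OF s] xy by (simp add: fl_def insert_commute)
 have "fl G' k (rpc_id S z) = fl G' k z" if "k \<in> hedges G'" for k z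
  using fun_cong[OF comp_rpc_id[OF dual_hom[OF obj_dual[OF X that]]], of z] by simp
 hence "(\<lambda>z. fl G x (rpc_id S z) - fl G' x z) = fl G' (flip G x)"
  unfolding va_fl_x[OF s xy] using xh yh by (auto simp: fun_eq_iff)
 thus "fl G' (flip G x) \<in> dual_monoid S \<and> fl G' (flip G x) ~= (\<lambda>z. 0) \<and> flip G x \<in> hedges G' \<and>
   b \<in> hedges G' \<and> fl G' b = fl G' (flip G x) \<and>
   (\<lambda>z. fl G x (rpc_id S z) - fl G' x z) = fl G' (flip G x)"
  using obj_dual[OF X yh(1)] obj_nz[OF X yh(1)] yh fb by blast
qed

text \<open>Independence of the choice in \<open>last_pt\<close>: the other edge flag yields the
  complementary distance from the opposite end, which is the same point by
  \<open>pt_at_flip\<close>.\<close>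

lemma last_pt_vertex_added:
 assumes s: "vertex_added n (forget_last n G') G' x a b" and X: "mobj g (Suc n) S G'"
 shows "last_pt n S G' = pt_at (forget_last n G') x (fl G' x) (rpc_id S)"
proof -
 define G where "G = forget_last n G'"
 note s = s[folded G_def]
 have u: "\<not> stable (delete_last n G')" by (rule vertex_added_unstable[OF s X])
 have G: "marked_graph n G" using vertex_added_graph[OF s] obj_graph[OF X] by simp
 note L = vertex_added_lengths[OF s X] and F = va_flip_new[OF s]
 define c where "c = (SOME a. a \<in> other_flags n G' \<and> flip G' a ~= a)"
 have "a \<in> other_flags n G' \<and> flip G' a ~= a"
  using vertex_added_other_flags[OF s] F(3) va_new(3)[OF s] va_xy(1)[OF s] by auto
 hence c: "c \<in> {a, b}" "flip G' c ~= c" unfolding c_def vertex_added_other_flags[OF s] by (metis (mono_tags, lifting) someI)+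
 have lp: "last_pt n S G' = pt_at G (flip G' c) (fl G' c) (rpc_id S)"
  using u by (simp add: last_pt_def c_def G_def Let_def)
 show ?thesis
 proof (cases "c = a")
  case True
  thus ?thesis using lp F(3) L(5) by (simp add: G_def)
 next
  case False
  hence b: "c = b" using c by simp
  hence xy: "flip G x ~= x" using c(2) F(5) by auto
  have "pt_at G (flip G x) (\<lambda>z. fl G x (rpc_id S z) - fl G' x z) (rpc_id S) = pt_at G x (fl G' x) (rpc_id S)"
   by (rule pt_at_flip[OF G va_x[OF s] xy])
  thus ?thesis using lp b L(6)[OF xy] F(5) xy by (simp add: G_def)
 qed
qed

text \<open>In the unstable case the parts of the subdivided edge or leg have nonzero length over
  the identity, so the point meets no vertex.\<close>

lemma last_pt_rules:
 assumes X: "mobj g (Suc n) S G'" and gn: "2 * int g - 2 + int n > 0"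
 shows last_pt_pieces: "last_pt n S G' \<in> pieces_pts S (forget_last n G') S"
  and last_pt_base: "pt_base (last_pt n S G') = rpc_id S"
  and last_pt_at: "at_v (forget_last n G') (last_pt n S G') = (if stable (delete_last n G') then {last_vertex n G'} else {})"
proof -
 note Y = forget_obj[OF X gn]
 have "last_pt n S G' \<in> pieces_pts S (forget_last n G') S \<and> pt_base (last_pt n S G') = rpc_id S \<and>
  at_v (forget_last n G') (last_pt n S G') = (if stable (delete_last n G') then {last_vertex n G'} else {})"
  using X gn
 proof (cases rule: forget_cases)
  case stable
  thus ?thesis using rpc_id_in[OF obj_cone[OF X]] la_vert[OF stable(2)] by (simp add: last_pt_def pieces_V)
 next
  case (unstable x a b)
  note s = unstable(2)
  note L = vertex_added_lengths[OF s X] and lp = last_pt_vertex_added[OF s X]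
  have "pt_at (forget_last n G') x (fl G' x) (rpc_id S) \<in> pieces_pts S (forget_last n G') S"
   by (rule pt_at_pieces[OF Y va_x[OF s] rpc_id_in[OF obj_cone[OF X]] L(1)]) (use L(6) in simp)
  moreover have "at_v (forget_last n G') (pt_at (forget_last n G') x (fl G' x) (rpc_id S)) = {}"
   unfolding pt_at_at_v[OF obj_graph[OF Y] va_x[OF s]] using L(2,6) by auto
  ultimately show ?thesis using lp unstable(1) by (simp add: pt_at_base)
 qed
 thus "last_pt n S G' \<in> pieces_pts S (forget_last n G') S" "pt_base (last_pt n S G') = rpc_id S"
  "at_v (forget_last n G') (last_pt n S G') = (if stable (delete_last n G') then {last_vertex n G'} else {})" by blast+
qed

lemma last_section_in:
 assumes X: "mobj g (Suc n) S G'" and gn: "2 * int g - 2 + int n > 0"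
 shows "last_section n S G' \<in> cone_sections S (forget_last n G')"
 using last_pt_rules[OF X gn] cone_base_cls[OF forget_obj[OF X gn] obj_cone[OF X]]
 by (auto simp: sections_iff last_section_def cone_pts_cls)

section \<open>The forgetful morphism on arrows\<close>

lemma contr_last:
 assumes c: "contr (Suc n) A' B' P"
 shows "P (last_leg n A') = last_leg n B'" and "P (last_vertex n A') = last_vertex n B'"
  and "z \<in> Cells A' ==> P z = last_leg n B' ==> z = last_leg n A'"
proof -
 note C = contr_rules[OF c]
 note LA = last_leg_rules[OF C(1)] and LB = last_leg_rules[OF C(2)]
 show 1: "P (last_leg n A') = last_leg n B'" unfolding last_leg_def by (rule C(8)) simp
 thus "P (last_vertex n A') = last_vertex n B'" unfolding last_vertex_def using C(6)[OF LA(2)] by simp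
 show "z \<in> Cells A' ==> P z = last_leg n B' ==> z = last_leg n A'" using C(9)[OF _ LA(2)] 1 LB(4) by simp
qed

lemma contr_vert_value:
 assumes c: "contr m A' B' P" and k: "k \<in> Cells A'" and v: "P k \<in> verts B'"
 shows "P k = P (rt A' k)" "P (flip A' k) = P k"
 using contr_vert_iff[OF c k] contr_flip[OF c k] mg_flip_vert[OF contr_tgt[OF c] v] v by auto

lemma contr_echar_ge:
 assumes c: "contr m A' B' P" and s: "stable A'" and W: "W \<subseteq> {w \<in> verts A'. P w = v}" and v: "v \<in> verts B'"
 shows "(\<Sum>w\<in>W. echar A' w) \<le> echar B' v"
 unfolding contr_echar[OF c v] using W s finite_cells[OF contr_src[OF c]]
 by (intro sum_mono2) (auto simp: stable_echar less_imp_le)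

text \<open>Here \<open>P\<close> contracts \<open>A'\<close> to \<open>B'\<close>, and instability
  means \<open>echar = 1\<close> at the vertex of the last leg. In \<open>B'\<close> this value is a
  sum of positive terms that includes the value in \<open>A'\<close>, so a stable deletion stays
  stable. If \<open>B'\<close> is unstable, that vertex is alone in its fibre and no edge at it is
  contracted (\<open>TT\<close>); if only \<open>A'\<close> is unstable, an edge at it must be
  contracted (\<open>TS\<close>).\<close>

lemma forget_arr_cases:
 assumes a: "marr g (Suc n) S B' S' A' f P" and gn: "2 * int g - 2 + int n > 0"
 obtains (SS) "stable (delete_last n A')" "stable (delete_last n B')"
   "leg_added n (forget_last n A') A'" "leg_added n (forget_last n B') B'"
 | (TT) x a b where "\<not> stable (delete_last n A')" "\<not> stable (delete_last n B')"
   "vertex_added n (forget_last n A') A' x a b" "vertex_added n (forget_last n B') B' (P x) (P a) (P b)"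
   "P x \<notin> verts B'" "P (flip (forget_last n A') x) \<notin> verts B'" "P a \<notin> verts B'" "P b \<notin> verts B'"
   "\<And>w. w \<in> verts A' ==> P w = last_vertex n B' ==> w = last_vertex n A'"
 | (TS) x a b where "\<not> stable (delete_last n A')" "stable (delete_last n B')"
   "vertex_added n (forget_last n A') A' x a b" "leg_added n (forget_last n B') B'" "P x \<in> verts B'"
proof -
 note M = mtrop_arrD[OF a] and C = contr_rules[OF arr_contr[OF a]]
 note la = contr_last[OF M(4)]
 have sA: "stable A'" and sB: "stable B'" using obj_stable M(1,2) by blast+
 let ?v = "last_vertex n A'" and ?w = "last_vertex n B'" and ?A = "forget_last n A'" and ?B = "forget_last n B'"
 have v: "?v \<in> verts A'" "?w \<in> verts B'" using last_leg_rules(5) C(1,2) by blast+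
 have eA: "echar A' ?v > 0" using sA v by (simp add: stable_echar)
 show thesis
  using M(2) gn
 proof (cases rule: forget_cases)
  case stable
  have "echar A' ?v ~= 1" using delete_stable_iff[OF C(1) sA] stable(1) by simp
  moreover have "echar A' ?v \<le> echar B' ?w" using contr_echar_ge[OF M(4) sA, of "{?v}" ?w] v la by simp
  ultimately have "stable (delete_last n B')" using delete_stable_iff[OF C(2) sB] eA by simp
  thus thesis using SS stable forget_leg_added[OF C(2)] by blast
 next
  case (unstable x a b)
  note s = unstable(2) and T = vertex_added_sets[OF unstable(2)] and F = va_flip_new[OF unstable(2)] and R = va_rt_new[OF unstable(2)]
  define y where "y = flip ?A x"
  note F = F[folded y_def] and T = T[folded y_def]
  have cl: "a \<in> Cells A'" "b \<in> Cells A'" "x \<in> Cells A'" "y \<in> Cells A'" using T(6,7) va_Cells[OF s] by auto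
  have vn: "last_vertex n A' \<notin> Cells ?A" using va_new(2)[OF s] .
  have rx: "rt A' x ~= ?v" "rt A' y ~= ?v" using va_rt[OF s] va_rt_in[OF s] T(6,7) vn by metis+
  have ax: "P a \<in> verts B' \<longleftrightarrow> P x \<in> verts B'" using contr_flip_vert[OF M(4) cl(1)] F(3) by simp
  have bl: "P b \<notin> verts B'" if "y = x"
  proof -
   have "b \<in> legs A'" using T(3,8) that by auto
   thus ?thesis using contr_legs[OF M(4), of b] by (simp add: legs_def flags_def)
  qed
  have bv: "P b \<in> verts B' \<longleftrightarrow> y ~= x \<and> P y \<in> verts B'"
   using contr_flip_vert[OF M(4) cl(2)] F(5) bl by (cases "y = x") auto
  show thesis
  proof (cases "stable (delete_last n B')")
   case True
   have "echar B' ?w ~= 1" using delete_stable_iff[OF C(2) sB] True by simp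
   hence "{w \<in> verts A'. P w = ?w} ~= {?v}" using C(11)[OF v(2)] vertex_added_echar(2)[OF s] by auto
   then obtain w where w: "w \<in> verts A'" "P w = ?w" "w ~= ?v" using v la by auto
   \<comment> \<open>Fibres are connected by contracted flags, so the first step away from
     \<open>?v\<close> uses a contracted flag at \<open>?v\<close>.\<close>
   have "(?v, w) \<in> (steps A' {k \<in> flags A'. P k \<in> verts B'})\<^sup>*" using C(10)[OF v(1) w(1)] w la by simp
   then obtain u where "(?v, u) \<in> steps A' {k \<in> flags A'. P k \<in> verts B'}" using w(3) by (metis converse_rtranclE)
   then obtain k where k: "k \<in> flags A'" "P k \<in> verts B'" "rt A' k = ?v" unfolding steps_def by auto
   have "k ~= last_leg n A'" using k(2) la(1) last_leg_rules(4)[OF C(2)] by auto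
   hence "k \<in> other_flags n A'" using k by (simp add: other_flags_def)
   hence "k = a \<or> k = b" using vertex_added_other_flags[OF s] by auto
   hence "P x \<in> verts B' \<or> (y ~= x \<and> P y \<in> verts B')" using k ax bv by auto
   thus thesis
   proof
    assume "P x \<in> verts B'"
    thus thesis using TS[OF unstable(1) True s forget_leg_added[OF C(2) True]] by blast
   next
    assume y: "y ~= x \<and> P y \<in> verts B'"
    have "marked_graph n ?A" using vertex_added_graph[OF s] C(1) by simp
    \<comment> \<open>Exchanging the two halves of the subdivided edge makes the contracted one play
      the role of \<open>x\<close>.\<close>
    hence "vertex_added n ?A A' y b a" using vertex_added_swap[OF s] y by (simp add: y_def)
    thus thesis using TS[OF unstable(1) True _ forget_leg_added[OF C(2) True]] y by blast
   qed
  next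
   case False
   have e1: "echar B' ?w = 1" using delete_stable_iff[OF C(2) sB] False by simp
   \<comment> \<open>The fibre has total \<open>echar\<close> equal to 1 and every term is at least
     1.\<close>
   have fib: "w = ?v" if w: "w \<in> verts A'" "P w = ?w" for w
   proof (rule ccontr)
    assume "w ~= ?v"
    hence "echar A' w + echar A' ?v \<le> 1" using contr_echar_ge[OF M(4) sA, of "{w, ?v}" ?w] v la w e1 by simp
    moreover have "echar A' w > 0" using sA w by (simp add: stable_echar)
    ultimately show False using eA by simp
   qed
   have nx: "P k \<notin> verts B'" if k: "k \<in> Cells A'" "rt A' k = ?v" "rt A' (flip A' k) ~= ?v" for k
   proof
    assume kv: "P k \<in> verts B'"
    have "P (flip A' k) \<in> verts B'" using contr_flip_vert[OF M(4) k(1)] kv by simp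
    hence "P (rt A' (flip A' k)) = ?w"
     using contr_vert_value[OF M(4) k(1) kv] contr_vert_value(1)[OF M(4) mg_flip[OF C(1) k(1)]] k(2) la(2) by simp
    thus False using fib[OF rt_verts[OF mg_flip[OF C(1) k(1)]]] k(3) by simp
   qed
   have na: "P a \<notin> verts B'" using nx[OF cl(1)] R(3) F(3) rx by simp
   have nb: "P b \<notin> verts B'" using nx[OF cl(2)] R(4) F(5) rx bl by (cases "y = x") auto
   have ny: "P y \<notin> verts B'" using bv nb na ax by (cases "y = x") auto
   have af: "a \<in> flags A'" "b \<in> flags A'" using T(2) by auto
   have d: "distinct [last_leg n A', ?v, a, b]" using va_distinct[OF s] .
   have of': "P k \<in> other_flags n B'" if k: "k = a \<or> k = b" for k
   proof -
    have kc: "k \<in> Cells A'" "P k \<notin> verts B'" "rt A' k = ?v" "k ~= last_leg n A'" using k cl na nb R d by auto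
    hence "P k ~= last_leg n B'" using la(3) by blast
    thus ?thesis using C(5,6)[OF kc(1)] kc la(2) by (simp add: other_flags_def flags_def)
   qed
   have ab: "P a ~= P b" using C(9)[OF cl(1,2)] na d by auto
   have fa: "flip B' (P a) = P x" using C(7)[OF cl(1)] F(3) by simp
   have "P a ~= P x" using C(9)[OF cl(1,3)] na va_new(3)[OF s] T(6) by auto
   then obtain b' where s': "vertex_added n ?B B' (P x) (P a) b'"
    using forget_vertex_added[OF M(1) gn False, of "P a"] of'[of a] fa by auto
   have "b' = P b" using of'[of b] ab vertex_added_other_flags[OF s'] by auto
   thus thesis using TT[OF unstable(1) False s] s' na nb ny ax fib by (simp add: y_def)
  qed
 qed
qed

lemma forget_map_stable:
 "stable (delete_last n A') ==> forget_map n A' B' P = restrict P (Cells (forget_last n A'))"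
 by (simp add: forget_map_def)

lemma forget_map_unstable:
 assumes u: "\<not> stable (delete_last n A')" and s: "vertex_added n (forget_last n A') A' x a b"
  and z: "z \<in> Cells (forget_last n A')"
 defines "y \<equiv> flip (forget_last n A') x"
 shows "forget_map n A' B' P z = (if z = x \<and> P x \<in> verts B' then P b
   else if z = y \<and> y ~= x \<and> P y \<in> verts B' then P a else P z)"
proof -
 note F = va_flip_new[OF s, folded y_def] and N = va_new[OF s] and T = va_xy[OF s, folded y_def]
 have ab: "a ~= b" using va_distinct[OF s] by simp
 note of' = vertex_added_other_flags[OF s] and P = partner_eq[OF vertex_added_other_flags[OF s] ab]
 have "flip A' z \<in> {a, b} \<longleftrightarrow> z = x \<or> z = y"
 proof (cases "z = x \<or> z = y")
  case False
  hence "flip A' z = flip (forget_last n A') z" using va_flip[OF s z] by (simp add: y_def)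
  thus ?thesis using False va_flip_in[OF s z] N by auto
 qed (use F in auto)
 thus ?thesis using u z of' P F by (auto simp: forget_map_def)
qed

lemma forget_map_TT:
 assumes u: "\<not> stable (delete_last n A')" and s: "vertex_added n (forget_last n A') A' x a b"
  and z: "z \<in> Cells (forget_last n A')" and n: "P x \<notin> verts B'" "P (flip (forget_last n A') x) \<notin> verts B'"
 shows "forget_map n A' B' P z = P z"
 using forget_map_unstable[OF u s z] n by auto

text \<open>If the half at \<open>y\<close> is contracted as well, then \<open>a\<close>,
  \<open>b\<close> and \<open>y\<close> all have the same image, so the exceptional value at
  \<open>y\<close> agrees with \<open>P y\<close> and only the one at \<open>x\<close>
  remains.\<close>

lemma forget_map_TS:
 assumes u: "\<not> stable (delete_last n A')" and s: "vertex_added n (forget_last n A') A' x a b"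
  and z: "z \<in> Cells (forget_last n A')" and c: "contr (Suc n) A' B' P" and x: "P x \<in> verts B'"
 shows "forget_map n A' B' P z = (if z = x then P b else P z)"
proof -
 define y where "y = flip (forget_last n A') x"
 note F = va_flip_new[OF s, folded y_def] and R = va_rt_new[OF s]
 have cl: "a \<in> Cells A'" "b \<in> Cells A'" "y \<in> Cells A'" using va_Cells[OF s] va_xy[OF s] by (auto simp: y_def)
 have "P a = P y" if y: "y ~= x" "P y \<in> verts B'"
 proof -
  have "P a \<in> verts B'" "P b \<in> verts B'" using contr_flip_vert[OF c cl(1)] contr_flip_vert[OF c cl(2)] F x y by auto
  hence "P a = P (rt A' a)" "P b = P (rt A' b)" "P (flip A' b) = P b"
   using contr_vert_value[OF c cl(1)] contr_vert_value[OF c cl(2)] by auto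
  thus ?thesis using R F y by simp
 qed
 thus ?thesis using forget_map_unstable[OF u s z] x by (auto simp: y_def)
qed

lemma forget_map_ext: "forget_map n A' B' P \<in> extensional (Cells (forget_last n A'))"
 by (simp add: forget_map_def)

section \<open>The forgotten graph map is a contraction: three cases\<close>

lemma forget_contr_SS:
 assumes c: "contr (Suc n) A' B' P" and A: "leg_added n A A'" and B: "leg_added n B B'"
 shows "contr n A B (restrict P (Cells A))"
proof -
 note C = contr_rules[OF c] and la = contr_last[OF c] and SA = leg_added_sets[OF A] and SB = leg_added_sets[OF B]
 have GA: "marked_graph n A" and GB: "marked_graph n B" using leg_added_graph[OF A] leg_added_graph[OF B] C(1,2) by simp_all
 have cA: "z \<in> Cells A'" if "z \<in> Cells A" for z using that la_Cells[OF A] by simp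
 have cB: "P z \<in> Cells B" if "z \<in> Cells A" for z
  using C(5)[OF cA[OF that]] la(3)[OF cA[OF that]] la_Cells[OF B] la_new[OF A] that by auto
 show ?thesis
 proof (rule contrI[OF GA GB])
  show "restrict P (Cells A) ` Cells A = Cells B"
  proof -
   have "w \<in> P ` Cells A" if w: "w \<in> Cells B" for w
   proof -
    obtain z where "z \<in> Cells A'" "w = P z" using w la_Cells[OF B] C(4) by blast
    moreover have "z ~= last_leg n A'" using la(1) la_new[OF B] w calculation by auto
    ultimately show ?thesis using la_Cells[OF A] by auto
   qed
   thus ?thesis using cB by auto
  qed
  show "restrict P (Cells A) (rt A z) = rt B (restrict P (Cells A) z)" "restrict P (Cells A) (flip A z) = flip B (restrict P (Cells A) z)"
   if "z \<in> Cells A" for z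
   using that C(6,7)[OF cA[OF that]] la_rt[OF A that] la_flip[OF A that] la_rt[OF B cB[OF that]] la_flip[OF B cB[OF that]]
    la_rt_in[OF A that] la_flip_in[OF A that] by simp_all
  show "restrict P (Cells A) (mark A i) = mark B i" if "i \<in> {1..n}" for i
   using C(8)[of i] la_mark[OF A that] la_mark[OF B that] la_mark_in[OF A that] that by simp
  show "z = w" if "z \<in> Cells A" "w \<in> Cells A" "restrict P (Cells A) z = restrict P (Cells A) w" "restrict P (Cells A) z \<notin> verts B" for z w
   using C(9)[OF cA[OF that(1)] cA[OF that(2)]] that SB(1) by simp
  show "(v, w) \<in> (steps A {k \<in> flags A. restrict P (Cells A) k \<in> verts B})\<^sup>*"
   if v: "v \<in> verts A" "w \<in> verts A" "restrict P (Cells A) v = restrict P (Cells A) w" for v w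
  proof -
   let ?K = "{k \<in> flags A'. P k \<in> verts B'}"
   have "v \<in> Cells A" "w \<in> Cells A" using v SA(5) by auto
   hence p: "(v, w) \<in> (steps A' ?K)\<^sup>*" using C(10)[of v w] v SA(1) by simp
   have sub: "?K - {last_leg n A'} \<subseteq> flags A" using SA(2) by auto
   have "?K - {last_leg n A'} = {k \<in> flags A. restrict P (Cells A) k \<in> verts B}"
    using SA(2) SB(1) la_new[OF A] by (auto simp: flags_def)
   thus ?thesis using p leg_added_steps[OF A sub] by simp
  qed
  show "echar B v = (\<Sum>w\<in>{w \<in> verts A. restrict P (Cells A) w = v}. echar A w)" if v: "v \<in> verts B" for v
  proof -
   have fib: "{w \<in> verts A. restrict P (Cells A) w = v} = {w \<in> verts A'. P w = v}" using SA(1,5) by auto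
   have fin: "finite {w \<in> verts A'. P w = v}" using finite_cells(1)[OF C(1)] by simp
   have mem: "last_vertex n A' \<in> {w \<in> verts A'. P w = v} \<longleftrightarrow> v = last_vertex n B'"
    using la(2) la_vert[OF A] SA(1) by auto
   \<comment> \<open>The last leg adds 1 at its vertex in both graphs and \<open>P\<close> maps the
     one vertex to the other, so the corrections cancel.\<close>
   have "echar B v + (if v = last_vertex n B' then 1 else 0) = (\<Sum>w\<in>{w \<in> verts A'. P w = v}. echar A' w)"
    using C(11)[of v] leg_added_echar[OF B GB v] v SB(1) by simp
   also have "\<dots> = (\<Sum>w\<in>{w \<in> verts A'. P w = v}. echar A w + (if w = last_vertex n A' then 1 else 0))"
    using leg_added_echar[OF A GA] SA(1) by (intro sum.cong) auto
   also have "\<dots> = (\<Sum>w\<in>{w \<in> verts A'. P w = v}. echar A w) + (if v = last_vertex n B' then 1 else 0)"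
    unfolding sum.distrib sum.delta[OF fin] using mem by simp
   finally show ?thesis unfolding fib by simp
  qed
 qed simp
qed

lemma vertex_added_image:
 assumes c: "contr (Suc n) A' B' P" and A: "vertex_added n A A' x a b" and B: "vertex_added n B B' (P x) (P a) (P b)"
  and nv: "P x \<notin> verts B'" "P (flip A x) \<notin> verts B'" "P a \<notin> verts B'" "P b \<notin> verts B'"
 shows "flip B (P x) = P (flip A x)"
proof -
 note C = contr_rules[OF c]
 have cl: "b \<in> Cells A'" "flip A x \<in> Cells A'" using va_Cells[OF A] va_xy(2)[OF A] by auto
 note fA = va_flip_new(5)[OF A] and fB = va_flip_new(5)[OF B]
 have "flip B' (P b) = P (flip A' b)" using C(7)[OF cl(1)] by simp
 show ?thesis
 proof (cases "flip A x = x")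
  case True
  hence "flip B' (P b) = P b" using fA C(7)[OF cl(1)] by simp
  thus ?thesis using fB True va_xy(2)[OF B] va_new(4)[OF B] by (metis (full_types))
 next
  case False
  hence e: "flip B' (P b) = P (flip A x)" using fA C(7)[OF cl(1)] by simp
  have "P (flip A x) ~= P b" using C(9)[OF cl(2,1)] nv(2) va_new(4)[OF A] va_xy(2)[OF A] by auto
  thus ?thesis using fB e by (metis (full_types))
 qed
qed

lemma forget_contr_TT:
 assumes c: "contr (Suc n) A' B' P" and A: "vertex_added n A A' x a b" and B: "vertex_added n B B' (P x) (P a) (P b)"
  and nv: "P x \<notin> verts B'" "P (flip A x) \<notin> verts B'" "P a \<notin> verts B'" "P b \<notin> verts B'"
  and fib: "\<And>w. w \<in> verts A' ==> P w = last_vertex n B' ==> w = last_vertex n A'"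
 shows "contr n A B (restrict P (Cells A))"
  and "\<And>z. z \<in> Cells A ==> P z \<in> verts B \<longleftrightarrow> P z \<in> verts B'"
proof -
 note C = contr_rules[OF c] and la = contr_last[OF c] and SA = vertex_added_sets[OF A] and SB = vertex_added_sets[OF B]
 have GA: "marked_graph n A" and GB: "marked_graph n B" using vertex_added_graph[OF A] vertex_added_graph[OF B] C(1,2) by simp_all
 have cA: "z \<in> Cells A'" if "z \<in> Cells A" for z using that va_Cells[OF A] by simp
 have abc: "a \<in> Cells A'" "b \<in> Cells A'" using va_Cells[OF A] by auto
 \<comment> \<open>The root of such a cell would lie in the fibre of the last vertex, which consists
   of the deleted vertex alone.\<close>
 have nw: "P z ~= last_vertex n B'" if z: "z \<in> Cells A" for z
 proof
  assume e: "P z = last_vertex n B'"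
  hence "P z \<in> verts B'" using last_leg_rules(5)[OF C(2)] by simp
  hence "P (rt A' z) = last_vertex n B'" using contr_vert_value(1)[OF c cA[OF z]] e by simp
  hence "rt A' z = last_vertex n A'" using fib[OF rt_verts[OF cA[OF z]]] by simp
  thus False using va_rt[OF A z] va_rt_in[OF A z] va_new(2)[OF A] by simp
 qed
 show vB: "P z \<in> verts B \<longleftrightarrow> P z \<in> verts B'" if "z \<in> Cells A" for z using SB(1) nw[OF that] by auto
 have cB: "P z \<in> Cells B" if z: "z \<in> Cells A" for z
 proof -
  have "P z ~= P a" "P z ~= P b" using C(9)[OF abc(1) cA[OF z]] C(9)[OF abc(2) cA[OF z]] nv z va_new(3,4)[OF A] by metis+
  moreover have "P z ~= last_leg n B'" using la(3)[OF cA[OF z]] z va_new(1)[OF A] by auto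
  ultimately show ?thesis using C(5)[OF cA[OF z]] va_Cells[OF B] nw[OF z] by auto
 qed
 note fx = vertex_added_image[OF c A B nv]
 show "contr n A B (restrict P (Cells A))"
 proof (rule contrI[OF GA GB])
  show "restrict P (Cells A) ` Cells A = Cells B"
  proof -
   have "w \<in> P ` Cells A" if w: "w \<in> Cells B" for w
   proof -
    have "w \<in> Cells B'" using w va_Cells[OF B] by simp
    then obtain z where z: "z \<in> Cells A'" "w = P z" using C(4) by blast
    have "z \<notin> {last_leg n A', last_vertex n A', a, b}" using z w va_new[OF B] la(1,2) by auto
    thus ?thesis using z va_Cells[OF A] by auto
   qed
   thus ?thesis using cB by auto
  qed
  show "restrict P (Cells A) (rt A z) = rt B (restrict P (Cells A) z)" if z: "z \<in> Cells A" for z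
   using z C(6)[OF cA[OF z]] va_rt[OF A z] va_rt[OF B cB[OF z]] va_rt_in[OF A z] by simp
  show "restrict P (Cells A) (flip A z) = flip B (restrict P (Cells A) z)" if z: "z \<in> Cells A" for z
  proof -
   consider "z = x" | "z = flip A x" | "z ~= x" "z ~= flip A x" by blast
   hence "P (flip A z) = flip B (P z)"
   proof cases
    case 1 thus ?thesis using fx by simp
   next
    case 2 thus ?thesis using fx va_yx[OF A] va_yx[OF B] by simp
   next
    case 3
    have "P z ~= P x" "P z ~= P (flip A x)"
     using C(9)[OF cA[OF SA(6)] cA[OF z]] C(9)[OF cA[OF SA(7)] cA[OF z]] nv 3 by metis+
    thus ?thesis using C(7)[OF cA[OF z]] va_flip[OF A z 3] va_flip[OF B cB[OF z]] fx by simp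
   qed
   thus ?thesis using z va_flip_in[OF A z] by simp
  qed
  show "restrict P (Cells A) (mark A i) = mark B i" if i: "i \<in> {1..n}" for i
  proof -
   have m: "mark A i \<in> Cells A" "mark B i \<in> Cells B" using va_mark_in[OF A i] va_mark_in[OF B i] .
   have e: "P (mark A' i) = mark B' i" using C(8)[of i] i by simp
   have "P (mark A i) = mark B i"
   proof (cases "mark A i = x")
    case True
    hence "mark B' i = P b" using e va_mark[OF A i] by simp
    hence "mark B i = P x" using va_mark[OF B i] m va_new(4)[OF B] by (auto split: if_splits)
    thus ?thesis using True by simp
   next
    case False
    hence e': "mark B' i = P (mark A i)" using e va_mark[OF A i] by simp
    hence "mark B' i ~= P b" using cB[OF m(1)] va_new(4)[OF B] by auto
    thus ?thesis using va_mark[OF B i] e' by (auto split: if_splits)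
   qed
   thus ?thesis using m by simp
  qed
  show "z = w" if zw: "z \<in> Cells A" "w \<in> Cells A" "restrict P (Cells A) z = restrict P (Cells A) w" "restrict P (Cells A) z \<notin> verts B" for z w
   using C(9)[OF cA[OF zw(1)] cA[OF zw(2)]] zw vB[OF zw(1)] by simp
  show "(v, w) \<in> (steps A {k \<in> flags A. restrict P (Cells A) k \<in> verts B})\<^sup>*"
   if v: "v \<in> verts A" "w \<in> verts A" "restrict P (Cells A) v = restrict P (Cells A) w" for v w
  proof (rule vertex_added_path[OF A _ _ _ _ v(1,2)])
   have "v \<in> Cells A" "w \<in> Cells A" using v SA(5) by auto
   thus "(v, w) \<in> (steps A' {k \<in> flags A'. P k \<in> verts B'})\<^sup>*" using C(10)[of v w] v SA(1) by simp
   show "flip A' k \<in> {k \<in> flags A'. P k \<in> verts B'}" if "k \<in> {k \<in> flags A'. P k \<in> verts B'}" for k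
    using that flip_flags[OF C(1)] contr_flip_vert[OF c] flags_Cells[of k A'] by auto
  qed (use nv vB in \<open>auto simp: flags_def\<close>)
  show "echar B v = (\<Sum>w\<in>{w \<in> verts A. restrict P (Cells A) w = v}. echar A w)" if v: "v \<in> verts B" for v
  proof -
   have "v ~= last_vertex n B'" using v SB(5) va_new(2)[OF B] by auto
   hence fib: "{w \<in> verts A. restrict P (Cells A) w = v} = {w \<in> verts A'. P w = v}" using SA(1,5) la(2) by auto
   have "(\<Sum>w\<in>{w \<in> verts A'. P w = v}. echar A' w) = (\<Sum>w\<in>{w \<in> verts A'. P w = v}. echar A w)"
    unfolding fib[symmetric] using vertex_added_echar(1)[OF A] by (intro sum.cong) auto
   thus ?thesis unfolding fib using C(11)[of v] v SB(1) vertex_added_echar(1)[OF B v] by simp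
  qed
 qed simp
qed

text \<open>Contracting the edge of \<open>x\<close> and \<open>a\<close> moves the last leg to the
  root of \<open>x\<close>. What remains of the inserted vertex is the flag \<open>b\<close>, whose
  image \<open>x\<close> takes over; away from \<open>x\<close> the map is unchanged.\<close>

lemma forget_contr_TS:
 assumes c: "contr (Suc n) A' B' P" and A: "vertex_added n A A' x a b" and B: "leg_added n B B'"
  and cx: "P x \<in> verts B'"
 shows "contr n A B (restrict (\<lambda>z. if z = x then P b else P z) (Cells A))"
  and "P (rt A x) = last_vertex n B'"
proof -
 note C = contr_rules[OF c] and la = contr_last[OF c] and SA = vertex_added_sets[OF A] and SB = leg_added_sets[OF B]
 define y where "y = flip A x"
 note SA = SA[folded y_def] and F = va_flip_new[OF A, folded y_def] and R = va_rt_new[OF A]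
 have GA: "marked_graph n A" and GB: "marked_graph n B" using vertex_added_graph[OF A] leg_added_graph[OF B] C(1,2) by simp_all
 have cA: "z \<in> Cells A'" if "z \<in> Cells A" for z using that va_Cells[OF A] by simp
 have abc: "a \<in> Cells A'" "b \<in> Cells A'" using va_Cells[OF A] by auto
 note xc = SA(6,7) and xc' = cA[OF SA(6)] cA[OF SA(7)]
 have xf: "x \<in> flags A" "y \<in> flags A" using va_x[OF A] va_y[OF A] by (auto simp: y_def)
 have rtx: "rt A z ~= x" if "z \<in> Cells A" for z using rt_verts[OF that] xf by (auto simp: flags_def)
 have av: "P a \<in> verts B'" using contr_flip_vert[OF c abc(1)] F(3) cx by simp
 have pa: "P a = last_vertex n B'" "P x = last_vertex n B'"
  using contr_vert_value[OF c abc(1) av] R(3) F(3) la(2) by auto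
 show prx: "P (rt A x) = last_vertex n B'" using contr_vert_value(1)[OF c xc'(1) cx] va_rt[OF A xc(1)] pa by simp
 let ?r = "\<lambda>z. if z = x then P b else P z"
 let ?R = "restrict ?r (Cells A)"
 have R1: "?R z = ?r z" if "z \<in> Cells A" for z using that by simp
 have vx: "v ~= x" if "v \<in> verts A" for v using that xf by (auto simp: flags_def)
 have bv: "P b \<in> verts B' \<longleftrightarrow> P y \<in> verts B'" if "y ~= x" using contr_flip_vert[OF c abc(2)] F(5) that by simp
 have cB: "?r z \<in> Cells B" if z: "z \<in> Cells A" for z
 proof -
  have "P w \<in> Cells B" if "w \<in> Cells A'" "w ~= last_leg n A'" for w
   using C(5)[OF that(1)] la(3)[OF that(1)] that(2) la_Cells[OF B] by auto
  moreover have "b ~= last_leg n A'" "z ~= last_leg n A'" using va_distinct[OF A] va_new(1)[OF A] z by auto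
  ultimately show ?thesis using abc cA[OF z] by simp
 qed
 show "contr n A B ?R"
 proof (rule contrI[OF GA GB])
  show "?R ` Cells A = Cells B"
  proof -
   have "w \<in> ?r ` Cells A" if w: "w \<in> Cells B" for w
   proof -
    obtain z where z: "z \<in> Cells A'" "w = P z" using w la_Cells[OF B] C(4) by blast
    have "last_vertex n B' \<in> ?r ` Cells A" using prx va_rt_in[OF A xc(1)] rtx[OF xc(1)] by (intro image_eqI[of _ _ "rt A x"]) auto
    moreover have "z ~= last_leg n A'" using la(1) la_new[OF B] w z by auto
    moreover have "P b \<in> ?r ` Cells A" using xc(1) by (intro image_eqI[of _ _ x]) auto
    moreover have "P z \<in> ?r ` Cells A" if "z \<in> Cells A" "z ~= x" using that by (intro image_eqI[of _ _ z]) auto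
    moreover have "z \<in> {last_leg n A', last_vertex n A', a, b, x} \<or> (z \<in> Cells A \<and> z ~= x)" using z va_Cells[OF A] by blast
    moreover have "P z = last_vertex n B'" if "z \<in> {last_vertex n A', a, x}" using that pa la(2) by blast
    ultimately show ?thesis unfolding z(2) by (elim disjE insertE emptyE conjE) (simp_all del: image_iff)
   qed
   hence "Cells B \<subseteq> ?r ` Cells A" by blast
   moreover have "?r ` Cells A \<subseteq> Cells B" using cB by blast
   moreover have "?R ` Cells A = ?r ` Cells A" by (rule image_cong) simp_all
   ultimately show ?thesis by (metis subset_antisym)
  qed
  show "?R (rt A z) = rt B (?R z)" if z: "z \<in> Cells A" for z
  proof (cases "z = x")
   case True
   have "rt B (P b) = last_vertex n B'" using la_rt[OF B, of "P b"] cB[OF xc(1)] C(6)[OF abc(2)] R(4) la(2) by simp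
   thus ?thesis using True prx va_rt_in[OF A xc(1)] rtx[OF xc(1)] xc by simp
  next
   case False
   thus ?thesis using z rtx[OF z] C(6)[OF cA[OF z]] va_rt[OF A z] la_rt[OF B, of "P z"] cB[OF z] va_rt_in[OF A z] by simp
  qed
  show "?R (flip A z) = flip B (?R z)" if z: "z \<in> Cells A" for z
  proof -
   have fB: "flip B (?r z) = flip B' (?r z)" using la_flip[OF B cB[OF z]] by simp
   have "?r (flip A z) = flip B' (?r z)"
   proof (cases "z = x")
    case True
    thus ?thesis using C(7)[OF abc(2)] F(5) by (cases "y = x") (auto simp: y_def)
   next
    case False
    note z' = this
    show ?thesis
    proof (cases "z = y")
     case True
     hence "flip A z = x" using va_yx[OF A] by (simp add: y_def)
     thus ?thesis using z' True C(7)[OF xc'(2)] F(6) by simp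
    next
     case False
     hence "flip A' z = flip A z" using va_flip[OF A z] z' by (simp add: y_def)
     moreover have "flip A z ~= x" using mg_flip_flip[OF GA z] False by (auto simp: y_def)
     ultimately show ?thesis using z' C(7)[OF cA[OF z]] by simp
    qed
   qed
   thus ?thesis using fB z va_flip_in[OF A z] by simp
  qed
  show "?R (mark A i) = mark B i" if i: "i \<in> {1..n}" for i
  proof -
   have "?r (mark A i) = P (mark A' i)" using va_mark[OF A i] by simp
   thus ?thesis using C(8)[of i] la_mark[OF B i] va_mark_in[OF A i] i by simp
  qed
  show "z = w" if zw: "z \<in> Cells A" "w \<in> Cells A" "?R z = ?R w" "?R z \<notin> verts B" for z w
  proof -
   \<comment> \<open>The map is \<open>P\<close> after relabelling \<open>x\<close> as the new flag
     \<open>b\<close>; this relabelling is injective on the old cells.\<close>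
   define e where "e t = (if t = x then b else t)" for t
   have R: "?R t = P (e t)" if "t \<in> Cells A" for t using that by (simp add: e_def)
   have E: "e t \<in> Cells A'" if "t \<in> Cells A" for t using cA[OF that] abc(2) by (simp add: e_def)
   have "e z = e w" using C(9)[OF E[OF zw(1)] E[OF zw(2)]] zw(3,4) R[OF zw(1)] R[OF zw(2)] SB(1) by simp
   thus ?thesis using va_new(4)[OF A] zw(1,2) by (auto simp: e_def split: if_splits)
  qed
  show "(v, w) \<in> (steps A {k \<in> flags A. ?R k \<in> verts B})\<^sup>*"
   if v: "v \<in> verts A" "w \<in> verts A" "?R v = ?R w" for v w
  proof (rule vertex_added_path[OF A _ _ _ _ v(1,2)])
   have "v \<in> Cells A" "w \<in> Cells A" using v SA(5) by auto
   thus "(v, w) \<in> (steps A' {k \<in> flags A'. P k \<in> verts B'})\<^sup>*" using C(10)[of v w] v vx[OF v(1)] vx[OF v(2)] SA(1) by auto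
   show "flip A' k \<in> {k \<in> flags A'. P k \<in> verts B'}" if "k \<in> {k \<in> flags A'. P k \<in> verts B'}" for k
    using that flip_flags[OF C(1)] contr_flip_vert[OF c] flags_Cells[of k A'] by auto
   show "x \<in> {k \<in> flags A. ?R k \<in> verts B} \<and> flip A x \<in> {k \<in> flags A. ?R k \<in> verts B}"
    if "flip A x \<in> {k \<in> flags A'. P k \<in> verts B'}" "flip A x ~= x"
    using that xf xc bv SB(1) by (simp add: y_def)
  qed (use SB(1) in \<open>auto simp: flags_def\<close>)
  show "echar B v = (\<Sum>w\<in>{w \<in> verts A. ?R w = v}. echar A w)" if v: "v \<in> verts B" for v
  proof -
   let ?u = "last_vertex n A'"
   define W where "W = {w \<in> verts A. P w = v}"
   have W: "{w \<in> verts A. ?R w = v} = W" "?u \<notin> W" "finite W"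
    using SA(5) vx va_new(2)[OF A] finite_cells(1)[OF GA] by (auto simp: W_def)
   \<comment> \<open>Over the last vertex the fibre contains the deleted vertex too. Its
     \<open>echar\<close> is 1, which is what the last leg contributes on the side of
     \<open>B'\<close>.\<close>
   have W': "{w \<in> verts A'. P w = v} = (if v = last_vertex n B' then insert ?u W else W)"
    unfolding SA(1) W_def using la(2) by auto
   have "sum (echar A') W = sum (echar A) W"
    using vertex_added_echar(1)[OF A] by (intro sum.cong) (auto simp: W_def)
   moreover have "sum (echar A') (insert ?u W) = 1 + sum (echar A') W"
    using sum.insert[OF W(3,2), of "echar A'"] vertex_added_echar(2)[OF A] by simp
   moreover have "echar B' v = (\<Sum>w\<in>{w \<in> verts A'. P w = v}. echar A' w)" using C(11)[of v] v SB(1) by simp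
   ultimately have "echar B' v = (\<Sum>w\<in>{w \<in> verts A. ?R w = v}. echar A w) + (if v = last_vertex n B' then 1 else 0)"
    unfolding W(1) W' by (simp split: if_splits)
   thus ?thesis using leg_added_echar[OF B GB v] by simp
  qed
 qed simp
qed

text \<open>Each of the three cases yields a contraction, the equation for pulled back lengths and a
  lift of the last point. The second conclusion is the compatibility of sections that makes
  forgetting a functor to the universal curve.\<close>

lemma forget_arr:
 assumes m: "marr g (Suc n) S B' S' A' f P" and gn: "2 * int g - 2 + int n > 0"
 shows forget_arr_in: "((S, forget_last n B'), (S', forget_last n A'), (f, forget_map n A' B' P)) \<in> mtrop_arr g n" (is ?P)
  and forget_arr_section: "cone_map ((S, forget_last n B'), (S', forget_last n A'), (f, forget_map n A' B' P)) S (last_section n S B')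
   = cone_pull S' (forget_last n A') S f (last_section n S' A')" (is ?Q)
proof -
 note M = mtrop_arrD[OF m] and C = contr_rules[OF arr_contr[OF m]]
 note la = contr_last[OF M(4)]
 define A B R where "A = forget_last n A'" and "B = forget_last n B'" and "R = forget_map n A' B' P"
 note YA = forget_obj[OF M(2) gn, folded A_def] and YB = forget_obj[OF M(1) gn, folded B_def]
 have ext: "R \<in> extensional (Cells A)" unfolding R_def A_def by (rule forget_map_ext)
 have hc: "k \<in> Cells A" if "k \<in> hedges A" for k using that by (simp add: hedges_def flags_def)
 have r: "is_rpcone S" "is_rpcone S'" using obj_cone YA YB by blast+
 note PA = last_pt_rules[OF M(2) gn, folded A_def] and PB = last_pt_rules[OF M(1) gn, folded B_def]
 have fid: "f o rpc_id S = f" "rpc_id S' o f = f" using comp_rpc_id[OF M(3)] rpc_id_comp[OF M(3)] by auto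
 \<comment> \<open>The last clause compares representatives only up to gluing, as the case
   \<open>TS\<close> requires; it is conditional because lifting points uses the arrow that the
   other clauses establish.\<close>
 have main: "contr n A B R \<and> (\<forall>k\<in>hedges A. fl A k o f = (if R k \<in> verts B then (\<lambda>x. 0) else fl B (R k))) \<and>
  (marr g n S B S' A f R \<longrightarrow>
   (\<exists>x'. (last_pt n S B', x') \<in> pt_lift B A f R \<and> (x' = pt_pull f (last_pt n S' A') \<or> same_spot A x' (pt_pull f (last_pt n S' A')))))"
  using m gn
 proof (cases rule: forget_arr_cases)
  case SS
  note s = SS(3)[folded A_def] and s' = SS(4)[folded B_def]
  have R: "R = restrict P (Cells A)" using forget_map_stable[OF SS(1)] by (simp add: R_def A_def)
  have c: "contr n A B R" unfolding R by (rule forget_contr_SS[OF M(4) s s'])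
  have "fl A k o f = (if R k \<in> verts B then (\<lambda>x. 0) else fl B (R k))" if k: "k \<in> hedges A" for k
   using M(5)[of k] la_fl[OF s k] k la_hedges[OF s] la_hedges[OF s'] la_verts[OF s'] la_fl[OF s', of "P k"]
    contr_hedges[OF M(4), of k] hc[OF k] by (simp add: R)
  moreover have "(last_pt n S B', VPt (last_vertex n A') f) \<in> pt_lift B A f R"
  proof -
   have v: "last_vertex n A' \<in> verts A" "R (last_vertex n A') = last_vertex n B'"
    using la_vert[OF s] la_verts_sub[OF s] la(2) by (auto simp: R)
   thus ?thesis using SS(2) fid(1) by (auto simp: lift_V last_pt_def)
  qed
  moreover have "VPt (last_vertex n A') f = pt_pull f (last_pt n S' A')" using SS(1) fid(2) by (simp add: last_pt_def)
  ultimately show ?thesis using c by blast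
 next
  case (TT x a b)
  note s = TT(3)[folded A_def] and s' = TT(4)[folded B_def] and nv = TT(5-8)[folded A_def]
  have R: "R = restrict P (Cells A)"
   by (rule extensionalityI[OF ext]) (use forget_map_TT[OF TT(1,3) _ TT(5,6)] in \<open>auto simp: R_def A_def\<close>)
  have c: "contr n A B R" unfolding R by (rule forget_contr_TT(1)[OF M(4) s s' nv]) (rule TT(9))
  have cv: "P z \<in> verts B \<longleftrightarrow> P z \<in> verts B'" if "z \<in> Cells A" for z
   by (rule forget_contr_TT(2)[OF M(4) s s' nv _ that]) (rule TT(9))
  define y where "y = flip A x"
  have xc: "x \<in> Cells A" "y \<in> Cells A" using va_xy[OF s] by (auto simp: y_def)
  have fB: "flip B (P x) = P y" unfolding y_def by (rule vertex_added_image[OF M(4) s s' nv])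
  have cA: "k \<in> Cells A'" if "k \<in> Cells A" for k using that va_Cells[OF s] by simp
  have lenx: "fl A x o f = fl B (P x)" if xy: "y ~= x"
  proof -
   have h: "x \<in> hedges A'" "y \<in> hedges A'" using va_hedges[OF s] va_xh(2)[OF s] xy by (auto simp: y_def)
   have "P y ~= P x" using C(9)[OF cA[OF xc(2)] cA[OF xc(1)]] nv xy unfolding y_def by metis
   hence "fl B (P x) = (\<lambda>z. fl B' (P x) z + fl B' (P y) z)" using va_fl_x[OF s'] fB by simp
   moreover have "fl A' x o f = fl B' (P x)" "fl A' y o f = fl B' (P y)" using M(5)[OF h(1)] M(5)[OF h(2)] nv by (simp_all add: y_def)
   ultimately show ?thesis using va_fl_x[OF s] xy by (auto simp: y_def fun_eq_iff)
  qed
  have "fl A k o f = (if R k \<in> verts B then (\<lambda>x. 0) else fl B (R k))" if k: "k \<in> hedges A" for k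
  proof -
   have kc: "k \<in> Cells A" by (rule hc[OF k])
   consider "k = x" "y ~= x" | "k = y" "y ~= x" | "k ~= x" "k ~= y" using k va_xh(1)[OF s] by (cases "k = x") (auto simp: y_def)
   thus ?thesis
   proof cases
    case 1 thus ?thesis using lenx kc cv[OF xc(1)] nv by (simp add: R)
   next
    case 2
    have "fl A y = fl A x" "fl B (P y) = fl B (P x)"
     using va_yx[OF s] va_yx[OF s'] fB by (simp_all add: fl_def y_def insert_commute)
    thus ?thesis using 2 lenx kc cv[OF xc(2)] nv by (simp add: R y_def)
   next
    case 3
    have kh: "k \<in> hedges A'" using k va_hedges[OF s] by simp
    have e: "fl A k o f = (if P k \<in> verts B' then (\<lambda>x. 0) else fl B' (P k))"
     using M(5)[OF kh] va_fl[OF s k 3(1)] 3(2) by (simp add: y_def)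
    show ?thesis
    proof (cases "P k \<in> verts B'")
     case True thus ?thesis using e kc cv[OF kc] by (simp add: R)
    next
     case False
     have "P k \<in> hedges B" using contr_hedges[OF c k] kc cv[OF kc] False by (simp add: R)
     moreover have "P k ~= P x" "P k ~= P y" using C(9)[OF cA[OF kc] cA] xc 3 False by metis+
     ultimately have "fl B' (P k) = fl B (P k)" using va_fl[OF s'] fB by simp
     thus ?thesis using e kc cv[OF kc] False by (simp add: R)
    qed
   qed
  qed
  moreover have "(last_pt n S B', pt_pull f (last_pt n S' A')) \<in> pt_lift B A f R"
   if ar: "marr g n S B S' A f R"
  proof -
   have "R x = P x" "R x \<notin> verts B" using xc cv[OF xc(1)] nv by (simp_all add: R)
   hence "(pt_at B (P x) (fl B' (P x)) (rpc_id S), pt_at A x (fl B' (P x)) (f o rpc_id S)) \<in> pt_lift B A f R"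
    using pt_at_lift[OF ar va_x[OF s]] by metis
   moreover have "fl A' x o f = fl B' (P x)" using M(5)[of x] va_hedges[OF s] nv by simp
   ultimately show ?thesis
    using last_pt_vertex_added[OF TT(3) M(2)] last_pt_vertex_added[OF TT(4) M(1)] fid
    by (simp add: pt_at_pull A_def B_def)
  qed
  ultimately show ?thesis using c by blast
 next
  case (TS x a b)
  note s = TS(3)[folded A_def] and s' = TS(4)[folded B_def]
  have R: "R = restrict (\<lambda>z. if z = x then P b else P z) (Cells A)"
   by (rule extensionalityI[OF ext]) (use forget_map_TS[OF TS(1,3) _ M(4) TS(5)] in \<open>auto simp: R_def A_def\<close>)
  note c0 = forget_contr_TS[OF M(4) s s' TS(5)]
  have c: "contr n A B R" unfolding R by (rule c0(1))
  define y where "y = flip A x"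
  have xc: "x \<in> Cells A" "y \<in> Cells A" using va_xy[OF s] by (auto simp: y_def)
  have VB: "verts B' = verts B" and HB: "hedges B' = hedges B" using la_verts[OF s'] la_hedges[OF s'] by auto
  have xh: "x \<in> hedges A'" using va_hedges[OF s] by simp
  have z0: "fl A' x o f = (\<lambda>z. 0)" using M(5)[OF xh] TS(5) by simp
  \<comment> \<open>The part at \<open>x\<close> is contracted, so the whole edge pulls back to the
    length of the part at \<open>y\<close>.\<close>
  have lenx: "fl A x o f = (if P y \<in> verts B' then (\<lambda>z. 0) else fl B' (P y))" if xy: "y ~= x"
  proof -
   have h: "y \<in> hedges A'" using va_hedges[OF s] va_xh(2)[OF s] xy by (auto simp: y_def)
   have "fl A x o f = fl A' y o f" using va_fl_x[OF s] xy z0 by (auto simp: y_def fun_eq_iff)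
   thus ?thesis using M(5)[OF h] by simp
  qed
  have "fl A k o f = (if R k \<in> verts B then (\<lambda>x. 0) else fl B (R k))" if k: "k \<in> hedges A" for k
  proof -
   have kc: "k \<in> Cells A" by (rule hc[OF k])
   consider "k = x" "y ~= x" | "k = y" "y ~= x" | "k ~= x" "k ~= y" using k va_xh(1)[OF s] by (cases "k = x") (auto simp: y_def)
   thus ?thesis
   proof cases
    case 1
    have bc: "b \<in> Cells A'" "y \<in> Cells A'" using va_Cells[OF s] xc by auto
    have fb: "flip A' b = y" using va_flip_new(5)[OF s] 1(2) by (simp add: y_def)
    have "P b \<in> verts B' \<longleftrightarrow> P y \<in> verts B'" using contr_flip_vert[OF M(4) bc(1)] fb by simp
    moreover have "P b \<in> hedges B'" if "P b \<notin> verts B'"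
     using contr_hedges[OF M(4) _ that] va_hedges[OF s] 1(2) by (simp add: y_def)
    moreover have "fl B' (P y) = fl B' (P b)" using fl_flip[OF C(2) C(5)[OF bc(1)]] C(7)[OF bc(1)] fb by simp
    ultimately show ?thesis using lenx 1 kc la_fl[OF s', of "P b"] VB HB by (simp add: R)
   next
    case 2
    have yh: "y \<in> hedges A'" using va_hedges[OF s] va_xh(2)[OF s] 2 by (auto simp: y_def)
    have "fl A y = fl A x" using va_yx[OF s] by (simp add: fl_def y_def insert_commute)
    thus ?thesis using 2 lenx kc la_fl[OF s', of "P y"] contr_hedges[OF M(4) yh] VB HB by (simp add: R)
   next
    case 3
    have kh: "k \<in> hedges A'" using k va_hedges[OF s] by simp
    thus ?thesis using M(5)[OF kh] va_fl[OF s k 3(1)] 3 la_fl[OF s', of "P k"] contr_hedges[OF M(4) kh] VB HB kc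
     by (simp add: R y_def)
   qed
  qed
  \<comment> \<open>The distance from the root of \<open>x\<close> pulls back to zero, so the
    restricted point is glued to that root, whose image is the vertex of the last leg of
    \<open>B'\<close>.\<close>
  moreover have "\<exists>x'. (last_pt n S B', x') \<in> pt_lift B A f R \<and> same_spot A x' (pt_pull f (last_pt n S' A'))"
  proof -
   have rv: "rt A x \<in> verts A" "rt A x ~= x" "rt A x \<in> Cells A"
    using rt_verts[OF xc(1)] va_x[OF s] va_rt_in[OF s xc(1)] by (auto simp: flags_def)
   hence "R (rt A x) = last_vertex n B'" using c0(2) by (simp add: R)
   hence 1: "(last_pt n S B', VPt (rt A x) f) \<in> pt_lift B A f R" using rv TS(2) fid(1) by (auto simp: lift_V last_pt_def)
   have e: "pt_pull f (last_pt n S' A') = pt_at A x (\<lambda>z. 0) f"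
    using last_pt_vertex_added[OF TS(3) M(2)] z0 fid(2) by (simp add: pt_at_pull A_def)
   have "rt A x \<in> at_v A (pt_at A x (\<lambda>z. 0) f)" using pt_at_at_v[OF obj_graph[OF YA] va_x[OF s]] by simp
   hence "same_spot A (VPt (rt A x) f) (pt_at A x (\<lambda>z. 0) f)" unfolding same_spot_def by (auto simp: pt_at_base)
   thus ?thesis using 1 e by metis
  qed
  ultimately show ?thesis using c by blast
 qed
 hence ar: "marr g n S B S' A f R" unfolding mtrop_arr_iff using YA YB M(3) by blast
 thus ?P unfolding A_def B_def R_def .
 obtain x' where x': "(last_pt n S B', x') \<in> pt_lift B A f R" "x' = pt_pull f (last_pt n S' A') \<or> same_spot A x' (pt_pull f (last_pt n S' A'))"
  using main ar by blast
 have "cone_map ((S, B), (S', A), (f, R)) S (cls S B S (last_pt n S B')) = cls S' A S x'"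
  by (rule cone_map_cls[OF ar r(1) x'(1) PB(1)])
 also have "\<dots> = cls S' A S (pt_pull f (last_pt n S' A'))"
  using cls_eq_iff[OF YA r(1) lift_pieces[OF ar x'(1) PB(1)] pull_pieces[OF YA PA(1) M(3)]] x'(2) by simp
 also have "\<dots> = cone_pull S' A S f (cls S' A S' (last_pt n S' A'))"
  by (rule cone_pull_cls[OF YA r PA(1) M(3), symmetric])
 finally show ?Q unfolding last_section_def A_def B_def R_def .
qed

text \<open>The cases are those of the first contraction \<open>P'\<close>. In \<open>TT\<close> the
  exceptional flags of \<open>A'\<close> are the images of those of \<open>E'\<close>; in
  \<open>TS\<close> the vertex of the last leg survives in \<open>A'\<close>, where no further
  exception can occur.\<close>

lemma forget_map_comp:
 assumes m: "marr g (Suc n) S B' S' A' f P"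
  and m': "marr g (Suc n) S' A' S'' E' f' P'" and gn: "2 * int g - 2 + int n > 0"
 shows "forget_map n E' B' (compose (Cells E') P P') =
  compose (Cells (forget_last n E')) (forget_map n A' B' P) (forget_map n E' A' P')"
proof (rule extensionalityI[OF forget_map_ext])
 let ?h = "compose (Cells E') P P'" and ?E = "forget_last n E'" and ?A = "forget_last n A'"
 have c: "contr (Suc n) E' B' ?h" using arr_contr[OF mtrop_comp[OF m m']] .
 note M = mtrop_arrD[OF m] and M' = mtrop_arrD[OF m'] and C' = contr_rules[OF arr_contr[OF m']]
 note F' = forget_arr_in[OF m' gn]
 fix z assume z: "z \<in> Cells ?E"
 have zA: "forget_map n E' A' P' z \<in> Cells ?A" using contr_Cells[OF arr_contr[OF F'] z] .
 have sub: "P v \<in> verts B'" if "v \<in> verts A'" for v using contr_verts[OF M(4) that] .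
 have "forget_map n E' B' ?h z = forget_map n A' B' P (forget_map n E' A' P' z)"
  using m' gn
 proof (cases rule: forget_arr_cases)
  case SS
  have "z \<in> Cells E'" using z la_Cells[OF SS(3)] by simp
  thus ?thesis using z zA forget_map_stable[OF SS(1)] forget_map_stable[OF SS(2)] by (simp add: compose_def)
 next
  case (TT x a b)
  define y where "y = flip ?E x"
  have xc: "x \<in> Cells ?E" "y \<in> Cells ?E" using va_xy[OF TT(3)] by (auto simp: y_def)
  have cE: "k \<in> Cells E'" if "k \<in> Cells ?E" for k using that va_Cells[OF TT(3)] by simp
  have hE: "?h k = P (P' k)" if "k \<in> {x, y, z, a, b}" for k
   using that xc z va_Cells[OF TT(3)] by (auto simp: compose_def)
  have e: "forget_map n E' A' P' z = P' z" by (rule forget_map_TT[OF TT(1,3) z TT(5,6)])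
  have fy: "flip ?A (P' x) = P' y" unfolding y_def by (rule vertex_added_image[OF M'(4) TT(3-8)])
  have i: "P' z = P' x \<longleftrightarrow> z = x" "P' z = P' y \<longleftrightarrow> z = y" "P' y = P' x \<longleftrightarrow> y = x"
   using C'(9)[OF cE[OF xc(1)] cE[OF z]] C'(9)[OF cE[OF xc(2)] cE[OF z]] C'(9)[OF cE[OF xc(1)] cE[OF xc(2)]] TT(5,6) unfolding y_def by metis+
  show ?thesis
   unfolding e forget_map_unstable[OF TT(1,3) z, where B' = B' and P = ?h]
    forget_map_unstable[OF TT(2,4) zA[unfolded e], where B' = B' and P = P] fy y_def[symmetric]
   using hE i by (simp split del: if_split cong: if_cong)
 next
  case (TS x a b)
  have xc: "x \<in> Cells ?E" using va_xy[OF TS(3)] by auto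
  have hE: "?h k = P (P' k)" if "k \<in> {x, z, b}" for k
   using that xc z va_Cells[OF TS(3)] by (auto simp: compose_def)
  have e: "forget_map n E' A' P' z = (if z = x then P' b else P' z)" by (rule forget_map_TS[OF TS(1,3) z M'(4) TS(5)])
  have e2: "forget_map n E' B' ?h z = (if z = x then ?h b else ?h z)"
   by (rule forget_map_TS[OF TS(1,3) z c]) (use hE sub[OF TS(5)] in simp)
  show ?thesis unfolding e2 using e zA forget_map_stable[OF TS(2)] hE by simp
 qed
 thus "forget_map n E' B' ?h z = compose (Cells ?E) (forget_map n A' B' P) (forget_map n E' A' P') z"
  using z by (simp add: compose_def)
qed (simp add: compose_def)

lemma forget_map_id:
 assumes X: "mobj g (Suc n) S G" and gn: "2 * int g - 2 + int n > 0"
 shows "forget_map n G G (restrict (\<lambda>x. x) (Cells G)) = restrict (\<lambda>x. x) (Cells (forget_last n G))"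
proof (rule extensionalityI[OF forget_map_ext])
 fix z assume z: "z \<in> Cells (forget_last n G)"
 show "forget_map n G G (restrict (\<lambda>x. x) (Cells G)) z = restrict (\<lambda>x. x) (Cells (forget_last n G)) z"
  using X gn
 proof (cases rule: forget_cases)
  case stable
  thus ?thesis using z la_Cells[OF stable(2)] forget_map_stable[OF stable(1)] by simp
 next
  case (unstable x a b)
  note s = unstable(2)
  have C: "z \<in> Cells G" "x \<in> Cells G" "flip (forget_last n G) x \<in> Cells G" using z va_xy[OF s] va_Cells[OF s] by auto
  have "x \<in> flags G" "flip (forget_last n G) x \<in> flags G" using va_flags[OF s] va_x[OF s] va_y[OF s] by auto
  hence "x \<notin> verts G" "flip (forget_last n G) x \<notin> verts G" by (auto simp: flags_def)
  thus ?thesis using forget_map_TT[OF unstable(1) s z] C z by simp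
 qed
qed (simp add: compose_def)

section \<open>The equivalence with the universal curve\<close>

lemma vertical_iso:
 assumes a: "marr g n S G S G' (rpc_id S) j"
 shows vi_bij: "bij_betw j (Cells G') (Cells G)"
  and vi_verts: "\<And>x. x \<in> Cells G' ==> j x \<in> verts G \<longleftrightarrow> x \<in> verts G'"
  and vi_wt: "\<And>v. v \<in> verts G' ==> wt G (j v) = wt G' v"
  and vi_fl: "\<And>k. k \<in> hedges G' ==> fl G (j k) = fl G' k"
proof -
 note A = mtrop_arrD[OF a]
 obtain i where "compose (Cells G') i j = restrict (\<lambda>x. x) (Cells G')" using mtrop_vertical_inverse[OF a] by blast
 hence "i (j x) = x" if "x \<in> Cells G'" for x using that by (auto simp: compose_def fun_eq_iff split: if_splits)
 hence "inj_on j (Cells G')" by (rule inj_on_inverseI)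
 from contr_inj_iso[OF A(4) this] have "cell_map n (graph_of G') (graph_of G) j"
  and b: "bij_betw j (Cells G') (Cells G)" and w: "\<forall>v\<in>verts G'. wt G (j v) = wt G' v" unfolding wgraph_iso_def by simp_all
 show "bij_betw j (Cells G') (Cells G)" by (rule b)
 show v: "j x \<in> verts G \<longleftrightarrow> x \<in> verts G'" if "x \<in> Cells G'" for x
  using iso_cells(1)[OF contr_src[OF A(4)] contr_tgt[OF A(4)] b _ that] contr_rt[OF A(4)] by blast
 show "wt G (j v) = wt G' v" if "v \<in> verts G'" for v using w that by blast
 show "fl G (j k) = fl G' k" if k: "k \<in> hedges G'" for k
  using A(5)[OF k] v[of k] k comp_rpc_id[OF dual_hom[OF obj_dual[OF A(2) k]]] by (simp add: hedges_def flags_def)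
qed

lemma mtrop_isoI:
 assumes X: "mobj g n S G" and X': "mobj g n S G'" and e: "J \<in> extensional (Cells G')"
  and b: "bij_betw J (Cells G') (Cells G)"
  and r: "\<And>x. x \<in> Cells G' ==> J (rt G' x) = rt G (J x)" and f: "\<And>x. x \<in> Cells G' ==> J (flip G' x) = flip G (J x)"
  and w: "\<And>v. v \<in> verts G' ==> wt G (J v) = wt G' v" and m: "\<And>i. i \<in> {1..n} ==> J (mark G' i) = mark G i"
  and l: "\<And>k. k \<in> hedges G' ==> fl G (J k) = fl G' k"
 shows "marr g n S G S G' (rpc_id S) J"
proof -
 note G = obj_graph[OF X] and G' = obj_graph[OF X']
 have "wgraph_iso n (graph_of G') (graph_of G) J"
  unfolding wgraph_iso_def cell_map_def using G G' e b r f w m bij_betw_imp_surj_on[OF b] by simp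
 hence "contr n G' G J" using iso_imp_contr contr_truncate by metis
 moreover have "fl G' k o rpc_id S = (if J k \<in> verts G then (\<lambda>x. 0) else fl G (J k))" if k: "k \<in> hedges G'" for k
  using l[OF k] comp_rpc_id[OF dual_hom[OF obj_dual[OF X' k]]] iso_cells(1)[OF G' G b, of k] r k
  by (simp add: hedges_def flags_def)
 ultimately show ?thesis unfolding mtrop_arr_iff using X X' rpc_id_in[OF obj_cone[OF X]] by blast
qed

lemma leg_added_iso:
 assumes j: "marr g n S B S E (rpc_id S) j"
  and B: "leg_added n B B'" "mobj g (Suc n) S B'" and E: "leg_added n E E'" "mobj g (Suc n) S E'"
  and v: "j (last_vertex n E') = last_vertex n B'"
 shows "\<exists>J. marr g (Suc n) S B' S E' (rpc_id S) J \<and> restrict J (Cells E) = j"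
proof -
 let ?l = "last_leg n E'" and ?l' = "last_leg n B'"
 define J where "J = restrict (\<lambda>z. if z = ?l then ?l' else j z) (Cells E')"
 note V = vertical_iso[OF j] and C = contr_rules[OF arr_contr[OF j]] and b = B(1) and e = E(1)
 have Jl: "J ?l = ?l'" using la_Cells[OF e] by (simp add: J_def)
 have J: "J z = j z" if "z \<in> Cells E" for z using that la_Cells[OF e] la_new[OF e] by (auto simp: J_def)
 have cl: "z = ?l \<or> z \<in> Cells E" if "z \<in> Cells E'" for z using that la_Cells[OF e] by auto
 have "marr g (Suc n) S B' S E' (rpc_id S) J"
 proof (rule mtrop_isoI[OF B(2) E(2)])
  have "bij_betw J (Cells E) (Cells B)" using V(1) J bij_betw_cong by metis
  hence "bij_betw J (Cells E \<union> {?l}) (Cells B \<union> {J ?l})"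
   by (intro notIn_Un_bij_betw) (simp_all add: la_new[OF e] la_new[OF b] Jl)
  thus "bij_betw J (Cells E') (Cells B')" using la_Cells[OF e] la_Cells[OF b] Jl by simp
  have ve: "last_vertex n E' \<in> Cells E" using la_vert[OF e] la_verts_sub[OF e] by blast
  show "J (rt E' z) = rt B' (J z)" if z: "z \<in> Cells E'" for z
   using cl[OF z] J[OF ve] Jl v J[of z] J[of "rt E z"] C(6)[of z] la_rt[OF e, of z] la_rt[OF b, of "j z"] la_rt_in[OF e, of z] C(5)[of z]
   by (auto simp: last_vertex_def)
  show "J (flip E' z) = flip B' (J z)" if z: "z \<in> Cells E'" for z
   using cl[OF z] Jl J[of z] J[of "flip E z"] C(7)[of z] la_flip[OF e, of z] la_flip[OF b, of "j z"] la_flip_in[OF e, of z] C(5)[of z]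
    la_flip_last[OF e] la_flip_last[OF b] by auto
  show "wt B' (J w) = wt E' w" if "w \<in> verts E'" for w
  proof -
   have w: "w \<in> verts E" "w \<in> Cells E" using that la_verts[OF e] la_verts_sub[OF e] by auto
   thus ?thesis using V(2,3) J la_wt[OF e] la_wt[OF b] by simp
  qed
  show "J (mark E' i) = mark B' i" if i: "i \<in> {1..Suc n}" for i
  proof (cases "i = Suc n")
   case True thus ?thesis using Jl by (simp add: last_leg_def)
  next
   case False
   hence "i \<in> {1..n}" using i by simp
   thus ?thesis using la_mark[OF e] la_mark[OF b] la_mark_in[OF e] J C(8) by simp
  qed
  show "fl B' (J k) = fl E' k" if "k \<in> hedges E'" for k
  proof -
   have k: "k \<in> hedges E" "k \<in> Cells E" using that la_hedges[OF e] by (auto simp: hedges_def flags_def)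
   have "j k \<in> hedges B" using contr_hedges[OF arr_contr[OF j] k(1)] V(2)[OF k(2)] k by (simp add: hedges_def flags_def)
   thus ?thesis using V(4)[OF k(1)] J[OF k(2)] la_fl[OF e k(1)] la_fl[OF b] by simp
  qed
 qed (simp add: J_def)
 moreover have "restrict J (Cells E) = j"
  by (rule extensionalityI[OF _ C(3)]) (simp_all add: J)
 ultimately show ?thesis by blast
qed

text \<open>The new cells are matched with each other. The parts at \<open>x\<close> have equal
  length by hypothesis, and since \<open>j\<close> preserves total lengths the parts at
  \<open>y\<close> agree as differences.\<close>

lemma vertex_added_iso:
 assumes j: "marr g n S B S E (rpc_id S) j"
  and B: "vertex_added n B B' x' a' b'" "mobj g (Suc n) S B'"
  and E: "vertex_added n E E' x a b" "mobj g (Suc n) S E'"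
  and x: "j x = x'" and t: "fl E' x = fl B' x'"
 shows "\<exists>J. marr g (Suc n) S B' S E' (rpc_id S) J \<and> restrict J (Cells E) = j"
proof -
 define l v y l' v' y' where "l = last_leg n E'" and "v = last_vertex n E'" and "y = flip E x"
  and "l' = last_leg n B'" and "v' = last_vertex n B'" and "y' = flip B x'"
 define J where "J = restrict (\<lambda>z. if z = l then l' else if z = v then v' else if z = a then a' else if z = b then b' else j z) (Cells E')"
 note V = vertical_iso[OF j] and C = contr_rules[OF arr_contr[OF j]]
 note b = vertex_addedD[OF B(1), folded l'_def v'_def y'_def] and e = vertex_addedD[OF E(1), folded l_def v_def y_def]
 note bs = vertex_added_sets[OF B(1), folded l'_def v'_def y'_def] and es = vertex_added_sets[OF E(1), folded l_def v_def y_def]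
 have Jn: "J l = l'" "J v = v'" "J a = a'" "J b = b'" using e(4,9) by (auto simp: J_def)
 have J: "J z = j z" if "z \<in> Cells E" for z using that e(5-9) by (auto simp: J_def)
 have xy: "j y = y'" "x \<in> Cells E" "y \<in> Cells E" using C(7)[OF es(6)] x es(6,7) by (auto simp: y_def y'_def)
 have i: "j z = x' \<longleftrightarrow> z = x" "j z = y' \<longleftrightarrow> z = y" if "z \<in> Cells E" for z
  using inj_onD[OF bij_betw_imp_inj_on[OF V(1)], of z x] inj_onD[OF bij_betw_imp_inj_on[OF V(1)], of z y] x xy that by auto
 have xyi: "y' = x' \<longleftrightarrow> y = x" using i(1)[OF xy(3)] xy(1) by simp
 have cl: "z \<in> {l, v, a, b} \<or> z \<in> Cells E" if "z \<in> Cells E'" for z using that e(9) by auto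
 have "marr g (Suc n) S B' S E' (rpc_id S) J"
 proof (rule mtrop_isoI[OF B(2) E(2)])
  have "bij_betw J {l, v, a, b} {l', v', a', b'}" unfolding bij_betw_def inj_on_def using b(4) Jn by auto
  moreover have "bij_betw J (Cells E) (Cells B)" using V(1) J bij_betw_cong by metis
  ultimately have "bij_betw J ({l, v, a, b} \<union> Cells E) ({l', v', a', b'} \<union> Cells B)"
   by (rule bij_betw_combine) (use b(5-8) in auto)
  thus "bij_betw J (Cells E') (Cells B')" using e(9) b(9) by simp
  show "J (rt E' z) = rt B' (J z)" if z: "z \<in> Cells E'" for z
  proof (cases "z \<in> Cells E")
   case True
   thus ?thesis using J e(22,20) C(5,6) b(22) by simp
  next
   case False
   hence "z \<in> {l, v, a, b}" using cl[OF z] by blast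
   thus ?thesis using Jn e(10-13) b(10-13) by auto
  qed
  show "J (flip E' z) = flip B' (J z)" if z: "z \<in> Cells E'" for z
  proof (cases "z \<in> Cells E")
   case True
   consider "z = x" | "z = y" "y ~= x" | "z ~= x" "z ~= y" by blast
   thus ?thesis
   proof cases
    case 1 thus ?thesis using J[OF True] Jn x e(17) b(17) by simp
   next
    case 2 thus ?thesis using J[OF True] Jn xy xyi e(19) b(19) by simp
   next
    case 3 thus ?thesis
     using J[OF True] J[OF e(21)[OF True]] e(23)[OF True] b(23)[of "j z"] i[OF True] C(5,7)[OF True] by simp
   qed
  next
   case False
   hence "z \<in> {l, v, a, b}" using cl[OF z] by blast
   thus ?thesis using Jn e(14-18) b(14-18) xy xyi x J by auto
  qed
  show "wt B' (J w) = wt E' w" if "w \<in> verts E'" for w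
  proof (cases "w = v")
   case True thus ?thesis using Jn e(24) b(24) by simp
  next
   case False
   hence w: "w \<in> verts E" "w \<in> Cells E" using that es(1,5) by auto
   thus ?thesis using V(2,3) J e(25) b(25) by simp
  qed
  show "J (mark E' i) = mark B' i" if i': "i \<in> {1..Suc n}" for i
  proof (cases "i = Suc n")
   case True thus ?thesis using Jn by (simp add: last_leg_def l_def l'_def)
  next
   case False
   hence "i \<in> {1..n}" using i' by simp
   thus ?thesis using e(26,27) b(26) J C(8) Jn i by metis
  qed
  have Cl: "fl E x = fl B x'" if "y ~= x" using V(4)[of x] es(8,9) that x by simp
  have Fx: "fl B' (J x) = fl E' x" using J[OF xy(2)] x t by simp
  have Fy: "fl B' (J y) = fl E' y" if "y ~= x"
  proof -
   have "(\<lambda>z. fl B' x' z + fl B' y' z) = (\<lambda>z. fl E' x z + fl E' y z)" using e(29) b(29) that xyi Cl by metis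
   thus ?thesis using J[OF xy(3)] xy t by (simp add: fun_eq_iff)
  qed
  have flip: "fl B' (J k) = fl E' k" if "fl B' (J (flip E' k)) = fl E' (flip E' k)" "J (flip E' k) = flip B' (J k)" "k \<in> Cells E'" "J k \<in> Cells B'" for k
   using that fl_flip[OF obj_graph[OF E(2)]] fl_flip[OF obj_graph[OF B(2)]] by metis
  show "fl B' (J k) = fl E' k" if k: "k \<in> hedges E'" for k
  proof -
   consider "k = x" | "k = y" "y ~= x" | "k = a" | "k = b" "y ~= x" | "k \<in> hedges E" "k ~= x" "k ~= y" using k es(4) by (auto split: if_splits)
   thus ?thesis
   proof cases
    case 3 thus ?thesis using flip[of a] Fx Jn e(9,16) b(9,16) x J xy by simp
   next
    case 4 thus ?thesis using flip[of b] Fy Jn e(9,18) b(9,18) xyi J xy by simp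
   next
    case 5
    hence kc: "k \<in> Cells E" by (simp add: hedges_def flags_def)
    have "j k \<in> hedges B" using contr_hedges[OF arr_contr[OF j] 5(1)] V(2)[OF kc] 5 by (simp add: hedges_def flags_def)
    thus ?thesis using V(4)[OF 5(1)] J[OF kc] e(28)[OF 5] b(28) i[OF kc] 5 by simp
   qed (use Fx Fy in simp_all)
  qed
 qed (simp add: J_def)
 moreover have "restrict J (Cells E) = j"
  by (rule extensionalityI[OF _ C(3)]) (simp_all add: J)
 ultimately show ?thesis by blast
qed

lemma forget_ftor_simps [simp]:
 "FObj (forget_ftor n) (S, G) = (S, forget_last n G)"
 "FArr (forget_ftor n) ((S, G), (S', G'), (f, P)) = ((S, forget_last n G), (S', forget_last n G'), (f, forget_map n G' G P))"
 by (simp_all add: forget_ftor_def)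

section \<open>The functor to the universal curve\<close>

definition section_ftor ::
 "nat \<Rightarrow> (('x, 'v::real_vector) mtrop_obj, ('x, 'v) mtrop_arr, ('x, 'v) xtrop_obj, ('x, 'v) xtrop_arr) ftor" where
 "section_ftor n = \<lparr>
   FObj = (\<lambda>(S, G). (S, forget_last n G, last_section n S G)),
   FArr = (\<lambda>((S, G), (S', G'), (f, P)). ((S, forget_last n G, last_section n S G),
    (S', forget_last n G', last_section n S' G'), (f, forget_map n G' G P)))\<rparr>"

lemma section_ftor_simps [simp]:
 "FObj (section_ftor n) (S, G) = (S, forget_last n G, last_section n S G)"
 "FArr (section_ftor n) ((S, G), (S', G'), (f, P)) = ((S, forget_last n G, last_section n S G),
   (S', forget_last n G', last_section n S' G'), (f, forget_map n G' G P))"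
 by (simp_all add: section_ftor_def)

lemma is_functor_Xtrop: "is_functor (Xtrop g n) RPC (Pr (Xtrop g n))"
 by (rule fo_src[OF functor_xtrop_proj])

lemma functor_section_ftor:
 assumes gn: "2 * int g - 2 + int n > 0"
 shows "functor_over RPC (Mtrop g (Suc n) :: ('x, 'v::real_vector) mtrop_cat) (Xtrop g n) (section_ftor n)" (is "functor_over _ ?M ?X _")
 unfolding functor_over_def
proof (intro conjI ballI is_functor_Mtrop is_functor_Xtrop)
 show "is_functor ?M ?X (section_ftor n)"
  unfolding is_functor_def
 proof (intro conjI ballI impI category_Mtrop category_Xtrop)
  fix X :: "('x, 'v) mtrop_obj" assume X: "X \<in> Obj ?M"
  obtain S G where e: "X = (S, G)" by (cases X)
  with X have X': "mobj g (Suc n) S G" by simp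
  show "FObj (section_ftor n) X \<in> Obj ?X"
   using forget_obj[OF X' gn] last_section_in[OF X' gn] by (simp add: e)
  show "FArr (section_ftor n) (Ide ?M X) = Ide ?X (FObj (section_ftor n) X)"
   using forget_map_id[OF X' gn] by (simp add: e)
 next
  fix m :: "('x, 'v) mtrop_arr" assume "m \<in> Arr ?M"
  hence "m \<in> mtrop_arr g (Suc n)" by simp
  then obtain S B S' A f P where e: "m = ((S, B), (S', A), (f, P))" and m: "marr g (Suc n) S B S' A f P"
   by (rule mtrop_arr_cases)
  show "FArr (section_ftor n) m \<in> Arr ?X"
   using forget_arr[OF m gn] last_section_in[OF arr_dom[OF m] gn] last_section_in[OF arr_cod[OF m] gn] by (simp add: e)
  show "Dom ?X (FArr (section_ftor n) m) = FObj (section_ftor n) (Dom ?M m)"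
   "Cod ?X (FArr (section_ftor n) m) = FObj (section_ftor n) (Cod ?M m)" by (simp_all add: e)
  fix m' :: "('x, 'v) mtrop_arr" assume "m' \<in> Arr ?M"
  hence "m' \<in> mtrop_arr g (Suc n)" by simp
  then obtain S1 B' S'' E f' P' where e': "m' = ((S1, B'), (S'', E), (f', P'))"
   and m': "marr g (Suc n) S1 B' S'' E f' P'" by (rule mtrop_arr_cases)
  assume "Cod ?M m = Dom ?M m'"
  hence "S1 = S'" "B' = A" by (simp_all add: e e')
  thus "FArr (section_ftor n) (Comp ?M m' m) = Comp ?X (FArr (section_ftor n) m') (FArr (section_ftor n) m)"
   using forget_map_comp[OF m _ gn, of S'' E f' P'] m' by (simp add: e e')
 qed
next
 fix X :: "('x, 'v) mtrop_obj" show "FObj (Pr ?X) (FObj (section_ftor n) X) = FObj (Pr ?M) X" by (cases X) simp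
next
 fix m :: "('x, 'v) mtrop_arr" assume "m \<in> Arr ?M"
 hence "m \<in> mtrop_arr g (Suc n)" by simp
 then obtain S B S' A f P where "m = ((S, B), (S', A), (f, P))" by (rule mtrop_arr_cases)
 thus "FArr (Pr ?X) (FArr (section_ftor n) m) = FArr (Pr ?M) m" by simp
qed

lemma proj_section_ftor: "comp_ftor xtrop_proj (section_ftor n) = forget_ftor n"
 by (simp add: comp_ftor_def xtrop_proj_def section_ftor_def forget_ftor_def fun_eq_iff)

lemma functor_forget_ftor:
 assumes gn: "2 * int g - 2 + int n > 0"
 shows "functor_over RPC (Mtrop g (Suc n) :: ('x, 'v::real_vector) mtrop_cat) (Mtrop g n) (forget_ftor n)"
 unfolding proj_section_ftor[symmetric] by (rule functor_over_comp[OF functor_section_ftor[OF gn] functor_xtrop_proj])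

text \<open>By the cartesian property it suffices to treat automorphisms over the identity of the cone.\<close>

lemma section_ftor_faithful:
 assumes gn: "2 * int g - 2 + int n > 0"
  and a: "marr g (Suc n) S B' S' A' f P1" and b: "marr g (Suc n) S B' S' A' f P2"
  and eq: "forget_map n A' B' P1 = forget_map n A' B' P2"
 shows "P1 = P2"
proof -
 let ?B = "forget_last n B'" and ?A = "forget_last n A'" and ?id = "restrict (\<lambda>x. x)"
 obtain j where j: "marr g (Suc n) S B' S B' (rpc_id S) j" and jc: "compose (Cells A') j P2 = P1"
  using mtrop_cartesian[OF a b] by blast
 note F = forget_arr_in[OF j gn] and Fb = forget_arr_in[OF b gn]
 note C = contr_rules[OF arr_contr[OF j]] and V = vertical_iso[OF j]
 \<comment> \<open>After forgetting, \<open>j\<close> fixes the graph map of an arrow, and that map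
   is surjective.\<close>
 have fj: "forget_map n B' B' j = ?id (Cells ?B)"
 proof (rule mtrop_faithful[OF Fb])
  have "compose (Cells ?A) (forget_map n B' B' j) (forget_map n A' B' P2) = forget_map n A' B' P2"
   using forget_map_comp[OF j b gn] jc eq by simp
  also have "\<dots> = compose (Cells ?A) (?id (Cells ?B)) (forget_map n A' B' P2)"
   using compose_restrict_id(1)[OF contr_ext[OF arr_contr[OF Fb]]] contr_img[OF arr_contr[OF Fb]] by simp
  finally show "compose (Cells ?A) (forget_map n B' B' j) (forget_map n A' B' P2) = compose (Cells ?A) (?id (Cells ?B)) (forget_map n A' B' P2)" .
 qed (simp_all add: forget_map_ext)
 note la = contr_last[OF arr_contr[OF j]]
 have "j z = z" if z: "z \<in> Cells B'" for z
  using arr_dom[OF j] gn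
 proof (cases rule: forget_cases)
  case stable
  thus ?thesis using z la_Cells[OF stable(2)] forget_map_stable[OF stable(1), of B' j] fj la(1) by (metis insertE restrict_apply)
 next
  case (unstable x a b)
  note s = unstable(2)
  have xc: "x \<in> Cells ?B" "flip ?B x \<in> Cells ?B" using va_xy[OF s] by auto
  have nv: "x \<notin> verts B'" "flip ?B x \<notin> verts B'" using va_flags[OF s] va_x[OF s] va_y[OF s] by (auto simp: flags_def)
  hence nj: "j x \<notin> verts B'" "j (flip ?B x) \<notin> verts B'" using V(2) xc va_Cells[OF s] by auto
  have id: "j w = w" if w: "w \<in> Cells ?B" for w
   using forget_map_TT[OF unstable(1) s w nj] fj w by simp
  have c: "a \<in> Cells B'" "b \<in> Cells B'" "x \<in> Cells B'" "flip ?B x \<in> Cells B'" using va_Cells[OF s] xc by auto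
  \<comment> \<open>The removed cells are recovered from the surviving ones: \<open>a\<close>, and
    \<open>b\<close> on an edge, as halves of edges, \<open>b\<close> on a leg and the last leg by
    their markings, and the vertex as the root of the last leg.\<close>
  have a: "j a = a" using C(7)[OF c(3)] id[OF xc(1)] va_flip_new(4)[OF s] by simp
  have b: "j b = b"
  proof (cases "flip ?B x = x")
   case True
   hence "b \<in> legs B'" using va_flip_new(5)[OF s] va_flags[OF s] by (simp add: legs_def)
   then obtain i where "i \<in> {1..Suc n}" "b = mark B' i" using legs_mark[OF C(1)] by blast
   thus ?thesis using C(8) by metis
  next
   case False
   thus ?thesis using C(7)[OF c(4)] id[OF xc(2)] va_flip_new(6)[OF s] by simp
  qed
  show ?thesis using z va_Cells[OF s] id a b la(1,2) by auto
 qed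
 hence "j = ?id (Cells B')" by (intro extensionalityI[OF C(3)]) simp_all
 thus ?thesis
  using jc compose_restrict_id(1)[OF contr_ext[OF arr_contr[OF b]]] contr_img[OF arr_contr[OF b]] by simp
qed

text \<open>Edge lengths are nonzero elements of the dual monoid, so none vanishes over the
  identity. Hence sections at different vertices stay distinct.\<close>

lemma zadj_rpc_id:
 assumes X: "mobj g n S G" shows "zadj G (rpc_id S) = {}"
 using comp_rpc_id[OF dual_hom[OF obj_dual[OF X]]] obj_nz[OF X] by (fastforce simp: zadj_def steps_def)

lemma same_spot_section:
 assumes X: "mobj g n S G" and s: "same_spot G x y" and b: "pt_base x = rpc_id S"
 shows "at_v G x \<inter> at_v G y ~= {}"
 using s zadj_rpc_id[OF X] b unfolding same_spot_def by auto

text \<open>The two sections correspond as points. At a vertex, this says that the last legs sit at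
  corresponding vertices. Otherwise the points lie on corresponding edges or legs, and equal
  distances allow the isomorphism to be extended over the inserted vertices.\<close>

lemma section_iso_lift:
 assumes gn: "2 * int g - 2 + int n > 0"
  and B': "mobj g (Suc n) S B'" and E': "mobj g (Suc n) S E'"
 defines "B \<equiv> forget_last n B'" and "E \<equiv> forget_last n E'"
 assumes j: "marr g n S B S E (rpc_id S) j"
  and s: "cone_map ((S, B), (S, E), (rpc_id S, j)) S (last_section n S B') = last_section n S E'"
 shows "\<exists>J. marr g (Suc n) S B' S E' (rpc_id S) J \<and> forget_map n E' B' J = j"
proof -
 note YB = arr_dom[OF j] and YE = arr_cod[OF j] and r = obj_cone[OF B']
 note PB = last_pt_rules[OF B' gn, folded B_def] and PE = last_pt_rules[OF E' gn, folded E_def]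
 obtain x' where x': "(last_pt n S B', x') \<in> pt_lift B E (rpc_id S) j" using lift_ex[OF j PB(1)] by blast
 note L = lift_props[OF j x' PB(1)]
 have bx: "pt_base x' = rpc_id S" using L(2) PB(2) rpc_id_idem by simp
 have "cls S E S x' = cls S E S (last_pt n S E')"
  using s cone_map_cls[OF j r x' PB(1)] unfolding last_section_def B_def E_def by simp
 hence eq: "x' = last_pt n S E' \<or> same_spot E x' (last_pt n S E')" using cls_eq_iff[OF YE r L(1) PE(1)] by simp
 have at: "at_v E x' = at_v E (last_pt n S E') \<or> at_v E x' \<inter> at_v E (last_pt n S E') ~= {}"
  using eq same_spot_section[OF YE _ bx] by blast
 show ?thesis
 proof (cases "stable (delete_last n E')")
  case True
  hence "last_vertex n E' \<in> at_v E x'" using at PE(3) by auto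
  hence v: "stable (delete_last n B')" "j (last_vertex n E') = last_vertex n B'" using L(3) PB(3) by (auto split: if_splits)
  obtain J where J: "marr g (Suc n) S B' S E' (rpc_id S) J" "restrict J (Cells E) = j"
   using leg_added_iso[OF j _ B' _ E' v(2)] forget_leg_added[OF obj_graph[OF B'] v(1)] forget_leg_added[OF obj_graph[OF E'] True]
   unfolding B_def E_def by blast
  thus ?thesis using forget_map_stable[OF True, of B' J] unfolding E_def by metis
 next
  case False
  hence em: "at_v E (last_pt n S E') = {}" using PE(3) by simp
  \<comment> \<open>A point that meets no vertex is glued only to itself, so the classes being equal
    forces equal representatives.\<close>
  hence x'E: "x' = last_pt n S E'" using eq unfolding same_spot_def by auto
  hence uB: "\<not> stable (delete_last n B')" using L(3) PB(3) em by (auto split: if_splits)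
  obtain xE aE bE where e: "vertex_added n E E' xE aE bE" using forget_cases[OF E' gn] False unfolding E_def by metis
  obtain xB aB bB where b: "vertex_added n B B' xB aB bB" using forget_cases[OF B' gn] uB unfolding B_def by metis
  have xv: "xE \<in> Cells E" "xE \<notin> verts E" "xE \<in> flags E" using va_x[OF e] by (auto simp: flags_def)
  hence jv: "j xE \<notin> verts B" using vi_verts[OF j] by simp
  have jf: "j xE \<in> flags B" using jv contr_Cells[OF arr_contr[OF j] xv(1)] by (simp add: flags_def)
  have "(pt_at B (j xE) (fl E' xE) (rpc_id S), x') \<in> pt_lift B E (rpc_id S) j"
   using pt_at_lift[OF j xv(3) jv, of "fl E' xE" "rpc_id S"] last_pt_vertex_added[OF e[unfolded E_def] E'] x'E
   unfolding rpc_id_idem E_def by simp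
  from lift_unique[OF j this x'] have "pt_at B (j xE) (fl E' xE) (rpc_id S) = pt_at B xB (fl B' xB) (rpc_id S)"
   using last_pt_vertex_added[OF b[unfolded B_def] B'] PB(2) by (simp add: pt_at_base B_def)
  from pt_at_eq[OF obj_graph[OF YB] va_x[OF b] this[symmetric]]
  obtain x1 a1 b1 where b1: "vertex_added n B B' x1 a1 b1" "j xE = x1" "fl E' xE = fl B' x1"
  proof (elim disjE conjE)
   \<comment> \<open>The distance is measured from the opposite end, so \<open>B'\<close> is
     described from the other half of the edge.\<close>
   assume 1: "flip B xB ~= xB" "j xE = flip B xB" "fl E' xE = (\<lambda>z. fl B xB (rpc_id S z) - fl B' xB z)"
   show thesis
    by (rule that[OF vertex_added_swap[OF b 1(1) obj_graph[OF YB]] 1(2)])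
     (use vertex_added_lengths(6)[OF b B' 1(1)] 1(3) in simp)
  qed (use b in blast)
  from vertex_added_iso[OF j b1(1) B' e E' b1(2,3)] obtain J where
   J: "marr g (Suc n) S B' S E' (rpc_id S) J" "restrict J (Cells E) = j" by blast
  have "forget_map n E' B' J z = j z" if z: "z \<in> Cells E" for z
  proof -
   have "J w \<notin> verts B'" if "w \<in> {xE, flip E xE}" for w
    using that vi_verts[OF J(1), of w] va_Cells[OF e] va_xy[OF e] va_flags[OF e] va_x[OF e] va_y[OF e] by (auto simp: flags_def)
   hence "forget_map n E' B' J z = J z"
    using forget_map_TT[OF False e[unfolded E_def], of z J B'] z unfolding E_def by blast
   thus ?thesis using J(2) z by (metis restrict_apply)
  qed
  hence "forget_map n E' B' J = j"
   using extensionalityI[OF forget_map_ext[of n E' B' J, folded E_def] contr_ext[OF arr_contr[OF j]]] by blast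
  thus ?thesis using J(1) by blast
 qed
qed

text \<open>The curve \<open>A'\<close> is first pulled back along \<open>f\<close>. The given arrow
  differs from the forgotten pullback by a vertical isomorphism \<open>j\<close>, and once
  \<open>j\<close> is known to match the sections, \<open>section_iso_lift\<close> applies.\<close>

lemma section_ftor_full:
 assumes gn: "2 * int g - 2 + int n > 0"
  and B': "mobj g (Suc n) S B'" and A': "mobj g (Suc n) S' A'"
 defines "B \<equiv> forget_last n B'" and "A \<equiv> forget_last n A'"
 assumes m: "marr g n S B S' A f R"
  and s: "cone_map ((S, B), (S', A), (f, R)) S (last_section n S B') = cone_pull S' A S f (last_section n S' A')"
 shows "\<exists>P. marr g (Suc n) S B' S' A' f P \<and> forget_map n A' B' P = R"
proof -
 note r = obj_cone[OF B']
 obtain E' P1 where p: "marr g (Suc n) S E' S' A' f P1"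
  using mtrop_pullback[OF A' r arr_hom[OF m]] by blast
 define E R1 where "E = forget_last n E'" and "R1 = forget_map n A' E' P1"
 note F = forget_arr[OF p gn, folded E_def A_def R1_def]
 obtain j where j: "marr g n S B S E (rpc_id S) j" and jc: "compose (Cells A) j R1 = R"
  using mtrop_cartesian[OF m F(1)] by blast
 have sB: "last_section n S B' \<in> cone_sections S B" "last_section n S E' \<in> cone_sections S E"
  using last_section_in[OF B' gn] last_section_in[OF arr_dom[OF p] gn] by (simp_all add: B_def E_def)
 note sB' = sB[unfolded sections_iff]
 \<comment> \<open>Both sides are sections of the cone of \<open>E\<close> with the same image in
   the cone of \<open>A\<close>, and a point is determined by its base and its image.\<close>
 have "cone_map ((S, B), (S, E), (rpc_id S, j)) S (last_section n S B') = last_section n S E'"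
 proof (rule cone_map_inj[OF F(1) r])
  show "cone_map ((S, B), (S, E), (rpc_id S, j)) S (last_section n S B') \<in> cone_pts S E S"
   using cone_map_pts[OF j r] sB' by blast
  show "cone_base (cone_map ((S, B), (S, E), (rpc_id S, j)) S (last_section n S B')) = cone_base (last_section n S E')"
   using cone_map_base[OF j r] sB' rpc_id_idem by simp
  show "cone_map ((S, E), (S', A), (f, R1)) S (cone_map ((S, B), (S, E), (rpc_id S, j)) S (last_section n S B')) =
   cone_map ((S, E), (S', A), (f, R1)) S (last_section n S E')"
   using cone_map_comp[OF j F(1) r, of "last_section n S B'"] sB' comp_rpc_id[OF arr_hom[OF m]] jc s F(2) by simp
 qed (use sB' in blast)
 from section_iso_lift[OF gn B' arr_dom[OF p], folded B_def E_def, OF j this]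
 obtain J where J: "marr g (Suc n) S B' S E' (rpc_id S) J" "forget_map n E' B' J = j" by blast
 have "((S, B'), (S', A'), (f, compose (Cells A') J P1)) \<in> mtrop_arr g (Suc n)"
  using mtrop_comp[OF J(1) p] comp_rpc_id[OF arr_hom[OF m]] by simp
 moreover have "forget_map n A' B' (compose (Cells A') J P1) = R"
  using forget_map_comp[OF J(1) p gn] J(2) jc by (simp add: A_def R1_def)
 ultimately show ?thesis by blast
qed

lemma section_at_vertex:
 assumes X: "mobj g n S G" and x: "x \<in> pieces_pts S G S" "pt_base x = rpc_id S" and v: "v \<in> at_v G x"
 shows "cls S G S x = cls S G S (VPt v (rpc_id S))"
proof -
 have "VPt v (rpc_id S) \<in> pieces_pts S G S" using at_v_verts[OF X x(1) v] rpc_id_in[OF obj_cone[OF X]] by (simp add: pieces_V)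
 moreover have "same_spot G x (VPt v (rpc_id S))" using v x(2) by (auto simp: same_spot_def)
 ultimately show ?thesis using cls_eq_iff[OF X obj_cone[OF X] x(1)] by simp
qed

text \<open>A section that touches a vertex receives a leg there; any other section is a point
  \<open>pt_at\<close> of an edge or leg, which is subdivided at that point. Forgetting the new leg
  gives back the curve up to the identity on cells.\<close>

lemma section_ftor_surj:
 fixes G :: "('x::infinite, 'v::real_vector) curve"
 assumes gn: "2 * int g - 2 + int n > 0" and X: "mobj g n S G" and s: "s \<in> cone_sections S G"
 shows "\<exists>G' j. mobj g (Suc n) S G' \<and>
  ((S, forget_last n G', last_section n S G'), (S, G, s), (rpc_id S, j)) \<in> Arr (Xtrop g n)"
proof -
 note r = obj_cone[OF X] and id = rpc_id_in[OF obj_cone[OF X]]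
 obtain x where x: "x \<in> pieces_pts S G S" "s = cls S G S x" "pt_base x = rpc_id S"
  using s cone_base_cls[OF X r] unfolding sections_iff cone_pts_cls by auto
 have fin: ?thesis if X': "mobj g (Suc n) S G'" and j: "((S, forget_last n G'), (S, G), (rpc_id S, j)) \<in> mtrop_arr g n"
  and l: "(last_pt n S G', y) \<in> pt_lift (forget_last n G') G (rpc_id S) j" and y: "cls S G S y = s" for G' j y
 proof -
  have "cone_map ((S, forget_last n G'), (S, G), (rpc_id S, j)) S (last_section n S G') = cone_pull S G S (rpc_id S) s"
   using cone_map_cls[OF j r l last_pt_pieces[OF X' gn]] y cone_pull_id[OF X r] s
   unfolding last_section_def sections_iff by simp
  thus ?thesis using X' j s last_section_in[OF X' gn] by (auto intro!: exI[of _ G'] exI[of _ j])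
 qed
 show ?thesis
 proof (cases "at_v G x = {}")
  case False
  then obtain v where v: "v \<in> at_v G x" by blast
  have vv: "v \<in> verts G" by (rule at_v_verts[OF X x(1) v])
  obtain G' where G': "leg_added n G G'" "last_vertex n G' = v" "mobj g (Suc n) S G'"
   using leg_added_ex[OF X vv] by blast
  have st: "stable (delete_last n G')" by (rule leg_added_stable[OF G'(1) X])
  note j = leg_added_agree[OF G'(1) forget_leg_added[OF obj_graph[OF G'(3)] st] X]
  show ?thesis
  proof (rule fin[OF G'(3) j])
   show "(last_pt n S G', VPt v (rpc_id S)) \<in> pt_lift (forget_last n G') G (rpc_id S) (restrict (\<lambda>x. x) (Cells G))"
    using st G'(2) vv verts_Cells[OF obj_graph[OF X] vv] rpc_id_idem[of S] by (auto simp: last_pt_def lift_V)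
   show "cls S G S (VPt v (rpc_id S)) = s" using section_at_vertex[OF X x(1,3) v] x(2) by simp
  qed
 next
  case True
  obtain k t where k: "k \<in> flags G" "t \<in> dual_monoid S" "flip G k ~= k \<longrightarrow> (\<lambda>z. fl G k (rpc_id S z) - t z) \<in> dual_monoid S"
   "x = pt_at G k t (rpc_id S)" using pt_at_ex[OF X x(1) True] x(3) by auto
  \<comment> \<open>A vanishing distance to an end would put the point on a vertex.\<close>
  have nz: "t ~= (\<lambda>z. 0)" "flip G k ~= k ==> (\<lambda>z. fl G k (rpc_id S z) - t z) ~= (\<lambda>z. 0)"
   using True pt_at_at_v[OF obj_graph[OF X] k(1), of t "rpc_id S"] k(4) by (auto split: if_splits)
  have fid: "fl G k (rpc_id S z) = fl G k z" if "flip G k ~= k" for z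
   using comp_rpc_id[OF dual_hom[OF obj_dual[OF X]], of k] that k(1) by (simp add: hedges_def fun_eq_iff)
  have "\<exists>G' a b. vertex_added n G G' k a b \<and> fl G' k = t \<and> mobj g (Suc n) S G'"
   by (rule vertex_added_ex[OF X k(1,2) nz(1)]) (use k(3) nz(2) fid in simp)
  then obtain G' a b where G': "vertex_added n G G' k a b" "fl G' k = t" "mobj g (Suc n) S G'" by blast
  have u: "\<not> stable (delete_last n G')" by (rule vertex_added_unstable[OF G'(1,3)])
  have of: "other_flags n G' = {a, b}" by (rule vertex_added_other_flags[OF G'(1)])
  have ab: "a ~= b" "flip G' a = k" "k ~= a" using va_distinct[OF G'(1)] va_flip_new(3)[OF G'(1)] va_new(3)[OF G'(1)] flags_Cells[OF k(1)] by auto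
  obtain b' where b': "vertex_added n (forget_last n G') G' k a b'" using forget_vertex_added[OF G'(3) gn u, of a] of ab by auto
  have "b' = b" using vertex_added_other_flags[OF b'] of ab(1) va_distinct[OF b'] by (auto simp: doubleton_eq_iff)
  note j = vertex_added_agree[OF G'(1) b'[unfolded this] X]
  have kv: "restrict (\<lambda>x. x) (Cells G) k = k" "k \<notin> verts (forget_last n G')" using flags_Cells[OF k(1)] va_x[OF b'] by (auto simp: flags_def)
  show ?thesis
  proof (rule fin[OF G'(3) j])
   show "(last_pt n S G', x) \<in> pt_lift (forget_last n G') G (rpc_id S) (restrict (\<lambda>x. x) (Cells G))"
    using pt_at_lift[OF j k(1), of t "rpc_id S"] last_pt_vertex_added[OF b' G'(3)] kv rpc_id_idem[of S] G'(2) k(4) by simp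
   show "cls S G S x = s" using x(2) by simp
  qed
 qed
qed

text \<open>Equality of images is tested on \<open>\<sigma>\<close>-valued points: the section must
  come from the cone of \<open>v\<close> over some \<open>p\<close>, and its base forces
  \<open>p\<close> to be the identity. So \<open>image_is_vertex\<close> is equality of
  classes.\<close>

lemma section_genus_vertex:
 fixes G :: "('x, 'v::real_vector) curve"
 assumes X: "mobj g n S G" and s: "s \<in> cone_sections S G"
 shows "v \<in> verts G ==> s = cls S G S (VPt v (rpc_id S)) ==> section_genus S G s = wt G v"
  and "(\<And>v. v \<in> verts G ==> s ~= cls S G S (VPt v (rpc_id S))) ==> section_genus S G s = 0"
proof -
 note r = obj_cone[OF X] and id = rpc_id_in[OF obj_cone[OF X]] and s' = s[unfolded sections_iff]
 have V: "VPt v p \<in> pieces_pts S G T" if "v \<in> verts G" "p \<in> rpc_hom T S" for v p and T :: "'v rpcone" using that by (simp add: pieces_V)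
 have iv: "image_is_vertex S G s v \<longleftrightarrow> s = cls S G S (VPt v (rpc_id S))" if v: "v \<in> verts G" for v
 proof
  assume "image_is_vertex S G s v"
  hence e: "{cone_pull S G S h s | h. h \<in> rpc_hom S S} = {cls S G S (VPt v p) | p. p \<in> rpc_hom S S}"
   using r unfolding image_is_vertex_def cls_def by blast
  have "cone_pull S G S (rpc_id S) s \<in> {cone_pull S G S h s | h. h \<in> rpc_hom S S}" using id by blast
  then obtain p where p: "p \<in> rpc_hom S S" "s = cls S G S (VPt v p)"
   unfolding e using cone_pull_id[OF X r] s' by auto
  hence "p = rpc_id S" using cone_base_cls[OF X r V[OF v p(1)]] s' by simp
  thus "s = cls S G S (VPt v (rpc_id S))" using p by simp
 next
  assume e: "s = cls S G S (VPt v (rpc_id S))"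
  have "cone_pull S G T h s = glued S G T `` {VPt v h}" if "is_rpcone T" "h \<in> rpc_hom T S" for T h
   using cone_pull_cls[OF X that(1) r V[OF v id] that(2)] rpc_id_comp[OF that(2)] by (simp add: e cls_def)
  thus "image_is_vertex S G s v" unfolding image_is_vertex_def by blast
 qed
 \<comment> \<open>Over the identity no two vertices are glued, so the description in
   \<open>section_genus\<close> is unique.\<close>
 have u: "v = w" if "v \<in> verts G" "w \<in> verts G" "image_is_vertex S G s v" "image_is_vertex S G s w" for v w
 proof -
  have "VPt v (rpc_id S) = VPt w (rpc_id S) \<or> same_spot G (VPt v (rpc_id S)) (VPt w (rpc_id S))"
   using iv that cls_eq_iff[OF X r V[OF that(1) id] V[OF that(2) id]] by metis
  thus ?thesis using same_spot_section[OF X, of "VPt v (rpc_id S)" "VPt w (rpc_id S)"] by auto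
 qed
 show "section_genus S G s = wt G v" if v: "v \<in> verts G" "s = cls S G S (VPt v (rpc_id S))"
 proof -
  have i: "image_is_vertex S G s v" using iv v by simp
  hence "(THE v. v \<in> verts G \<and> image_is_vertex S G s v) = v" using v(1) u by (intro the_equality) auto
  thus ?thesis using i v(1) unfolding section_genus_def by auto
 qed
 show "section_genus S G s = 0" if "\<And>v. v \<in> verts G ==> s ~= cls S G S (VPt v (rpc_id S))"
  using that iv unfolding section_genus_def by auto
qed

text \<open>Weights are preserved by the vertical isomorphism to the forgotten curve. If the vertex
  of the last leg disappears, it had weight \<open>0\<close>, and the section meets no vertex, so
  both sides are \<open>0\<close>.\<close>

lemma section_genus_last_leg:
 assumes gn: "2 * int g - 2 + int n > 0" and X': "mobj g (Suc n) S G'"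
  and j: "((S, forget_last n G', last_section n S G'), (S, G, s), (rpc_id S, j)) \<in> Arr (Xtrop g n)"
 shows "section_genus S G s = last_leg_genus n (S, G')"
proof -
 let ?B = "forget_last n G'"
 have m: "marr g n S ?B S G (rpc_id S) j" and s: "s \<in> cone_sections S G"
  and e: "cone_map ((S, ?B), (S, G), (rpc_id S, j)) S (last_section n S G') = cone_pull S G S (rpc_id S) s"
  using j by simp_all
 note X = arr_cod[OF m] and r = obj_cone[OF X'] and id = rpc_id_in[OF obj_cone[OF X']] and P = last_pt_rules[OF X' gn]
 have e': "cone_map ((S, ?B), (S, G), (rpc_id S, j)) S (last_section n S G') = s"
  using e cone_pull_id[OF X r] s unfolding sections_iff by simp
 have cv: "cone_map ((S, ?B), (S, G), (rpc_id S, j)) S (cls S ?B S (VPt (j w) (rpc_id S))) = cls S G S (VPt w (rpc_id S))"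
  and Vj: "VPt (j w) (rpc_id S) \<in> pieces_pts S ?B S" if w: "w \<in> verts G" for w
 proof -
  show V: "VPt (j w) (rpc_id S) \<in> pieces_pts S ?B S" using contr_verts[OF arr_contr[OF m] w] id by (simp add: pieces_V)
  have "(VPt (j w) (rpc_id S), VPt w (rpc_id S)) \<in> pt_lift ?B G (rpc_id S) j" using w rpc_id_idem[of S] by (auto simp: lift_V)
  from cone_map_cls[OF m r this V] show "cone_map ((S, ?B), (S, G), (rpc_id S, j)) S (cls S ?B S (VPt (j w) (rpc_id S))) = cls S G S (VPt w (rpc_id S))" .
 qed
 show ?thesis
  using X' gn
 proof (cases rule: forget_cases)
  case stable
  obtain w where w: "w \<in> verts G" "j w = last_vertex n G'" using contr_surj_verts[OF arr_contr[OF m] la_vert[OF stable(2)]] by blast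
  have "s = cls S G S (VPt w (rpc_id S))" using cv[OF w(1)] w(2) e' stable(1) by (simp add: last_section_def last_pt_def)
  from section_genus_vertex(1)[OF X s w(1) this] show ?thesis
   using vi_wt[OF m w(1)] w(2) la_wt[OF stable(2) la_vert[OF stable(2)]] by (simp add: last_leg_genus_def)
 next
  case (unstable x a b)
  have "s ~= cls S G S (VPt w (rpc_id S))" if w: "w \<in> verts G" for w
  proof
   assume "s = cls S G S (VPt w (rpc_id S))"
   hence "cone_map ((S, ?B), (S, G), (rpc_id S, j)) S (cls S ?B S (VPt (j w) (rpc_id S))) =
     cone_map ((S, ?B), (S, G), (rpc_id S, j)) S (last_section n S G')" using cv[OF w] e' by simp
   moreover have "cone_base (cls S ?B S (VPt (j w) (rpc_id S))) = cone_base (last_section n S G')"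
    using last_section_in[OF X' gn] cone_base_cls[OF arr_dom[OF m] r Vj[OF w]] by (simp add: sections_iff)
   moreover have "cls S ?B S (VPt (j w) (rpc_id S)) \<in> cone_pts S ?B S" "last_section n S G' \<in> cone_pts S ?B S"
    using Vj[OF w] last_section_in[OF X' gn] by (simp_all add: sections_iff cone_pts_cls)
   ultimately have "cls S ?B S (VPt (j w) (rpc_id S)) = last_section n S G'" using cone_map_inj[OF m r] by blast
   hence "VPt (j w) (rpc_id S) = last_pt n S G' \<or> same_spot ?B (VPt (j w) (rpc_id S)) (last_pt n S G')"
    using cls_eq_iff[OF arr_dom[OF m] r Vj[OF w] P(1)] by (simp add: last_section_def)
   moreover have "at_v ?B (last_pt n S G') = {}" using P(3) unstable(1) by simp
   ultimately show False unfolding same_spot_def by (metis at_v.simps(1) empty_iff insert_not_empty)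
  qed
  thus ?thesis using section_genus_vertex(2)[OF X s] va_wt_new[OF unstable(2)] by (simp add: last_leg_genus_def)
 qed
qed

lemma section_ftor_full_arr:
 fixes X Y :: "('x, 'v::real_vector) mtrop_obj"
 assumes gn: "2 * int g - 2 + int n > 0"
  and X: "X \<in> Obj (Mtrop g (Suc n))" and Y: "Y \<in> Obj (Mtrop g (Suc n))" and h: "h \<in> Arr (Xtrop g n)"
  and d: "Dom (Xtrop g n) h = FObj (section_ftor n) X" "Cod (Xtrop g n) h = FObj (section_ftor n) Y"
 shows "\<exists>k. k \<in> Arr (Mtrop g (Suc n)) \<and> Dom (Mtrop g (Suc n)) k = X \<and> Cod (Mtrop g (Suc n)) k = Y \<and> FArr (section_ftor n) k = h"
proof -
 obtain S B' S' A' where e: "X = (S, B')" "Y = (S', A')" by (cases X; cases Y)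
 obtain S1 G1 s1 S2 G2 s2 f R where h': "h = ((S1, G1, s1), (S2, G2, s2), (f, R))" by (rule Xtrop_arr_cases[OF h])
 note d' = d[unfolded h' e, simplified]
 have "\<exists>P. marr g (Suc n) S B' S' A' f P \<and> forget_map n A' B' P = R"
  by (rule section_ftor_full[OF gn]) (use X Y h d' in \<open>simp_all add: h' e\<close>)
 then obtain P where "marr g (Suc n) S B' S' A' f P" "forget_map n A' B' P = R" by blast
 thus ?thesis
  using d' by (intro exI[of _ "((S, B'), (S', A'), (f, P))"]) (simp add: e h')
qed

lemma section_ftor_faithful_arr:
 fixes k k' :: "('x, 'v::real_vector) mtrop_arr"
 assumes gn: "2 * int g - 2 + int n > 0"
  and k: "k \<in> Arr (Mtrop g (Suc n))" "k' \<in> Arr (Mtrop g (Suc n))" "Dom (Mtrop g (Suc n)) k = Dom (Mtrop g (Suc n)) k'"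
  "Cod (Mtrop g (Suc n)) k = Cod (Mtrop g (Suc n)) k'" "FArr (section_ftor n) k = FArr (section_ftor n) k'"
 shows "k = k'"
proof -
 have k12: "k \<in> mtrop_arr g (Suc n)" "k' \<in> mtrop_arr g (Suc n)" using k by simp_all
 from k12(1) obtain S B S' A f P where e: "k = ((S, B), (S', A), (f, P))" by (rule mtrop_arr_cases)
 from k12(2) obtain S1 B1 S1' A1 f1 P1 where e1: "k' = ((S1, B1), (S1', A1), (f1, P1))" by (rule mtrop_arr_cases)
 show ?thesis using k section_ftor_faithful[OF gn, of S B S' A f P P1] unfolding e e1 by simp
qed

theorem section_ftor_quasi_inverse:
 assumes gn: "2 * int g - 2 + int n > 0"
 shows "\<exists>\<Phi> s t. functor_over RPC (Xtrop g n :: ('x::infinite, 'v::real_vector) xtrop_cat) (Mtrop g (Suc n)) \<Phi> \<and>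
   nat_iso_over RPC (Mtrop g (Suc n) :: ('x, 'v) mtrop_cat) (Mtrop g (Suc n)) id_ftor (comp_ftor \<Phi> (section_ftor n)) s \<and>
   nat_iso_over RPC (Xtrop g n :: ('x, 'v) xtrop_cat) (Xtrop g n) (comp_ftor (section_ftor n) \<Phi>) id_ftor t"
proof (rule quasi_inverse[OF functor_section_ftor[OF gn] section_ftor_full_arr[OF gn] section_ftor_faithful_arr[OF gn]])
 fix d :: "('x, 'v) xtrop_obj" assume d: "d \<in> Obj (Xtrop g n)"
 obtain S G s where e: "d = (S, G, s)" by (cases d)
 obtain G' j where "mobj g (Suc n) S G'"
  and j: "((S, forget_last n G', last_section n S G'), (S, G, s), (rpc_id S, j)) \<in> Arr (Xtrop g n)"
  using section_ftor_surj[OF gn, of S G s] d unfolding e Xtrop_simps(1) by blast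
 thus "\<exists>c k. c \<in> Obj (Mtrop g (Suc n)) \<and> iso_arrow (Xtrop g n) k \<and> Dom (Xtrop g n) k = FObj (section_ftor n) c \<and>
  Cod (Xtrop g n) k = d \<and> FArr (Pr (Xtrop g n)) k = Ide RPC (FObj (Pr (Xtrop g n)) d)"
  using iso_arrow_Xtrop[OF j]
  by (intro exI[of _ "(S, G')"] exI[of _ "((S, forget_last n G', last_section n S G'), (S, G, s), (rpc_id S, j))"])
   (simp add: e)
qed

section \<open>2-fibre products\<close>

lemma fprod_simps [simp]:
 "Obj (fprod B A D S F G) = fprod_obj B A D S F G"
 "Dom (fprod B A D S F G) (x, y, m) = x" "Cod (fprod B A D S F G) (x, y, m) = y"
 "Ide (fprod B A D S F G) (a, d, s) = ((a, d, s), (a, d, s), (Ide A a, Ide D d))"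
 "Comp (fprod B A D S F G) (y', z, (k', l')) (x, y, (k, l)) = (x, z, (Comp A k' k, Comp D l' l))"
 "FObj (Pr (fprod B A D S F G)) (a, d, s) = FObj (Pr A) a"
 "FArr (Pr (fprod B A D S F G)) (x, y, (k, l)) = FArr (Pr A) k"
 by (simp_all add: fprod_def)

lemma fprod_obj_iff:
 "(a, d, s) \<in> fprod_obj B A D S F G \<longleftrightarrow> a \<in> Obj A \<and> d \<in> Obj D \<and> FObj (Pr A) a = FObj (Pr D) d \<and>
   iso_arrow S s \<and> Dom S s = FObj F a \<and> Cod S s = FObj G d \<and> FArr (Pr S) s = Ide B (FObj (Pr A) a)"
 by (simp add: fprod_obj_def)

lemma fprod_arr_iff:
 "((a, d, s), (a', d', s'), (k, l)) \<in> Arr (fprod B A D S F G) \<longleftrightarrow>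
   (a, d, s) \<in> fprod_obj B A D S F G \<and> (a', d', s') \<in> fprod_obj B A D S F G \<and>
   k \<in> Arr A \<and> Dom A k = a \<and> Cod A k = a' \<and> l \<in> Arr D \<and> Dom D l = d \<and> Cod D l = d' \<and>
   FArr (Pr A) k = FArr (Pr D) l \<and> Comp S s' (FArr F k) = Comp S (FArr G l) s"
 by (simp add: fprod_def)

lemma fprod_arr_cases:
 assumes "f \<in> Arr (fprod B A D S F G)"
 obtains a d s a' d' s' k l where "f = ((a, d, s), (a', d', s'), (k, l))"
  "((a, d, s), (a', d', s'), (k, l)) \<in> Arr (fprod B A D S F G)"
 using assms by (auto simp: fprod_def)

lemma fprod_comp:
 assumes F: "functor_over B A S F" and G: "functor_over B D S G"
  and f: "((a, d, s), (a', d', s'), (k, l)) \<in> Arr (fprod B A D S F G)"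
  and h: "((a', d', s'), (a'', d'', s''), (k', l')) \<in> Arr (fprod B A D S F G)"
 shows "((a, d, s), (a'', d'', s''), (Comp A k' k, Comp D l' l)) \<in> Arr (fprod B A D S F G)"
proof -
 note f = f[unfolded fprod_arr_iff fprod_obj_iff] and h = h[unfolded fprod_arr_iff fprod_obj_iff]
 note FF = functor_rules[OF fo_ftor[OF F]] and GG = functor_rules[OF fo_ftor[OF G]] and S = category_rules[OF ftor_cod[OF fo_ftor[OF F]]]
  and A = category_rules[OF FF(1)] and D = category_rules[OF GG(1)]
 have s: "s \<in> Arr S" "s' \<in> Arr S" "s'' \<in> Arr S" using f h by (simp_all add: iso_Arr)
 have "Comp S s'' (FArr F (Comp A k' k)) = Comp S (Comp S s'' (FArr F k')) (FArr F k)"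
  using f h s FF(5-8) S(11)[of "FArr F k" "FArr F k'" s''] by simp
 also have "\<dots> = Comp S (FArr G l') (Comp S s' (FArr F k))"
  using f h s FF(5-7) GG(5-7) S(11)[of "FArr F k" s' "FArr G l'"] by simp
 also have "\<dots> = Comp S (FArr G (Comp D l' l)) s"
  using f h s GG(5-8) S(11)[of s "FArr G l" "FArr G l'"] by simp
 finally have e: "Comp S s'' (FArr F (Comp A k' k)) = Comp S (FArr G (Comp D l' l)) s" .
 have "FArr (Pr A) (Comp A k' k) = FArr (Pr D) (Comp D l' l)"
  using f h ftor_Comp[OF fo_src[OF F], of k k'] ftor_Comp[OF fo_src[OF G], of l l'] by simp
 thus ?thesis using e f h A D by (simp add: fprod_arr_iff fprod_obj_iff)
qed

lemma fprod_ide: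
 assumes F: "functor_over B A S F" and G: "functor_over B D S G" and x: "(a, d, s) \<in> fprod_obj B A D S F G"
 shows "((a, d, s), (a, d, s), (Ide A a, Ide D d)) \<in> Arr (fprod B A D S F G)"
proof -
 note x' = x[unfolded fprod_obj_iff] and FF = functor_rules[OF fo_ftor[OF F]] and GG = functor_rules[OF fo_ftor[OF G]]
 note S = category_rules[OF FF(2)] and A = category_rules[OF FF(1)] and D = category_rules[OF GG(1)]
 have "s \<in> Arr S" using x' by (simp add: iso_Arr)
 hence "Comp S s (FArr F (Ide A a)) = Comp S (FArr G (Ide D d)) s" using x' FF(4) GG(4) S(9)[of s] S(10)[of s] by simp
 thus ?thesis unfolding fprod_arr_iff
  using x x' A D ftor_Ide[OF fo_src[OF F]] ftor_Ide[OF fo_src[OF G]] by simp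
qed

lemma category_fprod:
 assumes F: "functor_over B A S F" and G: "functor_over B D S G"
 shows "category (fprod B A D S F G)" (is "category ?E")
proof -
 note A = category_rules[OF ftor_dom[OF fo_ftor[OF F]]] and D = category_rules[OF ftor_dom[OF fo_ftor[OF G]]]
 show ?thesis unfolding category_def
 proof (intro conjI ballI impI)
  fix x assume "x \<in> Obj ?E"
  then obtain a d s where x: "x = (a, d, s)" "(a, d, s) \<in> fprod_obj B A D S F G" by (cases x) auto
  thus "Ide ?E x \<in> Arr ?E"
   "Dom ?E (Ide ?E x) = x" "Cod ?E (Ide ?E x) = x"
   using fprod_ide[OF F G x(2)] by simp_all
 next
  fix f assume "f \<in> Arr ?E"
  then obtain a d s a' d' s' k l where f: "f = ((a, d, s), (a', d', s'), (k, l))"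
   and f': "((a, d, s), (a', d', s'), (k, l)) \<in> Arr ?E" by (rule fprod_arr_cases)
  note r = f'[unfolded fprod_arr_iff]
  show "Dom ?E f \<in> Obj ?E" "Cod ?E f \<in> Obj ?E"
   using r by (simp_all add: f)
  show "Comp ?E f (Ide ?E (Dom ?E f)) = f"
   "Comp ?E (Ide ?E (Cod ?E f)) f = f"
   using r by (simp_all add: f A(9,10) D(9,10))
  fix h assume "h \<in> Arr ?E"
  then obtain b e t b' e' t' k' l' where h: "h = ((b, e, t), (b', e', t'), (k', l'))"
   and h': "((b, e, t), (b', e', t'), (k', l')) \<in> Arr ?E" by (rule fprod_arr_cases)
  assume "Cod ?E f = Dom ?E h"
  hence c: "b = a'" "e = d'" "t = s'" by (simp_all add: f h)
  show "Comp ?E h f \<in> Arr ?E" using fprod_comp[OF F G f'] h' c by (simp add: f h)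
  show "Dom ?E (Comp ?E h f) = Dom ?E f"
   "Cod ?E (Comp ?E h f) = Cod ?E h" by (simp_all add: f h)
 next
  fix f h j assume as: "f \<in> Arr ?E" "h \<in> Arr ?E" "j \<in> Arr ?E"
   and c: "Cod ?E f = Dom ?E h \<and> Cod ?E h = Dom ?E j"
  from as(1) obtain x y k l where f: "f = (x, y, (k, l))" by (metis surj_pair)
  from as(2) obtain y' z k' l' where h: "h = (y', z, (k', l'))" by (metis surj_pair)
  from as(3) obtain z' w k'' l'' where j: "j = (z', w, (k'', l''))" by (metis surj_pair)
  have "k \<in> Arr A \<and> k' \<in> Arr A \<and> k'' \<in> Arr A \<and> Cod A k = Dom A k' \<and> Cod A k' = Dom A k''"
   "l \<in> Arr D \<and> l' \<in> Arr D \<and> l'' \<in> Arr D \<and> Cod D l = Dom D l' \<and> Cod D l' = Dom D l''"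
   using as c unfolding f h j fprod_def by auto
  thus "Comp ?E j (Comp ?E h f) = Comp ?E (Comp ?E j h) f"
   using A(11) D(11) by (simp add: f h j)
 qed
qed

lemma is_functor_fprod:
 assumes F: "functor_over B A S F" and G: "functor_over B D S G"
 shows "is_functor (fprod B A D S F G) B (Pr (fprod B A D S F G))" (is "is_functor ?E _ _")
 unfolding is_functor_def
proof (intro conjI ballI impI category_fprod[OF F G] ftor_cod[OF fo_src[OF F]])
 note P = functor_rules[OF fo_src[OF F]]
 fix x assume "x \<in> Obj ?E"
 then obtain a d s where x: "x = (a, d, s)" "(a, d, s) \<in> fprod_obj B A D S F G" by (cases x) auto
 hence "a \<in> Obj A" by (simp add: fprod_obj_iff)
 thus "FObj (Pr ?E) x \<in> Obj B"
  "FArr (Pr ?E) (Ide ?E x) = Ide B (FObj (Pr ?E) x)"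
  using P(3,4) by (simp_all add: x)
next
 note P = functor_rules[OF fo_src[OF F]]
 fix f assume "f \<in> Arr ?E"
 then obtain a d s a' d' s' k l where f: "f = ((a, d, s), (a', d', s'), (k, l))"
  and f': "((a, d, s), (a', d', s'), (k, l)) \<in> Arr ?E" by (rule fprod_arr_cases)
 note r = f'[unfolded fprod_arr_iff]
 show "FArr (Pr ?E) f \<in> Arr B"
  "Dom B (FArr (Pr ?E) f) = FObj (Pr ?E) (Dom ?E f)"
  "Cod B (FArr (Pr ?E) f) = FObj (Pr ?E) (Cod ?E f)"
  using r P(5)[of k] P(6)[of k] P(7)[of k] by (simp_all add: f)
 fix h assume "h \<in> Arr ?E"
 then obtain b e t b' e' t' k' l' where h: "h = ((b, e, t), (b', e', t'), (k', l'))"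
  and h': "((b, e, t), (b', e', t'), (k', l')) \<in> Arr ?E" by (rule fprod_arr_cases)
 assume "Cod ?E f = Dom ?E h"
 thus "FArr (Pr ?E) (Comp ?E h f) =
   Comp B (FArr (Pr ?E) h) (FArr (Pr ?E) f)"
  using r h'[unfolded fprod_arr_iff] P(8)[of k k'] by (simp add: f h)
qed

lemma fprod_iso:
 assumes F: "functor_over B A S F" and G: "functor_over B D S G"
  and f: "((a, d, s), (a', d, s'), (k, Ide D d)) \<in> Arr (fprod B A D S F G)" and k: "iso_arrow A k"
 shows "iso_arrow (fprod B A D S F G) ((a, d, s), (a', d, s'), (k, Ide D d))"
proof -
 note r = f[unfolded fprod_arr_iff fprod_obj_iff] and K = inv_arr_rules[OF k]
 note FF = functor_rules[OF fo_ftor[OF F]] and GG = functor_rules[OF fo_ftor[OF G]]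
 note S = category_rules[OF FF(2)] and D = category_rules[OF GG(1)]
 have s: "s \<in> Arr S" "s' \<in> Arr S" using r by (simp_all add: iso_Arr)
 have e: "Comp S s' (FArr F k) = s" using r s GG(4) S(10)[of s] by simp
 have "Comp S s (FArr F (inv_arr A k)) = Comp S (Comp S s' (FArr F k)) (FArr F (inv_arr A k))" using e by simp
 also have "\<dots> = Comp S s' (Comp S (FArr F k) (FArr F (inv_arr A k)))" by (rule S(11)[symmetric]) (use r s K FF(5-7) in simp_all)
 also have "Comp S (FArr F k) (FArr F (inv_arr A k)) = FArr F (Comp A k (inv_arr A k))" by (rule FF(8)[symmetric]) (use r K in simp_all)
 also have "Comp S s' (FArr F (Comp A k (inv_arr A k))) = s'" using K r FF(4) S(9)[OF s(2), of "FObj F a'"] by simp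
 finally have 1: "Comp S s (FArr F (inv_arr A k)) = Comp S (FArr G (Ide D d)) s'" using r s GG(4) S(10)[of s'] by simp
 have v: "FArr (Pr A) k = Ide B (FObj (Pr D) d)" using r ftor_Ide[OF fo_src[OF G]] by simp
 have "FArr (Pr A) (inv_arr A k) = Ide B (FObj (Pr D) d)"
  by (rule inv_arr_vertical[OF fo_src[OF F] k v]) (use r in simp)
 hence i: "((a', d, s'), (a, d, s), (inv_arr A k, Ide D d)) \<in> Arr (fprod B A D S F G)"
  using r K 1 ftor_Ide[OF fo_src[OF G], of d] unfolding fprod_arr_iff fprod_obj_iff by simp
 show ?thesis by (rule iso_arrowI[OF f i]) (use r K D(9)[of "Ide D d" d] in simp_all)
qed

text \<open>
 The square is pasted from a square that commutes strictly, with \<open>L\<close> lifting \<open>c\<close>, and the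
 equivalence \<open>\<Phi>\<close> with quasi-inverse \<open>\<Psi>\<close>.
\<close>

theorem two_cartesian_of_equivalence:
 assumes P: "functor_over B X S P" and \<Psi>: "functor_over B M X \<Psi>" and \<Phi>: "functor_over B X M \<Phi>"
  and t: "nat_iso_over B X X (comp_ftor \<Psi> \<Phi>) id_ftor t"
  and ff: "\<And>x y h. x \<in> Obj M ==> y \<in> Obj M ==> h \<in> Arr X ==> Dom X h = FObj \<Psi> x ==> Cod X h = FObj \<Psi> y ==>
    \<exists>f. f \<in> Arr M \<and> Dom M f = x \<and> Cod M f = y \<and> FArr \<Psi> f = h"
  and fa: "\<And>f f'. f \<in> Arr M ==> f' \<in> Arr M ==> Dom M f = Dom M f' ==> Cod M f = Cod M f' ==> FArr \<Psi> f = FArr \<Psi> f' ==> f = f'"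
  and u: "functor_over B D S u" and c: "functor_over B C D c" and L: "functor_over B C X L"
  and PL: "comp_ftor P L = comp_ftor u c"
  and cfa: "\<And>h h'. h \<in> Arr C ==> h' \<in> Arr C ==> Dom C h = Dom C h' ==> Cod C h = Cod C h' ==> FArr c h = FArr c h' ==> h = h'"
  and lift: "\<And>y y' \<xi> q. y \<in> Obj C ==> y' \<in> Obj C ==> \<xi> \<in> Arr X ==> Dom X \<xi> = FObj L y ==> Cod X \<xi> = FObj L y' ==>
    q \<in> Arr D ==> Dom D q = FObj c y ==> Cod D q = FObj c y' ==> FArr P \<xi> = FArr u q ==>
    \<exists>h. h \<in> Arr C \<and> Dom C h = y \<and> Cod C h = y' \<and> FArr L h = \<xi> \<and> FArr c h = q"
  and es: "\<And>w d s. w \<in> Obj X ==> d \<in> Obj D ==> iso_arrow S s ==> Dom S s = FObj P w ==> Cod S s = FObj u d ==>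
    FArr (Pr S) s = Ide B (FObj (Pr D) d) ==> FObj (Pr X) w = FObj (Pr D) d ==>
    \<exists>y e. y \<in> Obj C \<and> FObj c y = d \<and> iso_arrow X e \<and> Dom X e = w \<and> Cod X e = FObj L y \<and> FArr P e = s"
 shows "two_cartesian B C M D S (comp_ftor \<Phi> L) c (comp_ftor P \<Psi>) u (\<lambda>y. FArr P (t (FObj L y)))"
proof -
 let ?Q = "comp_ftor P \<Psi>" and ?U = "comp_ftor \<Phi> L" and ?\<alpha> = "\<lambda>y. FArr P (t (FObj L y))"
 define E where "E = fprod B M D S ?Q u"
 define I where "I = \<lparr>FObj = (\<lambda>x. (FObj ?U x, FObj c x, ?\<alpha> x)),
    FArr = (\<lambda>f. ((FObj ?U (Dom C f), FObj c (Dom C f), ?\<alpha> (Dom C f)),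
           (FObj ?U (Cod C f), FObj c (Cod C f), ?\<alpha> (Cod C f)), (FArr ?U f, FArr c f)))\<rparr>"
 have I: "FObj I x = (FObj ?U x, FObj c x, ?\<alpha> x)"
  "FArr I f = (FObj I (Dom C f), FObj I (Cod C f), (FArr ?U f, FArr c f))" for x f by (simp_all add: I_def)
 have Q: "functor_over B M S ?Q" by (rule functor_over_comp[OF \<Psi> P])
 have U: "functor_over B C M ?U" by (rule functor_over_comp[OF L \<Phi>])
 have "nat_iso_over B C S (comp_ftor P (comp_ftor (comp_ftor \<Psi> \<Phi>) L)) (comp_ftor P (comp_ftor id_ftor L)) ?\<alpha>"
  by (rule nat_iso_over_whisker[OF nat_iso_over_prewhisker[OF t L] P])
 moreover have "comp_ftor P (comp_ftor (comp_ftor \<Psi> \<Phi>) L) = comp_ftor ?Q ?U" "comp_ftor id_ftor L = L"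
  by (simp_all add: comp_ftor_def id_ftor_def comp_def)
 ultimately have \<alpha>: "nat_iso_over B C S (comp_ftor ?Q ?U) (comp_ftor u c) ?\<alpha>" using PL by simp
 note A = nat_iso_over_rules[OF \<alpha>] and T = nat_iso_over_rules[OF t]
 note cC = ftor_dom[OF fo_ftor[OF L]] and cX = ftor_cod[OF fo_ftor[OF L]] and cM = ftor_cod[OF fo_ftor[OF \<Phi>]] and cS = ftor_cod[OF fo_ftor[OF P]]
 note CC = category_rules[OF cC] and XX = category_rules[OF cX] and SS = category_rules[OF cS] and MM = category_rules[OF cM]
  and DD = category_rules[OF ftor_dom[OF fo_ftor[OF u]]]
 note UU = functor_rules[OF fo_ftor[OF U]] and cc = functor_rules[OF fo_ftor[OF c]] and PP = functor_rules[OF fo_ftor[OF P]]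
  and LL = functor_rules[OF fo_ftor[OF L]] and \<Psi>\<Psi> = functor_rules[OF fo_ftor[OF \<Psi>]] and \<Phi>\<Phi> = functor_rules[OF fo_ftor[OF \<Phi>]]
  and uu = functor_rules[OF fo_ftor[OF u]]
 have pl: "FObj P (FObj L y) = FObj u (FObj c y)" "FArr P (FArr L h) = FArr u (FArr c h)" for y h
  using PL by (metis comp_ftor_simps)+
 have PrI: "FObj (Pr M) (FObj ?U y) = FObj (Pr C) y" "FObj (Pr D) (FObj c y) = FObj (Pr C) y" if "y \<in> Obj C" for y
  using fo_Obj[OF U that] fo_Obj[OF c that] by simp_all
 have obj: "FObj I y \<in> fprod_obj B M D S ?Q u" if y: "y \<in> Obj C" for y
  unfolding I fprod_obj_iff using A(3-6)[OF y] UU(3)[OF y] cc(3)[OF y] PrI[OF y] by simp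
 have arr: "FArr I h \<in> Arr E" if h: "h \<in> Arr C" for h
 proof -
  have "FArr (Pr M) (FArr ?U h) = FArr (Pr D) (FArr c h)" using fo_Arr[OF U h] fo_Arr[OF c h] by simp
  moreover have "Comp S (?\<alpha> (Cod C h)) (FArr ?Q (FArr ?U h)) = Comp S (FArr u (FArr c h)) (?\<alpha> (Dom C h))" using A(7)[OF h] by simp
  ultimately show ?thesis using obj[OF CC(1)[OF h]] obj[OF CC(2)[OF h]] h UU(5-7) cc(5-7) unfolding E_def I fprod_arr_iff by simp
 qed
 have IE: "functor_over B C E I" unfolding functor_over_def
 proof (intro conjI ballI)
  show "is_functor C B (Pr C)" by (rule fo_src[OF L])
  show "is_functor E B (Pr E)" unfolding E_def by (rule is_functor_fprod[OF Q u])
  show "is_functor C E I" unfolding is_functor_def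
  proof (intro conjI ballI impI cC)
   show "category E" unfolding E_def by (rule category_fprod[OF Q u])
   show "FObj I x \<in> Obj E" if "x \<in> Obj C" for x using obj[OF that] by (simp add: E_def)
   show "FArr I (Ide C x) = Ide E (FObj I x)" if "x \<in> Obj C" for x
    using that CC(4,5) UU(4) cc(4) by (simp add: E_def I)
   show "FArr I f \<in> Arr E" if "f \<in> Arr C" for f by (rule arr[OF that])
   show "Dom E (FArr I f) = FObj I (Dom C f)" "Cod E (FArr I f) = FObj I (Cod C f)" for f by (simp_all add: E_def I(2))
   show "FArr I (Comp C h f) = Comp E (FArr I h) (FArr I f)" if "f \<in> Arr C" "h \<in> Arr C" "Cod C f = Dom C h" for f h
    using CC(7,8)[OF that] UU(8)[OF that] cc(8)[OF that] by (simp add: E_def I(2))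
  qed
  show "FObj (Pr E) (FObj I x) = FObj (Pr C) x" if "x \<in> Obj C" for x using PrI[OF that] by (simp add: E_def I(1))
  show "FArr (Pr E) (FArr I f) = FArr (Pr C) f" if "f \<in> Arr C" for f using fo_Arr[OF U that] by (simp add: E_def I(2))
 qed
 have "equivalence_over B C E I" unfolding equivalence_over_def
 proof (intro conjI IE)
  have "\<exists>G s t. functor_over B E C G \<and> nat_iso_over B C C id_ftor (comp_ftor G I) s \<and> nat_iso_over B E E (comp_ftor I G) id_ftor t"
  proof (rule quasi_inverse[OF IE])
   fix y y' h assume y: "y \<in> Obj C" "y' \<in> Obj C" and h: "h \<in> Arr E" "Dom E h = FObj I y" "Cod E h = FObj I y'"
   obtain k q where hkq: "h = (FObj I y, FObj I y', (k, q))" using h unfolding E_def by (metis fprod_simps(2,3) surj_pair)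
   note r = h(1)[unfolded hkq I E_def fprod_arr_iff]
   let ?w = "FObj L y" and ?w' = "FObj L y'"
   have w: "?w \<in> Obj X" "?w' \<in> Obj X" using LL(3) y by auto
   note ti = T(3)[OF w(1)] T(3)[OF w(2)]
   have tc: "Dom X (t ?w) = FObj \<Psi> (FObj \<Phi> ?w)" "Cod X (t ?w) = ?w" "Dom X (t ?w') = FObj \<Psi> (FObj \<Phi> ?w')" "Cod X (t ?w') = ?w'"
    using T(4,5) w by simp_all
   have k: "k \<in> Arr M" "Dom M k = FObj \<Phi> ?w" "Cod M k = FObj \<Phi> ?w'" using r by simp_all
   have \<Psi>k: "FArr \<Psi> k \<in> Arr X" "Dom X (FArr \<Psi> k) = FObj \<Psi> (FObj \<Phi> ?w)" "Cod X (FArr \<Psi> k) = FObj \<Psi> (FObj \<Phi> ?w')"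
    using \<Psi>\<Psi>(5-7) k by simp_all
   \<comment> \<open>\<open>k\<close> is transported along the natural isomorphism \<open>t\<close>:
     the arrow \<open>\<xi>\<close> defined below satisfies \<open>\<xi> t = t (\<Psi> k)\<close>.
     Naturality of \<open>t\<close> and faithfulness of \<open>\<Psi>\<close> then give
     \<open>\<Phi> \<xi> = k\<close>.\<close>
   define \<zeta> where "\<zeta> = Comp X (t ?w') (FArr \<Psi> k)"
   have \<zeta>: "\<zeta> \<in> Arr X" "Dom X \<zeta> = Dom X (t ?w)" "Cod X \<zeta> = ?w'"
    unfolding \<zeta>_def using XX(6-8) \<Psi>k tc iso_Arr[OF ti(2)] by simp_all
   define \<xi> where "\<xi> = Comp X \<zeta> (inv_arr X (t ?w))"
   have \<xi>: "\<xi> \<in> Arr X" "Dom X \<xi> = ?w" "Cod X \<xi> = ?w'"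
    unfolding \<xi>_def using XX(6-8) \<zeta> inv_arr_rules[OF ti(1)] tc by simp_all
   have \<xi>t: "Comp X \<xi> (t ?w) = \<zeta>"
    unfolding \<xi>_def using XX(11)[of "t ?w" "inv_arr X (t ?w)" \<zeta>] inv_arr_rules[OF ti(1)] \<zeta> XX(9)[OF \<zeta>(1)] tc by simp
   have "Comp X (t ?w') (FArr \<Psi> (FArr \<Phi> \<xi>)) = Comp X (t ?w') (FArr \<Psi> k)"
    using T(7)[OF \<xi>(1)] \<xi> \<xi>t \<zeta>_def by simp
   hence "FArr \<Psi> (FArr \<Phi> \<xi>) = FArr \<Psi> k"
    using iso_left_cancel[OF cX ti(2)] \<Psi>k tc \<Psi>\<Psi>(5-7) \<Phi>\<Phi>(5-7) \<xi> by simp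
   hence \<Phi>\<xi>: "FArr \<Phi> \<xi> = k" using fa \<Phi>\<Phi>(5-7) \<xi> k by simp
   \<comment> \<open>The condition on an arrow of the fibre product says that \<open>P \<xi>\<close>
     and \<open>u q\<close> agree after the invertible 2-cell at \<open>y\<close>. Cancelling it
     gives the equality that \<open>lift\<close> asks for.\<close>
   have "Comp S (FArr P \<xi>) (?\<alpha> y) = Comp S (?\<alpha> y') (FArr P (FArr \<Psi> k))"
    using PP(8)[of "t ?w" \<xi>] PP(8)[of "FArr \<Psi> k" "t ?w'"] \<xi> \<xi>t \<zeta>_def iso_Arr[OF ti(1)] iso_Arr[OF ti(2)] tc \<Psi>k by simp
   also have "\<dots> = Comp S (FArr u q) (?\<alpha> y)" using r by simp
   finally have eq: "Comp S (FArr P \<xi>) (?\<alpha> y) = Comp S (FArr u q) (?\<alpha> y)" .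
   have a: "iso_arrow S (?\<alpha> y)" "Cod S (?\<alpha> y) = FObj P ?w" using A(3,5)[OF y(1)] pl by simp_all
   have q: "q \<in> Arr D" "Dom D q = FObj c y" "Cod D q = FObj c y'" using r by simp_all
   have "Dom S (FArr P \<xi>) = Cod S (?\<alpha> y)" using PP(6)[OF \<xi>(1)] \<xi>(2) a(2) by simp
   moreover have "Dom S (FArr u q) = Cod S (?\<alpha> y)" using uu(6)[OF q(1)] q(2) a(2) pl by simp
   ultimately have "Comp S (Comp S (FArr P \<xi>) (?\<alpha> y)) (inv_arr S (?\<alpha> y)) = FArr P \<xi>"
    "Comp S (Comp S (FArr u q) (?\<alpha> y)) (inv_arr S (?\<alpha> y)) = FArr u q"
    using comp_cancel[OF cS a(1) PP(5)[OF \<xi>(1)]] comp_cancel[OF cS a(1) uu(5)[OF q(1)]] by blast+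
   hence "FArr P \<xi> = FArr u q" unfolding eq by (rule trans[OF sym])
   then obtain h' where "h' \<in> Arr C" "Dom C h' = y" "Cod C h' = y'" "FArr L h' = \<xi>" "FArr c h' = q"
    using lift[OF y \<xi> q] by blast
   thus "\<exists>f. f \<in> Arr C \<and> Dom C f = y \<and> Cod C f = y' \<and> FArr I f = h" using \<Phi>\<xi> by (auto simp: I(2) hkq)
  next
   fix f f' assume "f \<in> Arr C" "f' \<in> Arr C" "Dom C f = Dom C f'" "Cod C f = Cod C f'" "FArr I f = FArr I f'"
   thus "f = f'" using cfa by (simp add: I(2))
  next
   fix o' assume "o' \<in> Obj E"
   then obtain a d s where o: "o' = (a, d, s)" "(a, d, s) \<in> fprod_obj B M D S ?Q u" unfolding E_def by (cases o') simp
   note r = o(2)[unfolded fprod_obj_iff]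
   have "\<exists>y e. y \<in> Obj C \<and> FObj c y = d \<and> iso_arrow X e \<and> Dom X e = FObj \<Psi> a \<and> Cod X e = FObj L y \<and> FArr P e = s"
    by (rule es) (use r \<Psi>\<Psi>(3) fo_Obj[OF \<Psi>] in simp_all)
   then obtain y e where y: "y \<in> Obj C" "FObj c y = d" and e: "iso_arrow X e" "Dom X e = FObj \<Psi> a" "Cod X e = FObj L y" "FArr P e = s" by blast
   let ?w = "FObj L y"
   have w: "?w \<in> Obj X" using LL(3) y by auto
   note ti = T(3)[OF w] and ei = inv_arr_rules[OF e(1)]
   have tc: "Dom X (t ?w) = FObj \<Psi> (FObj \<Phi> ?w)" "Cod X (t ?w) = ?w" using T(4,5) w by simp_all
   \<comment> \<open>\<open>e\<close> identifies \<open>\<Psi> a\<close> with \<open>L y\<close>, so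
     \<open>\<eta>\<close> is an isomorphism from \<open>\<Psi> \<Phi> L y\<close> to
     \<open>\<Psi> a\<close>. Its preimage under \<open>\<Psi>\<close> is the first component of the
     required isomorphism; the second is an identity.\<close>
   define \<eta> where "\<eta> = Comp X (inv_arr X e) (t ?w)"
   have \<eta>: "\<eta> \<in> Arr X" "Dom X \<eta> = FObj \<Psi> (FObj \<Phi> ?w)" "Cod X \<eta> = FObj \<Psi> a"
    unfolding \<eta>_def using XX(6-8) iso_Arr[OF ti] tc ei e by simp_all
   have \<eta>i: "iso_arrow X \<eta>" unfolding \<eta>_def by (rule iso_comp[OF cX ti ei(6)]) (use ei tc e in simp)
   obtain k where k: "k \<in> Arr M" "Dom M k = FObj \<Phi> ?w" "Cod M k = a" "FArr \<Psi> k = \<eta>"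
    using ff[OF \<Phi>\<Phi>(3)[OF w] _ \<eta>] r by blast
   obtain k' where k': "k' \<in> Arr M" "Dom M k' = a" "Cod M k' = FObj \<Phi> ?w" "FArr \<Psi> k' = inv_arr X \<eta>"
    using ff[OF _ \<Phi>\<Phi>(3)[OF w], of a "inv_arr X \<eta>"] inv_arr_rules[OF \<eta>i] \<eta> r by auto
   have kk: "Comp M k' k = Ide M (Dom M k)" "Comp M k k' = Ide M (Cod M k)"
    by (rule fa; use k k' MM \<Psi>\<Psi>(4,8) inv_arr_rules[OF \<eta>i] \<eta> r \<Phi>\<Phi>(3)[OF w] in simp)+
   have ki: "iso_arrow M k" by (rule iso_arrowI[OF k(1) k'(1)]) (use k k' kk in simp_all)
   have "Comp X e \<eta> = t ?w" unfolding \<eta>_def by (rule comp_cancel_left[OF cX e(1) iso_Arr[OF ti]]) (use tc e in simp)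
   hence "Comp S s (FArr P \<eta>) = ?\<alpha> y" using PP(8)[of \<eta> e] \<eta> e iso_Arr[OF e(1)] by metis
   moreover have "Comp S (FArr u (Ide D d)) (?\<alpha> y) = ?\<alpha> y"
    using uu(4)[of d] r SS(10)[OF iso_Arr[OF A(3)[OF y(1)]]] A(5)[OF y(1)] y by simp
   moreover have "FArr (Pr M) k = FArr (Pr D) (Ide D d)"
   proof -
    have "FArr (Pr X) e = Ide B (FObj (Pr D) d)" using fo_Arr[OF P iso_Arr[OF e(1)]] e(4) r by simp
    moreover have 0: "FObj (Pr X) (Dom X e) = FObj (Pr D) d" using fo_Obj[OF \<Psi>] e r by simp
    ultimately have 1: "FArr (Pr X) (inv_arr X e) = Ide B (FObj (Pr D) d)" by (rule inv_arr_vertical[OF fo_src[OF P] e(1)])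
    have "FObj (Pr X) ?w = FObj (Pr D) d" using fo_Obj[OF L y(1)] PrI(2)[OF y(1)] y(2) by simp
    hence 2: "FArr (Pr X) (t ?w) = Ide B (FObj (Pr D) d)" using T(6)[OF w] by simp
    have b: "FObj (Pr D) d \<in> Obj B" using ftor_Obj[OF fo_src[OF u]] r by blast
    note BB = category_rules[OF ftor_cod[OF fo_src[OF u]]]
    have "FArr (Pr X) \<eta> = Comp B (Ide B (FObj (Pr D) d)) (Ide B (FObj (Pr D) d))"
     unfolding \<eta>_def using ftor_Comp[OF fo_src[OF P] iso_Arr[OF ti] ei(1)] ei tc e 1 2 by simp
    also have "\<dots> = Ide B (FObj (Pr D) d)" by (rule BB(10)) (simp_all add: BB(3,5)[OF b])
    finally show ?thesis using fo_Arr[OF \<Psi> k(1)] k(4) ftor_Ide[OF fo_src[OF u], of d] r by simp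
   qed
   ultimately have f: "((FObj ?U y, d, ?\<alpha> y), (a, d, s), (k, Ide D d)) \<in> Arr (fprod B M D S ?Q u)"
    using obj[OF y(1)] o(2) k r DD(3-5) y unfolding fprod_arr_iff I by simp
   show "\<exists>c e. c \<in> Obj C \<and> iso_arrow E e \<and> Dom E e = FObj I c \<and> Cod E e = o' \<and> FArr (Pr E) e = Ide B (FObj (Pr E) o')"
    using fprod_iso[OF Q u f ki] y f[unfolded fprod_arr_iff] r ftor_Ide[OF fo_src[OF u], of d]
    by (intro exI[of _ y] exI[of _ "((FObj ?U y, d, ?\<alpha> y), (a, d, s), (k, Ide D d))"]) (simp add: E_def I o(1))
  qed
  thus "\<exists>G. functor_over B E C G \<and> (\<exists>t. nat_iso_over B C C id_ftor (comp_ftor G I) t) \<and> (\<exists>t. nat_iso_over B E E (comp_ftor I G) id_ftor t)"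
   by blast
 qed
 thus ?thesis unfolding two_cartesian_def E_def I_def using U c Q u \<alpha> by simp
qed

section \<open>The cartesian squares\<close>

text \<open>The unique section over the pulled back curve that maps to the given point; it exists
  and is unique because the map of cones is bijective on points with prescribed base.\<close>

definition lifted_section ::
 "('v::real_vector slice_obj, 'v slice_arr, ('x, 'v) mtrop_obj, ('x, 'v) mtrop_arr) ftor
   \<Rightarrow> ('x, 'v) mtrop_obj \<Rightarrow> ('x, 'v) cone_obj \<Rightarrow> ('x, 'v) cpoint set" where
 "lifted_section u X y = (SOME s. (\<exists>T G. FObj u (FObj cone_proj y) = (T, G) \<and> s \<in> cone_sections T G) \<and>
   cone_map (to_base u X y) (fst y) s = snd y)"

text \<open>The morphism \<open>Cone(\<Gamma>) \<rightarrow> \<X>\<close>: a \<open>\<tau>\<close>-valued point is a section of the cone over the pulled back curve.\<close>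

definition cone_lift ::
 "('v::real_vector slice_obj, 'v slice_arr, ('x, 'v) mtrop_obj, ('x, 'v) mtrop_arr) ftor
   \<Rightarrow> ('x, 'v) mtrop_obj \<Rightarrow> (('x, 'v) cone_obj, ('x, 'v) cone_arr, ('x, 'v) xtrop_obj, ('x, 'v) xtrop_arr) ftor" where
 "cone_lift u X = \<lparr>
   FObj = (\<lambda>y. case FObj u (FObj cone_proj y) of (T, G) \<Rightarrow> (T, G, lifted_section u X y)),
   FArr = (\<lambda>h. case FArr u (FArr cone_proj h) of ((T, G), (T', G'), k) \<Rightarrow>
    ((T, G, lifted_section u X (fst h)), (T', G', lifted_section u X (fst (snd h))), k))\<rparr>"

lemma proj_cone_lift: "comp_ftor xtrop_proj (cone_lift u X) = comp_ftor u cone_proj"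
 by (simp add: comp_ftor_def xtrop_proj_def cone_lift_def fun_eq_iff split: prod.split)

lemma proj_cone_lift_simps:
 "FObj xtrop_proj (FObj (cone_lift u X) y) = FObj u (FObj cone_proj y)"
 "FArr xtrop_proj (FArr (cone_lift u X) h) = FArr u (FArr cone_proj h)"
 by (simp_all add: xtrop_proj_def cone_lift_def split: prod.split)

lemma Xtrop_arr_eqI:
 assumes "\<xi> \<in> Arr (Xtrop g n)" "\<xi>' \<in> Arr (Xtrop g n)" "Dom (Xtrop g n) \<xi> = Dom (Xtrop g n) \<xi>'"
  "Cod (Xtrop g n) \<xi> = Cod (Xtrop g n) \<xi>'" "FArr xtrop_proj \<xi> = FArr xtrop_proj \<xi>'"
 shows "\<xi> = \<xi>'"
proof -
 obtain S G s S' G' s' f P where e: "\<xi> = ((S, G, s), (S', G', s'), (f, P))" by (rule Xtrop_arr_cases[OF assms(1)])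
 obtain S1 G1 s1 S1' G1' s1' f1 P1 where e1: "\<xi>' = ((S1, G1, s1), (S1', G1', s1'), (f1, P1))" by (rule Xtrop_arr_cases[OF assms(2)])
 show ?thesis using assms(3-5) unfolding e e1 by simp
qed

text \<open>Over a fixed morphism of cones only the graph maps can differ, and the surjective graph
  map of \<open>b\<close> cancels.\<close>

lemma mtrop_cancel:
 assumes a: "a \<in> mtrop_arr g n" "a' \<in> mtrop_arr g n" and b: "b \<in> mtrop_arr g n"
  and d: "Dom (Mtrop g n) a = Dom (Mtrop g n) a'" "Cod (Mtrop g n) a = Dom (Mtrop g n) b" "Cod (Mtrop g n) a' = Dom (Mtrop g n) b"
  and p: "FArr (Pr (Mtrop g n)) a = FArr (Pr (Mtrop g n)) a'" and eq: "Comp (Mtrop g n) b a = Comp (Mtrop g n) b a'"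
 shows "a = a'"
proof -
 obtain S G S' G' f P where e: "a = ((S, G), (S', G'), (f, P))" "marr g n S G S' G' f P"
  using a(1) by (rule mtrop_arr_cases)
 obtain S1 G1 S1' G1' f1 P1 where e1: "a' = ((S1, G1), (S1', G1'), (f1, P1))" "marr g n S1 G1 S1' G1' f1 P1"
  using a(2) by (rule mtrop_arr_cases)
 obtain S2 G2 S2' G2' f2 P2 where e2: "b = ((S2, G2), (S2', G2'), (f2, P2))" "marr g n S2 G2 S2' G2' f2 P2"
  using b by (rule mtrop_arr_cases)
 note h = d p eq
 have "P = P1"
 proof (rule mtrop_faithful)
  show "marr g n S' G' S2' G2' f2 P2" using e2(2) h unfolding e(1) e1(1) e2(1) by simp
  show "P \<in> extensional (Cells G')" "P1 \<in> extensional (Cells G')"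
   using contr_ext[OF arr_contr[OF e(2)]] contr_ext[OF arr_contr[OF e1(2)]] h unfolding e(1) e1(1) e2(1) by simp_all
  show "compose (Cells G2') P P2 = compose (Cells G2') P1 P2" using h unfolding e(1) e1(1) e2(1) by simp
 qed
 thus ?thesis using h unfolding e(1) e1(1) e2(1) by simp
qed

text \<open>A point of \<open>Cone(\<Gamma>')\<close> is determined by its base and its image in \<open>Cone(\<Gamma>\<^sub>0)\<close>.\<close>

lemma section_transfer:
 assumes a: "marr g n T G T' G' h P" and b: "marr g n T' G' S G0 p P'"
  and s: "s \<in> cone_sections T G" and s': "s' \<in> cone_sections T' G'"
 shows "cone_map ((T, G), (T', G'), (h, P)) T s = cone_pull T' G' T h s' \<longleftrightarrow>
  cone_map (Comp (Mtrop g n) ((T', G'), (S, G0), (p, P')) ((T, G), (T', G'), (h, P))) T s =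
  cone_pull S G0 T h (cone_map ((T', G'), (S, G0), (p, P')) T' s')"
proof -
 note r = obj_cone[OF arr_dom[OF a]] obj_cone[OF arr_cod[OF a]] and h = arr_hom[OF a]
 note S = s[unfolded sections_iff] s'[unfolded sections_iff]
 let ?l = "cone_map ((T, G), (T', G'), (h, P)) T s" and ?r = "cone_pull T' G' T h s'" and ?b = "((T', G'), (S, G0), (p, P'))"
 have l: "?l \<in> cone_pts T' G' T" "cone_base ?l = h"
  using cone_map_pts[OF a r(1)] cone_map_base[OF a r(1)] S comp_rpc_id[OF h] by simp_all
 have rr: "?r \<in> cone_pts T' G' T" "cone_base ?r = h"
  using cone_pullD[OF arr_cod[OF a] r _ h] S rpc_id_comp[OF h] by simp_all
 have "cone_map ?b T ?l = cone_map (Comp (Mtrop g n) ?b ((T, G), (T', G'), (h, P))) T s"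
  using cone_map_comp[OF a b r(1)] S by simp
 moreover have "cone_map ?b T ?r = cone_pull S G0 T h (cone_map ?b T' s')"
  using cone_map_pull[OF b r(2) _ r(1) h] S by simp
 moreover have "?l = ?r \<longleftrightarrow> cone_map ?b T ?l = cone_map ?b T ?r" using cone_map_inj[OF b r(1) l(1) rr(1)] l(2) rr(2) by auto
 ultimately show ?thesis by simp
qed

lemma slice_arrow:
 assumes u: "functor_over RPC (slice S) (Mtrop g n) u" and q: "((T, p), (T', p'), h) \<in> Arr (slice S)"
 obtains G G' P where "FObj u (T, p) = (T, G)" "FObj u (T', p') = (T', G')"
  "FArr u ((T, p), (T', p'), h) = ((T, G), (T', G'), (h, P))" "marr g n T G T' G' h P"
proof -
 note U = functor_rules[OF fo_ftor[OF u]]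
 have a: "FArr u ((T, p), (T', p'), h) \<in> mtrop_arr g n" using U(5)[OF q] by simp
 then obtain T1 G T2 G' h1 P where e: "FArr u ((T, p), (T', p'), h) = ((T1, G), (T2, G'), (h1, P))" by (rule mtrop_arr_cases)
 have "FArr (Pr (Mtrop g n)) (FArr u ((T, p), (T', p'), h)) = (T, T', h)" using fo_Arr[OF u q] by simp
 hence i: "T1 = T" "T2 = T'" "h1 = h" unfolding e by simp_all
 have "FObj u (T, p) = (T, G)" "FObj u (T', p') = (T', G')" using U(6,7)[OF q] unfolding e i by simp_all
 thus thesis using that e a unfolding i by metis
qed

text \<open>In the slice, each \<open>(T, p)\<close> has the arrow \<open>p\<close> to
  \<open>slice_id S\<close>. The functor \<open>u\<close> turns it into an arrow from its chosen
  pulled back curve to the given one, along which points can be lifted.\<close>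

lemma classified_to_base:
 assumes X: "mobj g n S G" and u: "classifies g n (S, G) u" and y: "is_rpcone T" "K \<in> cone_pts S G T"
 obtains G0 P where "FObj u (FObj cone_proj (T, K)) = (T, G0)"
  "to_base u (S, G) (T, K) = ((T, G0), (S, G), (cone_base K, P))"
  "((T, G0), (S, G), (cone_base K, P)) \<in> mtrop_arr g n"
  "lifted_section u (S, G) (T, K) \<in> cone_sections T G0"
  "cone_map ((T, G0), (S, G), (cone_base K, P)) T (lifted_section u (S, G) (T, K)) = K"
  "FObj (cone_lift u (S, G)) (T, K) = (T, G0, lifted_section u (S, G) (T, K))"
proof -
 note r = obj_cone[OF X] and u' = u[unfolded classifies_def, simplified]
 have p: "cone_base K \<in> rpc_hom T S" using cone_base_hom[OF X y(1) y rpc_id_in[OF y(1)]] .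
 have q: "((T, cone_base K), (S, rpc_id S), cone_base K) \<in> Arr (slice S)"
  using p y r rpc_id_in[OF r] rpc_id_comp[OF p] by simp
 obtain G1 G2 P where 1: "FObj u (T, cone_base K) = (T, G1)" "FObj u (S, rpc_id S) = (S, G2)"
  "FArr u ((T, cone_base K), (S, rpc_id S), cone_base K) = ((T, G1), (S, G2), (cone_base K, P))"
  "((T, G1), (S, G2), (cone_base K, P)) \<in> mtrop_arr g n"
  by (rule slice_arrow[OF conjunct1[OF u'] q])
 have g2: "G2 = G" using 1(2) u' by (simp add: slice_id_def)
 note a = 1(4)[unfolded g2]
 have tb: "to_base u (S, G) (T, K) = ((T, G1), (S, G), (cone_base K, P))" using 1(3) g2 by (simp add: to_base_def slice_id_def)
 \<comment> \<open>\<open>K\<close> lies over \<open>cone_base K o rpc_id T\<close>, so it is the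
   image of a point over the identity, that is, of a section.\<close>
 obtain s where "s \<in> cone_pts T G1 T" "cone_base s = rpc_id T" "cone_map ((T, G1), (S, G), (cone_base K, P)) T s = K"
  using cone_map_surj[OF a y(1) y(2) rpc_id_in[OF y(1)] comp_rpc_id[OF p, symmetric]] by blast
 hence "(\<exists>T1 G'. FObj u (FObj cone_proj (T, K)) = (T1, G') \<and> s \<in> cone_sections T1 G') \<and>
   cone_map (to_base u (S, G) (T, K)) (fst (T, K)) s = snd (T, K)" using 1(1) tb by (simp add: sections_iff)
 hence "(\<exists>T1 G'. FObj u (FObj cone_proj (T, K)) = (T1, G') \<and> lifted_section u (S, G) (T, K) \<in> cone_sections T1 G') \<and>
   cone_map (to_base u (S, G) (T, K)) (fst (T, K)) (lifted_section u (S, G) (T, K)) = snd (T, K)"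
  unfolding lifted_section_def by (rule someI)
 hence L: "lifted_section u (S, G) (T, K) \<in> cone_sections T G1"
  "cone_map ((T, G1), (S, G), (cone_base K, P)) T (lifted_section u (S, G) (T, K)) = K" using 1(1) tb by simp_all
 show thesis by (rule that[OF _ tb a L]) (use 1(1) in \<open>simp_all add: cone_lift_def\<close>)
qed

lemma to_base_rules:
 assumes X: "X \<in> Obj (Mtrop g n)" and u: "classifies g n X u" and y: "y \<in> Obj (Cone (fst X) (snd X))"
 shows to_base_Arr: "to_base u X y \<in> Arr (Mtrop g n)"
  and to_base_Dom: "Dom (Mtrop g n) (to_base u X y) = FObj xtrop_proj (FObj (cone_lift u X) y)"
  and to_base_Cod: "Cod (Mtrop g n) (to_base u X y) = X"
  and to_base_Pr: "FArr (Pr (Mtrop g n)) (to_base u X y) = (fst y, fst X, cone_base (snd y))"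
  and cone_lift_obj: "FObj (cone_lift u X) y \<in> Obj (Xtrop g n)"
  and cone_lift_fst: "fst (FObj (cone_lift u X) y) = fst y"
proof -
 obtain S G T K where e: "X = (S, G)" "y = (T, K)" by (cases X; cases y)
 have "mobj g n S G" "classifies g n (S, G) u" "is_rpcone T" "K \<in> cone_pts S G T" using X u y by (simp_all add: e)
 then obtain G1 P where c: "FObj u (FObj cone_proj (T, K)) = (T, G1)"
  "to_base u (S, G) (T, K) = ((T, G1), (S, G), (cone_base K, P))"
  "((T, G1), (S, G), (cone_base K, P)) \<in> mtrop_arr g n" "lifted_section u (S, G) (T, K) \<in> cone_sections T G1"
  "FObj (cone_lift u (S, G)) (T, K) = (T, G1, lifted_section u (S, G) (T, K))" by (rule classified_to_base)
 show "to_base u X y \<in> Arr (Mtrop g n)" "Dom (Mtrop g n) (to_base u X y) = FObj xtrop_proj (FObj (cone_lift u X) y)"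
  "Cod (Mtrop g n) (to_base u X y) = X" "FArr (Pr (Mtrop g n)) (to_base u X y) = (fst y, fst X, cone_base (snd y))"
  "FObj (cone_lift u X) y \<in> Obj (Xtrop g n)" "fst (FObj (cone_lift u X) y) = fst y"
  using c arr_dom[OF c(3)] by (simp_all add: e)
qed

text \<open>By \<open>section_transfer\<close> the compatibility of lifted sections may be tested in
  the cone of the target curve, where the lifted section over \<open>z\<close> has become the point
  of \<open>z\<close> itself.\<close>

lemma cone_lift_arr_iff:
 assumes X: "X \<in> Obj (Mtrop g n)" and u: "classifies g n X u"
  and Y: "Y \<in> Obj (Mtrop g n)" and v: "classifies g n Y v"
  and y: "y \<in> Obj (Cone (fst X) (snd X))" and z: "z \<in> Obj (Cone (fst Y) (snd Y))"
  and a: "a \<in> Arr (Mtrop g n)" "Dom (Mtrop g n) a = FObj u (FObj cone_proj y)" "Cod (Mtrop g n) a = FObj v (FObj cone_proj z)"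
 shows "(FObj (cone_lift u X) y, FObj (cone_lift v Y) z, snd (snd a)) \<in> Arr (Xtrop g n) \<longleftrightarrow>
  cone_map (Comp (Mtrop g n) (to_base v Y z) a) (fst y) (lifted_section u X y) = cone_pull (fst Y) (snd Y) (fst y) (fst (snd (snd a))) (snd z)"
  and "FArr xtrop_proj (FObj (cone_lift u X) y, FObj (cone_lift v Y) z, snd (snd a)) = a"
proof -
 obtain S G T K where e: "X = (S, G)" "y = (T, K)" by (cases X; cases y)
 have "mobj g n S G" "classifies g n (S, G) u" "is_rpcone T" "K \<in> cone_pts S G T" using X u y by (simp_all add: e)
 then obtain G1 P where c: "FObj u (FObj cone_proj (T, K)) = (T, G1)" "lifted_section u (S, G) (T, K) \<in> cone_sections T G1"
  "FObj (cone_lift u (S, G)) (T, K) = (T, G1, lifted_section u (S, G) (T, K))" by (rule classified_to_base)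
 obtain S' G' T' K' where e': "Y = (S', G')" "z = (T', K')" by (cases Y; cases z)
 have "mobj g n S' G'" "classifies g n (S', G') v" "is_rpcone T'" "K' \<in> cone_pts S' G' T'" using Y v z by (simp_all add: e')
 then obtain G1' P' where c': "FObj v (FObj cone_proj (T', K')) = (T', G1')" "to_base v (S', G') (T', K') = ((T', G1'), (S', G'), (cone_base K', P'))"
  "((T', G1'), (S', G'), (cone_base K', P')) \<in> mtrop_arr g n" "lifted_section v (S', G') (T', K') \<in> cone_sections T' G1'"
  "cone_map ((T', G1'), (S', G'), (cone_base K', P')) T' (lifted_section v (S', G') (T', K')) = K'"
  "FObj (cone_lift v (S', G')) (T', K') = (T', G1', lifted_section v (S', G') (T', K'))" by (rule classified_to_base)
 obtain Sa Ga Sa' Ga' f R where ea: "a = ((Sa, Ga), (Sa', Ga'), (f, R))" using a(1) unfolding Mtrop_simps by (rule mtrop_arr_cases)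
 have ia: "Sa = T" "Ga = G1" "Sa' = T'" "Ga' = G1'" using a(2,3) c(1) c'(1) unfolding e e' ea by simp_all
 have a': "marr g n T G1 T' G1' f R" using a(1) unfolding ea ia by simp
 show "(FObj (cone_lift u X) y, FObj (cone_lift v Y) z, snd (snd a)) \<in> Arr (Xtrop g n) \<longleftrightarrow>
  cone_map (Comp (Mtrop g n) (to_base v Y z) a) (fst y) (lifted_section u X y) = cone_pull (fst Y) (snd Y) (fst y) (fst (snd (snd a))) (snd z)"
  using section_transfer[OF a' c'(3) c(2) c'(4)] c c' a' unfolding e e' ea ia by simp
 show "FArr xtrop_proj (FObj (cone_lift u X) y, FObj (cone_lift v Y) z, snd (snd a)) = a"
  using c c' unfolding e e' ea ia by simp
qed

lemma lifted_section_map: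
 assumes X: "X \<in> Obj (Mtrop g n)" and u: "classifies g n X u" and y: "y \<in> Obj (Cone (fst X) (snd X))"
 shows "cone_map (to_base u X y) (fst y) (lifted_section u X y) = snd y" (is ?L)
proof -
 obtain S G T K where e: "X = (S, G)" "y = (T, K)" by (cases X; cases y)
 have "mobj g n S G" "classifies g n (S, G) u" "is_rpcone T" "K \<in> cone_pts S G T" using X u y by (simp_all add: e)
 then obtain G1 P where
  "to_base u (S, G) (T, K) = ((T, G1), (S, G), (cone_base K, P))"
  "cone_map ((T, G1), (S, G), (cone_base K, P)) T (lifted_section u (S, G) (T, K)) = K" by (rule classified_to_base)
 thus ?L by (simp add: e)
qed

lemma Cone_arr_cases:
 assumes "h \<in> Arr (Cone S G)"
 obtains T K T' K' k where "h = ((T, K), (T', K'), k)"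
 using assms by (metis surj_pair)

text \<open>In the slice \<open>q\<close> and the two arrows to \<open>slice_id\<close> form a
  commuting triangle; \<open>u\<close> preserves it.\<close>

lemma to_base_natural:
 assumes X: "X \<in> Obj (Mtrop g n)" and u: "classifies g n X u"
  and y: "y \<in> Obj (Cone (fst X) (snd X))" "y' \<in> Obj (Cone (fst X) (snd X))"
  and q: "q \<in> Arr (slice (fst X))" "Dom (slice (fst X)) q = FObj cone_proj y" "Cod (slice (fst X)) q = FObj cone_proj y'"
 shows "Comp (Mtrop g n) (to_base u X y') (FArr u q) = to_base u X y"
  and "fst (snd (snd (FArr u q))) = snd (snd q)"
proof -
 obtain S G T K T' K' where e: "X = (S, G)" "y = (T, K)" "y' = (T', K')" by (cases X; cases y; cases y')
 obtain h where q': "q = ((T, cone_base K), (T', cone_base K'), h)"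
  using q(2,3) unfolding e by (cases q) (auto simp: slice_def)
 have u': "functor_over RPC (slice S) (Mtrop g n) u" using u by (simp add: classifies_def e)
 have r: "is_rpcone S" using X obj_cone by (simp add: e) blast
 have qa: "((T, cone_base K), (T', cone_base K'), h) \<in> Arr (slice S)" using q(1) by (simp add: q' e)
 have "((T', cone_base K'), slice_id S, cone_base K') \<in> Arr (slice S)"
  using qa r rpc_id_in[OF r] rpc_id_comp[of "cone_base K'" T' S] by (simp add: slice_id_def)
 from ftor_Comp[OF fo_ftor[OF u'] qa this] show "Comp (Mtrop g n) (to_base u X y') (FArr u q) = to_base u X y"
  using qa by (simp add: to_base_def e q')
 show "fst (snd (snd (FArr u q))) = snd (snd q)" using slice_arrow[OF u' qa] unfolding q' by (metis fst_conv snd_conv)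
qed

lemma cone_lift_arr:
 assumes X: "X \<in> Obj (Mtrop g n)" and u: "classifies g n X u" and h: "h \<in> Arr (Cone (fst X) (snd X))"
 shows "FArr (cone_lift u X) h \<in> Arr (Xtrop g n)"
  and "FArr (cone_lift u X) h = (FObj (cone_lift u X) (fst h), FObj (cone_lift u X) (fst (snd h)), snd (snd (FArr u (FArr cone_proj h))))"
proof -
 obtain S G where eX: "X = (S, G)" by (cases X)
 obtain T K T' K' k where e: "h = ((T, K), (T', K'), k)" by (rule Cone_arr_cases[OF h])
 have X': "mobj g n S G" using X by (simp add: eX)
 have u': "functor_over RPC (slice S) (Mtrop g n) u" using u by (simp add: classifies_def eX)
 note U = functor_rules[OF fo_ftor[OF u']] and c = functor_rules[OF fo_ftor[OF functor_cone_proj[OF X']]]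
 have h': "h \<in> Arr (Cone S G)" "h \<in> Arr (Cone (fst X) (snd X))" using h by (simp_all add: eX)
 have y: "(T, K) \<in> Obj (Cone (fst X) (snd X))" "(T', K') \<in> Obj (Cone (fst X) (snd X))" using h' by (simp_all add: e eX)
 let ?q = "FArr cone_proj h"
 have q: "?q \<in> Arr (slice (fst X))" "Dom (slice (fst X)) ?q = FObj cone_proj (T, K)" "Cod (slice (fst X)) ?q = FObj cone_proj (T', K')"
  using c(5-7)[OF h'(1)] by (simp_all add: eX e)
 note q' = q[unfolded eX fst_conv]
 have a: "FArr u ?q \<in> Arr (Mtrop g n)" "Dom (Mtrop g n) (FArr u ?q) = FObj u (FObj cone_proj (T, K))"
  "Cod (Mtrop g n) (FArr u ?q) = FObj u (FObj cone_proj (T', K'))" using U(5-7)[OF q'(1)] q'(2,3) by simp_all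
 show eq: "FArr (cone_lift u X) h = (FObj (cone_lift u X) (fst h), FObj (cone_lift u X) (fst (snd h)), snd (snd (FArr u ?q)))"
  using a(2,3) unfolding cone_lift_def e by (auto simp: Mtrop_def split: prod.splits)
 have "cone_map (Comp (Mtrop g n) (to_base u X (T', K')) (FArr u ?q)) T (lifted_section u X (T, K)) = K"
  using to_base_natural(1)[OF X u y q] lifted_section_map[OF X u y(1)] by simp
 moreover have "fst (snd (snd (FArr u ?q))) = k" using to_base_natural(2)[OF X u y q] by (simp add: e)
 moreover have "cone_pull S G T k K' = K" using h' by (simp add: e)
 ultimately show "FArr (cone_lift u X) h \<in> Arr (Xtrop g n)"
  unfolding eq using cone_lift_arr_iff(1)[OF X u X u y a] by (simp add: e eX)
qed

lemma functor_cone_lift: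
 fixes X :: "('x, 'v::real_vector) mtrop_obj"
 assumes X: "X \<in> Obj (Mtrop g n)" and u: "classifies g n X u"
 shows "functor_over RPC (Cone (fst X) (snd X)) (Xtrop g n) (cone_lift u X)" (is "functor_over _ _ ?X _")
proof -
 obtain S G where eX: "X = (S, G)" by (cases X)
 let ?C = "Cone (fst X) (snd X)" and ?L = "cone_lift u X"
 have X': "mobj g n S G" using X by (simp add: eX)
 have u': "functor_over RPC (slice S) (Mtrop g n) u" using u by (simp add: classifies_def eX)
 have fP: "functor_over RPC (Xtrop g n :: ('x, 'v) xtrop_cat) (Mtrop g n) xtrop_proj" by (rule functor_xtrop_proj)
 note PP = functor_rules[OF fo_ftor[OF fP]]
 note XC = category_rules[OF PP(1)]
 have uc: "is_functor ?C (Mtrop g n) (comp_ftor xtrop_proj ?L)"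
  unfolding proj_cone_lift eX fst_conv snd_conv by (rule fo_ftor[OF functor_over_comp[OF functor_cone_proj[OF X'] u']])
 note UC = functor_rules[OF uc, simplified comp_ftor_simps]
 have L: "FArr ?L h \<in> Arr ?X" "Dom ?X (FArr ?L h) = FObj ?L (Dom ?C h)" "Cod ?X (FArr ?L h) = FObj ?L (Cod ?C h)"
  if h: "h \<in> Arr ?C" for h
 proof -
  obtain T K T' K' k where e: "h = ((T, K), (T', K'), k)" by (rule Cone_arr_cases[OF h])
  show "FArr ?L h \<in> Arr ?X" by (rule cone_lift_arr(1)[OF X u h])
  show "Dom ?X (FArr ?L h) = FObj ?L (Dom ?C h)" "Cod ?X (FArr ?L h) = FObj ?L (Cod ?C h)"
   unfolding cone_lift_arr(2)[OF X u h] by (simp_all add: e)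
 qed
 have O: "FObj ?L y \<in> Obj ?X" if "y \<in> Obj ?C" for y using cone_lift_obj[OF X u that] .
 show ?thesis unfolding functor_over_def
 proof (intro conjI ballI is_functor_Xtrop)
  show "is_functor ?C RPC (Pr ?C)" using is_functor_Cone[OF X'] by (simp add: eX)
  show "is_functor ?C ?X ?L" unfolding is_functor_def
  proof (intro conjI ballI impI category_Xtrop)
   show "category ?C" using category_Cone[OF X'] by (simp add: eX)
   note CC = category_rules[OF this]
   show "FObj ?L y \<in> Obj ?X" if "y \<in> Obj ?C" for y by (rule O[OF that])
   show "FArr ?L h \<in> Arr ?X" "Dom ?X (FArr ?L h) = FObj ?L (Dom ?C h)" "Cod ?X (FArr ?L h) = FObj ?L (Cod ?C h)"
    if "h \<in> Arr ?C" for h using L[OF that] by auto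
   show "FArr ?L (Ide ?C y) = Ide ?X (FObj ?L y)" if y: "y \<in> Obj ?C" for y
    by (rule Xtrop_arr_eqI[where g = g and n = n]) (use y L[OF CC(3)[OF y]] CC(4,5)[OF y] XC(3-5)[OF O[OF y]] UC(4)[OF y] PP(4)[OF O[OF y]] in simp_all)
   show "FArr ?L (Comp ?C h' h) = Comp ?X (FArr ?L h') (FArr ?L h)"
    if hh: "h \<in> Arr ?C" "h' \<in> Arr ?C" "Cod ?C h = Dom ?C h'" for h h'
    by (rule Xtrop_arr_eqI[where g = g and n = n]) (use L[OF CC(6)[OF hh]] CC(7,8)[OF hh] L[OF hh(1)] L[OF hh(2)] hh(3)
      XC(6-8)[of "FArr ?L h" "FArr ?L h'"] UC(8)[OF hh] PP(8)[of "FArr ?L h" "FArr ?L h'"] in simp_all)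
  qed
  show "FObj (Pr ?X) (FObj ?L y) = FObj (Pr ?C) y" if "y \<in> Obj ?C" for y
   using cone_lift_fst[OF X u that] by (simp add: Xtrop_def)
  show "FArr (Pr ?X) (FArr ?L h) = FArr (Pr ?C) h" if h: "h \<in> Arr ?C" for h
  proof -
   have "FArr (Pr ?X) (FArr ?L h) = FArr (Pr (Mtrop g n)) (FArr (comp_ftor xtrop_proj ?L) h)"
    using fo_Arr[OF fP L(1)[OF h]] by simp
   also have "\<dots> = FArr (Pr ?C) h" unfolding proj_cone_lift
    using fo_Arr[OF functor_over_comp[OF functor_cone_proj[OF X'] u'], of h] h by (simp add: eX)
   finally show ?thesis .
  qed
 qed
qed

lemma cone_lift_full:
 assumes X: "X \<in> Obj (Mtrop g n)" and u: "classifies g n X u"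
  and y: "y \<in> Obj (Cone (fst X) (snd X))" "y' \<in> Obj (Cone (fst X) (snd X))"
  and \<xi>: "\<xi> \<in> Arr (Xtrop g n)" "Dom (Xtrop g n) \<xi> = FObj (cone_lift u X) y" "Cod (Xtrop g n) \<xi> = FObj (cone_lift u X) y'"
  and q: "q \<in> Arr (slice (fst X))" "Dom (slice (fst X)) q = FObj cone_proj y" "Cod (slice (fst X)) q = FObj cone_proj y'"
  and eq: "FArr xtrop_proj \<xi> = FArr u q"
 shows "\<exists>h. h \<in> Arr (Cone (fst X) (snd X)) \<and> Dom (Cone (fst X) (snd X)) h = y \<and> Cod (Cone (fst X) (snd X)) h = y' \<and>
  FArr (cone_lift u X) h = \<xi> \<and> FArr cone_proj h = q"
proof -
 obtain S G T K T' K' where e: "X = (S, G)" "y = (T, K)" "y' = (T', K')" by (cases X; cases y; cases y')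
 obtain k where q': "q = ((T, cone_base K), (T', cone_base K'), k)"
  using q(2,3) unfolding e by (cases q) (auto simp: slice_def)
 have u': "functor_over RPC (slice S) (Mtrop g n) u" using u by (simp add: classifies_def e)
 have q1: "q \<in> Arr (slice S)" "Dom (slice S) q = FObj cone_proj y" "Cod (slice S) q = FObj cone_proj y'" using q by (simp_all add: e)
 have a: "FArr u q \<in> Arr (Mtrop g n)" "Dom (Mtrop g n) (FArr u q) = FObj u (FObj cone_proj y)"
  "Cod (Mtrop g n) (FArr u q) = FObj u (FObj cone_proj y')"
  using functor_rules(5-7)[OF fo_ftor[OF u'] q1(1)] q1(2,3) by simp_all
 have \<xi>': "\<xi> = (FObj (cone_lift u X) y, FObj (cone_lift u X) y', snd (snd (FArr u q)))"
 proof -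
  obtain S1 G1 s1 S2 G2 s2 f P where x: "\<xi> = ((S1, G1, s1), (S2, G2, s2), (f, P))"
   by (rule Xtrop_arr_cases[OF \<xi>(1)])
  have "snd (snd (FArr u q)) = (f, P)" unfolding eq[symmetric] x by simp
  thus ?thesis using \<xi>(2,3) x by simp
 qed
 have "cone_pull S G T k K' = K"
  using cone_lift_arr_iff(1)[OF X u X u y a] \<xi>(1) \<xi>' to_base_natural[OF X u y q] lifted_section_map[OF X u y(1)]
  by (simp add: e q')
 hence h: "(y, y', k) \<in> Arr (Cone (fst X) (snd X))" using y q1(1) unfolding e q' by simp
 have c: "FArr cone_proj (y, y', k) = q" by (simp add: e q')
 hence "FArr (cone_lift u X) (y, y', k) = \<xi>" using cone_lift_arr(2)[OF X u h] \<xi>' by simp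
 with h c show ?thesis by (intro exI[of _ "(y, y', k)"]) simp
qed

lemma iso_arrow_Xtrop_vertical:
 assumes a: "\<xi> \<in> Arr (Xtrop g n)" and v: "FArr (Pr (Xtrop g n)) \<xi> = Ide RPC T"
 shows "iso_arrow (Xtrop g n) \<xi>"
proof -
 obtain S G s S' G' s' f P where e: "\<xi> = ((S, G, s), (S', G', s'), (f, P))" by (rule Xtrop_arr_cases[OF a])
 have i: "S = T" "S' = T" "f = rpc_id T" using v by (simp_all add: e)
 show ?thesis using iso_arrow_Xtrop a unfolding e i by blast
qed

text \<open>A section of any curve isomorphic to the chosen pullback along \<open>p\<close> is the
  lift of a point over \<open>p\<close>: push the section forward along \<open>s\<close> and then to
  the cone of \<open>X\<close>.\<close>

lemma cone_lift_surj:
 assumes X: "X \<in> Obj (Mtrop g n)" and u: "classifies g n X u"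
  and w: "w \<in> Obj (Xtrop g n)" and d: "d \<in> Obj (slice (fst X))" and s: "iso_arrow (Mtrop g n) s"
  and sd: "Dom (Mtrop g n) s = FObj xtrop_proj w" "Cod (Mtrop g n) s = FObj u d"
  and sv: "FArr (Pr (Mtrop g n)) s = Ide RPC (FObj (Pr (slice (fst X))) d)"
 shows "\<exists>y e. y \<in> Obj (Cone (fst X) (snd X)) \<and> FObj cone_proj y = d \<and> iso_arrow (Xtrop g n) e \<and> Dom (Xtrop g n) e = w \<and>
  Cod (Xtrop g n) e = FObj (cone_lift u X) y \<and> FArr xtrop_proj e = s"
proof -
 obtain S G T p T0 Gw sw where e: "X = (S, G)" "d = (T, p)" "w = (T0, Gw, sw)" by (cases X; cases d; cases w)
 have X': "mobj g n S G" and r: "is_rpcone T" "p \<in> rpc_hom T S" and rs: "is_rpcone S"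
  using X d obj_cone by (simp_all add: e) blast
 have u': "functor_over RPC (slice S) (Mtrop g n) u" "classifies g n (S, G) u" "FObj u (S, rpc_id S) = (S, G)"
  using u by (simp_all add: classifies_def e slice_id_def)
 have q: "((T, p), (S, rpc_id S), p) \<in> Arr (slice S)" using r rs rpc_id_in[OF rs] rpc_id_comp[OF r(2)] by simp
 obtain G1 G2 P where 1: "FObj u (T, p) = (T, G1)" "FObj u (S, rpc_id S) = (S, G2)"
  "FArr u ((T, p), (S, rpc_id S), p) = ((T, G1), (S, G2), (p, P))"
  "marr g n T G1 S G2 p P" by (rule slice_arrow[OF u'(1) q])
 have g2: "G2 = G" using 1(2) u'(3) by simp
 note tb = 1(4)[unfolded g2]
 have sa: "s \<in> mtrop_arr g n" using iso_Arr[OF s] by simp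
 then obtain T1 G3 T2 G4 f j where es: "s = ((T1, G3), (T2, G4), (f, j))" by (rule mtrop_arr_cases)
 have i: "T1 = T" "G3 = Gw" "T2 = T" "G4 = G1" "f = rpc_id T" "T0 = T" using sd sv 1(1) by (simp_all add: es e)
 have s': "marr g n T Gw T G1 (rpc_id T) j" using sa unfolding es i .
 have sw: "sw \<in> cone_sections T Gw" using w unfolding e i by simp
 note sw' = sw[unfolded sections_iff]
 define K1 where "K1 = cone_map ((T, Gw), (T, G1), (rpc_id T, j)) T sw"
 have K1: "K1 \<in> cone_pts T G1 T" "cone_base K1 = rpc_id T"
  using cone_map_pts[OF s' r(1)] cone_map_base[OF s' r(1)] sw' rpc_id_idem unfolding K1_def by simp_all
 define K where "K = cone_map ((T, G1), (S, G), (p, P)) T K1"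
 have K: "K \<in> cone_pts S G T" "cone_base K = p"
  using cone_map_pts[OF tb r(1) K1(1)] cone_map_base[OF tb r(1) K1(1)] K1(2) comp_rpc_id[OF r(2)] unfolding K_def by simp_all
 obtain G5 P5 where c: "FObj u (FObj cone_proj (T, K)) = (T, G5)"
  "to_base u (S, G) (T, K) = ((T, G5), (S, G), (cone_base K, P5))"
  "lifted_section u (S, G) (T, K) \<in> cone_sections T G5"
  "cone_map ((T, G5), (S, G), (cone_base K, P5)) T (lifted_section u (S, G) (T, K)) = K"
  "FObj (cone_lift u (S, G)) (T, K) = (T, G5, lifted_section u (S, G) (T, K))"
  by (rule classified_to_base[OF X' u'(2) r(1) K(1)])
 have j: "G5 = G1" "P5 = P" using c(1,2) 1(1,3) K(2) g2 by (simp_all add: to_base_def slice_id_def)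
 \<comment> \<open>Both are sections with image \<open>K\<close>, so the arbitrary choice in
   \<open>lifted_section\<close> agrees with \<open>K1\<close>.\<close>
 have "lifted_section u (S, G) (T, K) = K1"
  using cone_map_inj[OF tb r(1), of "lifted_section u (S, G) (T, K)" K1] c(3,4) K1 K(2) unfolding j K_def sections_iff by simp
 hence L: "FObj (cone_lift u X) (T, K) = (T, G1, K1)" using c(5) j by (simp add: e)
 have e': "((T, Gw, sw), (T, G1, K1), (rpc_id T, j)) \<in> Arr (Xtrop g n)"
  using s' sw K1 cone_pull_id[OF arr_cod[OF s'] r(1) K1(1)] K1_def by (simp add: sections_iff)
 show ?thesis
  using iso_arrow_Xtrop[OF e'] K r(1) L
  by (intro exI[of _ "(T, K)"] exI[of _ "((T, Gw, sw), (T, G1, K1), (rpc_id T, j))"]) (simp add: e es i)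
qed

text \<open>The comparison between the lifts of a point and of its image, characterised by
  compatibility with the arrows to \<open>X\<close> and \<open>Y\<close>. At most one arrow has this
  property, so no choice is involved despite the later use of \<open>SOME\<close>.\<close>

definition is_base_change ::
 "nat \<Rightarrow> nat \<Rightarrow> (('x, 'v::real_vector) mtrop_obj \<Rightarrow> ('v slice_obj, 'v slice_arr, ('x, 'v) mtrop_obj, ('x, 'v) mtrop_arr) ftor)
   \<Rightarrow> ('x, 'v) mtrop_arr \<Rightarrow> ('x, 'v) cone_obj \<Rightarrow> ('x, 'v) xtrop_arr \<Rightarrow> bool" where
 "is_base_change g n u m y \<xi> \<longleftrightarrow>
   (let M = Mtrop g n; X = Dom M m; Y = Cod M m; z = FObj (cone_map_ftor m) y in
   \<xi> \<in> Arr (Xtrop g n) \<and> Dom (Xtrop g n) \<xi> = FObj (cone_lift (u X) X) y \<and> Cod (Xtrop g n) \<xi> = FObj (cone_lift (u Y) Y) z \<and>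
   FArr (Pr (Xtrop g n)) \<xi> = Ide RPC (fst y) \<and> Comp M (to_base (u Y) Y z) (FArr xtrop_proj \<xi>) = Comp M m (to_base (u X) X y))"

definition base_change where "base_change g n u m y = (SOME \<xi>. is_base_change g n u m y \<xi>)"

section \<open>Comparison of the lifts along arrows of curves\<close>

locale classified_family =
 fixes g n :: nat
  and u :: "('x, 'v::real_vector) mtrop_obj \<Rightarrow> ('v slice_obj, 'v slice_arr, ('x, 'v) mtrop_obj, ('x, 'v) mtrop_arr) ftor"
 assumes classified: "\<And>X. X \<in> Obj (Mtrop g n) ==> classifies g n X (u X)"

begin

abbreviation M :: "('x, 'v) mtrop_cat" where "M \<equiv> Mtrop g n"

abbreviation XT :: "('x, 'v) xtrop_cat" where "XT \<equiv> Xtrop g n"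

abbreviation C where "C X \<equiv> Cone (fst X) (snd X)"

abbreviation L where "L X \<equiv> cone_lift (u X) X"

abbreviation tb where "tb X \<equiv> to_base (u X) X"

abbreviation pr :: "(('x, 'v) xtrop_obj, ('x, 'v) xtrop_arr, ('x, 'v) mtrop_obj, ('x, 'v) mtrop_arr) ftor" where "pr \<equiv> xtrop_proj"

lemma cat_M: "category M" by (rule category_Mtrop)

lemmas MM = category_rules[OF cat_M]

lemma fo_pr: "functor_over RPC XT M pr" by (rule functor_xtrop_proj)

lemmas PP = functor_rules[OF fo_ftor[OF fo_pr]]

lemmas XX = category_rules[OF PP(1)]

lemma fo_L: "X \<in> Obj M ==> functor_over RPC (C X) XT (L X)" by (rule functor_cone_lift[OF _ classified])

lemmas LL = functor_rules[OF fo_ftor[OF fo_L]]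

lemmas TB = to_base_rules[OF _ classified]

lemmas RR = category_rules[OF category_RPC]

lemmas PrX = functor_rules[OF fo_src[OF fo_pr]]

lemma to_base_lift:
 assumes X: "X \<in> Obj M" and h: "h \<in> Arr (C X)"
 shows "Comp M (tb X (Cod (C X) h)) (FArr pr (FArr (L X) h)) = tb X (Dom (C X) h)"
proof -
 have X': "(fst X, snd X) \<in> mtrop_obj g n" using X by simp
 note c = functor_rules[OF fo_ftor[OF functor_cone_proj[OF X']]] and CC = category_rules[OF category_Cone[OF X']]
 show ?thesis unfolding proj_cone_lift_simps
  by (rule to_base_natural(1)[OF X classified[OF X]]) (use h c(5-7) CC(1,2) in simp_all)
qed

text \<open>The projection to curves is faithful, and there an arrow with given base is determined
  by its composite with \<open>tb Y z\<close>. Equations between arrows to a lifted point are proved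
  this way.\<close>

lemma lift_cancel:
 assumes Y: "Y \<in> Obj M" and z: "z \<in> Obj (C Y)" and a: "\<xi> \<in> Arr XT" "\<xi>' \<in> Arr XT"
  and d: "Dom XT \<xi> = Dom XT \<xi>'" "Cod XT \<xi> = FObj (L Y) z" "Cod XT \<xi>' = FObj (L Y) z"
  and p: "FArr (Pr XT) \<xi> = FArr (Pr XT) \<xi>'" and eq: "Comp M (tb Y z) (FArr pr \<xi>) = Comp M (tb Y z) (FArr pr \<xi>')"
 shows "\<xi> = \<xi>'"
proof (rule Xtrop_arr_eqI[OF a])
 note T = TB(1,2)[OF Y Y z]
 show "FArr pr \<xi> = FArr pr \<xi>'"
 proof (rule mtrop_cancel[where b = "tb Y z" and g = g and n = n])
  show "FArr pr \<xi> \<in> mtrop_arr g n" "FArr pr \<xi>' \<in> mtrop_arr g n" "tb Y z \<in> mtrop_arr g n" using PP(5) a T(1) by simp_all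
  show "Dom M (FArr pr \<xi>) = Dom M (FArr pr \<xi>')" "Cod M (FArr pr \<xi>) = Dom M (tb Y z)" "Cod M (FArr pr \<xi>') = Dom M (tb Y z)"
   using PP(6)[OF a(1)] PP(6)[OF a(2)] PP(7)[OF a(1)] PP(7)[OF a(2)] d T(2) by simp_all
  show "FArr (Pr M) (FArr pr \<xi>) = FArr (Pr M) (FArr pr \<xi>')" using fo_Arr[OF fo_pr a(1)] fo_Arr[OF fo_pr a(2)] p by simp
 qed (rule eq)
qed (use d in simp_all)

text \<open>The arrow to \<open>X\<close> followed by \<open>m\<close> and the arrow to
  \<open>Y\<close> from the other pullback lie over the same morphism of cones, so they differ by a
  vertical arrow of curves. It respects the lifted sections because their images in the cone of
  \<open>Y\<close> agree.\<close>

lemma base_change_ex: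
 assumes m: "m \<in> Arr M" and y: "y \<in> Obj (C (Dom M m))"
 shows "\<exists>\<xi>. is_base_change g n u m y \<xi>"
proof -
 have "m \<in> mtrop_arr g n" using m by simp
 then obtain S G S' G' f R where em: "m = ((S, G), (S', G'), (f, R))" and m': "marr g n S G S' G' f R"
  by (rule mtrop_arr_cases)
 obtain T K where ey: "y = (T, K)" by (cases y)
 have y': "is_rpcone T" "K \<in> cone_pts S G T" using y by (simp_all add: em ey)
 note X = arr_dom[OF m'] and Y = arr_cod[OF m']
 let ?K = "cone_map m T K" and ?X = "(S, G)" and ?Y = "(S', G')"
 have K: "?K \<in> cone_pts S' G' T" "cone_base ?K = f o cone_base K"
  using cone_map_pts[OF m' y'] cone_map_base[OF m' y'] by (simp_all add: em)
 have cX: "classifies g n ?X (u ?X)" and cY: "classifies g n ?Y (u ?Y)" using classified X Y by simp_all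
 obtain G1 P1 where 1: "FObj (u ?X) (FObj cone_proj (T, K)) = (T, G1)"
  "to_base (u ?X) ?X (T, K) = ((T, G1), ?X, (cone_base K, P1))" "((T, G1), ?X, (cone_base K, P1)) \<in> mtrop_arr g n"
  "lifted_section (u ?X) ?X (T, K) \<in> cone_sections T G1"
  "cone_map ((T, G1), ?X, (cone_base K, P1)) T (lifted_section (u ?X) ?X (T, K)) = K"
  by (rule classified_to_base[OF X cX y'])
 obtain G2 P2 where 2: "FObj (u ?Y) (FObj cone_proj (T, ?K)) = (T, G2)"
  "to_base (u ?Y) ?Y (T, ?K) = ((T, G2), ?Y, (f o cone_base K, P2))" "((T, G2), ?Y, (f o cone_base K, P2)) \<in> mtrop_arr g n"
  by (rule classified_to_base[OF Y cY y'(1) K(1), unfolded K(2)])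
 obtain j where j: "marr g n T G1 T G2 (rpc_id T) j" "compose (Cells G') j P2 = compose (Cells G') P1 R"
  using mtrop_cartesian[OF mtrop_comp[OF 1(3) m'] 2(3)] by blast
 let ?a = "((T, G1), (T, G2), (rpc_id T, j))"
 have eq: "Comp M (to_base (u ?Y) ?Y (T, ?K)) ?a = Comp M m (to_base (u ?X) ?X (T, K))"
  unfolding 1(2) 2(2) using j(2) comp_rpc_id[OF arr_hom[OF 2(3)]] by (simp add: em)
 have y1: "(T, K) \<in> Obj (Cone (fst ?X) (snd ?X))" "(T, ?K) \<in> Obj (Cone (fst ?Y) (snd ?Y))" using y' K(1) by simp_all
 have "cone_map (Comp M m (to_base (u ?X) ?X (T, K))) T (lifted_section (u ?X) ?X (T, K)) = ?K"
  using cone_map_comp[OF 1(3) m' y'(1)] 1(2,4,5) by (simp add: em sections_iff)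
 hence "(FObj (L ?X) (T, K), FObj (L ?Y) (T, ?K), snd (snd ?a)) \<in> Arr XT"
  using cone_lift_arr_iff(1)[OF _ cX _ cY y1, of ?a] eq X Y j(1) 1(1) 2(1) cone_pull_id[OF Y y'(1) K(1)] by simp
 moreover have "FArr pr (FObj (L ?X) (T, K), FObj (L ?Y) (T, ?K), snd (snd ?a)) = ?a"
  using cone_lift_arr_iff(2)[OF _ cX _ cY y1, of ?a] X Y j(1) 1(1) 2(1) by simp
 moreover have "fst (FObj (L ?X) (T, K)) = T" "fst (FObj (L ?Y) (T, ?K)) = T"
  using cone_lift_fst[OF _ cX y1(1)] cone_lift_fst[OF _ cY y1(2)] X Y by simp_all
 ultimately have "is_base_change g n u m y (FObj (L ?X) (T, K), FObj (L ?Y) (T, ?K), (rpc_id T, j))"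
  unfolding is_base_change_def Let_def using eq by (simp add: em ey)
 thus ?thesis by blast
qed

lemma cone_map_ftor_obj:
 assumes m: "m \<in> Arr M" and y: "y \<in> Obj (C (Dom M m))"
 shows "FObj (cone_map_ftor m) y \<in> Obj (C (Cod M m))" "fst (FObj (cone_map_ftor m) y) = fst y"
  "functor_over RPC (C (Dom M m)) (C (Cod M m)) (cone_map_ftor m)"
proof -
 have "m \<in> mtrop_arr g n" using m by simp
 then obtain S G S' G' f R where em: "m = ((S, G), (S', G'), (f, R))" and m': "marr g n S G S' G' f R"
  by (rule mtrop_arr_cases)
 show F: "functor_over RPC (C (Dom M m)) (C (Cod M m)) (cone_map_ftor m)" using functor_cone_map[OF m'] by (simp add: em)
 show "FObj (cone_map_ftor m) y \<in> Obj (C (Cod M m))" using ftor_Obj[OF fo_ftor[OF F] y] .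
 show "fst (FObj (cone_map_ftor m) y) = fst y" by (cases y) simp
qed

lemma base_change_rules:
 assumes m: "m \<in> Arr M" and y: "y \<in> Obj (C (Dom M m))"
 defines "\<xi> \<equiv> base_change g n u m y" and "X \<equiv> Dom M m" and "Y \<equiv> Cod M m" and "z \<equiv> FObj (cone_map_ftor m) y"
 shows bc_Arr: "\<xi> \<in> Arr XT" and bc_Dom: "Dom XT \<xi> = FObj (L X) y" and bc_Cod: "Cod XT \<xi> = FObj (L Y) z"
  and bc_Pr: "FArr (Pr XT) \<xi> = Ide RPC (fst y)" and bc_eq: "Comp M (tb Y z) (FArr pr \<xi>) = Comp M m (tb X y)"
  and bc_unique: "\<And>\<eta>. \<eta> \<in> Arr XT ==> Dom XT \<eta> = FObj (L X) y ==> Cod XT \<eta> = FObj (L Y) z ==>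
   FArr (Pr XT) \<eta> = Ide RPC (fst y) ==> Comp M (tb Y z) (FArr pr \<eta>) = Comp M m (tb X y) ==> \<xi> = \<eta>"
proof -
 have "is_base_change g n u m y \<xi>" unfolding \<xi>_def base_change_def using base_change_ex[OF m y] by (rule someI_ex)
 thus *: "\<xi> \<in> Arr XT" "Dom XT \<xi> = FObj (L X) y" "Cod XT \<xi> = FObj (L Y) z"
  "FArr (Pr XT) \<xi> = Ide RPC (fst y)" "Comp M (tb Y z) (FArr pr \<xi>) = Comp M m (tb X y)"
  unfolding is_base_change_def Let_def X_def Y_def z_def by blast+
 have "Y \<in> Obj M" "z \<in> Obj (C Y)" unfolding Y_def z_def by (rule MM(2)[OF m], rule cone_map_ftor_obj(1)[OF m y])
 thus "\<xi> = \<eta>" if "\<eta> \<in> Arr XT" "Dom XT \<eta> = FObj (L X) y" "Cod XT \<eta> = FObj (L Y) z"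
  "FArr (Pr XT) \<eta> = Ide RPC (fst y)" "Comp M (tb Y z) (FArr pr \<eta>) = Comp M m (tb X y)" for \<eta>
  using lift_cancel[OF _ _ *(1) that(1)] * that by simp
qed

text \<open>Vertical arrows of the universal curve are invertible. Both composites in the naturality
  square end at a lifted point and become equal after the arrow to \<open>Y\<close>, so
  \<open>lift_cancel\<close> applies.\<close>

lemma base_change_nat_iso:
 assumes m: "m \<in> Arr M"
 shows "nat_iso_over RPC (C (Dom M m)) XT (L (Dom M m)) (comp_ftor (L (Cod M m)) (cone_map_ftor m)) (base_change g n u m)"
proof -
 define X Y cm where "X = Dom M m" and "Y = Cod M m" and "cm = cone_map_ftor m"
 let ?\<xi> = "base_change g n u m"
 have O: "X \<in> Obj M" "Y \<in> Obj M" unfolding X_def Y_def using MM(1,2) m by auto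
 note B = base_change_rules[OF m, folded X_def Y_def cm_def] and Z = cone_map_ftor_obj[OF m, folded X_def Y_def cm_def]
 note L1 = LL[OF O(1)] and L2 = LL[OF O(2)] and CX = category_rules[OF LL(1)[OF O(1)]]
 show ?thesis unfolding nat_iso_over_def X_def[symmetric] Y_def[symmetric] cm_def[symmetric]
 proof (intro conjI ballI)
  show "functor_over RPC (C X) XT (L X)" by (rule fo_L[OF O(1)])
  have cmf: "functor_over RPC (C X) (C Y) cm"
  proof -
   have "m \<in> mtrop_arr g n" using m by simp
   thus ?thesis unfolding X_def Y_def cm_def by (rule mtrop_arr_cases) (use functor_cone_map in auto)
  qed
  show "functor_over RPC (C X) XT (comp_ftor (L Y) cm)" by (rule functor_over_comp[OF cmf fo_L[OF O(2)]])
  show "iso_arrow XT (?\<xi> y)" if "y \<in> Obj (C X)" for y by (rule iso_arrow_Xtrop_vertical[OF B(1)[OF that] B(4)[OF that]])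
  show "Dom XT (?\<xi> y) = FObj (L X) y" "Cod XT (?\<xi> y) = FObj (comp_ftor (L Y) cm) y" if "y \<in> Obj (C X)" for y
   using B(2,3)[OF that] by simp_all
  show "FArr (Pr XT) (?\<xi> y) = Ide RPC (FObj (Pr (C X)) y)" if "y \<in> Obj (C X)" for y using B(4)[OF that] by (simp add: Cone_def)
  fix h assume h: "h \<in> Arr (C X)"
  define y y' where "y = Dom (C X) h" and "y' = Cod (C X) h"
  have y: "y \<in> Obj (C X)" "y' \<in> Obj (C X)" unfolding y_def y'_def using CX(1,2)[OF h] by auto
  define k where "k = FArr cm h"
  note cc = functor_rules[OF fo_ftor[OF cmf]]
  have k: "k \<in> Arr (C Y)" "Dom (C Y) k = FObj cm y" "Cod (C Y) k = FObj cm y'"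
   unfolding k_def y_def y'_def using cc(5-7)[OF h] by auto
  note By = B(1-5)[OF y(1)] and By' = B(1-5)[OF y(2)]
  have Lh: "FArr (L X) h \<in> Arr XT" "Dom XT (FArr (L X) h) = FObj (L X) y" "Cod XT (FArr (L X) h) = FObj (L X) y'"
   using L1(5-7)[OF h] by (simp_all add: y_def y'_def)
  have Lk: "FArr (L Y) k \<in> Arr XT" "Dom XT (FArr (L Y) k) = FObj (L Y) (FObj cm y)" "Cod XT (FArr (L Y) k) = FObj (L Y) (FObj cm y')"
   using L2(5-7)[OF k(1)] k by simp_all
  have c1: "Cod XT (?\<xi> y) = Dom XT (FArr (L Y) k)" and c2: "Cod XT (FArr (L X) h) = Dom XT (?\<xi> y')" using By By' Lh Lk by simp_all
  note X1 = XX(6-8)[OF By(1) Lk(1) c1] and X2 = XX(6-8)[OF Lh(1) By'(1) c2]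
  note z' = Z(1)[OF y(2)] and z = Z(1)[OF y(1)]
  have T: "tb X y \<in> Arr M" "Cod M (tb X y) = X" "tb X y' \<in> Arr M" "Cod M (tb X y') = X" "tb Y (FObj cm y') \<in> Arr M"
   "Dom M (tb Y (FObj cm y')) = FObj pr (FObj (L Y) (FObj cm y'))" "Dom M (tb X y') = FObj pr (FObj (L X) y')"
   using TB(1-3)[OF O(1) O(1) y(1)] TB(1-3)[OF O(1) O(1) y(2)] TB(1-3)[OF O(2) O(2) z'] by simp_all
  have P: "FArr pr (?\<xi> y) \<in> Arr M" "Cod M (FArr pr (?\<xi> y)) = FObj pr (FObj (L Y) (FObj cm y))"
   "FArr pr (?\<xi> y') \<in> Arr M" "Dom M (FArr pr (?\<xi> y')) = FObj pr (FObj (L X) y')" "Cod M (FArr pr (?\<xi> y')) = FObj pr (FObj (L Y) (FObj cm y'))"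
   "FArr pr (FArr (L X) h) \<in> Arr M" "Cod M (FArr pr (FArr (L X) h)) = FObj pr (FObj (L X) y')"
   "FArr pr (FArr (L Y) k) \<in> Arr M" "Dom M (FArr pr (FArr (L Y) k)) = FObj pr (FObj (L Y) (FObj cm y))"
   "Cod M (FArr pr (FArr (L Y) k)) = FObj pr (FObj (L Y) (FObj cm y'))"
   using PP(5-7)[OF By(1)] PP(5-7)[OF By'(1)] PP(5-7)[OF Lh(1)] PP(5-7)[OF Lk(1)] By By' Lh Lk by simp_all
  have md: "Dom M m = X" by (simp add: X_def)
  have "Comp XT (FArr (L Y) k) (?\<xi> y) = Comp XT (?\<xi> y') (FArr (L X) h)"
  proof (rule lift_cancel[OF O(2) z'])
   show "FArr (Pr XT) (Comp XT (FArr (L Y) k) (?\<xi> y)) = FArr (Pr XT) (Comp XT (?\<xi> y') (FArr (L X) h))"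
   proof -
    have b: "FArr (Pr XT) (FArr (L X) h) = FArr (Pr (C X)) h" "FArr (Pr XT) (FArr (L Y) k) = FArr (Pr (C X)) h"
     using fo_Arr[OF fo_L[OF O(1)] h] fo_Arr[OF fo_L[OF O(2)] k(1)] fo_Arr[OF cmf h] by (simp_all add: k_def)
    note F = functor_rules[OF fo_src[OF fo_L[OF O(1)]]]
    have "FArr (Pr (C X)) h \<in> Arr RPC" "Dom RPC (FArr (Pr (C X)) h) = fst y" "Cod RPC (FArr (Pr (C X)) h) = fst y'"
     using F(5-7)[OF h] by (simp_all add: Cone_def y_def y'_def)
    thus ?thesis
     unfolding PrX(8)[OF By(1) Lk(1) c1] PrX(8)[OF Lh(1) By'(1) c2] b By(4) By'(4)
     using RR(9)[of "FArr (Pr (C X)) h" "fst y"] RR(10)[of "FArr (Pr (C X)) h" "fst y'"] by simp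
   qed
   have "Comp M (tb Y (FObj cm y')) (FArr pr (Comp XT (FArr (L Y) k) (?\<xi> y))) =
     Comp M (Comp M (tb Y (FObj cm y')) (FArr pr (FArr (L Y) k))) (FArr pr (?\<xi> y))"
    unfolding PP(8)[OF By(1) Lk(1) c1] by (rule MM(11)) (simp_all only: P T)
   also have "\<dots> = Comp M m (tb X y)" using to_base_lift[OF O(2) k(1)] k By(5) by simp
   also have "\<dots> = Comp M m (Comp M (tb X y') (FArr pr (FArr (L X) h)))" using to_base_lift[OF O(1) h] by (simp add: y_def y'_def)
   also have "\<dots> = Comp M (Comp M m (tb X y')) (FArr pr (FArr (L X) h))" by (rule MM(11)) (simp_all only: P T m md)
   also have "\<dots> = Comp M (tb Y (FObj cm y')) (FArr pr (Comp XT (?\<xi> y') (FArr (L X) h)))"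
    unfolding PP(8)[OF Lh(1) By'(1) c2] By'(5)[symmetric] by (rule MM(11)[symmetric]) (simp_all only: P T)
   finally show "Comp M (tb Y (FObj cm y')) (FArr pr (Comp XT (FArr (L Y) k) (?\<xi> y))) =
    Comp M (tb Y (FObj cm y')) (FArr pr (Comp XT (?\<xi> y') (FArr (L X) h)))" .
  qed (use X1 X2 By By' Lh Lk in simp_all)
  thus "Comp XT (FArr (comp_ftor (L Y) cm) h) (?\<xi> (Dom (C X) h)) = Comp XT (?\<xi> (Cod (C X) h)) (FArr (L X) h)"
   by (simp add: k_def y_def y'_def)
 qed
qed

lemma base_change_id:
 assumes X: "X \<in> Obj M" and y: "y \<in> Obj (C X)"
 shows "base_change g n u (Ide M X) y = Ide XT (FObj (L X) y)"
proof -
 obtain S G T K where e: "X = (S, G)" "y = (T, K)" by (cases X; cases y)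
 have z: "FObj (cone_map_ftor (Ide M X)) y = y" using cone_map_id[of S G g n T K] X y by (simp add: e)
 note I = MM(3-5)[OF X] and T = TB(1-3)[OF X X y] and Lo = LL(3)[OF X y]
 note XI = XX(3-5)[OF Lo]
 have y': "y \<in> Obj (C (Dom M (Ide M X)))" using y I by simp
 show ?thesis
 proof (rule base_change_rules(6)[OF I(1) y', unfolded z I(2,3)])
  show "FArr (Pr XT) (Ide XT (FObj (L X) y)) = Ide RPC (fst y)"
   using PrX(4)[OF Lo] fo_Obj[OF fo_L[OF X] y] by (simp add: Cone_def)
  show "Comp M (tb X y) (FArr pr (Ide XT (FObj (L X) y))) = Comp M (Ide M X) (tb X y)"
   unfolding PP(4)[OF Lo] using MM(9)[OF T(1) T(2)[symmetric]] MM(10)[OF T(1) T(3)[symmetric]] by simp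
 qed (use XI in simp_all)
qed

text \<open>The composite has the characterising property of the comparison along
  \<open>m' m\<close>, so uniqueness identifies the two.\<close>

lemma base_change_comp:
 assumes m: "m \<in> Arr M" and m': "m' \<in> Arr M" and c: "Cod M m = Dom M m'" and y: "y \<in> Obj (C (Dom M m))"
 shows "base_change g n u (Comp M m' m) y = Comp XT (base_change g n u m' (FObj (cone_map_ftor m) y)) (base_change g n u m y)"
proof -
 define z where "z = FObj (cone_map_ftor m) y"
 note mm = MM(6-8)[OF m m' c]
 have zz: "FObj (cone_map_ftor (Comp M m' m)) y = FObj (cone_map_ftor m') z"
 proof -
  have a: "m \<in> mtrop_arr g n" "m' \<in> mtrop_arr g n" using m m' by simp_all
  from a(1) obtain S G S' G' f R where em: "m = ((S, G), (S', G'), (f, R))" "marr g n S G S' G' f R" by (rule mtrop_arr_cases)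
  from a(2) obtain S1 G1 S'' G'' f' R' where em': "m' = ((S1, G1), (S'', G''), (f', R'))" by (rule mtrop_arr_cases)
  have i: "S1 = S'" "G1 = G'" using c by (simp_all add: em em')
  have em'': "marr g n S' G' S'' G'' f' R'" using a(2) unfolding em' i .
  obtain T K where ey: "y = (T, K)" by (cases y)
  have y': "is_rpcone T" "K \<in> cone_pts S G T" using y by (simp_all add: em ey)
  show ?thesis using cone_map_comp[OF em(2) em'' y'] by (simp add: em em' i ey z_def)
 qed
 have z: "z \<in> Obj (C (Dom M m'))" "fst z = fst y" using cone_map_ftor_obj[OF m y] c by (simp_all add: z_def)
 have z2: "FObj (cone_map_ftor m') z \<in> Obj (C (Cod M m'))" by (rule cone_map_ftor_obj(1)[OF m' z(1)])
 note B = base_change_rules(1-5)[OF m y, folded z_def] and B' = base_change_rules(1-5)[OF m' z(1)]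
 let ?\<xi> = "base_change g n u m y" and ?\<xi>' = "base_change g n u m' z"
 have cc: "Cod XT ?\<xi> = Dom XT ?\<xi>'" using B B' c by simp
 have y': "y \<in> Obj (C (Dom M (Comp M m' m)))" using y mm by simp
 have O: "Dom M m \<in> Obj M" "Dom M m' \<in> Obj M" "Cod M m' \<in> Obj M" using MM(1,2) m m' by auto
 have T: "tb (Cod M m') (FObj (cone_map_ftor m') z) \<in> Arr M"
  "Dom M (tb (Cod M m') (FObj (cone_map_ftor m') z)) = FObj pr (FObj (L (Cod M m')) (FObj (cone_map_ftor m') z))"
  "tb (Dom M m') z \<in> Arr M" "Dom M (tb (Dom M m') z) = FObj pr (FObj (L (Dom M m')) z)" "Cod M (tb (Dom M m') z) = Dom M m'"
  "tb (Dom M m) y \<in> Arr M" "Cod M (tb (Dom M m) y) = Dom M m"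
  using TB(1-3)[OF O(3) O(3) z2] TB(1-3)[OF O(2) O(2) z(1)] TB(1-3)[OF O(1) O(1) y] by simp_all
 have P: "FArr pr ?\<xi> \<in> Arr M" "Cod M (FArr pr ?\<xi>) = FObj pr (FObj (L (Dom M m')) z)"
  "FArr pr ?\<xi>' \<in> Arr M" "Dom M (FArr pr ?\<xi>') = FObj pr (FObj (L (Dom M m')) z)"
  "Cod M (FArr pr ?\<xi>') = FObj pr (FObj (L (Cod M m')) (FObj (cone_map_ftor m') z))"
  using PP(5-7)[OF B(1)] PP(5-7)[OF B'(1)] B B' c by simp_all
 show ?thesis unfolding z_def[symmetric]
 proof (rule base_change_rules(6)[OF mm(1) y', unfolded zz mm(2,3)])
  show "FArr (Pr XT) (Comp XT ?\<xi>' ?\<xi>) = Ide RPC (fst y)"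
  proof -
   have "Comp RPC (Ide RPC (fst y)) (Ide RPC (fst y)) = Ide RPC (fst y)" by (simp add: rpc_id_idem)
   thus ?thesis unfolding PrX(8)[OF B(1) B'(1) cc] B(4) B'(4) z(2) .
  qed
  have "Comp M (tb (Cod M m') (FObj (cone_map_ftor m') z)) (FArr pr (Comp XT ?\<xi>' ?\<xi>)) =
   Comp M (Comp M (tb (Cod M m') (FObj (cone_map_ftor m') z)) (FArr pr ?\<xi>')) (FArr pr ?\<xi>)"
   unfolding PP(8)[OF B(1) B'(1) cc] by (rule MM(11)) (simp_all only: P T)
  also have "\<dots> = Comp M m' (Comp M (tb (Dom M m') z) (FArr pr ?\<xi>))"
   unfolding B'(5) by (rule MM(11)[symmetric]) (simp_all only: P T m')
  also have "\<dots> = Comp M (Comp M m' m) (tb (Dom M m) y)"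
   unfolding B(5)[unfolded c] by (rule MM(11)) (simp_all only: T m m' c)
  finally show "Comp M (tb (Cod M m') (FObj (cone_map_ftor m') z)) (FArr pr (Comp XT ?\<xi>' ?\<xi>)) = Comp M (Comp M m' m) (tb (Dom M m) y)" .
 qed (use XX(6-8)[OF B(1) B'(1) cc] B B' in simp_all)
qed

end

lemma comp_ftor_id: "comp_ftor F id_ftor = F" "comp_ftor id_ftor F = F"
 by (simp_all add: comp_ftor_def id_ftor_def comp_def)

lemma comp_ftor_assoc: "comp_ftor H (comp_ftor G F) = comp_ftor (comp_ftor H G) F"
 by (simp add: comp_ftor_def comp_def)

text \<open>A section has the identity as base, and \<open>u\<close> sends \<open>slice_id S\<close>
  strictly to \<open>(S, G)\<close>. Hence \<open>to_base\<close> is an identity arrow and the lift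
  of the point is the section itself.\<close>

lemma cone_lift_section:
 assumes X: "mobj g n S G" and u: "classifies g n (S, G) u" and s: "s \<in> cone_sections S G"
 shows "FObj (cone_lift u (S, G)) (S, s) = (S, G, s)"
proof -
 note r = obj_cone[OF X] and s' = s[unfolded sections_iff] and u' = u[unfolded classifies_def, simplified]
 obtain G1 P where c: "FObj u (FObj cone_proj (S, s)) = (S, G1)"
  "to_base u (S, G) (S, s) = ((S, G1), (S, G), (cone_base s, P))"
  "lifted_section u (S, G) (S, s) \<in> cone_sections S G1"
  "cone_map ((S, G1), (S, G), (cone_base s, P)) S (lifted_section u (S, G) (S, s)) = s"
  "FObj (cone_lift u (S, G)) (S, s) = (S, G1, lifted_section u (S, G) (S, s))"
  by (rule classified_to_base[OF X u r conjunct1[OF s']])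
 have g: "G1 = G" using c(1) u' s' by (simp add: slice_id_def)
 have "slice_id S \<in> Obj (slice S)" using r rpc_id_in[OF r] by (simp add: slice_id_def)
 from ftor_Ide[OF fo_ftor[OF conjunct1[OF u']] this] have "to_base u (S, G) (S, s) = Ide (Mtrop g n) (S, G)"
  using u' s' by (simp add: to_base_def slice_id_def)
 hence "cone_map ((S, G), (S, G), (rpc_id S, restrict (\<lambda>x. x) (Cells G))) S (lifted_section u (S, G) (S, s)) = s"
  using c(2,4) g by simp
 thus ?thesis using cone_map_id[OF X r] c(3,5) g by (simp add: sections_iff)
qed

theorem theorem2:
  fixes g n :: nat
  assumes "2 * int g - 2 + int n > 0"
  shows "\<exists>\<Phi> :: (('x::infinite, 'v::real_vector) xtrop_obj, ('x, 'v) xtrop_arr,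
                 ('x, 'v) mtrop_obj, ('x, 'v) mtrop_arr) ftor.
     isomorphism_over_object RPC (Xtrop g n) (Mtrop g (Suc n)) (Mtrop g n)
       xtrop_proj (forget_ftor n) \<Phi> \<and>
     (\<forall>u. (\<forall>X\<in>Obj (Mtrop g n). classifies g n X (u X)) \<longrightarrow>
       (\<exists>U \<alpha>.
          (\<forall>\<sigma> \<Gamma>. (\<sigma>, \<Gamma>) \<in> Obj (Mtrop g n) \<longrightarrow>
             two_cartesian RPC (Cone \<sigma> \<Gamma>) (Mtrop g (Suc n)) (slice \<sigma>) (Mtrop g n)
               (U (\<sigma>, \<Gamma>)) cone_proj (forget_ftor n) (u (\<sigma>, \<Gamma>)) (\<alpha> (\<sigma>, \<Gamma>))) \<and>
          contravariant_family g n u U \<alpha> \<and>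
          (\<forall>\<sigma> \<Gamma>. (\<sigma>, \<Gamma>) \<in> Obj (Mtrop g n) \<longrightarrow> (\<forall>s\<in>cone_sections \<sigma> \<Gamma>.
             FObj (U (\<sigma>, \<Gamma>)) (\<sigma>, s) = FObj \<Phi> (\<sigma>, \<Gamma>, s) \<and>
             section_genus \<sigma> \<Gamma> s = last_leg_genus n (FObj (U (\<sigma>, \<Gamma>)) (\<sigma>, s))))))"
proof -
 note gn = assms
 define P :: "(('x, 'v) xtrop_obj, ('x, 'v) xtrop_arr, ('x, 'v) mtrop_obj, ('x, 'v) mtrop_arr) ftor" where "P = xtrop_proj"
 define \<Psi> :: "(('x, 'v) mtrop_obj, ('x, 'v) mtrop_arr, ('x, 'v) xtrop_obj, ('x, 'v) xtrop_arr) ftor" where "\<Psi> = section_ftor n"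
 let ?M = "Mtrop g n :: ('x, 'v) mtrop_cat" and ?M' = "Mtrop g (Suc n) :: ('x, 'v) mtrop_cat" and ?X = "Xtrop g n :: ('x, 'v) xtrop_cat"
 have PQ: "comp_ftor P \<Psi> = forget_ftor n" unfolding P_def \<Psi>_def by (rule proj_section_ftor)
 have fP: "functor_over RPC ?X ?M P" unfolding P_def by (rule functor_xtrop_proj)
 have f\<Psi>: "functor_over RPC ?M' ?X \<Psi>" unfolding \<Psi>_def by (rule functor_section_ftor[OF gn])
 obtain \<Phi> s t where \<Phi>: "functor_over RPC ?X ?M' \<Phi>" and s: "nat_iso_over RPC ?M' ?M' id_ftor (comp_ftor \<Phi> \<Psi>) s"
  and t: "nat_iso_over RPC ?X ?X (comp_ftor \<Psi> \<Phi>) id_ftor t"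
  using section_ftor_quasi_inverse[OF gn, where 'x = 'x and 'v = 'v] unfolding \<Psi>_def by blast
 note T = nat_iso_over_rules[OF t, simplified comp_ftor_simps] and PF = functor_rules[OF fo_ftor[OF fP]]
  and \<Phi>\<Phi> = functor_rules[OF fo_ftor[OF \<Phi>]] and \<Psi>\<Psi> = functor_rules[OF fo_ftor[OF f\<Psi>]] and XX = category_rules[OF PF(1)]
 have iso: "isomorphism_over_object RPC ?X ?M' ?M xtrop_proj (forget_ftor n) \<Phi>"
 proof -
  \<comment> \<open>\<open>P \<Psi>\<close> is strictly the forgetful functor, so applying
    \<open>P\<close> to the counit \<open>t\<close> fills the triangle over the moduli of curves
    with \<open>n\<close> legs.\<close>
  have "nat_iso_over RPC ?X ?M (comp_ftor (forget_ftor n) \<Phi>) P (\<lambda>x. FArr P (t x))"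
   using nat_iso_over_whisker[OF t fP] unfolding comp_ftor_assoc PQ comp_ftor_id .
  thus ?thesis
   unfolding isomorphism_over_object_def equivalence_over_def
   using \<Phi> f\<Psi> nat_iso_over_sym[OF t] nat_iso_over_sym[OF s] functor_forget_ftor[OF gn] P_def by blast
 qed
 have family: "\<exists>U \<alpha>.
   (\<forall>S G. (S, G) \<in> Obj ?M \<longrightarrow> two_cartesian RPC (Cone S G) ?M' (slice S) ?M
     (U (S, G)) cone_proj (forget_ftor n) (u (S, G)) (\<alpha> (S, G))) \<and>
   contravariant_family g n u U \<alpha> \<and>
   (\<forall>S G. (S, G) \<in> Obj ?M \<longrightarrow> (\<forall>s\<in>cone_sections S G.
     FObj (U (S, G)) (S, s) = FObj \<Phi> (S, G, s) \<and> section_genus S G s = last_leg_genus n (FObj (U (S, G)) (S, s))))"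
  if cl: "\<forall>X\<in>Obj ?M. classifies g n X (u X)" for u
 proof -
  interpret classified_family g n u by unfold_locales (use cl in blast)
  \<comment> \<open>The upper edge of the square is the lift to sections followed by
    \<open>\<Phi>\<close>. The counit at the lifted point projects to the 2-isomorphism
    \<open>\<alpha>\<close>, because \<open>P L\<close> and \<open>u c\<close> are equal.\<close>
  define U where "U X = comp_ftor \<Phi> (L X)" for X
  define \<alpha> where "\<alpha> X y = FArr P (t (FObj (L X) y))" for X y
  have 1: "two_cartesian RPC (Cone S G) ?M' (slice S) ?M (U (S, G)) cone_proj (forget_ftor n) (u (S, G)) (\<alpha> (S, G))"
   if X: "(S, G) \<in> Obj ?M" for S G
  proof -
   have X': "(S, G) \<in> mtrop_obj g n" and c: "classifies g n (S, G) (u (S, G))" using X cl by auto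
   have "two_cartesian RPC (Cone S G) ?M' (slice S) ?M (comp_ftor \<Phi> (L (S, G))) cone_proj (comp_ftor P \<Psi>) (u (S, G))
    (\<lambda>y. FArr P (t (FObj (L (S, G)) y)))"
   proof (rule two_cartesian_of_equivalence[OF fP f\<Psi> \<Phi> t])
    show "functor_over RPC (slice S) ?M (u (S, G))" using c by (simp add: classifies_def)
    show "functor_over RPC (Cone S G) (slice S) cone_proj" by (rule functor_cone_proj[OF X'])
    show "functor_over RPC (Cone S G) ?X (L (S, G))" using fo_L[OF X] by simp
    show "comp_ftor P (L (S, G)) = comp_ftor (u (S, G)) cone_proj" unfolding P_def by (rule proj_cone_lift)
    show "h = h'" if h: "h \<in> Arr (Cone S G)" "h' \<in> Arr (Cone S G)" "Dom (Cone S G) h = Dom (Cone S G) h'"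
     "Cod (Cone S G) h = Cod (Cone S G) h'" "FArr cone_proj h = FArr cone_proj h'" for h h'
    proof -
     obtain T K T' K' k where e: "h = ((T, K), (T', K'), k)" by (rule Cone_arr_cases[OF h(1)])
     obtain T1 K1 T1' K1' k1 where e1: "h' = ((T1, K1), (T1', K1'), k1)" by (rule Cone_arr_cases[OF h(2)])
     show ?thesis using h(3-5) unfolding e e1 by simp
    qed
   qed (use section_ftor_full_arr[OF gn] section_ftor_faithful_arr[OF gn] cone_lift_full[OF X c] cone_lift_surj[OF X c]
      in \<open>simp_all only: \<Psi>_def P_def fst_conv snd_conv\<close>)
   thus ?thesis unfolding PQ U_def \<alpha>_def .
  qed
  have 2: "contravariant_family g n u U \<alpha>"
   unfolding contravariant_family_def Let_def
  \<comment> \<open>\<open>\<theta>\<close> is the image under \<open>\<Phi>\<close> of the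
    comparison of lifted sections; its functoriality is inherited from there.\<close>
  proof (intro exI[of _ "\<lambda>m y. FArr \<Phi> (base_change g n u m y)"] conjI ballI impI)
   fix m assume m: "m \<in> Arr ?M"
   show "nat_iso_over RPC (C (Dom ?M m)) ?M' (U (Dom ?M m)) (comp_ftor (U (Cod ?M m)) (cone_map_ftor m)) (\<lambda>y. FArr \<Phi> (base_change g n u m y))"
    using nat_iso_over_whisker[OF base_change_nat_iso[OF m] \<Phi>] unfolding U_def comp_ftor_assoc .
   fix m' assume m': "m' \<in> Arr ?M" and c: "Cod ?M m = Dom ?M m'"
   fix y assume y: "y \<in> Obj (C (Dom ?M m))"
   note B = base_change_rules[OF m y] and B' = base_change_rules[OF m', unfolded c[symmetric], OF cone_map_ftor_obj(1)[OF m y]]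
   have "Cod ?X (base_change g n u m y) = Dom ?X (base_change g n u m' (FObj (cone_map_ftor m) y))" using B(3) B'(2) by simp
   from \<Phi>\<Phi>(8)[OF B(1) B'(1) this] show "FArr \<Phi> (base_change g n u (Comp ?M m' m) y) =
    Comp ?M' (FArr \<Phi> (base_change g n u m' (FObj (cone_map_ftor m) y))) (FArr \<Phi> (base_change g n u m y))"
    unfolding base_change_comp[OF m m' c y] .
  next
   fix X y assume "X \<in> Obj ?M" "y \<in> Obj (C X)"
   thus "FArr \<Phi> (base_change g n u (Ide ?M X) y) = Ide ?M' (FObj (U X) y)"
    using base_change_id \<Phi>\<Phi>(4) LL(3) by (simp add: U_def)
  next
   fix m y assume m: "m \<in> Arr ?M" and y: "y \<in> Obj (C (Dom ?M m))"
   define X Y z \<xi> where "X = Dom ?M m" and "Y = Cod ?M m" and "z = FObj (cone_map_ftor m) y" and "\<xi> = base_change g n u m y"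
   note B = base_change_rules[OF m y, folded X_def Y_def z_def \<xi>_def]
   have O: "X \<in> Obj ?M" "Y \<in> Obj ?M" "y \<in> Obj (C X)" "z \<in> Obj (C Y)"
    using MM(1,2)[OF m] y cone_map_ftor_obj(1)[OF m y] unfolding X_def Y_def z_def by auto
   let ?y = "FObj (L X) y" and ?z = "FObj (L Y) z"
   have w: "?y \<in> Obj ?X" "?z \<in> Obj ?X" using LL(3) O by auto
   have \<Phi>\<xi>: "FArr \<Phi> \<xi> \<in> Arr ?M'" "Cod ?M' (FArr \<Phi> \<xi>) = FObj \<Phi> ?z" using \<Phi>\<Phi>(5,7)[OF B(1)] B(3) by auto
   have \<Psi>\<xi>: "FArr \<Psi> (FArr \<Phi> \<xi>) \<in> Arr ?X" "Cod ?X (FArr \<Psi> (FArr \<Phi> \<xi>)) = Dom ?X (t ?z)"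
    using \<Psi>\<Psi>(5,7)[OF \<Phi>\<xi>(1)] \<Phi>\<xi>(2) T(4)[OF w(2)] by auto
   have t1: "t ?y \<in> Arr ?X" "Cod ?X (t ?y) = Dom ?X \<xi>" "t ?z \<in> Arr ?X" "Cod ?X (t ?z) = ?z"
    using iso_Arr[OF T(3)[OF w(1)]] iso_Arr[OF T(3)[OF w(2)]] T(5)[OF w(1)] T(5)[OF w(2)] B(2) by auto
   have nat: "Comp ?X \<xi> (t ?y) = Comp ?X (t ?z) (FArr \<Psi> (FArr \<Phi> \<xi>))" using T(7)[OF B(1)] unfolding B(2,3) .
   have PQ': "FArr (forget_ftor n) k = FArr P (FArr \<Psi> k)" for k unfolding PQ[symmetric] by (rule comp_ftor_simps(2))
   \<comment> \<open>Naturality of \<open>t\<close> at the comparison \<open>\<xi>\<close>,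
     projected to curves with \<open>n\<close> legs.\<close>
   have e: "Comp ?M (\<alpha> Y z) (FArr (forget_ftor n) (FArr \<Phi> \<xi>)) = Comp ?M (FArr P \<xi>) (\<alpha> X y)"
    using PF(8)[OF \<Psi>\<xi>(1) t1(3) \<Psi>\<xi>(2)] PF(8)[OF t1(1) B(1) t1(2)] unfolding nat PQ' \<alpha>_def by (rule trans[OF sym])
   note Ty = TB(1-3)[OF O(1) O(1) O(3), folded P_def] and Tz = TB(1-3)[OF O(2) O(2) O(4), folded P_def]
   have A: "\<alpha> X y \<in> Arr ?M" "Cod ?M (\<alpha> X y) = FObj P ?y" "FArr P \<xi> \<in> Arr ?M" "Dom ?M (FArr P \<xi>) = FObj P ?y" "Cod ?M (FArr P \<xi>) = FObj P ?z"
    using PF(5,7)[OF t1(1)] PF(5-7)[OF B(1)] t1(2) B(2,3) by (auto simp: \<alpha>_def)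
   have "Comp ?M m (Comp ?M (tb X y) (\<alpha> X y)) = Comp ?M (Comp ?M m (tb X y)) (\<alpha> X y)"
    by (rule MM(11)) (simp_all only: A Ty m X_def[symmetric])
   also have "\<dots> = Comp ?M (Comp ?M (tb Y z) (FArr P \<xi>)) (\<alpha> X y)" using B(5) by (simp add: P_def)
   also have "\<dots> = Comp ?M (tb Y z) (Comp ?M (FArr P \<xi>) (\<alpha> X y))" by (rule MM(11)[symmetric]) (simp_all only: A Tz)
   finally show "Comp ?M m (Comp ?M (to_base (u (Dom ?M m)) (Dom ?M m) y) (\<alpha> (Dom ?M m) y)) =
    Comp ?M (to_base (u (Cod ?M m)) (Cod ?M m) (FObj (cone_map_ftor m) y))
     (Comp ?M (\<alpha> (Cod ?M m) (FObj (cone_map_ftor m) y)) (FArr (forget_ftor n) (FArr \<Phi> (base_change g n u m y))))"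
    unfolding X_def[symmetric] Y_def[symmetric] z_def[symmetric] \<xi>_def[symmetric] e .
  qed
  have 3: "FObj (U (S, G)) (S, s) = FObj \<Phi> (S, G, s) \<and> section_genus S G s = last_leg_genus n (FObj (U (S, G)) (S, s))"
   if X: "(S, G) \<in> Obj ?M" and s: "s \<in> cone_sections S G" for S G s
  proof -
   have e: "FObj (U (S, G)) (S, s) = FObj \<Phi> (S, G, s)"
    using cone_lift_section[of S G g n "u (S, G)" s] X cl s by (simp add: U_def)
   have w: "(S, G, s) \<in> Obj ?X" using X s by simp
   obtain S' G' where G': "FObj \<Phi> (S, G, s) = (S', G')" by (cases "FObj \<Phi> (S, G, s)")
   have S': "S' = S" using fo_Obj[OF \<Phi> w] G' by simp
   have O: "(S, G') \<in> mtrop_obj g (Suc n)" using \<Phi>\<Phi>(3)[OF w] G' S' by simp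
   \<comment> \<open>The counit at \<open>(S, G, s)\<close> is a vertical arrow from the forgotten
     curve of \<open>\<Phi> (S, G, s)\<close> with its last section, which is the comparison needed
     for the genus functions.\<close>
   have ta: "t (S, G, s) \<in> Arr ?X" by (rule iso_Arr[OF T(3)[OF w]])
   obtain S1 G1 s1 S2 G2 s2 f j where te: "t (S, G, s) = ((S1, G1, s1), (S2, G2, s2), (f, j))" by (rule Xtrop_arr_cases[OF ta])
   have "((S, forget_last n G', last_section n S G'), (S, G, s), (rpc_id S, j)) \<in> Arr ?X"
    using ta T(4-6)[OF w] G' S' unfolding te \<Psi>_def by simp
   from section_genus_last_leg[OF gn O this] show ?thesis using e G' S' by simp
  qed
  show ?thesis using 1 2 3 by blast
 qed
 show ?thesis using iso family by blast
qed

end
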